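(* Let $C\subset\mathbb{R}^n$ be the $n$-dimensional cube with vertices $(\pm1,\dots,\pm1)$ (more generally any $n$-cube centered at the origin). For every $k=0,\dots,n$, the space $\mathcal{H}_{C(k)}$ of $C(k)$-harmonic functions is a real vector space of dimension $2^n\cdot n!$, and as an $\mathbb{R}[\partial]$-module (with $\partial=(\partial/\partial x_1,\dots,\partial/\partial x_n)$ acting by differentiation) $\mathcal{H}_{C(k)}$ is generated by the polynomial $$\varDelta(x)=x_1\cdots x_n\prod_{1\le i<j\le n}(x_i^2-x_j^2),$$ i.e. $\mathcal{H}_{C(k)}$ is the linear span of all partial derivatives (of all orders, including order $0$) of $\varDelta$.
   Context: For an $n$-dimensional polytope $P\subset\mathbb{R}^n$ and $k\in\{0,\dots,n\}$, $P(k)$ denotes the $k$-dimensional skeleton of $P$ (the union of its faces of dimension $\le k$, equivalently of its $k$-dimensional faces), $\mu_k$ is $k$-dimensional Euclidean (Hausdorff) measure on $P(k)$ and $|P(k)|=\mu_k(P(k))$. A continuous function $f:\mathbb{R}^n\to\mathbb{R}$ is called $P(k)$-harmonic if $f(x)=\frac{1}{|P(k)|}\int_{P(k)}f(x+ry)\,d\mu_k(y)$ for all $x\in\mathbb{R}^n$ and all $r>0$. $\mathcal{H}_{P(k)}$ denotes the set of all $P(k)$-harmonic functions. The polynomial $\varDelta$ is the fundamental alternating polynomial of the symmetry group $W_n=S_n\ltimes\{\pm1\}^n$ of the cube (of order $2^n n!$). *)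

theory Defs
  imports "HOL-Analysis.Analysis" "HOL-Library.Function_Algebras"
begin

text \<open>Real-valued functions form a real vector space pointwise (addition comes from
  \<^theory>\<open>HOL-Library.Function_Algebras\<close>), so that \<^const>\<open>subspace\<close>, \<^const>\<open>span\<close> and
  \<^const>\<open>dim\<close> apply to sets of functions.\<close>

instantiation "fun" :: (type, real_vector) real_vector
begin

definition scaleR_fun :: "real \<Rightarrow> ('a \<Rightarrow> 'b) \<Rightarrow> 'a \<Rightarrow> 'b" where
  "scaleR_fun c f = (\<lambda>x. c *\<^sub>R f x)"

instance
  by standard (simp_all add: scaleR_fun_def fun_eq_iff scaleR_add_right scaleR_add_left)

end

text \<open>The \<open>d\<close>-dimensional Hausdorff measure, normalised as usual by the volume of the Euclidean
  unit ball so that it agrees with \<open>d\<close>-dimensional Euclidean volume. The case distinction is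
  needed for \<open>d = 0\<close>, where nonempty sets have gauge 1 (counting measure). Covers consist of
  bounded sets because \<^const>\<open>diameter\<close> is unspecified on unbounded ones.\<close>

definition hausdorff_gauge :: "nat \<Rightarrow> 'a::metric_space set \<Rightarrow> ennreal" where
  "hausdorff_gauge d U =
     (if U = {} then 0 else ennreal (unit_ball_vol (real d) * (diameter U / 2) ^ d))"

definition hausdorff_outer :: "nat \<Rightarrow> 'a::metric_space set \<Rightarrow> ennreal" where
  "hausdorff_outer d A =
     (SUP \<delta>\<in>{0::real<..}.
        INF U\<in>{U :: nat \<Rightarrow> 'a set. (\<forall>i. bounded (U i) \<and> diameter (U i) \<le> \<delta>) \<and> A \<subseteq> (\<Union>i. U i)}.
          \<Sum>i. hausdorff_gauge d (U i))"

text \<open>The outer measure is a metric outer measure, hence countably additive on Borel sets.\<close>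

definition hausdorff_measure :: "nat \<Rightarrow> 'a::metric_space measure" where
  "hausdorff_measure d = measure_of UNIV (sets borel) (hausdorff_outer d)"

definition skeleton :: "'a::euclidean_space set \<Rightarrow> nat \<Rightarrow> 'a set" where
  "skeleton P k = \<Union>{F. F face_of P \<and> aff_dim F \<le> int k}"

definition harmonic_functions :: "'a::euclidean_space set \<Rightarrow> nat \<Rightarrow> ('a \<Rightarrow> real) set" where
  "harmonic_functions P k =
     {f. continuous_on UNIV f \<and>
         (\<forall>x. \<forall>r>0. f x = 1 / measure (hausdorff_measure k) (skeleton P k) *
            (LINT y:skeleton P k|hausdorff_measure k. f (x + r *\<^sub>R y)))}"

definition std_cube :: "(real ^ 'n) set" where
  "std_cube = convex hull {v. \<forall>i. v $ i = 1 \<or> v $ i = - 1}"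

text \<open>The index type plays the role of \<open>{1, \<dots>, n}\<close>; its linear order is only used to
  select one factor for each pair of indices.\<close>

definition Delta :: "real ^ 'n::{finite,linorder} \<Rightarrow> real" where
  "Delta x = (\<Prod>i\<in>UNIV. x $ i) * (\<Prod>(i, j)\<in>{(i, j). i < j}. (x $ i)\<^sup>2 - (x $ j)\<^sup>2)"

definition partial_deriv :: "'n::finite \<Rightarrow> (real ^ 'n \<Rightarrow> real) \<Rightarrow> real ^ 'n \<Rightarrow> real" where
  "partial_deriv i f x = deriv (\<lambda>t. f (x + t *\<^sub>R axis i 1)) 0"

inductive_set iterated_partials :: "(real ^ 'n::finite \<Rightarrow> real) \<Rightarrow> (real ^ 'n \<Rightarrow> real) set"
  for f where
  base: "f \<in> iterated_partials f"
| step: "g \<in> iterated_partials f \<Longrightarrow> partial_deriv i g \<in> iterated_partials f"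

end

theory Submission
  imports Defs "HOL-Library.Poly_Mapping" "HOL-Computational_Algebra.Formal_Power_Series"
    "HOL-Probability.Probability_Measure"
begin

text \<open>Expanding the mean value property of a polynomial in powers of the radius gives a system of
  constant-coefficient differential equations, one for each degree. Up to a factor, the moments of the
  \<open>k\<close>-skeleton are read off from the coefficient of \<open>s ^ k\<close> in the product of \<open>cos x\<^sub>i + s * sin x\<^sub>i / x\<^sub>i\<close>. The
  logarithmic derivative of such a factor satisfies a Riccati equation, whose recursion shows that its coefficients
  are, up to a power of \<open>1 + s\<close>, polynomials in \<open>s\<close> with coefficients of one sign. Hence no power sum drops out, and
  the system says that the polynomial is annihilated by all power sums in the squares of the partial derivatives.
  The solutions are the derivatives of the alternating polynomial: reduction by complete symmetric polynomials
  bounds the dimension by the order of the group, and that many derivatives are linearly independent.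

  Every continuous solution is a polynomial: mollifying it with piecewise polynomial kernels gives smooth solutions,
  the homogeneous parts of their Taylor polynomials are again solutions and hence vanish in high degree, so
  high-order finite differences of the solution vanish.

  On a coordinate subspace the Hausdorff measure is a multiple of Lebesgue measure, by the uniqueness of translation
  invariant measures, which gives the moments of the skeleton; similarities transport the result to every cube.\<close>

subsection \<open>Positivity in the Riccati recursion\<close>

text \<open>At degree 2m, with the lower power sums already in the ideal, Newton's identity leaves a
  real multiple of the m-th power sum, and everything depends on that number being nonzero. A single
  k offers no product structure. The generating polynomial in s does: its logarithmic derivative is
  a sum of one-variable contributions, and the numbers for k = 0, ..., n appear together as the
  coefficients of one polynomial in s. Positivity is therefore proved coefficient by coefficient,
  not for values at particular s.

  Coefficients are taken with respect to divided powers, so that differentiation is an index shift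
  and the system becomes a linear recurrence on families indexed by exponents; the dimension bound
  and the independence are then counting arguments on exponents.

  The kernels are powers of max 0 (1 - |u|^2), whose expansion under a translation of u is explicit
  with an elementary error bound. The Hausdorff measure of a k-cube enters as a positive constant
  shared by all k-faces, which cancels in the mean.\<close>

definition pos_coeffs :: "nat \<Rightarrow> real poly \<Rightarrow> bool" where
  "pos_coeffs m p \<longleftrightarrow> (\<forall>j\<le>m. coeff p j > 0) \<and> (\<forall>j>m. coeff p j = 0)"

definition nonneg_coeffs :: "nat \<Rightarrow> real poly \<Rightarrow> bool" where
  "nonneg_coeffs m p \<longleftrightarrow> (\<forall>j. coeff p j \<ge> 0) \<and> (\<forall>j>m. coeff p j = 0)"

lemma pos_coeffs_imp_nonneg: "pos_coeffs m p \<Longrightarrow> nonneg_coeffs m p"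
  unfolding pos_coeffs_def nonneg_coeffs_def by (metis less_eq_real_def linorder_not_less)

lemma nonneg_coeffs_add: "nonneg_coeffs m p \<Longrightarrow> nonneg_coeffs m q \<Longrightarrow> nonneg_coeffs m (p + q)"
  by (auto simp: nonneg_coeffs_def)

lemma nonneg_coeffs_sum:
  "(\<And>i. i \<in> A \<Longrightarrow> nonneg_coeffs m (f i)) \<Longrightarrow> nonneg_coeffs m (sum f A)"
  by (induction A rule: infinite_finite_induct) (auto simp: nonneg_coeffs_add, auto simp: nonneg_coeffs_def)

lemma nonneg_coeffs_mult:
  assumes "nonneg_coeffs m p" "nonneg_coeffs n q"
  shows "nonneg_coeffs (m + n) (p * q)"
  unfolding nonneg_coeffs_def coeff_mult
proof (intro conjI allI impI)
  fix j show "0 \<le> (\<Sum>i\<le>j. coeff p i * coeff q (j - i))"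
    using assms by (intro sum_nonneg mult_nonneg_nonneg) (auto simp: nonneg_coeffs_def)
next
  fix j assume "m + n < j"
  then show "(\<Sum>i\<le>j. coeff p i * coeff q (j - i)) = 0"
  proof (intro sum.neutral ballI)
    fix i assume "i \<in> {..j}"
    then have "i > m \<or> j - i > n" using \<open>m + n < j\<close> by auto
    then show "coeff p i * coeff q (j - i) = 0" using assms by (auto simp: nonneg_coeffs_def)
  qed
qed

lemma nonneg_coeffs_pCons0: "nonneg_coeffs m p \<Longrightarrow> nonneg_coeffs (Suc m) (pCons 0 p)"
  by (auto simp: nonneg_coeffs_def coeff_pCons split: nat.splits)

text \<open>Coefficient j of the product is the sum of the coefficients j and j - 1 of p, and for j
  \<le> m + 1 at least one of them is positive. This is what allows a denominator (1 + s)^m to be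
  raised to a higher power without losing strict positivity.\<close>

lemma pos_coeffs_times_1X:
  assumes "pos_coeffs m p"
  shows "pos_coeffs (Suc m) ([:1, 1:] * p)"
  unfolding pos_coeffs_def
proof (intro conjI allI impI)
  fix j assume "j \<le> Suc m"
  show "0 < coeff ([:1, 1:] * p) j"
  proof (cases j)
    case (Suc i)
    then have "coeff p i > 0" "coeff p j \<ge> 0"
      using assms \<open>j \<le> Suc m\<close> pos_coeffs_imp_nonneg[OF assms] by (auto simp: pos_coeffs_def nonneg_coeffs_def)
    then show ?thesis using Suc by (simp add: coeff_pCons)
  qed (use assms in \<open>simp add: pos_coeffs_def\<close>)
next
  fix j assume "Suc m < j"
  then show "coeff ([:1, 1:] * p) j = 0"
    using assms by (cases j) (auto simp: pos_coeffs_def coeff_pCons)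
qed

lemma pos_coeffs_times_power_1X:
  assumes "pos_coeffs m p"
  shows "pos_coeffs (d + m) ([:1, 1:] ^ d * p)"
  using assms
proof (induction d)
  case (Suc d)
  from pos_coeffs_times_1X[OF Suc.IH[OF Suc.prems]] show ?case by (simp only: mult.assoc power_Suc add_Suc)
qed auto

text \<open>The even entire functions \<open>cos x\<close> and \<open>sin x / x\<close> as series in \<open>x\<^sup>2\<close>.\<close>
definition fps_cos_sqrt :: "real fps" where
  "fps_cos_sqrt = Abs_fps (\<lambda>m. (-1) ^ m / fact (2 * m))"

definition fps_sinc_sqrt :: "real fps" where
  "fps_sinc_sqrt = Abs_fps (\<lambda>m. (-1) ^ m / fact (2 * m + 1))"

text \<open>The factor 1 / (1 + s) makes the constant coefficient 1 for s > 0, as required for the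
  inverse in \<open>fps_ricc\<close> and for the leading term of Newton's identity.\<close>

definition fps_mix :: "real \<Rightarrow> real fps" where
  "fps_mix s = fps_const (1 / (1 + s)) * fps_cos_sqrt + fps_const (s / (1 + s)) * fps_sinc_sqrt"

text \<open>In the variable z = x^2 the operator 2 z d/dz is x d/dx, so this and the next lemma are
  x (cos x)' = - x sin x and x (sin x / x)' = cos x - sin x / x.\<close>

lemma deriv_cos_sqrt: "2 * fps_X * fps_deriv fps_cos_sqrt = - fps_X * fps_sinc_sqrt"
proof (rule fps_ext)
  fix n
  show "fps_nth (2 * fps_X * fps_deriv fps_cos_sqrt) n = fps_nth (- fps_X * fps_sinc_sqrt) n"
    by (cases n) (auto simp: fps_cos_sqrt_def fps_sinc_sqrt_def mult.assoc fps_numeral_fps_const divide_simps)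
qed

lemma deriv_sinc_sqrt: "2 * fps_X * fps_deriv fps_sinc_sqrt = fps_cos_sqrt - fps_sinc_sqrt"
proof (rule fps_ext)
  fix n
  show "fps_nth (2 * fps_X * fps_deriv fps_sinc_sqrt) n = fps_nth (fps_cos_sqrt - fps_sinc_sqrt) n"
  proof (cases n)
    case (Suc m)
    have "(fact (Suc (2 * n)) :: real) = (2 * real n + 1) * fact (2 * n)"
      by (simp add: algebra_simps)
    then show ?thesis using Suc
      by (simp add: fps_cos_sqrt_def fps_sinc_sqrt_def mult.assoc fps_numeral_fps_const divide_simps del: fact_Suc)
         (simp add: algebra_simps)
  qed (auto simp: fps_cos_sqrt_def fps_sinc_sqrt_def mult.assoc fps_numeral_fps_const)
qed

section \<open>The Riccati equation and the signs of its coefficients\<close>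

definition fps_ricc :: "real \<Rightarrow> real fps" where
  "fps_ricc s = (fps_sinc_sqrt - fps_cos_sqrt) * inverse (fps_mix s)"

lemma nth_cos_sqrt_0 [simp]: "fps_nth fps_cos_sqrt 0 = 1"
  and nth_sinc_sqrt_0 [simp]: "fps_nth fps_sinc_sqrt 0 = 1"
  by (simp_all add: fps_cos_sqrt_def fps_sinc_sqrt_def)

lemma nth_mix_0: "s > 0 \<Longrightarrow> fps_nth (fps_mix s) 0 = 1"
  by (simp add: fps_mix_def divide_simps)

lemma nth_ricc_0 [simp]: "fps_nth (fps_ricc s) 0 = 0"
  by (simp add: fps_ricc_def)

text \<open>Write C, S for the two series, F = a C + b S and U = (S - C) / F. Since a + b = 1, both
  S = F (1 + a U) and C = F (1 - b U) are F times an affine function of U; differentiating F U = S -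
  C therefore gives an equation of first order and quadratic in U.\<close>

lemma
  assumes s: "s > 0"
  defines "a \<equiv> fps_const (1 / (1 + s))" and "b \<equiv> fps_const (s / (1 + s))"
  defines "U \<equiv> fps_ricc s"
  shows ricc_log_deriv:
      "2 * fps_X * fps_deriv (fps_mix s) = - fps_mix s * (b * U + a * fps_X * (1 + a * U))"
    and ricc_eq: "2 * fps_X * fps_deriv U + U = fps_X + 2 * a * fps_X * U + (b + a\<^sup>2 * fps_X) * U\<^sup>2"
proof -
  define F where "F = fps_mix s"
  define Fi where "Fi = inverse F"
  define C S M where "C = fps_cos_sqrt" and "S = fps_sinc_sqrt" and "M = S - C"
  have F0: "fps_nth F 0 \<noteq> 0" using nth_mix_0[OF s] by (simp add: F_def)
  have FFi: "F * Fi = 1" unfolding Fi_def using inverse_mult_eq_1'[OF F0] by simp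
  have U: "U = M * Fi" by (simp add: U_def fps_ricc_def M_def C_def S_def Fi_def F_def)
  have MU: "M = F * U" using FFi by (simp add: U algebra_simps)
  have ab: "a + b = 1"
    using s by (simp add: a_def b_def fps_eq_iff divide_simps)
  have Fe: "F = a * C + b * S" by (simp add: F_def fps_mix_def a_def b_def C_def S_def)
  have SF: "S = F + a * M"
  proof -
    have "F + a * M = (a + b) * S" by (simp add: Fe M_def algebra_simps)
    then show ?thesis by (simp add: ab)
  qed
  have dC: "2 * fps_X * fps_deriv C = - fps_X * S" by (simp add: deriv_cos_sqrt C_def S_def)
  have dS: "2 * fps_X * fps_deriv S = - M" by (simp add: deriv_sinc_sqrt C_def S_def M_def)
  have "2 * fps_X * fps_deriv F = a * (2 * fps_X * fps_deriv C) + b * (2 * fps_X * fps_deriv S)"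
    by (simp add: Fe a_def b_def algebra_simps)
  then have dF0: "2 * fps_X * fps_deriv F = - (b * M + a * fps_X * S)"
    unfolding dC dS by (simp add: algebra_simps)
  then have dF: "2 * fps_X * fps_deriv F = - F * (b * U + a * fps_X * (1 + a * U))"
    by (simp add: SF MU algebra_simps)
  then show "2 * fps_X * fps_deriv (fps_mix s) = - fps_mix s * (b * U + a * fps_X * (1 + a * U))"
    by (simp add: F_def)
  have "2 * fps_X * fps_deriv M = 2 * fps_X * fps_deriv S - 2 * fps_X * fps_deriv C"
    by (simp add: M_def algebra_simps)
  then have dM: "2 * fps_X * fps_deriv M = - M + fps_X * S" unfolding dS dC by simp
  have "2 * fps_X * fps_deriv M = (2 * fps_X * fps_deriv F) * U + F * (2 * fps_X * fps_deriv U)"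
    by (simp add: MU algebra_simps)
  then have "F * (2 * fps_X * fps_deriv U) = - M + fps_X * S + F * (b * U + a * fps_X * (1 + a * U)) * U"
    unfolding dM dF by (simp add: algebra_simps)
  also have "\<dots> = F * (- U + fps_X * (1 + a * U) + (b * U + a * fps_X * (1 + a * U)) * U)"
    by (simp add: SF MU algebra_simps)
  finally have "2 * fps_X * fps_deriv U = - U + fps_X * (1 + a * U) + (b * U + a * fps_X * (1 + a * U)) * U"
    using F0 by (metis fps_nonzero_nth mult_cancel_left)
  then show "2 * fps_X * fps_deriv U + U = fps_X + 2 * a * fps_X * U + (b + a\<^sup>2 * fps_X) * U\<^sup>2"
    by (simp add: algebra_simps power2_eq_square)
qed

text \<open>This is \<open>ricc_eq\<close> read at degree n. The convolutions start at 1 because U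
  has constant coefficient 0, so the right side involves only lower coefficients, all with positive
  weights.\<close>

lemma ricc_recursion:
  assumes s: "s > 0" and n: "n > 0"
  shows "(2 * real n + 1) * fps_nth (fps_ricc s) n =
     (if n = 1 then 1 else 0) + 2 / (1 + s) * fps_nth (fps_ricc s) (n - 1)
     + s / (1 + s) * (\<Sum>i = 1..<n. fps_nth (fps_ricc s) i * fps_nth (fps_ricc s) (n - i))
     + 1 / (1 + s)\<^sup>2 * (\<Sum>i = 1..<n - 1. fps_nth (fps_ricc s) i * fps_nth (fps_ricc s) (n - 1 - i))"
proof -
  let ?U = "fps_ricc s"
  have sq: "fps_nth (?U\<^sup>2) m = (\<Sum>i = 1..<m. fps_nth ?U i * fps_nth ?U (m - i))" for m
  proof -
    have "fps_nth (?U\<^sup>2) m = (\<Sum>i = 0..m. fps_nth ?U i * fps_nth ?U (m - i))"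
      by (simp add: power2_eq_square fps_mult_nth)
    also have "\<dots> = (\<Sum>i = 1..<m. fps_nth ?U i * fps_nth ?U (m - i))"
    proof (intro sum.mono_neutral_right ballI)
      fix i assume "i \<in> {0..m} - {1..<m}"
      then have "i = 0 \<or> m - i = 0" by auto
      then show "fps_nth ?U i * fps_nth ?U (m - i) = 0" by auto
    qed auto
    finally show ?thesis .
  qed
  have "fps_nth (2 * fps_X * fps_deriv ?U + ?U) n = (2 * real n + 1) * fps_nth ?U n"
    using n by (simp add: fps_numeral_fps_const mult.assoc algebra_simps)
  moreover have "fps_nth (fps_X + 2 * fps_const (1 / (1 + s)) * fps_X * ?U
        + (fps_const (s / (1 + s)) + (fps_const (1 / (1 + s)))\<^sup>2 * fps_X) * ?U\<^sup>2) n
     = (if n = 1 then 1 else 0) + 2 / (1 + s) * fps_nth ?U (n - 1) + s / (1 + s) * fps_nth (?U\<^sup>2) n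
     + 1 / (1 + s)\<^sup>2 * fps_nth (?U\<^sup>2) (n - 1)"
    using n by (simp add: fps_numeral_fps_const mult.assoc distrib_right power_divide
        fps_const_power del: fps_const_mult)
  ultimately show ?thesis using ricc_eq[OF s] by (simp add: sq)
qed

text \<open>All terms of the recursion are brought to the denominator (1 + s)^(n - 1). The linear
  term contributes \<open>q (n - 1)\<close>, strictly positive in degrees 0 to n - 2. Degree n - 1
  is reached by the quadratic term that carries the factor s, and its summand i = 1 is strictly
  positive there.\<close>

lemma ricc_coeffs_positive:
  assumes "n > 0"
  shows "\<exists>q. pos_coeffs (n - 1) q \<and> (\<forall>s>0. fps_nth (fps_ricc s) n = poly q s / (1 + s) ^ (n - 1))"
  using assms
proof (induction n rule: less_induct)
  case (less n)
  show ?case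
  proof (cases "n = 1")
    case True
    have "fps_nth (fps_ricc s) 1 = 1 / 3" if "s > 0" for s
      using ricc_recursion[OF that, of 1] by simp
    then show ?thesis using True
      by (intro exI[of _ "[:1/3:]"]) (auto simp: pos_coeffs_def coeff_pCons split: nat.splits)
  next
    case False
    then have n: "n \<ge> 2" using less.prems by simp
    have "\<forall>i\<in>{1..<n}. \<exists>q. pos_coeffs (i - 1) q \<and>
        (\<forall>s>0. fps_nth (fps_ricc s) i = poly q s / (1 + s) ^ (i - 1))"
      using less.IH by auto
    then obtain q where q: "\<And>i. 0 < i \<Longrightarrow> i < n \<Longrightarrow> pos_coeffs (i - 1) (q i)"
      and qs: "\<And>i s. 0 < i \<Longrightarrow> i < n \<Longrightarrow> s > 0 \<Longrightarrow> fps_nth (fps_ricc s) i = poly (q i) s / (1 + s) ^ (i - 1)"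
      by (subst (asm) bchoice_iff) (metis One_nat_def Suc_leI atLeastLessThan_iff)
    \<comment> \<open>\<open>A\<close> and \<open>B\<close> are the numerators of the two quadratic
      terms over (1 + s)^(n - 1); \<open>pCons 0\<close> is the factor s.\<close>
    define A where "A = (\<Sum>i = 1..<n. pCons 0 (q i * q (n - i)))"
    define B where "B = (\<Sum>i = 1..<n - 1. q i * q (n - 1 - i))"
    define p where "p = smult (1 / (2 * real n + 1)) (smult 2 (q (n - 1)) + A + B)"
    have qn: "nonneg_coeffs (i - 1) (q i)" if "0 < i" "i < n" for i
      using q[OF that] by (rule pos_coeffs_imp_nonneg)
    have A1: "nonneg_coeffs (n - 1) (pCons 0 (q i * q (n - i)))" if "i \<in> {1..<n}" for i
    proof -
      have "nonneg_coeffs (Suc (i - 1 + (n - i - 1))) (pCons 0 (q i * q (n - i)))"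
        using that by (intro nonneg_coeffs_pCons0 nonneg_coeffs_mult qn) auto
      moreover have "Suc (i - 1 + (n - i - 1)) = n - 1" using that by auto
      ultimately show ?thesis by (simp only:)
    qed
    have A: "nonneg_coeffs (n - 1) A" unfolding A_def by (intro nonneg_coeffs_sum A1)
    have B: "nonneg_coeffs (n - 1) B" unfolding B_def
    proof (intro nonneg_coeffs_sum)
      fix i assume i: "i \<in> {1..<n - 1}"
      then have "nonneg_coeffs (i - 1 + (n - 1 - i - 1)) (q i * q (n - 1 - i))"
        by (intro nonneg_coeffs_mult qn) auto
      then show "nonneg_coeffs (n - 1) (q i * q (n - 1 - i))"
        using i by (auto simp: nonneg_coeffs_def)
    qed
    have Atop: "coeff A (n - 1) > 0"
    proof -
      have "coeff A (n - 1) \<ge> coeff (pCons 0 (q 1 * q (n - 1))) (n - 1)"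
        unfolding A_def coeff_sum
        using A1 n by (intro member_le_sum) (auto simp: nonneg_coeffs_def)
      moreover have "coeff (pCons 0 (q 1 * q (n - 1))) (n - 1) = coeff (q 1 * q (n - 1)) (n - 2)"
      proof -
        have "n - 1 = Suc (n - 2)" using n by simp
        then show ?thesis by (simp only: coeff_pCons_Suc)
      qed
      \<comment> \<open>\<open>q 1\<close> is a positive constant, so the summand i = 1 inherits its
        top coefficient from \<open>q (n - 1)\<close>.\<close>
      moreover have "q 1 = [:coeff (q 1) 0:]"
        using q[of 1] n by (intro poly_eqI) (auto simp: pos_coeffs_def coeff_pCons split: nat.splits)
      then have "coeff (q 1 * q (n - 1)) (n - 2) = coeff (q 1) 0 * coeff (q (n - 1)) (n - 2)"
        by (metis coeff_smult mult_pCons_left mult_zero_left pCons_0_0 add.right_neutral)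
      moreover have "coeff (q 1) 0 > 0" "coeff (q (n - 1)) (n - 2) > 0"
        using q[of 1] q[of "n - 1"] n by (auto simp: pos_coeffs_def)
      ultimately show ?thesis by (metis less_le_trans mult_pos_pos)
    qed
    have "pos_coeffs (n - 1) p"
      unfolding pos_coeffs_def
    proof (intro conjI allI impI)
      fix j assume j: "j \<le> n - 1"
      show "coeff p j > 0"
      proof (cases "j = n - 1")
        case True
        have "coeff (q (n - 1)) (n - 1) \<ge> 0" "coeff B (n - 1) \<ge> 0"
          using qn[of "n - 1"] n B by (auto simp: nonneg_coeffs_def)
        then show ?thesis using Atop True by (simp add: p_def add_nonneg_pos add_pos_nonneg)
      next
        case False
        then have "coeff (q (n - 1)) j > 0" using q[of "n - 1"] j n by (auto simp: pos_coeffs_def)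
        moreover have "coeff A j \<ge> 0" "coeff B j \<ge> 0" using A B by (auto simp: nonneg_coeffs_def)
        ultimately show ?thesis by (simp add: p_def add_pos_nonneg)
      qed
    next
      fix j assume "j > n - 1"
      then show "coeff p j = 0"
        using A B qn[of "n - 1"] n by (auto simp: p_def nonneg_coeffs_def)
    qed
    moreover have "fps_nth (fps_ricc s) n = poly p s / (1 + s) ^ (n - 1)" if s: "s > 0" for s
    proof -
      let ?u = "fps_nth (fps_ricc s)" and ?D = "1 + s"
      have D: "?D > 0" using s by simp
      have 1: "2 / ?D * ?u (n - 1) = 2 * poly (q (n - 1)) s / ?D ^ (n - 1)"
      proof -
        have "?D ^ (n - 1) = ?D * ?D ^ (n - 2)" using n
          by (metis Suc_diff_le diff_Suc_Suc numeral_2_eq_2 power_Suc One_nat_def)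
        then show ?thesis using qs[of "n - 1" s] s n by (simp add: numeral_2_eq_2)
      qed
      have 2: "s / ?D * (\<Sum>i = 1..<n. ?u i * ?u (n - i)) = poly A s / ?D ^ (n - 1)"
      proof -
        have "s / ?D * (?u i * ?u (n - i)) = poly (pCons 0 (q i * q (n - i))) s / ?D ^ (n - 1)"
          if i: "i \<in> {1..<n}" for i
        proof -
          have "?D ^ (n - 1) = ?D * ?D ^ (i - 1) * ?D ^ (n - i - 1)"
            using i by (simp flip: power_add power_Suc)
          then show ?thesis using qs[of i s] qs[of "n - i" s] s i by simp
        qed
        then show ?thesis by (simp add: A_def poly_sum sum_distrib_left sum_divide_distrib)
      qed
      have 3: "1 / ?D\<^sup>2 * (\<Sum>i = 1..<n - 1. ?u i * ?u (n - 1 - i)) = poly B s / ?D ^ (n - 1)"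
      proof -
        have "1 / ?D\<^sup>2 * (?u i * ?u (n - 1 - i)) = poly (q i * q (n - 1 - i)) s / ?D ^ (n - 1)"
          if i: "i \<in> {1..<n - 1}" for i
        proof -
          have "2 + (i - 1) + (n - 1 - i - 1) = n - 1" using i by auto
          then have "?D ^ (n - 1) = ?D\<^sup>2 * ?D ^ (i - 1) * ?D ^ (n - 1 - i - 1)"
            by (metis power_add)
          moreover have "i < n" "Suc i < n" using i by auto
          ultimately show ?thesis using qs[of i s] qs[of "n - 1 - i" s] s i by simp
        qed
        then show ?thesis by (simp add: B_def poly_sum sum_distrib_left sum_divide_distrib)
      qed
      have "(2 * real n + 1) * ?u n = (2 * poly (q (n - 1)) s + poly A s + poly B s) / ?D ^ (n - 1)"
        using ricc_recursion[OF s less.prems] False unfolding 1 2 3 by (simp add: add_divide_distrib)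
      moreover have "2 * real n + 1 \<noteq> 0" by linarith
      ultimately have "?u n = (2 * poly (q (n - 1)) s + poly A s + poly B s) / ?D ^ (n - 1) / (2 * real n + 1)"
        by (metis nonzero_mult_div_cancel_left)
      then show ?thesis by (simp add: p_def)
    qed
    ultimately show ?thesis by blast
  qed
qed

text \<open>This is X F' / F for F = \<open>fps_mix s\<close>; the factor X aligns its coefficients
  with the power sums in Newton's identity.\<close>

definition fps_kappa :: "real \<Rightarrow> real fps" where
  "fps_kappa s = fps_const (- 1 / 2) * (fps_const (s / (1 + s)) * fps_ricc s
     + fps_const (1 / (1 + s)) * fps_X * (1 + fps_const (1 / (1 + s)) * fps_ricc s))"

lemma X_deriv_mix: "s > 0 \<Longrightarrow> fps_X * fps_deriv (fps_mix s) = fps_mix s * fps_kappa s"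
proof -
  assume s: "s > 0"
  have "fps_X * fps_deriv (fps_mix s) = fps_const (1/2) * (2 * fps_X * fps_deriv (fps_mix s))"
    by (simp add: fps_numeral_fps_const flip: mult.assoc)
  also have "\<dots> = fps_mix s * fps_kappa s"
  proof -
    have "fps_const (- 1 / 2) = - fps_const (1 / 2 :: real)" by simp
    then show ?thesis
    unfolding ricc_log_deriv[OF s] fps_kappa_def by (simp only: algebra_simps minus_mult_minus mult_minus_left mult_minus_right)
  qed
  finally show ?thesis .
qed

lemma nth_kappa_0 [simp]: "fps_nth (fps_kappa s) 0 = 0"
  by (simp add: fps_kappa_def)

text \<open>Over (1 + s)^n the numerator is, up to the factor - 1/2, the numerator of U_n times s,
  which covers the degrees 1 to n, plus a term covering degree 0: the constant 1 when n = 1, and the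
  numerator of U_(n - 1) otherwise.\<close>

lemma kappa_coeffs_negative:
  assumes n: "n > 0"
  shows "\<exists>q. pos_coeffs n q \<and> (\<forall>s>0. fps_nth (fps_kappa s) n = - poly q s / (1 + s) ^ n)"
proof -
  have kap: "fps_nth (fps_kappa s) n = - 1 / 2 * (s / (1 + s) * fps_nth (fps_ricc s) n
     + 1 / (1 + s) * ((if n = 1 then 1 else 0) + 1 / (1 + s) * fps_nth (fps_ricc s) (n - 1)))" for s
    using n by (simp add: fps_kappa_def mult.assoc distrib_left del: fps_const_mult) (simp add: divide_simps)
  obtain q where q: "pos_coeffs (n - 1) q"
    and qs: "\<And>s. s > 0 \<Longrightarrow> fps_nth (fps_ricc s) n = poly q s / (1 + s) ^ (n - 1)"
    using ricc_coeffs_positive[OF n] by blast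
  show ?thesis
  proof (cases "n = 1")
    case True
    have "pos_coeffs n (smult (1/2) (pCons 1 q))"
      using q True by (auto simp: pos_coeffs_def coeff_pCons le_Suc_eq split: nat.splits)
    moreover have "fps_nth (fps_kappa s) n = - poly (smult (1/2) (pCons 1 q)) s / (1 + s) ^ n" if "s > 0" for s
      using qs[OF that] True that unfolding kap by (simp add: divide_simps)
    ultimately show ?thesis by blast
  next
    case False
    then have n2: "n \<ge> 2" using n by simp
    obtain r where r: "pos_coeffs (n - 1 - 1) r"
      and rs: "\<And>s. s > 0 \<Longrightarrow> fps_nth (fps_ricc s) (n - 1) = poly r s / (1 + s) ^ (n - 1 - 1)"
      using ricc_coeffs_positive[of "n - 1"] n2 by auto
    have "pos_coeffs n (smult (1/2) (pCons 0 q + r))"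
      unfolding pos_coeffs_def
    proof (intro conjI allI impI)
      fix j assume j: "j \<le> n"
      show "coeff (smult (1/2) (pCons 0 q + r)) j > 0"
      proof (cases j)
        case 0
        then show ?thesis using r by (simp add: pos_coeffs_def)
      next
        case (Suc i)
        then have "coeff q i > 0" "coeff r j \<ge> 0"
          using q pos_coeffs_imp_nonneg[OF r] j by (auto simp: pos_coeffs_def nonneg_coeffs_def)
        then show ?thesis using Suc by simp
      qed
    next
      fix j assume "j > n"
      then show "coeff (smult (1/2) (pCons 0 q + r)) j = 0"
        using q r n by (cases j) (auto simp: pos_coeffs_def less_Suc_eq_le Suc_le_eq)
    qed
    moreover have "fps_nth (fps_kappa s) n = - poly (smult (1/2) (pCons 0 q + r)) s / (1 + s) ^ n" if s: "s > 0" for s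
    proof -
      obtain d where d: "n = Suc (Suc d)" using n2 by (metis Suc_le_D numeral_2_eq_2 Suc_le_mono)
      have "1 + s \<noteq> 0" using s by simp
      then have "1 / (1 + s) * (1 / (1 + s) * (poly r s / (1 + s) ^ d)) = poly r s / (1 + s) ^ n"
         "s / (1 + s) * (poly q s / (1 + s) ^ (n - 1)) = s * poly q s / (1 + s) ^ n"
        by (simp_all add: d)
      then show ?thesis
        unfolding kap qs[OF s] rs[OF s] using False d by (simp add: add_divide_distrib diff_divide_distrib mult.commute)
    qed
    ultimately show ?thesis by blast
  qed
qed


subsection \<open>Symmetric functions modulo the annihilator of a functional\<close>

lemma X_deriv_prod:
  fixes f g :: "'b \<Rightarrow> 'a::comm_ring_1 fps"
  assumes "finite T" "\<And>i. i \<in> T \<Longrightarrow> fps_X * fps_deriv (f i) = f i * g i"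
  shows "fps_X * fps_deriv (\<Prod>i\<in>T. f i) = (\<Prod>i\<in>T. f i) * (\<Sum>i\<in>T. g i)"
  using assms
proof (induction T rule: finite_induct)
  case (insert x T)
  have "fps_X * fps_deriv (\<Prod>i\<in>insert x T. f i)
      = f x * (fps_X * fps_deriv (\<Prod>i\<in>T. f i)) + (fps_X * fps_deriv (f x)) * (\<Prod>i\<in>T. f i)"
    using insert.hyps by (simp add: algebra_simps)
  also have "\<dots> = f x * ((\<Prod>i\<in>T. f i) * (\<Sum>i\<in>T. g i)) + (f x * g x) * (\<Prod>i\<in>T. f i)"
    using insert by simp
  finally show ?case using insert.hyps by (simp add: algebra_simps)
qed auto

lemma nth_prod_0: "fps_nth (\<Prod>i\<in>T. f i) 0 = (\<Prod>i\<in>T. fps_nth (f i :: 'a::comm_ring_1 fps) 0)"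
  by (induction T rule: infinite_finite_induct) auto

lemma nth_prod_linear_eq_0:
  fixes c :: "'b \<Rightarrow> 'a::comm_ring_1"
  assumes "finite T" "m > card T"
  shows "fps_nth (\<Prod>i\<in>T. 1 - fps_const (c i) * fps_X) m = 0"
  using assms
proof (induction T arbitrary: m rule: finite_induct)
  case (insert x T)
  then have "fps_nth (\<Prod>i\<in>T. 1 - fps_const (c i) * fps_X) m = 0"
    "fps_nth (\<Prod>i\<in>T. 1 - fps_const (c i) * fps_X) (m - 1) = 0" "m > 0"
    by auto
  then show ?case using insert.hyps by (simp add: left_diff_distrib mult.assoc)
qed simp

text \<open>The intended ring consists of the constant-coefficient differential operators, with
  \<open>h\<close> embedding the constants and \<open>Phi\<close> applying an operator to a fixed
  polynomial and evaluating at 0. Membership in \<open>Ann\<close> then says that the operator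
  annihilates the polynomial.\<close>

locale annihilator =
  fixes h :: "real \<Rightarrow> 'a::comm_ring_1" and Phi :: "'a \<Rightarrow> real"
  assumes h_add: "h (x + y) = h x + h y" and h_mult: "h (x * y) = h x * h y" and h_1 [simp]: "h 1 = 1"
    and Phi_add: "Phi (p + q) = Phi p + Phi q" and Phi_h: "Phi (h c * p) = c * Phi p"
begin

lemma h_0 [simp]: "h 0 = 0"
  using h_add[of 0 0] by simp

lemma h_minus: "h (- x) = - h x"
  using h_add[of x "- x"] by (simp add: add_eq_0_iff)

lemma h_sum: "h (sum f T) = (\<Sum>i\<in>T. h (f i))"
  by (induction T rule: infinite_finite_induct) (auto simp: h_add)

lemma h_power: "h (x ^ n) = h x ^ n"
  by (induction n) (auto simp: h_mult)

lemma h_of_nat: "h (of_nat n) = of_nat n"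
  by (induction n) (auto simp: h_add)

lemma Phi_0 [simp]: "Phi 0 = 0"
  using Phi_add[of 0 0] by simp

lemma Phi_sum: "Phi (sum f T) = (\<Sum>i\<in>T. Phi (f i))"
  by (induction T rule: infinite_finite_induct) (auto simp: Phi_add)

text \<open>The largest ideal contained in the kernel of \<open>Phi\<close>.\<close>

definition Ann :: "'a set" where
  "Ann = {p. \<forall>q. Phi (p * q) = 0}"

lemma Ann_0 [simp]: "0 \<in> Ann"
  by (simp add: Ann_def)

lemma Ann_add: "p \<in> Ann \<Longrightarrow> q \<in> Ann \<Longrightarrow> p + q \<in> Ann"
  by (simp add: Ann_def distrib_right Phi_add)

lemma Ann_mult: "p \<in> Ann \<Longrightarrow> q * p \<in> Ann"
proof -
  assume "p \<in> Ann"
  then have "Phi (p * (q * r)) = 0" for r by (simp add: Ann_def)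
  then show ?thesis by (simp add: Ann_def mult_ac)
qed

lemma Ann_mult': "p \<in> Ann \<Longrightarrow> p * q \<in> Ann"
  using Ann_mult[of p q] by (simp add: mult.commute)

lemma Ann_minus: "p \<in> Ann \<Longrightarrow> - p \<in> Ann"
  using Ann_mult[of p "- 1"] by simp

lemma Ann_diff: "p \<in> Ann \<Longrightarrow> q \<in> Ann \<Longrightarrow> p - q \<in> Ann"
  using Ann_add[OF _ Ann_minus, of p q] by simp

lemma Ann_sum: "(\<And>i. i \<in> T \<Longrightarrow> f i \<in> Ann) \<Longrightarrow> sum f T \<in> Ann"
  by (induction T rule: infinite_finite_induct) (auto simp: Ann_add)

lemma Ann_cancel: 
  assumes "h c * p \<in> Ann" "c \<noteq> 0"
  shows "p \<in> Ann"
proof -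
  have "h (1 / c) * (h c * p) = p"
    using assms(2) by (simp flip: h_mult mult.assoc)
  then show ?thesis using Ann_mult[OF assms(1)] by metis
qed

text \<open>Applying \<open>Phi\<close> after multiplication by q turns the family into a real
  polynomial in s with infinitely many roots, so each of its coefficients is 0.\<close>

lemma Ann_extract_coeff:
  assumes "\<And>s. s > 0 \<Longrightarrow> (\<Sum>j\<le>n. h (s ^ j) * v j) \<in> Ann" and "j \<le> n"
  shows "v j \<in> Ann"
  unfolding Ann_def
proof (intro CollectI allI)
  fix q
  define p where "p = (\<Sum>j\<le>n. monom (Phi (v j * q)) j)"
  have "poly p s = 0" if "s > 0" for s
  proof -
    have "poly p s = Phi ((\<Sum>j\<le>n. h (s ^ j) * v j) * q)"
      by (simp add: p_def poly_sum poly_monom sum_distrib_right Phi_sum Phi_h mult.assoc) (simp add: mult.commute)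
    then show ?thesis using assms(1)[OF that] by (simp add: Ann_def)
  qed
  then have "{0<..} \<subseteq> {s. poly p s = 0}" by auto
  then have "infinite {s. poly p s = 0}"
    using infinite_Ioi[of "0::real"] infinite_super by blast
  then have "p = 0" using poly_roots_finite by blast
  then have "coeff p j = 0" by simp
  then show "Phi (v j * q) = 0" using assms(2) by (simp add: p_def coeff_sum)
qed

section \<open>Substitution into power series and Newton's identities\<close>

definition sub :: "real fps \<Rightarrow> 'a \<Rightarrow> 'a fps" where
  "sub f a = Abs_fps (\<lambda>m. h (fps_nth f m) * a ^ m)"

lemma nth_sub [simp]: "fps_nth (sub f a) m = h (fps_nth f m) * a ^ m"
  by (simp add: sub_def)

lemma sub_mult: "sub (f * g) a = sub f a * sub g a"
proof (rule fps_ext)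
  fix n
  have "h (fps_nth f i * fps_nth g (n - i)) * a ^ n = h (fps_nth f i) * a ^ i * (h (fps_nth g (n - i)) * a ^ (n - i))"
    if "i \<le> n" for i
  proof -
    have "a ^ n = a ^ i * a ^ (n - i)" using that by (simp flip: power_add)
    then show ?thesis by (simp add: h_mult mult_ac)
  qed
  then show "fps_nth (sub (f * g) a) n = fps_nth (sub f a * sub g a) n"
    by (simp add: fps_mult_nth h_sum sum_distrib_right)
qed

lemma sub_1 [simp]: "sub 1 a = 1"
  by (rule fps_ext) simp

lemma X_deriv_sub: "fps_X * fps_deriv (sub f a) = sub (fps_X * fps_deriv f) a"
  by (rule fps_ext) (auto simp: h_mult h_of_nat mult.assoc simp flip: of_nat_Suc)

text \<open>The logarithmic derivative turns the product K into the sum of the series kap(a_i X),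
  whose coefficients are multiples of power sums. F = 1 - X gives the classical identity; the
  general F is needed for \<open>fps_mix s\<close>.\<close>

lemma newton_identity:
  fixes a :: "'b \<Rightarrow> 'a"
  assumes "fps_X * fps_deriv F = F * kap" "fps_nth kap 0 = 0" "finite T"
  defines "K \<equiv> \<Prod>i\<in>T. sub F (a i)"
  shows "of_nat m * fps_nth K m = (\<Sum>j=1..m. h (fps_nth kap j) * (\<Sum>i\<in>T. a i ^ j) * fps_nth K (m - j))"
proof -
  have "fps_X * fps_deriv K = K * (\<Sum>i\<in>T. sub kap (a i))"
    unfolding K_def using assms by (intro X_deriv_prod) (auto simp: X_deriv_sub sub_mult)
  then have "fps_nth (fps_X * fps_deriv K) m = fps_nth ((\<Sum>i\<in>T. sub kap (a i)) * K) m"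
    by (simp add: mult.commute)
  also have "\<dots> = (\<Sum>j=0..m. h (fps_nth kap j) * (\<Sum>i\<in>T. a i ^ j) * fps_nth K (m - j))"
    by (simp add: fps_mult_nth fps_sum_nth sum_distrib_left)
  also have "\<dots> = (\<Sum>j=1..m. h (fps_nth kap j) * (\<Sum>i\<in>T. a i ^ j) * fps_nth K (m - j))"
    using assms(2) by (simp add: sum.atLeast_Suc_atMost)
  finally show ?thesis by (cases m) (auto simp flip: of_nat_Suc)
qed

text \<open>Modulo the ideal only the summand j = m survives, and there the remaining factor is K_0
  = 1.\<close>

lemma newton_identity_Ann:
  assumes "fps_X * fps_deriv F = F * kap" "fps_nth kap 0 = 0" "fps_nth F 0 = 1" "finite T" "m > 0"
    and "\<And>j. 0 < j \<Longrightarrow> j < m \<Longrightarrow> (\<Sum>i\<in>T. a i ^ j) \<in> Ann"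
  shows "of_nat m * fps_nth (\<Prod>i\<in>T. sub F (a i)) m - h (fps_nth kap m) * (\<Sum>i\<in>T. a i ^ m) \<in> Ann"
proof -
  let ?K = "\<Prod>i\<in>T. sub F (a i)"
  let ?t = "\<lambda>j. h (fps_nth kap j) * (\<Sum>i\<in>T. a i ^ j) * fps_nth ?K (m - j)"
  have K0: "fps_nth ?K 0 = 1" using assms(3,4) by (simp add: nth_prod_0)
  have "of_nat m * fps_nth ?K m = (\<Sum>j=1..m. ?t j)"
    by (rule newton_identity) fact+
  also have "\<dots> = (\<Sum>j\<in>{1..<m}. ?t j) + ?t m"
  proof -
    have "{1..m} = insert m {1..<m}" using assms(5) by auto
    then show ?thesis by (simp add: add.commute)
  qed
  finally have "of_nat m * fps_nth ?K m - h (fps_nth kap m) * (\<Sum>i\<in>T. a i ^ m) = (\<Sum>j\<in>{1..<m}. ?t j)"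
    by (simp add: K0)
  moreover have "(\<Sum>j\<in>{1..<m}. ?t j) \<in> Ann"
  proof (rule Ann_sum)
    fix j assume "j \<in> {1..<m}"
    then have "(\<Sum>i\<in>T. a i ^ j) \<in> Ann" using assms(6) by auto
    then show "?t j \<in> Ann" by (rule Ann_mult'[OF Ann_mult])
  qed
  ultimately show ?thesis by simp
qed

text \<open>The coefficient of s^k in the product of cos + s sinc over \<open>T\<close>: a sinc for
  each direction along a k-face, a cos for each coordinate that is fixed on it.\<close>

definition skel_series :: "'b set \<Rightarrow> ('b \<Rightarrow> 'a) \<Rightarrow> nat \<Rightarrow> 'a fps" where
  "skel_series T a k = (\<Sum>S | S \<subseteq> T \<and> card S = k.
     (\<Prod>i\<in>S. sub fps_sinc_sqrt (a i)) * (\<Prod>i\<in>T - S. sub fps_cos_sqrt (a i)))"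

lemma prod_sub_mix:
  assumes "finite T" "s > 0"
  shows "fps_const (h ((1 + s) ^ card T)) * (\<Prod>i\<in>T. sub (fps_mix s) (a i))
       = (\<Sum>j\<le>card T. fps_const (h (s ^ j)) * skel_series T a j)"
proof -
  let ?C = "\<lambda>i. sub fps_cos_sqrt (a i)" and ?S = "\<lambda>i. sub fps_sinc_sqrt (a i)"
  have "fps_const (h (1 + s)) * sub (fps_mix s) (a i) = fps_const (h s) * ?S i + ?C i" for i
  proof (rule fps_ext)
    fix n
    have "(1 + s) * fps_nth (fps_mix s) n = s * fps_nth fps_sinc_sqrt n + fps_nth fps_cos_sqrt n"
      using assms(2) by (simp add: fps_mix_def divide_simps)
    then show "fps_nth (fps_const (h (1 + s)) * sub (fps_mix s) (a i)) n = fps_nth (fps_const (h s) * ?S i + ?C i) n"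
      by (simp flip: h_mult h_add distrib_right mult.assoc)
  qed
  then have "(\<Prod>i\<in>T. fps_const (h s) * ?S i + ?C i) = (\<Prod>i\<in>T. fps_const (h (1 + s)) * sub (fps_mix s) (a i))"
    by simp
  then have "fps_const (h ((1 + s) ^ card T)) * (\<Prod>i\<in>T. sub (fps_mix s) (a i)) = (\<Prod>i\<in>T. fps_const (h s) * ?S i + ?C i)"
    by (simp add: prod.distrib h_power flip: fps_const_power)
  also have "\<dots> = (\<Sum>S\<in>Pow T. (\<Prod>i\<in>S. fps_const (h s) * ?S i) * (\<Prod>i\<in>T - S. ?C i))"
    by (rule prod_add) fact
  also have "\<dots> = (\<Sum>S\<in>Pow T. fps_const (h (s ^ card S)) * ((\<Prod>i\<in>S. ?S i) * (\<Prod>i\<in>T - S. ?C i)))"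
    by (simp add: prod.distrib h_power mult.assoc flip: fps_const_power)
  also have "\<dots> = (\<Sum>j\<le>card T. \<Sum>S | S \<in> Pow T \<and> card S = j. fps_const (h (s ^ card S)) * ((\<Prod>i\<in>S. ?S i) * (\<Prod>i\<in>T - S. ?C i)))"
    using assms(1) by (intro sum.group[symmetric]) (auto intro: card_mono)
  also have "\<dots> = (\<Sum>j\<le>card T. fps_const (h (s ^ j)) * skel_series T a j)"
    by (simp add: skel_series_def sum_distrib_left)
  finally show ?thesis .
qed

text \<open>Once the lower power sums lie in the ideal, Newton's identity for
  \<open>fps_mix s\<close> times (1 + s)^n says that the sum over j of s^j * (m * (skeleton series
  j)_m + r_j * p_m) is in the ideal for every s > 0, with p_m the m-th power sum. The coefficient of
  s^k, together with the hypothesis on the k-th series and r_k > 0, yields p_m.\<close>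

lemma power_sums_in_Ann:
  assumes "finite T" "k \<le> card T" and skel: "\<And>m. m > 0 \<Longrightarrow> fps_nth (skel_series T a k) m \<in> Ann"
    and "0 < m" "m \<le> card T"
  shows "(\<Sum>i\<in>T. a i ^ m) \<in> Ann"
  using assms(4,5)
proof (induction m rule: less_induct)
  case (less m)
  let ?n = "card T" and ?p = "\<Sum>i\<in>T. a i ^ m"
  obtain q where q: "pos_coeffs m q" and qs: "\<And>s. s > 0 \<Longrightarrow> fps_nth (fps_kappa s) m = - poly q s / (1 + s) ^ m"
    using kappa_coeffs_negative[OF less.prems(1)] by blast
  \<comment> \<open>Since m \<le> n, the denominator (1 + s)^m can be raised to (1 + s)^n. The
    numerator then has positive coefficients in all degrees up to n, in particular at every
    admissible k.\<close>
  define r where "r = [:1, 1:] ^ (?n - m) * q"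
  have r: "pos_coeffs ?n r"
    using pos_coeffs_times_power_1X[OF q, of "?n - m"] less.prems by (simp add: r_def)
  define v where "v = (\<lambda>j. of_nat m * fps_nth (skel_series T a j) m + h (coeff r j) * ?p)"
  have "(\<Sum>j\<le>?n. h (s ^ j) * v j) \<in> Ann" if s: "s > 0" for s
  proof -
    let ?K = "\<Prod>i\<in>T. sub (fps_mix s) (a i)"
    have "of_nat m * fps_nth ?K m - h (fps_nth (fps_kappa s) m) * ?p \<in> Ann"
      using less s assms(1) by (intro newton_identity_Ann) (auto simp: X_deriv_mix nth_mix_0)
    then have "h ((1 + s) ^ ?n) * (of_nat m * fps_nth ?K m - h (fps_nth (fps_kappa s) m) * ?p) \<in> Ann"
      by (rule Ann_mult)
    moreover have "h ((1 + s) ^ ?n) * (of_nat m * fps_nth ?K m) = (\<Sum>j\<le>?n. h (s ^ j) * (of_nat m * fps_nth (skel_series T a j) m))"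
    proof -
      have *: "h ((1 + s) ^ ?n) * fps_nth ?K m = (\<Sum>j\<le>?n. h (s ^ j) * fps_nth (skel_series T a j) m)"
        using arg_cong[OF prod_sub_mix[OF assms(1) s, of a], of "\<lambda>f. fps_nth f m"]
        by (simp add: fps_sum_nth)
      have "h ((1 + s) ^ ?n) * (of_nat m * fps_nth ?K m) = of_nat m * (h ((1 + s) ^ ?n) * fps_nth ?K m)"
        by (simp only: mult.left_commute)
      also have "\<dots> = (\<Sum>j\<le>?n. h (s ^ j) * (of_nat m * fps_nth (skel_series T a j) m))"
        unfolding * by (simp only: sum_distrib_left mult.left_commute)
      finally show ?thesis .
    qed
    moreover have "h ((1 + s) ^ ?n) * (h (fps_nth (fps_kappa s) m) * ?p) = - (\<Sum>j\<le>?n. h (s ^ j) * (h (coeff r j) * ?p))"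
    proof -
      have "(1 + s) ^ ?n = (1 + s) ^ (?n - m) * (1 + s) ^ m" using less.prems by (simp flip: power_add)
      then have "(1 + s) ^ ?n * fps_nth (fps_kappa s) m = - poly r s"
        using s by (simp add: qs[OF s] r_def poly_power)
      also have "poly r s = (\<Sum>j\<le>?n. s ^ j * coeff r j)"
      proof -
        have "degree r \<le> ?n" using r by (intro degree_le) (auto simp: pos_coeffs_def)
        then have "poly r s = (\<Sum>j\<le>?n. coeff r j * s ^ j)"
          unfolding poly_altdef by (intro sum.mono_neutral_left) (auto simp: coeff_eq_0)
        then show ?thesis by (simp add: mult.commute)
      qed
      finally have "h ((1 + s) ^ ?n) * h (fps_nth (fps_kappa s) m) = - (\<Sum>j\<le>?n. h (s ^ j) * h (coeff r j))"
        by (simp only: h_sum h_minus flip: h_mult)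
      then show ?thesis
        by (simp only: sum_distrib_right mult_minus_left flip: mult.assoc)
    qed
    ultimately show ?thesis
      by (simp add: v_def right_diff_distrib distrib_left sum.distrib)
  qed
  then have "v k \<in> Ann" using Ann_extract_coeff[where n = ?n and v = v] assms(2) by blast
  moreover have "of_nat m * fps_nth (skel_series T a k) m \<in> Ann"
    using skel less.prems by (intro Ann_mult) auto
  ultimately have "h (coeff r k) * ?p \<in> Ann"
    using Ann_diff unfolding v_def by (metis add_diff_cancel_left')
  then show ?case by (rule Ann_cancel) (use r assms(2) in \<open>auto simp: pos_coeffs_def order_less_le\<close>)
qed

section \<open>Elementary and complete symmetric polynomials in the ideal\<close>

lemma sub_1_minus_X: "sub (1 - fps_X) a = 1 - fps_const a * fps_X"
  by (rule fps_ext) (auto simp: h_minus fps_X_def)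

text \<open>Newton's identity for F = 1 - X, where X F' / F = - (X + X^2 + ...). Above degree
  \<open>card T\<close> the coefficient is 0.\<close>

lemma elementary_in_Ann:
  assumes "finite T" and p: "\<And>m. 0 < m \<Longrightarrow> m \<le> card T \<Longrightarrow> (\<Sum>i\<in>T. a i ^ m) \<in> Ann" and "m > 0"
  shows "fps_nth (\<Prod>i\<in>T. 1 - fps_const (a i) * fps_X) m \<in> Ann"
proof (cases "m > card T")
  case False
  define kap :: "real fps" where "kap = Abs_fps (\<lambda>j. if j = 0 then 0 else - 1)"
  have "fps_X * fps_deriv (1 - fps_X) = (1 - fps_X) * kap"
    by (rule fps_ext) (auto simp: kap_def left_diff_distrib)
  then have "of_nat m * fps_nth (\<Prod>i\<in>T. sub (1 - fps_X) (a i)) m - h (fps_nth kap m) * (\<Sum>i\<in>T. a i ^ m) \<in> Ann"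
    using assms False by (intro newton_identity_Ann) (auto simp: kap_def)
  then have "of_nat m * fps_nth (\<Prod>i\<in>T. sub (1 - fps_X) (a i)) m - h (fps_nth kap m) * (\<Sum>i\<in>T. a i ^ m)
      + h (fps_nth kap m) * (\<Sum>i\<in>T. a i ^ m) \<in> Ann"
    using p[of m] False assms(3) by (intro Ann_add Ann_mult) auto
  then have "h (of_nat m) * fps_nth (\<Prod>i\<in>T. sub (1 - fps_X) (a i)) m \<in> Ann"
    by (simp add: h_of_nat)
  then have "fps_nth (\<Prod>i\<in>T. sub (1 - fps_X) (a i)) m \<in> Ann"
    by (rule Ann_cancel) (use assms(3) in simp)
  then show ?thesis by (simp only: sub_1_minus_X)
qed (use assms(1) in \<open>simp add: nth_prod_linear_eq_0\<close>)

text \<open>The series 1 / (1 - a X). Coefficients of products of these are the complete homogeneous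
  symmetric polynomials.\<close>

definition geom :: "'a \<Rightarrow> 'a fps" where
  "geom a = Abs_fps (\<lambda>m. a ^ m)"

lemma geom_mult: "geom a * (1 - fps_const a * fps_X) = 1"
proof -
  have "geom a = sub (Abs_fps (\<lambda>_. 1)) a" by (rule fps_ext) (simp add: geom_def)
  moreover have "Abs_fps (\<lambda>_. 1 :: real) * (1 - fps_X) = 1"
    by (rule fps_ext) (auto simp: right_diff_distrib)
  ultimately show ?thesis by (simp flip: sub_1_minus_X sub_mult)
qed

text \<open>Modulo the ideal, the product over a subset \<open>R\<close> of the geometric series is the complementary product
  of linear factors, hence a polynomial of degree \<open>card T - card R\<close>.\<close>
lemma complete_in_Ann:
  assumes T: "finite T" and p: "\<And>m. 0 < m \<Longrightarrow> m \<le> card T \<Longrightarrow> (\<Sum>i\<in>T. a i ^ m) \<in> Ann"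
    and R: "R \<subseteq> T" and m: "m > card T - card R"
  shows "fps_nth (\<Prod>i\<in>R. geom (a i)) m \<in> Ann"
proof -
  let ?l = "\<lambda>i. 1 - fps_const (a i) * fps_X"
  define G where "G = (\<Prod>i\<in>R. geom (a i))"
  define E where "E = (\<Prod>i\<in>T. ?l i)"
  have E: "E = (\<Prod>i\<in>R. ?l i) * (\<Prod>i\<in>T - R. ?l i)"
    unfolding E_def prod.subset_diff[OF R T] by (rule mult.commute)
  have G: "G * (\<Prod>i\<in>R. ?l i) = 1"
    unfolding G_def prod.distrib[symmetric] by (simp only: geom_mult prod.neutral_const)
  have GE: "G * E = (\<Prod>i\<in>T - R. ?l i)"
    unfolding E mult.assoc[symmetric] G by (rule mult_1)
  have fin: "finite R" using T R finite_subset by blast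
  have "fps_nth (G * E) m = 0"
  proof -
    have "card (T - R) < m" using card_Diff_subset[OF fin R] m by simp
    then show ?thesis unfolding GE using T by (intro nth_prod_linear_eq_0) simp_all
  qed
  \<comment> \<open>G = G E - G (E - 1), where G E vanishes at degree m and all coefficients of E -
    1 lie in the ideal.\<close>
  moreover have "G * (E - 1) = G * E - G" by (simp add: algebra_simps)
  ultimately have *: "fps_nth G m = - fps_nth (G * (E - 1)) m" by simp
  have "- fps_nth (G * (E - 1)) m \<in> Ann"
    unfolding fps_mult_nth
  proof (intro Ann_minus Ann_sum Ann_mult)
    fix i
    show "fps_nth (E - 1) (m - i) \<in> Ann"
    proof (cases "m - i = 0")
      case True
      have "fps_nth E 0 = 1" by (simp add: E_def nth_prod_0)
      then show ?thesis using True by simp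
    next
      case False
      then have "fps_nth E (m - i) \<in> Ann"
        unfolding E_def by (intro elementary_in_Ann T p) auto
      then show ?thesis using False by simp
    qed
  qed
  then show ?thesis using * by (simp add: G_def)
qed

end

subsection \<open>Polynomial functions in divided-power coordinates\<close>

lemma pos_poly_eq_0D:
  fixes c :: "nat \<Rightarrow> real"
  assumes "\<And>s. s > 0 \<Longrightarrow> (\<Sum>j\<le>n. c j * s ^ j) = 0" and "j \<le> n"
  shows "c j = 0"
proof -
  define p where "p = (\<Sum>j\<le>n. monom (c j) j)"
  have "{0<..} \<subseteq> {s. poly p s = 0}"
    using assms(1) by (auto simp: p_def poly_sum poly_monom)
  then have "infinite {s. poly p s = 0}"
    using infinite_Ioi[of "0::real"] infinite_super by blast
  then have "p = 0" using poly_roots_finite by blast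
  then have "coeff p j = 0" by simp
  then show ?thesis using assms(2) by (simp add: p_def coeff_sum)
qed

definition expo_box :: "nat \<Rightarrow> ('n::finite \<Rightarrow> nat) set" where
  "expo_box d = {\<beta>. \<forall>i. \<beta> i \<le> d}"

definition expo_deg :: "('n::finite \<Rightarrow> nat) \<Rightarrow> nat" where
  "expo_deg \<beta> = (\<Sum>i\<in>UNIV. \<beta> i)"

definition expo_inc :: "'n \<Rightarrow> ('n \<Rightarrow> nat) \<Rightarrow> 'n \<Rightarrow> nat" where
  "expo_inc i \<beta> = \<beta>(i := Suc (\<beta> i))"

text \<open>Divided powers: differentiation lowers an exponent without producing a factor, and the
  binomial expansion in \<open>dmon_add\<close> has no coefficients.\<close>

definition dmon :: "('n::finite \<Rightarrow> nat) \<Rightarrow> real ^ 'n \<Rightarrow> real" where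
  "dmon \<beta> x = (\<Prod>i\<in>UNIV. x $ i ^ \<beta> i / fact (\<beta> i))"

text \<open>\<open>\<phi>\<close> is the family of partial derivatives at 0. Every \<open>d\<close>
  whose box contains the support of \<open>\<phi>\<close> gives the same function, see
  \<open>pf_mono\<close>.\<close>

definition pf :: "nat \<Rightarrow> (('n::finite \<Rightarrow> nat) \<Rightarrow> real) \<Rightarrow> real ^ 'n \<Rightarrow> real" where
  "pf d \<phi> x = (\<Sum>\<beta>\<in>expo_box d. \<phi> \<beta> * dmon \<beta> x)"

definition supp_in :: "nat \<Rightarrow> (('n::finite \<Rightarrow> nat) \<Rightarrow> real) \<Rightarrow> bool" where
  "supp_in d \<phi> \<longleftrightarrow> (\<forall>\<beta>. \<phi> \<beta> \<noteq> 0 \<longrightarrow> \<beta> \<in> expo_box d)"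

lemma finite_expo_le: "finite {\<alpha>. \<forall>i. \<alpha> i \<le> (\<gamma> :: 'n::finite \<Rightarrow> nat) i}"
proof -
  have "{\<alpha>. \<forall>i. \<alpha> i \<le> \<gamma> i} = PiE UNIV (\<lambda>i. {..\<gamma> i})"
    by (auto simp: PiE_def Pi_def)
  then show ?thesis by (simp add: finite_PiE)
qed

lemma finite_expo_box [simp]: "finite (expo_box d :: ('n::finite \<Rightarrow> nat) set)"
  using finite_expo_le[of "\<lambda>_. d"] by (simp add: expo_box_def)

lemma expo_deg_inc: "expo_deg (expo_inc i \<beta>) = Suc (expo_deg \<beta>)"
proof -
  have "expo_deg \<gamma> = \<gamma> i + (\<Sum>j\<in>UNIV - {i}. \<gamma> j)" for \<gamma> :: "'a \<Rightarrow> nat"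
    by (simp add: expo_deg_def sum.remove)
  from this[of "expo_inc i \<beta>"] this[of \<beta>] show ?thesis
    by (simp add: expo_inc_def)
qed

lemma expo_deg_add: "expo_deg (\<alpha> + \<beta>) = expo_deg \<alpha> + expo_deg \<beta>"
  by (simp add: expo_deg_def sum.distrib)

lemma expo_le_deg: "\<beta> i \<le> expo_deg \<beta>"
  by (simp add: expo_deg_def member_le_sum)

lemma expo_deg_cases:
  assumes "expo_deg \<alpha> = Suc n"
  obtains i \<beta> where "\<alpha> = expo_inc i \<beta>" "expo_deg \<beta> = n"
proof -
  have "\<exists>i. \<alpha> i \<noteq> 0"
  proof (rule ccontr)
    assume "\<nexists>i. \<alpha> i \<noteq> 0"
    then show False using assms by (simp add: expo_deg_def)
  qed
  then obtain i where i: "\<alpha> i \<noteq> 0" ..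
  define \<beta> where "\<beta> = \<alpha>(i := \<alpha> i - 1)"
  have "\<alpha> = expo_inc i \<beta>" using i by (auto simp: \<beta>_def expo_inc_def)
  moreover have "expo_deg \<beta> = n" using assms unfolding \<open>\<alpha> = expo_inc i \<beta>\<close> expo_deg_inc by simp
  ultimately show thesis by (rule that)
qed

lemma expo_deg_0: "expo_deg \<alpha> = 0 \<longleftrightarrow> \<alpha> = 0"
  by (auto simp: expo_deg_def fun_eq_iff)

lemma dmon_at_0: "dmon \<beta> 0 = (if \<beta> = 0 then 1 else 0)"
proof (cases "\<beta> = 0")
  case False
  then obtain i where "\<beta> i \<noteq> 0" by (auto simp: fun_eq_iff)
  then have "(0::real) ^ \<beta> i / fact (\<beta> i) = 0" by simp
  then have "dmon \<beta> 0 = 0" unfolding dmon_def by (intro prod_zero) (auto intro: exI[of _ i])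
  then show ?thesis using False by simp
qed (simp add: dmon_def)

lemma dmon_0 [simp]: "dmon 0 x = 1" "dmon (\<lambda>_. 0) x = 1"
  by (simp_all add: dmon_def)

lemma dmon_scale: "dmon \<beta> (r *\<^sub>R x) = r ^ expo_deg \<beta> * dmon \<beta> x"
proof -
  have "dmon \<beta> (r *\<^sub>R x) = (\<Prod>i\<in>UNIV. r ^ \<beta> i * (x $ i ^ \<beta> i / fact (\<beta> i)))"
    unfolding dmon_def by (intro prod.cong) (auto simp: power_mult_distrib)
  then show ?thesis unfolding prod.distrib power_sum[symmetric] by (simp add: dmon_def expo_deg_def)
qed

lemma pf_at_0: "pf d \<phi> 0 = \<phi> 0"
proof -
  have "pf d \<phi> 0 = (\<Sum>\<beta>\<in>expo_box d. if \<beta> = 0 then \<phi> \<beta> else 0)"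
    unfolding pf_def by (intro sum.cong) (auto simp: dmon_at_0)
  also have "\<dots> = \<phi> 0"
    by (simp add: sum.delta) (simp add: expo_box_def)
  finally show ?thesis .
qed

lemma continuous_on_dmon [continuous_intros]: "continuous_on A (dmon \<beta>)"
  unfolding dmon_def by (intro continuous_intros) auto

lemma continuous_on_pf [continuous_intros]: "continuous_on A (pf d \<phi>)"
  unfolding pf_def by (intro continuous_intros)

lemma pf_add: "pf d (\<lambda>\<beta>. \<phi> \<beta> + \<psi> \<beta>) x = pf d \<phi> x + pf d \<psi> x"
  by (simp add: pf_def sum.distrib distrib_right)

lemma pf_diff: "pf d (\<lambda>\<beta>. \<phi> \<beta> - \<psi> \<beta>) x = pf d \<phi> x - pf d \<psi> x"
  by (simp add: pf_def sum_subtractf left_diff_distrib)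

lemma pf_scale: "pf d (\<lambda>\<beta>. c * \<phi> \<beta>) x = c * pf d \<phi> x"
  by (simp add: pf_def sum_distrib_left mult.assoc)

lemma supp_in_mono: "supp_in d \<phi> \<Longrightarrow> d \<le> e \<Longrightarrow> supp_in e \<phi>"
  unfolding supp_in_def expo_box_def by (blast intro: le_trans)

lemma pf_mono:
  assumes "supp_in d \<phi>" "d \<le> e"
  shows "pf e \<phi> = pf d \<phi>"
proof
  fix x
  have "expo_box d \<subseteq> (expo_box e :: ('a \<Rightarrow> nat) set)"
    using assms(2) by (auto simp: expo_box_def intro: order_trans)
  then show "pf e \<phi> x = pf d \<phi> x"
    unfolding pf_def using assms(1) by (intro sum.mono_neutral_right) (auto simp: supp_in_def)
qed

lemma supp_in_inc: "supp_in d \<phi> \<Longrightarrow> supp_in d (\<lambda>\<beta>. \<phi> (expo_inc i \<beta>))"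
proof -
  have "\<beta> \<in> expo_box d" if "expo_inc i \<beta> \<in> expo_box d" for \<beta>
    unfolding expo_box_def
  proof (intro CollectI allI)
    fix j
    have "\<beta> j \<le> expo_inc i \<beta> j" by (simp add: expo_inc_def)
    also have "\<dots> \<le> d" using that by (simp add: expo_box_def)
    finally show "\<beta> j \<le> d" .
  qed
  then show "supp_in d \<phi> \<Longrightarrow> supp_in d (\<lambda>\<beta>. \<phi> (expo_inc i \<beta>))"
    unfolding supp_in_def by blast
qed

lemma dmon_has_partial:
  "((\<lambda>t. dmon \<beta> (x + t *\<^sub>R axis i 1)) has_real_derivative
     (if \<beta> i = 0 then 0 else dmon (\<beta>(i := \<beta> i - 1)) x)) (at 0)"
proof -
  define c where "c = (\<Prod>j\<in>UNIV - {i}. x $ j ^ \<beta> j / fact (\<beta> j))"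
  have split: "dmon \<gamma> y = (y $ i ^ \<gamma> i / fact (\<gamma> i)) * (\<Prod>j\<in>UNIV - {i}. y $ j ^ \<gamma> j / fact (\<gamma> j))" for \<gamma> y
    by (simp add: dmon_def prod.remove)
  have "(\<lambda>t. dmon \<beta> (x + t *\<^sub>R axis i 1)) = (\<lambda>t. (x $ i + t) ^ \<beta> i / fact (\<beta> i) * c)"
    by (rule ext, subst split) (auto simp: c_def axis_def intro!: prod.cong)
  moreover have "((\<lambda>t. (x $ i + t) ^ \<beta> i / fact (\<beta> i) * c) has_real_derivative
       (real (\<beta> i) * (x $ i) ^ (\<beta> i - 1) / fact (\<beta> i) * c)) (at 0)"
    by (auto intro!: derivative_eq_intros)
  moreover have "real (\<beta> i) * (x $ i) ^ (\<beta> i - 1) / fact (\<beta> i) * c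
      = (if \<beta> i = 0 then 0 else dmon (\<beta>(i := \<beta> i - 1)) x)"
  proof (cases "\<beta> i")
    case (Suc m)
    have "dmon (\<beta>(i := \<beta> i - 1)) x = (x $ i) ^ m / fact m * c"
      by (subst split) (auto simp: c_def Suc intro!: prod.cong)
    then show ?thesis using Suc by (simp add: divide_simps)
  qed simp
  ultimately show ?thesis by simp
qed

lemma pf_has_partial:
  assumes "supp_in d \<phi>"
  shows "((\<lambda>t. pf d \<phi> (x + t *\<^sub>R axis i 1)) has_real_derivative pf d (\<lambda>\<beta>. \<phi> (expo_inc i \<beta>)) x) (at 0)"
proof -
  have "((\<lambda>t. pf d \<phi> (x + t *\<^sub>R axis i 1)) has_real_derivative
      (\<Sum>\<beta>\<in>expo_box d. \<phi> \<beta> * (if \<beta> i = 0 then 0 else dmon (\<beta>(i := \<beta> i - 1)) x))) (at 0)"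
    unfolding pf_def by (intro DERIV_sum DERIV_cmult dmon_has_partial)
  moreover have "(\<Sum>\<beta>\<in>expo_box d. \<phi> \<beta> * (if \<beta> i = 0 then 0 else dmon (\<beta>(i := \<beta> i - 1)) x))
      = pf d (\<lambda>\<beta>. \<phi> (expo_inc i \<beta>)) x"
  proof -
    have "(\<Sum>\<beta>\<in>expo_box d. \<phi> \<beta> * (if \<beta> i = 0 then 0 else dmon (\<beta>(i := \<beta> i - 1)) x))
       = (\<Sum>\<beta> | \<beta> \<in> expo_box d \<and> \<beta> i \<noteq> 0. \<phi> \<beta> * dmon (\<beta>(i := \<beta> i - 1)) x)"
      by (rule sum.mono_neutral_cong_right) auto
    also have "\<dots> = (\<Sum>\<beta> | \<beta> \<in> expo_box d \<and> expo_inc i \<beta> \<in> expo_box d. \<phi> (expo_inc i \<beta>) * dmon \<beta> x)"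
    proof (rule sum.reindex_bij_witness[where i = "expo_inc i" and j = "\<lambda>\<beta>. \<beta>(i := \<beta> i - 1)"])
      fix \<beta> :: "'a \<Rightarrow> nat" assume *: "\<beta> \<in> {\<beta>. \<beta> \<in> expo_box d \<and> \<beta> i \<noteq> 0}"
      then show **: "expo_inc i (\<beta>(i := \<beta> i - 1)) = \<beta>" by (auto simp: expo_inc_def)
      have "\<beta>(i := \<beta> i - 1) \<in> expo_box d" using * by (simp add: expo_box_def le_diff_conv le_SucI)
      then show "\<beta>(i := \<beta> i - 1) \<in> {\<beta>. \<beta> \<in> expo_box d \<and> expo_inc i \<beta> \<in> expo_box d}"
        using * ** by simp
    qed (auto simp: expo_inc_def)
    also have "\<dots> = pf d (\<lambda>\<beta>. \<phi> (expo_inc i \<beta>)) x"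
      unfolding pf_def using assms by (intro sum.mono_neutral_cong_left) (auto simp: supp_in_def)
    finally show ?thesis .
  qed
  ultimately show ?thesis by simp
qed

lemma partial_deriv_pf:
  assumes "supp_in d \<phi>"
  shows "partial_deriv i (pf d \<phi>) = pf d (\<lambda>\<beta>. \<phi> (expo_inc i \<beta>))"
  unfolding partial_deriv_def using pf_has_partial[OF assms] by (auto intro!: DERIV_imp_deriv)

text \<open>A partial derivative shifts the family and a value at 0 reads off its entry at 0, so
  induction on the degree reaches every coefficient.\<close>

lemma pf_eq_0D:
  assumes "supp_in d \<phi>" "pf d \<phi> = (\<lambda>_. 0)"
  shows "\<phi> \<alpha> = 0"
proof -
  have "expo_deg \<alpha> = n \<Longrightarrow> \<phi> \<alpha> = 0" for n
    using assms
  proof (induction n arbitrary: \<phi> \<alpha>)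
    case 0
    then show ?case using pf_at_0[of d \<phi>] by (simp add: expo_deg_0 zero_fun_def)
  next
    case (Suc n)
    obtain i \<beta> where \<beta>: "\<alpha> = expo_inc i \<beta>" "expo_deg \<beta> = n"
      using Suc.prems(1) by (rule expo_deg_cases)
    have "pf d (\<lambda>\<beta>. \<phi> (expo_inc i \<beta>)) = (\<lambda>_. 0)"
      using partial_deriv_pf[OF Suc.prems(2), of i] unfolding Suc.prems(3)
      by (simp add: partial_deriv_def fun_eq_iff)
    from Suc.IH[OF \<beta>(2) supp_in_inc[OF Suc.prems(2)] this] show ?case by (simp add: \<beta>)
  qed
  then show ?thesis by blast
qed

lemma pf_inject:
  assumes "supp_in d \<phi>" "supp_in d \<psi>" "pf d \<phi> = pf d \<psi>"
  shows "\<phi> = \<psi>"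
proof
  fix \<alpha>
  have "supp_in d (\<lambda>\<beta>. \<phi> \<beta> - \<psi> \<beta>)" using assms(1,2) unfolding supp_in_def
    by (metis diff_zero)
  moreover have "pf d (\<lambda>\<beta>. \<phi> \<beta> - \<psi> \<beta>) = (\<lambda>_. 0)" using assms(3) by (simp add: pf_diff fun_eq_iff)
  ultimately have "\<phi> \<alpha> - \<psi> \<alpha> = 0" by (rule pf_eq_0D)
  then show "\<phi> \<alpha> = \<psi> \<alpha>" by simp
qed

lemma dmon_add:
  "dmon \<gamma> (x + y) = (\<Sum>\<alpha> | \<forall>i. \<alpha> i \<le> \<gamma> i. dmon \<alpha> y * dmon (\<gamma> - \<alpha>) x)"
proof -
  have one: "(a + b) ^ n / fact n = (\<Sum>j\<le>n. (b ^ j / fact j) * (a ^ (n - j) / fact (n - j)))" for a b :: real and n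
  proof -
    have "(b + a) ^ n / fact n = (\<Sum>j\<le>n. of_nat (n choose j) * b ^ j * a ^ (n - j) / fact n)"
      by (simp add: binomial_ring sum_divide_distrib)
    also have "\<dots> = (\<Sum>j\<le>n. (b ^ j / fact j) * (a ^ (n - j) / fact (n - j)))"
      by (intro sum.cong) (auto simp: binomial_fact divide_simps)
    finally show ?thesis by (simp add: add.commute)
  qed
  have "dmon \<gamma> (x + y) = (\<Prod>i\<in>UNIV. \<Sum>j\<in>{..\<gamma> i}. (y $ i ^ j / fact j) * (x $ i ^ (\<gamma> i - j) / fact (\<gamma> i - j)))"
    unfolding dmon_def vector_add_component one ..
  also have "\<dots> = (\<Sum>\<alpha>\<in>PiE UNIV (\<lambda>i. {..\<gamma> i}). \<Prod>i\<in>UNIV. (y $ i ^ \<alpha> i / fact (\<alpha> i)) * (x $ i ^ (\<gamma> i - \<alpha> i) / fact (\<gamma> i - \<alpha> i)))"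
    by (rule prod_sum_PiE) auto
  also have "PiE UNIV (\<lambda>i. {..\<gamma> i}) = {\<alpha>. \<forall>i. \<alpha> i \<le> \<gamma> i}"
    by (auto simp: PiE_def Pi_def)
  finally show ?thesis by (simp add: dmon_def prod.distrib del: times_divide_eq_left times_divide_eq_right)
qed

text \<open>Expand each divided power by \<open>dmon_add\<close> and reindex by \<gamma> = \<alpha>
  + \<beta>. The pairs in the square of the box with \<alpha> + \<beta> outside the box contribute
  0, because \<open>\<phi>\<close> vanishes there.\<close>

lemma pf_taylor:
  fixes \<phi> :: "('n::finite \<Rightarrow> nat) \<Rightarrow> real"
  assumes "supp_in d \<phi>"
  shows "pf d \<phi> (x + r *\<^sub>R y) =
     (\<Sum>\<beta>\<in>expo_box d. (\<Sum>\<alpha>\<in>expo_box d. \<phi> (\<alpha> + \<beta>) * r ^ expo_deg \<alpha> * dmon \<alpha> y) * dmon \<beta> x)"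
proof -
  define A where "A = Sigma (expo_box d) (\<lambda>\<gamma>. {\<alpha>. \<forall>i. \<alpha> i \<le> \<gamma> i} :: ('n \<Rightarrow> nat) set)"
  define g where "g = (\<lambda>(\<beta>, \<alpha>). \<phi> (\<alpha> + \<beta>) * (r ^ expo_deg \<alpha> * dmon \<alpha> y) * dmon \<beta> x)"
  have "pf d \<phi> (x + r *\<^sub>R y) = (\<Sum>\<gamma>\<in>expo_box d. \<Sum>\<alpha> | \<forall>i. \<alpha> i \<le> \<gamma> i. \<phi> \<gamma> * (r ^ expo_deg \<alpha> * dmon \<alpha> y) * dmon (\<gamma> - \<alpha>) x)"
    by (simp add: pf_def dmon_add dmon_scale sum_distrib_left mult.assoc)
  also have "\<dots> = (\<Sum>(\<gamma>, \<alpha>)\<in>A. \<phi> \<gamma> * (r ^ expo_deg \<alpha> * dmon \<alpha> y) * dmon (\<gamma> - \<alpha>) x)"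
    unfolding A_def by (subst sum.Sigma) (auto simp: finite_expo_le)
  also have "\<dots> = sum g (expo_box d \<times> expo_box d)"
  proof (rule sum.reindex_bij_witness_not_neutral[where S' = "{}" 
      and T' = "{(\<beta>, \<alpha>). (\<beta>, \<alpha>) \<in> expo_box d \<times> expo_box d \<and> \<alpha> + \<beta> \<notin> expo_box d}"
      and i = "\<lambda>(\<beta>, \<alpha>). (\<alpha> + \<beta>, \<alpha>)" and j = "\<lambda>(\<gamma>, \<alpha>). (\<gamma> - \<alpha>, \<alpha>)"])
    show "finite {(\<beta>, \<alpha>). (\<beta>, \<alpha>) \<in> expo_box d \<times> expo_box d \<and> \<alpha> + \<beta> \<notin> (expo_box d :: ('n \<Rightarrow> nat) set)}"
      by (rule finite_subset[of _ "expo_box d \<times> expo_box d"]) auto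
    show "g b = 0" if "b \<in> {(\<beta>, \<alpha>). (\<beta>, \<alpha>) \<in> expo_box d \<times> expo_box d \<and> \<alpha> + \<beta> \<notin> expo_box d}" for b
      using that assms by (auto simp: g_def supp_in_def)
  next
    fix a assume "a \<in> A"
    then obtain \<gamma> \<alpha> where a: "a = (\<gamma>, \<alpha>)" "\<gamma> \<in> expo_box d" "\<And>i. \<alpha> i \<le> \<gamma> i" by (auto simp: A_def)
    then have "\<alpha> + (\<gamma> - \<alpha>) = \<gamma>" by (auto simp: fun_eq_iff)
    then show "g (case a of (\<gamma>, \<alpha>) \<Rightarrow> (\<gamma> - \<alpha>, \<alpha>)) = (case a of (\<gamma>, \<alpha>) \<Rightarrow> \<phi> \<gamma> * (r ^ expo_deg \<alpha> * dmon \<alpha> y) * dmon (\<gamma> - \<alpha>) x)"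
      using a by (simp add: g_def)
  next
    fix a assume "a \<in> A - {}"
    then obtain \<gamma> \<alpha> where a: "a = (\<gamma>, \<alpha>)" "\<gamma> \<in> expo_box d" "\<And>i. \<alpha> i \<le> \<gamma> i" by (auto simp: A_def)
    have *: "\<alpha> + (\<gamma> - \<alpha>) = \<gamma>" using a by (auto simp: fun_eq_iff)
    have **: "\<gamma> - \<alpha> \<in> expo_box d" "\<alpha> \<in> expo_box d" 
      using a unfolding expo_box_def by (simp_all add: le_diff_conv trans_le_add1) (meson order_trans)
    show "(case case a of (\<gamma>, \<alpha>) \<Rightarrow> (\<gamma> - \<alpha>, \<alpha>) of (\<beta>, \<alpha>) \<Rightarrow> (\<alpha> + \<beta>, \<alpha>)) = a"
      using a * by simp
    show "(case a of (\<gamma>, \<alpha>) \<Rightarrow> (\<gamma> - \<alpha>, \<alpha>)) \<in> expo_box d \<times> expo_box d - {(\<beta>, \<alpha>). (\<beta>, \<alpha>) \<in> expo_box d \<times> expo_box d \<and> \<alpha> + \<beta> \<notin> expo_box d}"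
      using a * ** by simp
  next
    fix b :: "('n \<Rightarrow> nat) \<times> ('n \<Rightarrow> nat)" assume "b \<in> expo_box d \<times> expo_box d - {(\<beta>, \<alpha>). (\<beta>, \<alpha>) \<in> expo_box d \<times> expo_box d \<and> \<alpha> + \<beta> \<notin> expo_box d}"
    then obtain \<beta> \<alpha> where b: "b = (\<beta>, \<alpha>)" "\<alpha> + \<beta> \<in> expo_box d" by auto
    have "\<alpha> + \<beta> - \<alpha> = \<beta>" by (simp add: fun_eq_iff)
    then show "(case case b of (\<beta>, \<alpha>) \<Rightarrow> (\<alpha> + \<beta>, \<alpha>) of (\<gamma>, \<alpha>) \<Rightarrow> (\<gamma> - \<alpha>, \<alpha>)) = b"
      by (simp add: b)
    show "(case b of (\<beta>, \<alpha>) \<Rightarrow> (\<alpha> + \<beta>, \<alpha>)) \<in> A - {}"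
      using b by (simp add: A_def)
  qed (simp_all add: A_def finite_expo_le)
  also have "\<dots> = (\<Sum>\<beta>\<in>expo_box d. \<Sum>\<alpha>\<in>expo_box d. \<phi> (\<alpha> + \<beta>) * (r ^ expo_deg \<alpha> * dmon \<alpha> y) * dmon \<beta> x)"
    by (simp add: g_def sum.cartesian_product)
  finally show ?thesis by (simp add: sum_distrib_right mult.assoc)
qed

text \<open>Coefficients up to degree m depend only on the truncations at m, and a product of finite
  sums expands over choice functions.\<close>

lemma fps_nth_prod:
  fixes f :: "'b \<Rightarrow> 'a::comm_ring_1 fps"
  assumes "finite T"
  shows "fps_nth (\<Prod>i\<in>T. f i) m =
    (\<Sum>\<gamma> | \<gamma> \<in> PiE T (\<lambda>_. {..m}) \<and> (\<Sum>i\<in>T. \<gamma> i) = m. \<Prod>i\<in>T. fps_nth (f i) (\<gamma> i))"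
proof -
  define g where "g = (\<lambda>i. \<Sum>j\<in>{..m}. fps_const (fps_nth (f i) j) * fps_X ^ j)"
  have g: "fps_nth (g i) j = fps_nth (f i) j" if "j \<le> m" for i j
    using that by (simp add: g_def fps_sum_nth if_distrib[of "\<lambda>x. _ * x"] cong: if_cong)
  have "\<forall>j\<le>m. fps_nth (\<Prod>i\<in>T. f i) j = fps_nth (\<Prod>i\<in>T. g i) j"
    using assms
  proof (induction T rule: finite_induct)
    case (insert x T)
    have "fps_nth (f x * (\<Prod>i\<in>T. f i)) j = fps_nth (g x * (\<Prod>i\<in>T. g i)) j" if "j \<le> m" for j
      unfolding fps_mult_nth
    proof (intro sum.cong refl)
      fix i assume "i \<in> {0..j}"
      then show "fps_nth (f x) i * fps_nth (\<Prod>i\<in>T. f i) (j - i) = fps_nth (g x) i * fps_nth (\<Prod>i\<in>T. g i) (j - i)"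
        using g[of i x] insert.IH that by simp
    qed
    then show ?case using insert.hyps by simp
  qed simp
  then have "fps_nth (\<Prod>i\<in>T. f i) m = fps_nth (\<Prod>i\<in>T. g i) m" by simp
  also have "(\<Prod>i\<in>T. g i) = (\<Sum>\<gamma>\<in>PiE T (\<lambda>_. {..m}). \<Prod>i\<in>T. fps_const (fps_nth (f i) (\<gamma> i)) * fps_X ^ \<gamma> i)"
    unfolding g_def by (rule prod_sum_PiE) (use assms in auto)
  also have "\<dots> = (\<Sum>\<gamma>\<in>PiE T (\<lambda>_. {..m}). fps_const (\<Prod>i\<in>T. fps_nth (f i) (\<gamma> i)) * fps_X ^ (\<Sum>i\<in>T. \<gamma> i))"
  proof -
    have "(\<Prod>i\<in>T. fps_const (c i)) = fps_const (\<Prod>i\<in>T. c i)" for c :: "'b \<Rightarrow> 'a"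
      by (induction T rule: infinite_finite_induct) auto
    then show ?thesis by (simp add: prod.distrib power_sum)
  qed
  also have "fps_nth \<dots> m = (\<Sum>\<gamma>\<in>PiE T (\<lambda>_. {..m}). if (\<Sum>i\<in>T. \<gamma> i) = m then \<Prod>i\<in>T. fps_nth (f i) (\<gamma> i) else 0)"
    by (auto simp: fps_sum_nth intro!: sum.cong)
  also have "\<dots> = (\<Sum>\<gamma> | \<gamma> \<in> PiE T (\<lambda>_. {..m}) \<and> (\<Sum>i\<in>T. \<gamma> i) = m. \<Prod>i\<in>T. fps_nth (f i) (\<gamma> i))"
    using assms by (intro sum.mono_neutral_cong_right) (auto simp: finite_PiE)
  finally show ?thesis .
qed

lemma expo_box_addD:
  assumes "\<alpha> + \<beta> \<in> expo_box d"
  shows "\<alpha> \<in> expo_box d" "\<beta> \<in> expo_box d"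
proof -
  have "\<alpha> i + \<beta> i \<le> d" for i using assms by (simp add: expo_box_def)
  then show "\<alpha> \<in> expo_box d" "\<beta> \<in> expo_box d"
    unfolding expo_box_def using add_leD1 add_leD2 by blast+
qed

lemma expo_deg_le_box:
  assumes "\<alpha> \<in> expo_box d"
  shows "expo_deg (\<alpha> :: 'n::finite \<Rightarrow> nat) \<le> CARD('n) * d"
proof -
  have "\<alpha> i \<le> d" for i using assms by (simp add: expo_box_def)
  then show ?thesis unfolding expo_deg_def using sum_bounded_above[of UNIV \<alpha> d] by simp
qed

text \<open>The mean of y^\<alpha> over the faces with free coordinates \<open>S\<close>, averaged
  over the signs of the fixed ones: t^a has mean 1 / (a + 1) on [-1, 1] for even a and 0 for odd a,
  while the two values (1)^a and (-1)^a have mean 1 or 0.\<close>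

definition face_moment :: "'n set \<Rightarrow> ('n::finite \<Rightarrow> nat) \<Rightarrow> real" where
  "face_moment S \<alpha> = (\<Prod>i\<in>UNIV. if even (\<alpha> i) then if i \<in> S then 1 / real (\<alpha> i + 1) else 1 else 0)"

section \<open>The mean value property as a system of equations for the coefficients\<close>

definition mean_value_functions :: "(real ^ 'n) measure \<Rightarrow> (real ^ 'n \<Rightarrow> real) set" where
  "mean_value_functions \<nu> = {f. continuous_on UNIV f \<and> (\<forall>x. \<forall>r>0. f x = (\<integral>y. f (x + r *\<^sub>R y) \<partial>\<nu>))}"

text \<open>The algebra and the regularity argument are carried out for any probability measure with
  these moments and an almost sure bound. The moments are averages of \<open>face_moment\<close>
  over the choices of k free coordinates; \<open>cube_measure_skeleton\<close> provides the
  instance.\<close>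

locale cube_measure = prob_space \<nu> for \<nu> :: "(real ^ 'n::finite) measure" +
  fixes k :: nat
  assumes sets_eq [measurable_cong, simp]: "sets \<nu> = sets borel"
    and k_le: "k \<le> CARD('n)"
    and bounded_AE: "\<exists>R. AE y in \<nu>. norm y \<le> R"
    and moments: "(\<integral>y. (\<Prod>i\<in>UNIV. y $ i ^ \<alpha> i) \<partial>\<nu>) = (\<Sum>S | card S = k. face_moment S \<alpha>) / real (CARD('n) choose k)"
begin

lemma integrable_continuous:
  assumes "continuous_on UNIV (f :: _ \<Rightarrow> real)"
  shows "integrable \<nu> f"
proof -
  obtain R where R: "AE y in \<nu>. norm y \<le> R" using bounded_AE by blast
  have "compact (f ` cball 0 R)"
    using assms by (intro compact_continuous_image continuous_on_subset[OF assms]) auto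
  then obtain B where "\<forall>z\<in>f ` cball 0 R. norm z \<le> B"
    using compact_imp_bounded bounded_iff by metis
  then have B: "norm (f y) \<le> B" if "norm y \<le> R" for y
    using that by simp
  show ?thesis
  proof (rule integrable_const_bound)
    show "AE y in \<nu>. norm (f y) \<le> B" using R by eventually_elim (rule B)
    show "f \<in> borel_measurable \<nu>" using borel_measurable_continuous_onI[OF assms] by simp
  qed
qed

definition dmoment :: "('n \<Rightarrow> nat) \<Rightarrow> real" where
  "dmoment \<alpha> = (\<integral>y. dmon \<alpha> y \<partial>\<nu>)"

lemma dmoment_eq:
  "dmoment \<alpha> = (\<Sum>S | card S = k. face_moment S \<alpha>) / real (CARD('n) choose k) / (\<Prod>i\<in>UNIV. fact (\<alpha> i))"
  unfolding dmoment_def dmon_def prod_dividef by (simp add: moments)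

lemma dmoment_0: "dmoment 0 = 1"
  by (simp add: dmoment_def prob_space)

lemma integral_pf_taylor:
  assumes "supp_in d \<phi>"
  shows "(\<integral>y. pf d \<phi> (x + r *\<^sub>R y) \<partial>\<nu>) =
     pf d (\<lambda>\<beta>. \<Sum>\<alpha>\<in>expo_box d. \<phi> (\<alpha> + \<beta>) * dmoment \<alpha> * r ^ expo_deg \<alpha>) x"
proof -
  have int: "integrable \<nu> (dmon \<alpha>)" for \<alpha>
    by (intro integrable_continuous continuous_intros)
  show ?thesis
    unfolding pf_taylor[OF assms] by (simp add: pf_def int dmoment_def mult_ac)
qed

text \<open>For each m > 0 one homogeneous differential equation of order m, written out for each
  coefficient \<beta> of the result. Finite support is a consequence, see
  \<open>harmonic_coeffs_supp\<close>.\<close>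

definition harmonic_coeffs :: "(('n \<Rightarrow> nat) \<Rightarrow> real) \<Rightarrow> bool" where
  "harmonic_coeffs \<phi> \<longleftrightarrow>
    (\<forall>m>0. \<forall>\<beta>. (\<Sum>\<alpha> | expo_deg \<alpha> = m. \<phi> (\<alpha> + \<beta>) * dmoment \<alpha>) = 0)"

lemma finite_expo_deg: "finite {\<alpha> :: 'n \<Rightarrow> nat. expo_deg \<alpha> = m}"
  by (rule finite_subset[OF _ finite_expo_box[of m]]) (auto simp: expo_box_def expo_le_deg)

lemma harmonic_sum_by_degree:
  assumes "supp_in d \<phi>" 
  shows "(\<Sum>\<alpha>\<in>expo_box d. \<phi> (\<alpha> + \<beta>) * dmoment \<alpha> * r ^ expo_deg \<alpha>)
     = (\<Sum>m\<le>CARD('n) * d. (\<Sum>\<alpha> | expo_deg \<alpha> = m. \<phi> (\<alpha> + \<beta>) * dmoment \<alpha>) * r ^ m)"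
proof -
  have "(\<Sum>\<alpha>\<in>expo_box d. \<phi> (\<alpha> + \<beta>) * dmoment \<alpha> * r ^ expo_deg \<alpha>)
    = (\<Sum>m\<le>CARD('n) * d. \<Sum>\<alpha> | \<alpha> \<in> expo_box d \<and> expo_deg \<alpha> = m. \<phi> (\<alpha> + \<beta>) * dmoment \<alpha> * r ^ expo_deg \<alpha>)"
    by (intro sum.group[symmetric]) (auto intro: expo_deg_le_box)
  also have "\<dots> = (\<Sum>m\<le>CARD('n) * d. (\<Sum>\<alpha> | expo_deg \<alpha> = m. \<phi> (\<alpha> + \<beta>) * dmoment \<alpha>) * r ^ m)"
  proof (intro sum.cong refl)
    fix m
    have "(\<Sum>\<alpha> | \<alpha> \<in> expo_box d \<and> expo_deg \<alpha> = m. \<phi> (\<alpha> + \<beta>) * dmoment \<alpha> * r ^ expo_deg \<alpha>)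
       = (\<Sum>\<alpha> | expo_deg \<alpha> = m. \<phi> (\<alpha> + \<beta>) * dmoment \<alpha> * r ^ m)"
    proof (intro sum.mono_neutral_cong_left finite_expo_deg ballI)
      fix \<alpha> :: "'n \<Rightarrow> nat" assume "\<alpha> \<in> {\<alpha>. expo_deg \<alpha> = m} - {\<alpha> \<in> expo_box d. expo_deg \<alpha> = m}"
      then have "\<alpha> \<notin> expo_box d" by auto
      then have "\<alpha> + \<beta> \<notin> expo_box d" using expo_box_addD by blast
      then show "\<phi> (\<alpha> + \<beta>) * dmoment \<alpha> * r ^ m = 0" using assms by (auto simp: supp_in_def)
    qed auto
    then show "(\<Sum>\<alpha> | \<alpha> \<in> expo_box d \<and> expo_deg \<alpha> = m. \<phi> (\<alpha> + \<beta>) * dmoment \<alpha> * r ^ expo_deg \<alpha>)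
       = (\<Sum>\<alpha> | expo_deg \<alpha> = m. \<phi> (\<alpha> + \<beta>) * dmoment \<alpha>) * r ^ m"
      by (simp add: sum_distrib_right)
  qed
  finally show ?thesis .
qed

lemma expo_deg_0_set: "{\<alpha> :: 'n \<Rightarrow> nat. expo_deg \<alpha> = 0} = {0}"
  by (auto simp: expo_deg_0)

text \<open>Coefficient by coefficient, the mean at radius r is a polynomial in r with constant term
  \<open>\<phi> \<beta>\<close>. Being equal to \<open>\<phi> \<beta>\<close> for all r > 0 means
  that its higher coefficients vanish.\<close>

lemma pf_mean_value_iff:
  assumes "supp_in d \<phi>"
  shows "pf d \<phi> \<in> mean_value_functions \<nu> \<longleftrightarrow> harmonic_coeffs \<phi>"
proof
  assume h: "harmonic_coeffs \<phi>"
  have "(\<Sum>m\<le>CARD('n) * d. (\<Sum>\<alpha> | expo_deg \<alpha> = m. \<phi> (\<alpha> + \<beta>) * dmoment \<alpha>) * r ^ m) = \<phi> \<beta>" for r \<beta>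
  proof -
    have "(\<Sum>m\<le>CARD('n) * d. (\<Sum>\<alpha> | expo_deg \<alpha> = m. \<phi> (\<alpha> + \<beta>) * dmoment \<alpha>) * r ^ m)
       = (\<Sum>m\<in>{0}. (\<Sum>\<alpha> | expo_deg \<alpha> = m. \<phi> (\<alpha> + \<beta>) * dmoment \<alpha>) * r ^ m)"
      using h by (intro sum.mono_neutral_right) (auto simp: harmonic_coeffs_def)
    then show ?thesis by (simp add: expo_deg_0_set dmoment_0)
  qed
  then have "pf d \<phi> x = (\<integral>y. pf d \<phi> (x + r *\<^sub>R y) \<partial>\<nu>)" for x r
    unfolding integral_pf_taylor[OF assms] harmonic_sum_by_degree[OF assms] by simp
  then show "pf d \<phi> \<in> mean_value_functions \<nu>"
    unfolding mean_value_functions_def by (blast intro: continuous_on_pf)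
next
  assume mv: "pf d \<phi> \<in> mean_value_functions \<nu>"
  define c where "c = (\<lambda>\<beta> m. (\<Sum>\<alpha> | expo_deg \<alpha> = m. \<phi> (\<alpha> + \<beta>) * dmoment \<alpha>))"
  have c0: "c \<beta> 0 = \<phi> \<beta>" for \<beta> by (simp add: c_def expo_deg_0_set dmoment_0)
  have big: "\<phi> (\<alpha> + \<beta>) = 0" if "\<beta> \<notin> expo_box d" for \<alpha> \<beta>
  proof -
    have "\<alpha> + \<beta> \<notin> expo_box d" using that expo_box_addD by blast
    then show ?thesis using assms by (auto simp: supp_in_def)
  qed
  have eq: "(\<Sum>m\<le>CARD('n) * d. c \<beta> m * r ^ m) = \<phi> \<beta>" if r: "r > 0" for r \<beta>
  proof -
    have "pf d (\<lambda>\<beta>. \<Sum>m\<le>CARD('n) * d. c \<beta> m * r ^ m) = pf d \<phi>"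
    proof
      fix x
      have "pf d \<phi> x = (\<integral>y. pf d \<phi> (x + r *\<^sub>R y) \<partial>\<nu>)"
        using mv r unfolding mean_value_functions_def by blast
      then show "pf d (\<lambda>\<beta>. \<Sum>m\<le>CARD('n) * d. c \<beta> m * r ^ m) x = pf d \<phi> x"
        unfolding integral_pf_taylor[OF assms] harmonic_sum_by_degree[OF assms] c_def by (rule sym)
    qed
    moreover have "supp_in d (\<lambda>\<beta>. \<Sum>m\<le>CARD('n) * d. c \<beta> m * r ^ m)"
      unfolding supp_in_def
    proof (intro allI impI, rule ccontr)
      fix \<beta> assume "(\<Sum>m\<le>CARD('n) * d. c \<beta> m * r ^ m) \<noteq> 0" "\<beta> \<notin> expo_box d"
      moreover have "c \<beta> m = 0" for m unfolding c_def by (simp add: big[OF \<open>\<beta> \<notin> expo_box d\<close>])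
      ultimately show False by simp
    qed
    ultimately have "(\<lambda>\<beta>. \<Sum>m\<le>CARD('n) * d. c \<beta> m * r ^ m) = \<phi>"
      by (intro pf_inject[OF _ assms])
    then show ?thesis by (rule fun_cong)
  qed
  show "harmonic_coeffs \<phi>"
    unfolding harmonic_coeffs_def
  proof (intro allI impI)
    fix m :: nat and \<beta> assume m: "m > 0"
    have "c \<beta> m = 0" if "m \<le> CARD('n) * d"
    proof -
      have "(\<lambda>j. if j = 0 then 0 else c \<beta> j) m = 0"
      proof (rule pos_poly_eq_0D[where n = "CARD('n) * d"])
        fix s :: real assume "s > 0"
        have "(\<Sum>j\<le>CARD('n) * d. (if j = 0 then 0 else c \<beta> j) * s ^ j) = (\<Sum>j\<le>CARD('n) * d. c \<beta> j * s ^ j - (if j = 0 then \<phi> \<beta> else 0))"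
          by (intro sum.cong) (auto simp: c0)
        also have "\<dots> = 0" using eq[OF \<open>s > 0\<close>, of \<beta>] by (simp add: sum_subtractf)
        finally show "(\<Sum>j\<le>CARD('n) * d. (if j = 0 then 0 else c \<beta> j) * s ^ j) = 0" .
      qed fact
      then show ?thesis using m by simp
    qed
    \<comment> \<open>Degrees beyond the range of the polynomial in r: here \<alpha> + \<beta>
      leaves the box that supports \<open>\<phi>\<close>.\<close>
    moreover have "c \<beta> m = 0" if "\<not> m \<le> CARD('n) * d"
      unfolding c_def
    proof (intro sum.neutral ballI)
      fix \<alpha> :: "'n \<Rightarrow> nat" assume "\<alpha> \<in> {\<alpha>. expo_deg \<alpha> = m}"
      then have "\<not> expo_deg (\<alpha> + \<beta>) \<le> CARD('n) * d" using that unfolding expo_deg_add by simp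
      then have "\<alpha> + \<beta> \<notin> expo_box d" using expo_deg_le_box by blast
      then show "\<phi> (\<alpha> + \<beta>) * dmoment \<alpha> = 0" using assms by (auto simp: supp_in_def)
    qed
    ultimately show "(\<Sum>\<alpha> | expo_deg \<alpha> = m. \<phi> (\<alpha> + \<beta>) * dmoment \<alpha>) = 0"
      unfolding c_def by blast
  qed
qed

end

subsection \<open>Polynomials acting on coefficient families\<close>

text \<open>The value at \<open>0\<close> of the constant-coefficient differential operator \<open>p\<close> applied to the polynomial
  with divided-power coefficients \<open>\<phi>\<close>.\<close>
definition apolar :: "(('n::finite \<Rightarrow> nat) \<Rightarrow> real) \<Rightarrow> (('n \<Rightarrow> nat) \<Rightarrow>\<^sub>0 real) \<Rightarrow> real" where
  "apolar \<phi> p = (\<Sum>\<alpha>\<in>Poly_Mapping.keys p. Poly_Mapping.lookup p \<alpha> * \<phi> \<alpha>)"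

lemma apolar_superset:
  assumes "finite A" "Poly_Mapping.keys p \<subseteq> A"
  shows "apolar \<phi> p = (\<Sum>\<alpha>\<in>A. Poly_Mapping.lookup p \<alpha> * \<phi> \<alpha>)"
  unfolding apolar_def using assms by (intro sum.mono_neutral_left) (auto simp: in_keys_iff)

lemma apolar_add: "apolar \<phi> (p + q) = apolar \<phi> p + apolar \<phi> q"
proof -
  let ?A = "Poly_Mapping.keys p \<union> Poly_Mapping.keys q"
  have "Poly_Mapping.keys (p + q) \<subseteq> ?A" by (rule keys_add)
  then have "apolar \<phi> (p + q) = (\<Sum>\<alpha>\<in>?A. Poly_Mapping.lookup (p + q) \<alpha> * \<phi> \<alpha>)"
    by (intro apolar_superset) auto
  also have "\<dots> = (\<Sum>\<alpha>\<in>?A. Poly_Mapping.lookup p \<alpha> * \<phi> \<alpha>) + (\<Sum>\<alpha>\<in>?A. Poly_Mapping.lookup q \<alpha> * \<phi> \<alpha>)"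
    by (simp add: lookup_add distrib_right sum.distrib)
  finally show ?thesis using apolar_superset[of ?A p \<phi>] apolar_superset[of ?A q \<phi>] by auto
qed

lemma apolar_single: "apolar \<phi> (Poly_Mapping.single \<alpha> c) = c * \<phi> \<alpha>"
  using apolar_superset[of "{\<alpha>}" "Poly_Mapping.single \<alpha> c" \<phi>] by (auto simp: keys_single)

lemma apolar_0: "apolar \<phi> 0 = 0"
  by (simp add: apolar_def)

lemma apolar_sum: "apolar \<phi> (sum f A) = (\<Sum>i\<in>A. apolar \<phi> (f i))"
  by (induction A rule: infinite_finite_induct) (simp_all add: apolar_add apolar_0)

lemma poly_mapping_eq_sum_single: "p = (\<Sum>\<alpha>\<in>Poly_Mapping.keys p. Poly_Mapping.single \<alpha> (Poly_Mapping.lookup p \<alpha>))"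
proof (rule poly_mapping_eqI)
  fix \<beta>
  show "Poly_Mapping.lookup p \<beta> = Poly_Mapping.lookup (\<Sum>\<alpha>\<in>Poly_Mapping.keys p. Poly_Mapping.single \<alpha> (Poly_Mapping.lookup p \<alpha>)) \<beta>"
    by (simp add: lookup_sum lookup_single when_def in_keys_iff)
qed

lemma apolar_const_mult: "apolar \<phi> (Poly_Mapping.single 0 c * p) = c * apolar \<phi> p"
proof -
  have "apolar \<phi> (Poly_Mapping.single 0 c * p) = apolar \<phi> (Poly_Mapping.single 0 c * (\<Sum>\<alpha>\<in>Poly_Mapping.keys p. Poly_Mapping.single \<alpha> (Poly_Mapping.lookup p \<alpha>)))"
    by (rule arg_cong[OF poly_mapping_eq_sum_single])
  also have "\<dots> = (\<Sum>\<alpha>\<in>Poly_Mapping.keys p. c * (Poly_Mapping.lookup p \<alpha> * \<phi> \<alpha>))"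
    by (simp add: sum_distrib_left mult_single apolar_sum apolar_single mult.assoc)
  finally show ?thesis by (simp add: apolar_def sum_distrib_left)
qed

lemma annihilator_apolar: "annihilator (Poly_Mapping.single 0) (apolar \<phi>)"
  by standard (auto simp: single_add mult_single apolar_add apolar_const_mult)

lemma prod_single: "finite T \<Longrightarrow> (\<Prod>i\<in>T. Poly_Mapping.single (u i) (c i)) = Poly_Mapping.single (\<Sum>i\<in>T. u i) (\<Prod>i\<in>T. c i)"
  for u :: "'b \<Rightarrow> 'c::comm_monoid_add" and c :: "'b \<Rightarrow> 'a::comm_ring_1"
  by (induction T rule: finite_induct) (auto simp: mult_single)

lemma sum_fun_apply: "(\<Sum>i\<in>T. f i) x = (\<Sum>i\<in>T. (f i x :: 'a::comm_monoid_add))"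
  by (induction T rule: infinite_finite_induct) auto

text \<open>The operator - d_i^2. The sign turns cos and sinc into cosh d_i and sinh d_i / d_i,
  whose coefficients 1 / (2j)! and 1 / (2j + 1)! are the moments of a sign and of the interval
  [-1, 1] in divided-power form.\<close>

definition neg_square :: "'n::finite \<Rightarrow> ('n \<Rightarrow> nat) \<Rightarrow>\<^sub>0 real" where
  "neg_square i = Poly_Mapping.single (\<lambda>j. if j = i then 2 else 0) (- 1)"

lemma neg_square_power: "neg_square i ^ n = Poly_Mapping.single (\<lambda>j. if j = i then 2 * n else 0) ((- 1) ^ n)"
proof (induction n)
  case 0
  have "(\<lambda>j. if j = i then 2 * 0 else 0) = (0 :: 'a \<Rightarrow> nat)" by auto
  then show ?case by simp
next
  case (Suc n)
  have "(\<lambda>j. if j = i then 2 else 0) + (\<lambda>j. if j = i then 2 * n else 0) = (\<lambda>j. if j = i then 2 * Suc n else 0)"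
    by (auto simp: fun_eq_iff)
  then show ?case unfolding power_Suc Suc unfolding neg_square_def mult_single by simp
qed

lemma prod_neg_square_power:
  "(\<Prod>i\<in>T. Poly_Mapping.single 0 (c i) * neg_square i ^ \<gamma> i) =
     Poly_Mapping.single (\<lambda>j. if j \<in> T then 2 * \<gamma> j else 0) (\<Prod>i\<in>T. c i * (- 1) ^ \<gamma> i)"
  for T :: "'n::finite set"
proof -
  have "(\<Sum>i\<in>T. (\<lambda>j. if j = i then 2 * \<gamma> i else 0)) = (\<lambda>j. if j \<in> T then 2 * \<gamma> j else 0)"
    by (rule ext) (auto simp: sum_fun_apply sum.delta)
  then show ?thesis
    by (simp add: neg_square_power mult_single prod_single)
qed

context cube_measure
begin

text \<open>Exponents with an odd entry have moment 0, so in degree 2m only \<alpha> = 2 \<gamma>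
  remains. There 1 / (2j + 1) * 1 / (2j)! = 1 / (2j + 1)! absorbs the face moment into the
  factorial.\<close>

lemma harmonic_coeffs_even:
  assumes "harmonic_coeffs \<phi>" "m > 0"
  shows "(\<Sum>S | card S = k. \<Sum>\<gamma> | expo_deg \<gamma> = m.
     (\<Prod>i\<in>UNIV. 1 / fact (2 * \<gamma> i + of_bool (i \<in> S))) * \<phi> ((\<lambda>i. 2 * \<gamma> i) + \<beta>)) = 0"
proof -
  let ?B = "real (CARD('n) choose k)"
  let ?e = "\<lambda>S \<alpha>. \<phi> (\<alpha> + \<beta>) * (face_moment S \<alpha> / (\<Prod>i\<in>UNIV. fact (\<alpha> i)))"
  have B: "?B \<noteq> 0" using k_le by simp
  have "0 = ?B * (\<Sum>\<alpha> | expo_deg \<alpha> = 2 * m. \<phi> (\<alpha> + \<beta>) * dmoment \<alpha>)"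
    using assms by (simp add: harmonic_coeffs_def)
  also have "\<dots> = (\<Sum>\<alpha> | expo_deg \<alpha> = 2 * m. \<Sum>S | card S = k. ?e S \<alpha>)"
  proof -
    have "?B * (\<phi> (\<alpha> + \<beta>) * dmoment \<alpha>) = (\<Sum>S | card S = k. ?e S \<alpha>)" for \<alpha>
    proof -
      have "?B * dmoment \<alpha> = (\<Sum>S | card S = k. face_moment S \<alpha>) / (\<Prod>i\<in>UNIV. fact (\<alpha> i))"
        using B by (simp add: dmoment_eq)
      then have "?B * (\<phi> (\<alpha> + \<beta>) * dmoment \<alpha>) = \<phi> (\<alpha> + \<beta>) * ((\<Sum>S | card S = k. face_moment S \<alpha>) / (\<Prod>i\<in>UNIV. fact (\<alpha> i)))"
        by (simp only: mult.left_commute)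
      then show ?thesis by (simp add: sum_divide_distrib sum_distrib_left)
    qed
    then show ?thesis by (simp add: sum_distrib_left)
  qed
  also have "\<dots> = (\<Sum>S | card S = k. \<Sum>\<alpha> | expo_deg \<alpha> = 2 * m. ?e S \<alpha>)"
    by (rule sum.swap)
  also have "\<dots> = (\<Sum>S | card S = k. \<Sum>\<gamma> | expo_deg \<gamma> = m.
     (\<Prod>i\<in>UNIV. 1 / fact (2 * \<gamma> i + of_bool (i \<in> S))) * \<phi> ((\<lambda>i. 2 * \<gamma> i) + \<beta>))"
  proof (rule sum.cong[OF refl])
    fix S :: "'n set"
    have "(\<Sum>\<alpha> | expo_deg \<alpha> = 2 * m. ?e S \<alpha>) = (\<Sum>\<alpha> | expo_deg \<alpha> = 2 * m \<and> (\<forall>i. even (\<alpha> i)). ?e S \<alpha>)"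
    proof (intro sum.mono_neutral_right ballI)
      fix \<alpha> :: "'n \<Rightarrow> nat" assume "\<alpha> \<in> {\<alpha>. expo_deg \<alpha> = 2 * m} - {\<alpha>. expo_deg \<alpha> = 2 * m \<and> (\<forall>i. even (\<alpha> i))}"
      then obtain i where "odd (\<alpha> i)" by auto
      then have "face_moment S \<alpha> = 0" unfolding face_moment_def by (intro prod_zero) auto
      then show "?e S \<alpha> = 0" by simp
    qed (auto simp: finite_expo_deg)
    also have "\<dots> = (\<Sum>\<gamma> | expo_deg \<gamma> = m. (\<Prod>i\<in>UNIV. 1 / fact (2 * \<gamma> i + of_bool (i \<in> S))) * \<phi> ((\<lambda>i. 2 * \<gamma> i) + \<beta>))"
    proof (rule sum.reindex_bij_witness[where i = "\<lambda>\<gamma> i. 2 * \<gamma> i" and j = "\<lambda>\<alpha> i. \<alpha> i div 2"])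
      fix \<alpha> :: "'n \<Rightarrow> nat" assume "\<alpha> \<in> {\<alpha>. expo_deg \<alpha> = 2 * m \<and> (\<forall>i. even (\<alpha> i))}"
      then have d: "expo_deg \<alpha> = 2 * m" and ev: "\<And>i. even (\<alpha> i)" by auto
      show e: "(\<lambda>i. 2 * (\<alpha> i div 2)) = \<alpha>" using ev by auto
      have "2 * expo_deg (\<lambda>i. \<alpha> i div 2) = expo_deg (\<lambda>i. 2 * (\<alpha> i div 2))"
        by (simp add: expo_deg_def sum_distrib_left)
      then show "(\<lambda>i. \<alpha> i div 2) \<in> {\<gamma>. expo_deg \<gamma> = m}" using d by (simp add: e)
      have "face_moment S \<alpha> / (\<Prod>i\<in>UNIV. fact (\<alpha> i)) = (\<Prod>i\<in>UNIV. 1 / fact (\<alpha> i + of_bool (i \<in> S)))"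
        unfolding face_moment_def prod_dividef[symmetric]
        using ev by (intro prod.cong) (auto simp: divide_simps)
      then show "(\<Prod>i\<in>UNIV. 1 / fact (2 * (\<alpha> i div 2) + of_bool (i \<in> S))) * \<phi> ((\<lambda>i. 2 * (\<alpha> i div 2)) + \<beta>) = ?e S \<alpha>"
        using ev by simp
    next
      fix \<gamma> :: "'n \<Rightarrow> nat" assume "\<gamma> \<in> {\<gamma>. expo_deg \<gamma> = m}"
      then show "(\<lambda>i. 2 * \<gamma> i) \<in> {\<alpha>. expo_deg \<alpha> = 2 * m \<and> (\<forall>i. even (\<alpha> i))}"
        by (simp add: expo_deg_def flip: sum_distrib_left)
    qed simp
    finally show "(\<Sum>\<alpha> | expo_deg \<alpha> = 2 * m. ?e S \<alpha>) = (\<Sum>\<gamma> | expo_deg \<gamma> = m.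
     (\<Prod>i\<in>UNIV. 1 / fact (2 * \<gamma> i + of_bool (i \<in> S))) * \<phi> ((\<lambda>i. 2 * \<gamma> i) + \<beta>))" .
  qed
  finally show ?thesis by simp
qed

text \<open>Up to the binomial factor, the coefficient of degree m is the part of order 2m of the
  averaging operator. Testing it against monomials is \<open>harmonic_coeffs_even\<close>, and
  linearity extends this to all q.\<close>

lemma skel_series_in_Ann:
  assumes h: "harmonic_coeffs \<phi>" and m: "m > 0"
  shows "fps_nth (annihilator.skel_series (Poly_Mapping.single 0) UNIV neg_square k) m \<in> annihilator.Ann (apolar \<phi>)"
proof -
  interpret annihilator "Poly_Mapping.single 0" "apolar \<phi>" by (rule annihilator_apolar)
  define F where "F = (\<lambda>S (i :: 'n). if i \<in> S then fps_sinc_sqrt else fps_cos_sqrt)"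
  have F: "fps_nth (F S i) j * (- 1) ^ j = 1 / fact (2 * j + of_bool (i \<in> S))" for S i j
    by (simp add: F_def fps_sinc_sqrt_def fps_cos_sqrt_def flip: power_mult_distrib)
  have ser: "skel_series UNIV neg_square k = (\<Sum>S | card S = k. \<Prod>i\<in>UNIV. sub (F S i) (neg_square i))"
    unfolding skel_series_def
  proof (intro sum.cong)
    fix S :: "'n set"
    have "(\<Prod>i\<in>UNIV. sub (F S i) (neg_square i)) = (\<Prod>i\<in>UNIV - S. sub (F S i) (neg_square i)) * (\<Prod>i\<in>S. sub (F S i) (neg_square i))"
      by (rule prod.subset_diff) auto
    then show "(\<Prod>i\<in>S. sub fps_sinc_sqrt (neg_square i)) * (\<Prod>i\<in>UNIV - S. sub fps_cos_sqrt (neg_square i)) = (\<Prod>i\<in>UNIV. sub (F S i) (neg_square i))"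
      by (simp add: F_def mult.commute)
  qed auto
  have coeff: "fps_nth (\<Prod>i\<in>UNIV. sub (F S i) (neg_square i)) m = (\<Sum>\<gamma> | expo_deg \<gamma> = m.
      Poly_Mapping.single (\<lambda>i. 2 * \<gamma> i) (\<Prod>i\<in>UNIV. 1 / fact (2 * \<gamma> i + of_bool (i \<in> S))))" for S
  proof -
    have "{\<gamma>. \<gamma> \<in> PiE UNIV (\<lambda>_. {..m}) \<and> sum \<gamma> UNIV = m} = {\<gamma> :: 'n \<Rightarrow> nat. expo_deg \<gamma> = m}"
      using expo_le_deg by (auto simp: expo_deg_def PiE_def Pi_def)
    then show ?thesis
      by (simp add: fps_nth_prod prod_neg_square_power F)
  qed
  have zero: "apolar \<phi> (fps_nth (skel_series UNIV neg_square k) m * Poly_Mapping.single \<beta> 1) = 0" for \<beta>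
    using harmonic_coeffs_even[OF h m, of \<beta>]
    by (simp add: ser fps_sum_nth coeff sum_distrib_right apolar_sum mult_single apolar_single)
  show ?thesis
    unfolding Ann_def
  proof (intro CollectI allI)
    fix q :: "('n \<Rightarrow> nat) \<Rightarrow>\<^sub>0 real"
    let ?p = "fps_nth (skel_series UNIV neg_square k) m"
    have "?p * q = ?p * (\<Sum>\<alpha>\<in>Poly_Mapping.keys q. Poly_Mapping.single \<alpha> (Poly_Mapping.lookup q \<alpha>))"
      by (rule arg_cong[OF poly_mapping_eq_sum_single])
    also have "\<dots> = (\<Sum>\<alpha>\<in>Poly_Mapping.keys q. Poly_Mapping.single 0 (Poly_Mapping.lookup q \<alpha>) * (?p * Poly_Mapping.single \<alpha> 1))"
    proof -
      have "?p * Poly_Mapping.single \<alpha> c = Poly_Mapping.single 0 c * (?p * Poly_Mapping.single \<alpha> 1)" for \<alpha> c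
      proof -
        have "?p * Poly_Mapping.single \<alpha> c = ?p * (Poly_Mapping.single 0 c * Poly_Mapping.single \<alpha> 1)"
          by (simp add: mult_single)
        also have "\<dots> = Poly_Mapping.single 0 c * (?p * Poly_Mapping.single \<alpha> 1)"
          by (rule mult.left_commute)
        finally show ?thesis .
      qed
      then show ?thesis unfolding sum_distrib_left by (intro sum.cong refl)
    qed
    finally show "apolar \<phi> (?p * q) = 0"
      by (simp add: apolar_sum apolar_const_mult zero)
  qed
qed

text \<open>Joins the two halves: the harmonic equations put the skeleton series into the ideal,
  hence the power sums, hence the complete symmetric polynomials in the operators - d_i^2.\<close>

lemma complete_in_Ann_harmonic:
  assumes h: "harmonic_coeffs \<phi>" and m: "m > CARD('n) - card R"
  shows "apolar \<phi> (fps_nth (\<Prod>i\<in>R. annihilator.geom (neg_square i)) m * q) = 0"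
proof -
  interpret annihilator "Poly_Mapping.single 0" "apolar \<phi>" by (rule annihilator_apolar)
  have "fps_nth (\<Prod>i\<in>R. geom (neg_square i)) m \<in> Ann"
  proof (rule complete_in_Ann)
    fix j :: nat assume "0 < j" "j \<le> CARD('n)"
    then show "(\<Sum>i\<in>UNIV. neg_square i ^ j) \<in> Ann"
      by (intro power_sums_in_Ann[where k = k] skel_series_in_Ann h) (auto simp: k_le)
  qed (use m in auto)
  then show ?thesis by (simp add: Ann_def)
qed

lemma coeff_geom_neg_square:
  "fps_nth (\<Prod>i\<in>R. annihilator.geom (neg_square i)) m =
    (\<Sum>\<gamma> | \<gamma> \<in> PiE R (\<lambda>_. {..m}) \<and> sum \<gamma> R = m. Poly_Mapping.single (\<lambda>j. if j \<in> R then 2 * \<gamma> j else 0) ((- 1) ^ m))"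
  for R :: "'n set"
proof -
  interpret annihilator "Poly_Mapping.single 0" "apolar (\<lambda>_ :: 'n \<Rightarrow> nat. 0)" by (rule annihilator_apolar)
  have "(\<Prod>i\<in>R. neg_square i ^ \<gamma> i) = Poly_Mapping.single (\<lambda>j. if j \<in> R then 2 * \<gamma> j else 0) ((- 1) ^ sum \<gamma> R)" for \<gamma>
    using prod_neg_square_power[of "\<lambda>_. 1" \<gamma> R] by (simp add: power_sum)
  then show ?thesis by (simp add: fps_nth_prod geom_def)
qed

text \<open>For one variable the complete symmetric polynomial is a single power, so the operator (-
  d_i^2)^\<open>CARD('n)\<close> annihilates the family.\<close>

lemma harmonic_coeffs_bounded:
  assumes h: "harmonic_coeffs \<phi>" and \<alpha>: "\<alpha> i \<ge> 2 * CARD('n)"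
  shows "\<phi> \<alpha> = 0"
proof -
  interpret annihilator "Poly_Mapping.single 0" "apolar \<phi>" by (rule annihilator_apolar)
  define \<beta> where "\<beta> = \<alpha>(i := \<alpha> i - 2 * CARD('n))"
  have \<beta>: "(\<lambda>j. if j = i then 2 * CARD('n) else 0) + \<beta> = \<alpha>"
    using \<alpha> by (auto simp: \<beta>_def fun_eq_iff)
  have "0 = apolar \<phi> (fps_nth (\<Prod>i\<in>{i}. geom (neg_square i)) CARD('n) * Poly_Mapping.single \<beta> 1)"
    using complete_in_Ann_harmonic[OF h, of "{i}" "CARD('n)"] by simp
  also have "\<dots> = (- 1) ^ CARD('n) * \<phi> \<alpha>"
    by (simp add: geom_def neg_square_power mult_single apolar_single \<beta>)
  finally show ?thesis by simp
qed

text \<open>Rank the variables by \<open>\<rho>\<close> and let N be their number. The complete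
  symmetric polynomial of degree N - j in the squared variables of rank at most j lies in the ideal,
  and it contains the pure power N - j of the variable of rank j. These relations reduce every
  exponent to the staircase of \<open>box\<close>, whose size bounds the dimension.\<close>

lemma harmonic_coeffs_determined:
  fixes \<rho> :: "'n \<Rightarrow> nat"
  assumes h: "harmonic_coeffs \<phi>" and \<rho>: "bij_betw \<rho> UNIV {..<CARD('n)}"
    and box: "\<And>\<alpha>. (\<And>i. \<alpha> i < 2 * (CARD('n) - \<rho> i)) \<Longrightarrow> \<phi> \<alpha> = 0"
  shows "\<phi> \<alpha> = 0"
proof -
  interpret annihilator "Poly_Mapping.single 0" "apolar \<phi>" by (rule annihilator_apolar)
  let ?N = "CARD('n)"
  have inj: "inj \<rho>" and im: "range \<rho> = {..<?N}" using \<rho> by (simp_all add: bij_betw_def)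
  \<comment> \<open>Exponents at ranks below j are unrestricted: j = 0 is the hypothesis
    \<open>box\<close>, and j = \<open>CARD('n)\<close> is the goal.\<close>
  have *: "\<phi> \<alpha> = 0" if "j \<le> ?N" "\<And>i. \<rho> i \<ge> j \<Longrightarrow> \<alpha> i < 2 * (?N - \<rho> i)" for j \<alpha>
    using that
  proof (induction j arbitrary: \<alpha>)
    case 0
    then show ?case by (intro box) simp
  next
    case (Suc j)
    have "j \<in> {..<?N}" using Suc.prems(1) by simp
    then have "j \<in> range \<rho>" unfolding im .
    then obtain s where s: "\<rho> s = j" by (metis imageE)
    \<comment> \<open>The relation trades powers of the variable s for powers of variables of lower
      rank, which are already free; the exponent at s alone therefore serves as induction
      measure.\<close>
    have "\<phi> \<alpha> = 0" if "\<alpha> s = a" "\<And>i. \<rho> i \<ge> Suc j \<Longrightarrow> \<alpha> i < 2 * (?N - \<rho> i)" for a \<alpha>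
      using that
    proof (induction a arbitrary: \<alpha> rule: less_induct)
      case (less a)
      show ?case
      proof (cases "\<alpha> s < 2 * (?N - j)")
        case True
        have "\<alpha> i < 2 * (?N - \<rho> i)" if "\<rho> i \<ge> j" for i
        proof (cases "\<rho> i = j")
          case True
          then have "i = s" using injD[OF inj] s by blast
          then show ?thesis using \<open>\<alpha> s < 2 * (?N - j)\<close> s by simp
        qed (use less.prems that in auto)
        moreover have "j \<le> ?N" using Suc.prems(1) by simp
        ultimately show ?thesis by (intro Suc.IH)
      next
        case False
        define m where "m = ?N - j"
        define \<beta> where "\<beta> = \<alpha>(s := \<alpha> s - 2 * m)"
        define R where "R = {i. \<rho> i < j}"
        have \<beta>: "\<alpha> = (\<lambda>i. if i = s then 2 * m else 0) + \<beta>"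
        proof
          fix i show "\<alpha> i = ((\<lambda>i. if i = s then 2 * m else 0) + \<beta>) i"
            using False by (simp add: \<beta>_def m_def)
        qed
        have sR: "s \<notin> R" using s by (simp add: R_def)
        have "\<rho> ` R = {..<j}"
        proof
          show "{..<j} \<subseteq> \<rho> ` R"
          proof
            fix x assume x: "x \<in> {..<j}"
            then have "x \<in> {..<?N}" using Suc.prems(1) by simp
            then have "x \<in> range \<rho>" unfolding im .
            then obtain i where "\<rho> i = x" by (metis imageE)
            moreover from this have "i \<in> R" using x by (simp add: R_def)
            ultimately show "x \<in> \<rho> ` R" by blast
          qed
        qed (auto simp: R_def)
        moreover have "inj_on \<rho> R" using inj by (rule inj_on_subset) simp
        then have "card (\<rho> ` R) = card R" by (rule card_image)
        ultimately have cardR: "card R = j" by simp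
        have "card (insert s R) = Suc j" using sR cardR by simp
        then have ins: "apolar \<phi> (fps_nth (\<Prod>i\<in>insert s R. geom (neg_square i)) m * Poly_Mapping.single \<beta> 1) = 0"
          using Suc.prems(1) by (intro complete_in_Ann_harmonic h) (simp add: m_def)
        \<comment> \<open>The complete symmetric polynomial of \<open>insert s R\<close>, sorted by
          powers of s; the summand of top power is isolated.\<close>
        have expand: "fps_nth (\<Prod>i\<in>insert s R. geom (neg_square i)) m
            = neg_square s ^ m + (\<Sum>l<m. neg_square s ^ l * fps_nth (\<Prod>i\<in>R. geom (neg_square i)) (m - l))"
        proof -
          have "fps_nth (\<Prod>i\<in>insert s R. geom (neg_square i)) m
              = fps_nth (geom (neg_square s) * (\<Prod>i\<in>R. geom (neg_square i))) m"
            using sR by simp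
          also have "\<dots> = (\<Sum>l\<in>insert m {..<m}. neg_square s ^ l * fps_nth (\<Prod>i\<in>R. geom (neg_square i)) (m - l))"
            unfolding fps_mult_nth by (intro sum.cong) (auto simp: geom_def)
          also have "\<dots> = neg_square s ^ m + (\<Sum>l<m. neg_square s ^ l * fps_nth (\<Prod>i\<in>R. geom (neg_square i)) (m - l))"
            by (simp add: geom_def nth_prod_0)
          finally show ?thesis .
        qed
        have zero: "apolar \<phi> (neg_square s ^ l * fps_nth (\<Prod>i\<in>R. geom (neg_square i)) (m - l) * Poly_Mapping.single \<beta> 1) = 0"
          if l: "l < m" for l
        proof -
          have "\<phi> ((\<lambda>i. if i = s then 2 * l else 0) + ((\<lambda>i. if i \<in> R then 2 * \<gamma> i else 0) + \<beta>)) = 0" for \<gamma>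
          proof (rule less.IH[OF _ refl])
            show "((\<lambda>i. if i = s then 2 * l else 0) + ((\<lambda>i. if i \<in> R then 2 * \<gamma> i else 0) + \<beta>)) s < a"
              using sR l False less.prems(1) by (simp add: \<beta>_def m_def)
            fix i assume i: "Suc j \<le> \<rho> i"
            then have "i \<noteq> s" "i \<notin> R" using s by (auto simp: R_def)
            then show "((\<lambda>i. if i = s then 2 * l else 0) + ((\<lambda>i. if i \<in> R then 2 * \<gamma> i else 0) + \<beta>)) i < 2 * (?N - \<rho> i)"
              using less.prems(2)[OF i] by (simp add: \<beta>_def)
          qed
          then have "apolar \<phi> (neg_square s ^ l * Poly_Mapping.single (\<lambda>i. if i \<in> R then 2 * \<gamma> i else 0) c * Poly_Mapping.single \<beta> 1) = 0" for \<gamma> c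
            unfolding neg_square_power mult_single apolar_single add.assoc by simp
          then show ?thesis
            unfolding coeff_geom_neg_square sum_distrib_left sum_distrib_right apolar_sum by simp
        qed
        have "apolar \<phi> (neg_square s ^ m * Poly_Mapping.single \<beta> 1) = 0"
          using ins zero unfolding expand distrib_right apolar_add sum_distrib_right apolar_sum by simp
        then show ?thesis by (simp add: neg_square_power mult_single apolar_single flip: \<beta>)
      qed
    qed
    from this[OF refl Suc.prems(2)] show ?case .
  qed
  show ?thesis
  proof (rule *[of ?N])
    fix i assume "?N \<le> \<rho> i"
    moreover have "\<rho> i < ?N" using \<rho> unfolding bij_betw_def by blast
    ultimately show "\<alpha> i < 2 * (?N - \<rho> i)" by simp
  qed simp
qed

end

subsection \<open>Closure properties of polynomial functions\<close>

definition polyfun :: "(real ^ 'n::finite \<Rightarrow> real) set" where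
  "polyfun = {f. \<exists>d \<phi>. supp_in d \<phi> \<and> f = pf d \<phi>}"

lemma polyfunI: "supp_in d \<phi> \<Longrightarrow> pf d \<phi> \<in> polyfun"
  unfolding polyfun_def by blast

lemma polyfun_dmon_scale: "(\<lambda>x. c * dmon \<delta> x) \<in> polyfun"
proof -
  let ?\<phi> = "\<lambda>\<beta>. if \<beta> = \<delta> then c else 0" and ?d = "expo_deg \<delta>"
  have \<delta>: "\<delta> \<in> expo_box ?d" by (simp add: expo_box_def expo_le_deg)
  have "pf ?d ?\<phi> = (\<lambda>x. c * dmon \<delta> x)"
  proof
    fix x
    have "pf ?d ?\<phi> x = (\<Sum>\<beta>\<in>expo_box ?d. if \<beta> = \<delta> then c * dmon \<delta> x else 0)"
      unfolding pf_def by (intro sum.cong) auto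
    then show "pf ?d ?\<phi> x = c * dmon \<delta> x" using \<delta> by simp
  qed
  moreover have "supp_in ?d ?\<phi>" using \<delta> by (simp add: supp_in_def)
  ultimately show ?thesis using polyfunI by metis
qed

lemma polyfun_const: "(\<lambda>x. c) \<in> polyfun"
  using polyfun_dmon_scale[of c 0] by simp

lemma polyfun_add:
  assumes "f \<in> polyfun" "g \<in> polyfun"
  shows "(\<lambda>x. f x + g x) \<in> polyfun"
proof -
  obtain d \<phi> e \<psi> where f: "supp_in d \<phi>" "f = pf d \<phi>" and g: "supp_in e \<psi>" "g = pf e \<psi>"
    using assms unfolding polyfun_def by blast
  let ?m = "max d e"
  have s: "supp_in ?m \<phi>" "supp_in ?m \<psi>" using f g by (auto intro: supp_in_mono)
  have "supp_in ?m (\<lambda>\<beta>. \<phi> \<beta> + \<psi> \<beta>)"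
    unfolding supp_in_def
  proof (intro allI impI)
    fix \<beta> assume "\<phi> \<beta> + \<psi> \<beta> \<noteq> 0"
    then have "\<phi> \<beta> \<noteq> 0 \<or> \<psi> \<beta> \<noteq> 0" by auto
    then show "\<beta> \<in> expo_box ?m" using s unfolding supp_in_def by blast
  qed
  moreover have "pf ?m (\<lambda>\<beta>. \<phi> \<beta> + \<psi> \<beta>) = (\<lambda>x. f x + g x)"
    using pf_mono[OF f(1), of ?m] pf_mono[OF g(1), of ?m] by (simp add: fun_eq_iff pf_add f(2) g(2))
  ultimately show ?thesis using polyfunI by metis
qed

lemma polyfun_sum: "(\<And>i. i \<in> A \<Longrightarrow> f i \<in> polyfun) \<Longrightarrow> (\<lambda>x. \<Sum>i\<in>A. f i x) \<in> polyfun"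
  by (induction A rule: infinite_finite_induct) (auto simp: polyfun_const polyfun_add)

lemma dmon_mult: "dmon \<beta> x * dmon \<gamma> x = (\<Prod>i\<in>UNIV. fact (\<beta> i + \<gamma> i) / (fact (\<beta> i) * fact (\<gamma> i))) * dmon (\<beta> + \<gamma>) x"
  unfolding dmon_def prod.distrib[symmetric] by (intro prod.cong) (auto simp: power_add)

lemma polyfun_mult:
  assumes "f \<in> polyfun" "g \<in> polyfun"
  shows "(\<lambda>x. f x * g x) \<in> polyfun"
proof -
  obtain d \<phi> e \<psi> where f: "f = pf d \<phi>" and g: "g = pf e \<psi>"
    using assms unfolding polyfun_def by blast
  define c where "c = (\<lambda>\<beta> \<gamma>. \<phi> \<beta> * \<psi> \<gamma> * (\<Prod>i\<in>UNIV. fact (\<beta> i + \<gamma> i) / (fact (\<beta> i) * fact (\<gamma> i))))"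
  have "f x * g x = (\<Sum>\<beta>\<in>expo_box d. \<Sum>\<gamma>\<in>expo_box e. c \<beta> \<gamma> * dmon (\<beta> + \<gamma>) x)" for x
  proof -
    have "f x * g x = (\<Sum>\<beta>\<in>expo_box d. \<Sum>\<gamma>\<in>expo_box e. (\<phi> \<beta> * dmon \<beta> x) * (\<psi> \<gamma> * dmon \<gamma> x))"
      unfolding f g pf_def by (rule sum_product)
    moreover have "(\<phi> \<beta> * dmon \<beta> x) * (\<psi> \<gamma> * dmon \<gamma> x) = c \<beta> \<gamma> * dmon (\<beta> + \<gamma>) x" for \<beta> \<gamma>
    proof -
      have "(\<phi> \<beta> * dmon \<beta> x) * (\<psi> \<gamma> * dmon \<gamma> x) = \<phi> \<beta> * \<psi> \<gamma> * (dmon \<beta> x * dmon \<gamma> x)" by (simp only: mult_ac)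
      then show ?thesis unfolding dmon_mult c_def by (simp only: mult_ac)
    qed
    ultimately show ?thesis by simp
  qed
  then show ?thesis by (simp add: polyfun_sum polyfun_dmon_scale)
qed

lemma polyfun_prod: "(\<And>i. i \<in> A \<Longrightarrow> f i \<in> polyfun) \<Longrightarrow> (\<lambda>x. \<Prod>i\<in>A. f i x) \<in> polyfun"
  by (induction A rule: infinite_finite_induct) (auto simp: polyfun_const polyfun_mult)

lemma polyfun_power: "f \<in> polyfun \<Longrightarrow> (\<lambda>x. f x ^ n) \<in> polyfun"
  by (induction n) (auto simp: polyfun_const polyfun_mult)

lemma polyfun_component: "(\<lambda>x. x $ i) \<in> polyfun"
proof -
  have "(\<lambda>x. 1 * dmon (\<lambda>j. if j = i then 1 else 0) x) = (\<lambda>x. x $ i)"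
  proof
    fix x :: "real ^ 'a"
    have "dmon (\<lambda>j. if j = i then 1 else 0) x = (\<Prod>j\<in>UNIV. if j = i then x $ i else 1)"
      unfolding dmon_def by (intro prod.cong) auto
    then show "1 * dmon (\<lambda>j. if j = i then 1 else 0) x = x $ i" by simp
  qed
  note eq = this
  from polyfun_dmon_scale[of 1 "\<lambda>j. if j = i then 1 else 0"] show ?thesis unfolding eq .
qed

lemma polyfun_diff: "f \<in> polyfun \<Longrightarrow> g \<in> polyfun \<Longrightarrow> (\<lambda>x. f x - g x) \<in> polyfun"
proof -
  assume "f \<in> polyfun" "g \<in> polyfun"
  then have "(\<lambda>x. f x + - 1 * g x) \<in> polyfun" by (intro polyfun_add polyfun_mult polyfun_const)
  then show ?thesis by simp
qed

lemma polyfun_compose_linear: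
  assumes "f \<in> polyfun" "linear L"
  shows "(\<lambda>x. f (L x)) \<in> polyfun"
proof -
  obtain d \<phi> where f: "f = pf d \<phi>" using assms(1) unfolding polyfun_def by blast
  have L: "(\<lambda>x. L x $ i) \<in> polyfun" for i
  proof -
    have "L x $ i = (\<Sum>j\<in>UNIV. x $ j * L (axis j 1) $ i)" for x
    proof -
      have "L x = L (\<Sum>j\<in>UNIV. x $ j *\<^sub>R axis j 1)"
        by (simp add: basis_expansion flip: scalar_mult_eq_scaleR)
      also have "\<dots> = (\<Sum>j\<in>UNIV. x $ j *\<^sub>R L (axis j 1))"
        using assms(2) by (simp add: linear_sum linear_scale)
      finally show ?thesis by simp
    qed
    then have "(\<lambda>x. L x $ i) = (\<lambda>x. \<Sum>j\<in>UNIV. x $ j * L (axis j 1) $ i)" by (rule ext)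
    moreover have "(\<lambda>x. \<Sum>j\<in>UNIV. x $ j * L (axis j 1) $ i) \<in> polyfun"
      by (rule polyfun_sum) (rule polyfun_mult[OF polyfun_component polyfun_const])
    ultimately show ?thesis by (simp only:)
  qed
  have "(\<lambda>x. L x $ i ^ n / c) \<in> polyfun" for i n c
    using polyfun_mult[OF polyfun_power[OF L] polyfun_const, of i n "1 / c"] by simp
  then have "(\<lambda>x. dmon \<beta> (L x)) \<in> polyfun" for \<beta>
    unfolding dmon_def by (rule polyfun_prod)
  then have "(\<lambda>x. \<phi> \<beta> * dmon \<beta> (L x)) \<in> polyfun" for \<beta>
    by (rule polyfun_mult[OF polyfun_const])
  then show ?thesis unfolding f pf_def by (rule polyfun_sum)
qed

lemma polyfun_differentiable:
  assumes "f \<in> polyfun"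
  shows "f differentiable (at x)"
proof -
  obtain d \<phi> where f: "f = pf d \<phi>" using assms unfolding polyfun_def by blast
  have comp: "(\<lambda>x. x $ i ^ n / c) differentiable (at x)" if "c \<noteq> 0" for i n and c :: real and x :: "real ^ 'a"
  proof (rule differentiableI)
    show "((\<lambda>x. x $ i ^ n / c) has_derivative (\<lambda>h. (of_nat n * (h $ i * x $ i ^ (n - 1))) / c)) (at x)"
      using that by (auto intro!: derivative_eq_intros bounded_linear_imp_has_derivative bounded_linear_vec_nth)
  qed
  have "(\<lambda>x. \<Prod>i\<in>A. x $ i ^ \<beta> i / fact (\<beta> i)) differentiable (at x)" for A \<beta> and x :: "real ^ 'a"
  proof (induction A rule: infinite_finite_induct)
    case (insert i A)
    have "(\<lambda>x. x $ i ^ \<beta> i / fact (\<beta> i) * (\<Prod>i\<in>A. x $ i ^ \<beta> i / fact (\<beta> i))) differentiable (at x)"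
      by (rule differentiable_mult[OF comp insert.IH]) simp
    then show ?case by (simp only: prod.insert[OF insert.hyps])
  qed auto
  then have "dmon \<beta> differentiable (at x)" for \<beta> and x :: "real ^ 'a"
    unfolding dmon_def by blast
  then show ?thesis unfolding f pf_def by (intro differentiable_sum differentiable_mult) auto
qed

subsection \<open>The coefficients of the alternating polynomial\<close>

lemma Delta_polyfun: "(Delta :: real ^ 'n::{finite,linorder} \<Rightarrow> real) \<in> polyfun"
proof -
  have "(\<lambda>x. \<Prod>p\<in>{(i, j). i < j}. (x $ fst p)\<^sup>2 - (x $ snd p)\<^sup>2) \<in> (polyfun :: ((real, 'n) vec \<Rightarrow> real) set)"
    by (rule polyfun_prod) (rule polyfun_diff[OF polyfun_power[OF polyfun_component] polyfun_power[OF polyfun_component]])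
  then have "(\<lambda>x :: (real, 'n) vec. (\<Prod>i\<in>UNIV. x $ i) * (\<Prod>p\<in>{(i, j). i < j}. (x $ fst p)\<^sup>2 - (x $ snd p)\<^sup>2)) \<in> (polyfun :: ((real, 'n) vec \<Rightarrow> real) set)"
    by (rule polyfun_mult[OF polyfun_prod[OF polyfun_component]])
  moreover have "Delta = (\<lambda>x :: (real, 'n) vec. (\<Prod>i\<in>UNIV. x $ i) * (\<Prod>p\<in>{(i, j). i < j}. (x $ fst p)\<^sup>2 - (x $ snd p)\<^sup>2))"
    by (simp add: Delta_def fun_eq_iff case_prod_beta)
  ultimately show ?thesis by simp
qed

text \<open>The degree of \<open>Delta\<close>, one for each coordinate and two for each pair,
  obtained by splitting all pairs into the diagonal and two halves of equal size.\<close>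

lemma card_less_pairs: "CARD('n::{finite,linorder}) + 2 * card {(i, j). i < (j :: 'n)} = (CARD('n))\<^sup>2"
proof -
  let ?L = "{(i, j). i < (j :: 'n)}" and ?G = "{(i, j). j < (i :: 'n)}"
  have "UNIV = range (\<lambda>i :: 'n. (i, i)) \<union> (?L \<union> ?G)" by auto
  then have "card (UNIV :: ('n \<times> 'n) set) = card (range (\<lambda>i :: 'n. (i, i)) \<union> (?L \<union> ?G))" by simp
  also have "\<dots> = card (range (\<lambda>i :: 'n. (i, i))) + (card ?L + card ?G)"
    by (subst card_Un_disjoint, auto)+
  also have "card (range (\<lambda>i :: 'n. (i, i))) = CARD('n)" by (rule card_image) (simp add: inj_on_def)
  also have "card ?G = card ?L"
    by (rule bij_betw_same_card[of prod.swap]) (auto intro!: bij_betwI[of _ _ _ prod.swap])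
  finally show ?thesis by (simp add: power2_eq_square)
qed

lemma Delta_scale: "Delta (t *\<^sub>R x) = t ^ ((CARD('n))\<^sup>2) * Delta (x :: real ^ 'n::{finite,linorder})"
proof -
  have "Delta (t *\<^sub>R x) = (\<Prod>i\<in>UNIV. t * x $ i) * (\<Prod>(i, j)\<in>{(i, j). i < j}. t\<^sup>2 * ((x $ i)\<^sup>2 - (x $ j)\<^sup>2))"
    by (simp add: Delta_def power_mult_distrib right_diff_distrib)
  also have "\<dots> = t ^ (CARD('n) + 2 * card {(i, j). i < (j :: 'n)}) * Delta x"
    by (simp add: Delta_def prod.distrib case_prod_beta power_add power_mult)
  finally show ?thesis by (simp only: card_less_pairs)
qed

lemma Delta_reflect:
  fixes x :: "real ^ 'n::{finite,linorder}"
  shows "Delta (\<chi> j. if j = i then - x $ j else x $ j) = - Delta x"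
proof -
  have "(\<Prod>j\<in>UNIV. if j = i then - x $ j else x $ j) = - (\<Prod>j\<in>UNIV. x $ j)"
    by (simp add: prod.remove[of UNIV i])
  moreover have "((if j = i then - x $ j else x $ j)\<^sup>2) = (x $ j)\<^sup>2" for j by simp
  ultimately show ?thesis by (simp add: Delta_def)
qed

definition vperm :: "('n \<Rightarrow> 'n) \<Rightarrow> real ^ 'n \<Rightarrow> real ^ 'n" where
  "vperm \<tau> x = (\<chi> j. x $ \<tau> j)"

text \<open>The transposition permutes the quadratic factors up to sign. The order of a pair is
  reversed exactly for (a, b) and for (a, c), (c, b) with c strictly between, which is an odd number
  of pairs.\<close>

lemma Delta_swap_less:
  fixes x :: "real ^ 'n::{finite,linorder}"
  assumes ab: "a < b"
  shows "Delta (vperm (Transposition.transpose a b) x) = - Delta x"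
proof -
  let ?\<tau> = "Transposition.transpose a b"
  define P where "P = {(i, j). i < (j :: 'n)}"
  \<comment> \<open>The image pair put back into increasing order, an involution of
    \<open>P\<close>; \<open>s\<close> records whether reordering was necessary.\<close>
  define \<sigma> where "\<sigma> = (\<lambda>(i, j). if ?\<tau> i < ?\<tau> j then (?\<tau> i, ?\<tau> j) else (?\<tau> j, ?\<tau> i))"
  define f where "f = (\<lambda>(i, j). (x $ i)\<^sup>2 - (x $ j)\<^sup>2)"
  define s where "s = (\<lambda>(i, j). if ?\<tau> i < ?\<tau> j then 1 else - 1 :: real)"
  define I where "I = {c. a < c \<and> c < b}"
  have tt: "?\<tau> (?\<tau> i) = i" for i by simp
  have ne: "?\<tau> i \<noteq> ?\<tau> j" if "i \<noteq> j" for i j using that tt by metis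
  have \<sigma>P: "\<sigma> p \<in> P" if "p \<in> P" for p
  proof -
    obtain i j where p: "p = (i, j)" "i < j" using \<open>p \<in> P\<close> unfolding P_def by blast
    then have "?\<tau> i < ?\<tau> j \<or> ?\<tau> j < ?\<tau> i" using ne[of i j] by (simp add: neq_iff)
    then show ?thesis by (auto simp: p \<sigma>_def P_def)
  qed
  have \<sigma>\<sigma>: "\<sigma> (\<sigma> p) = p" if "p \<in> P" for p
    using that by (auto simp: \<sigma>_def P_def split: prod.splits if_splits)
  have "(\<Prod>(i, j)\<in>P. (x $ ?\<tau> i)\<^sup>2 - (x $ ?\<tau> j)\<^sup>2) = (\<Prod>p\<in>P. s p * f (\<sigma> p))"
    by (intro prod.cong) (auto simp: s_def f_def \<sigma>_def)
  also have "\<dots> = (\<Prod>p\<in>P. s p) * (\<Prod>p\<in>P. f (\<sigma> p))" by (rule prod.distrib)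
  also have "(\<Prod>p\<in>P. f (\<sigma> p)) = (\<Prod>p\<in>P. f p)"
    by (rule prod.reindex_bij_witness[where i = \<sigma> and j = \<sigma>]) (auto simp: \<sigma>P \<sigma>\<sigma>)
  also have "(\<Prod>p\<in>P. s p) = (\<Prod>p\<in>insert (a, b) ({a} \<times> I \<union> I \<times> {b}). - 1)"
  proof (rule prod.mono_neutral_cong_right)
    show "insert (a, b) ({a} \<times> I \<union> I \<times> {b}) \<subseteq> P" using ab by (auto simp: P_def I_def)
    show "\<forall>p\<in>P - insert (a, b) ({a} \<times> I \<union> I \<times> {b}). s p = 1"
    proof
      fix p assume "p \<in> P - insert (a, b) ({a} \<times> I \<union> I \<times> {b})"
      then obtain i j where p: "p = (i, j)" "i < j" "\<not> (i = a \<and> j \<le> b)" "\<not> (j = b \<and> a \<le> i)"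
        by (cases p) (auto simp: P_def I_def order_le_less)
      then have "?\<tau> i < ?\<tau> j"
        using ab by (auto simp: Transposition.transpose_def not_le)
      then show "s p = 1" by (simp add: s_def p)
    qed
    fix p assume "p \<in> insert (a, b) ({a} \<times> I \<union> I \<times> {b})"
    then show "s p = - 1" using ab by (auto simp: s_def I_def Transposition.transpose_def)
  qed (simp add: P_def)
  also have "\<dots> = - 1"
  proof -
    have "card ({a} \<times> I \<union> I \<times> {b}) = 2 * card I"
      by (subst card_Un_disjoint) (auto simp: I_def card_cartesian_product)
    moreover have "(a, b) \<notin> {a} \<times> I \<union> I \<times> {b}" by (simp add: I_def)
    ultimately have "card (insert (a, b) ({a} \<times> I \<union> I \<times> {b})) = Suc (2 * card I)" by simp
    then show ?thesis by (simp add: power_mult)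
  qed
  finally have "(\<Prod>(i, j)\<in>P. (x $ ?\<tau> i)\<^sup>2 - (x $ ?\<tau> j)\<^sup>2) = - (\<Prod>(i, j)\<in>P. (x $ i)\<^sup>2 - (x $ j)\<^sup>2)"
    by (simp add: f_def)
  moreover have "(\<Prod>i\<in>UNIV. x $ ?\<tau> i) = (\<Prod>i\<in>UNIV. x $ i)"
    by (rule prod.reindex_bij_witness[where i = ?\<tau> and j = ?\<tau>]) auto
  ultimately show ?thesis by (simp add: Delta_def vperm_def P_def)
qed

lemma Delta_swap:
  fixes x :: "real ^ 'n::{finite,linorder}"
  assumes "a \<noteq> b"
  shows "Delta (vperm (Transposition.transpose a b) x) = - Delta x"
  using assms Delta_swap_less[of a b x] Delta_swap_less[of b a x]
  by (cases "a < b") (auto simp: transpose_commute)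

lemma Delta_nonzero: "\<exists>x. Delta (x :: real ^ 'n::{finite,linorder}) \<noteq> 0"
proof -
  obtain \<rho> :: "'n \<Rightarrow> nat" where inj: "inj \<rho>"
    using finite_imp_inj_to_nat_seg[of "UNIV :: 'n set"] by auto
  have "Delta (\<chi> i. real (\<rho> i) + 1) \<noteq> 0"
  proof -
    have "(real (\<rho> i) + 1)\<^sup>2 - (real (\<rho> j) + 1)\<^sup>2 \<noteq> 0" if "i < j" for i j
    proof -
      have "\<rho> i \<noteq> \<rho> j" using that injD[OF inj, of i j] by auto
      then show ?thesis by (simp add: power2_eq_iff)
    qed
    moreover have "real n + 1 \<noteq> 0" for n by linarith
    ultimately show ?thesis by (auto simp: Delta_def)
  qed
  then show ?thesis by blast
qed

section \<open>Exponents occurring in the alternating polynomial\<close>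

definition Delta_coeffs :: "(('n::{finite,linorder} \<Rightarrow> nat) \<Rightarrow> real) \<Rightarrow> bool" where
  "Delta_coeffs \<phi> \<longleftrightarrow> (\<exists>d. supp_in d \<phi> \<and> Delta = pf d \<phi>)"

lemma Delta_coeffs_exist: "\<exists>\<phi>. Delta_coeffs \<phi>"
  using Delta_polyfun unfolding polyfun_def Delta_coeffs_def by blast

lemma dmon_reflect: "dmon \<beta> (\<chi> j. if j = i then - x $ j else x $ j) = (- 1) ^ \<beta> i * dmon \<beta> x"
proof -
  have "dmon \<gamma> y = (y $ i ^ \<gamma> i / fact (\<gamma> i)) * (\<Prod>j\<in>UNIV - {i}. y $ j ^ \<gamma> j / fact (\<gamma> j))" for \<gamma> and y :: "real ^ 'a"
    by (simp add: dmon_def prod.remove)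
  note split = this
  have "(\<Prod>j\<in>UNIV - {i}. (\<chi> j. if j = i then - x $ j else x $ j) $ j ^ \<beta> j / fact (\<beta> j)) = (\<Prod>j\<in>UNIV - {i}. x $ j ^ \<beta> j / fact (\<beta> j))"
    by (intro prod.cong) auto
  moreover have "(- x $ i) ^ \<beta> i = (- 1) ^ \<beta> i * x $ i ^ \<beta> i" by (metis mult_minus1 power_mult_distrib)
  ultimately show ?thesis unfolding split[of \<beta>] by simp
qed

lemma dmon_vperm:
  assumes "\<And>i. \<tau> (\<tau> i) = i"
  shows "dmon \<beta> (vperm \<tau> x) = dmon (\<beta> \<circ> \<tau>) x"
  unfolding dmon_def vperm_def using assms
  by (intro prod.reindex_bij_witness[where i = \<tau> and j = \<tau>]) auto

text \<open>Coefficients are unique by \<open>pf_inject\<close>, so each symmetry of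
  \<open>Delta\<close> passes to its family. For homogeneity the single scaling factor 2 suffices,
  since equal powers of 2 have equal exponents.\<close>

lemma
  fixes \<phi> :: "('n::{finite,linorder} \<Rightarrow> nat) \<Rightarrow> real"
  assumes "Delta_coeffs \<phi>"
  shows Delta_coeffs_deg: "\<phi> \<beta> \<noteq> 0 \<Longrightarrow> expo_deg \<beta> = (CARD('n))\<^sup>2"
    and Delta_coeffs_odd: "\<phi> \<beta> \<noteq> 0 \<Longrightarrow> odd (\<beta> i)"
    and Delta_coeffs_swap: "a \<noteq> b \<Longrightarrow> \<phi> (\<beta> \<circ> Transposition.transpose a b) = - \<phi> \<beta>"
proof -
  obtain d where d: "supp_in d \<phi>" and D: "Delta = pf d \<phi>"
    using assms unfolding Delta_coeffs_def by blast
  have supp: "supp_in d \<psi>" if "\<And>\<beta>. \<phi> \<beta> = 0 \<Longrightarrow> \<psi> \<beta> = 0" for \<psi>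
    using that d unfolding supp_in_def by blast
  have "(\<lambda>\<beta>. 2 ^ expo_deg \<beta> * \<phi> \<beta>) = (\<lambda>\<beta>. 2 ^ ((CARD('n))\<^sup>2) * \<phi> \<beta>)"
  proof (rule pf_inject[of d])
    have "pf d (\<lambda>\<beta>. 2 ^ expo_deg \<beta> * \<phi> \<beta>) x = pf d \<phi> (2 *\<^sub>R x)" for x
      by (simp add: pf_def dmon_scale mult_ac)
    then show "pf d (\<lambda>\<beta>. 2 ^ expo_deg \<beta> * \<phi> \<beta>) = pf d (\<lambda>\<beta>. 2 ^ ((CARD('n))\<^sup>2) * \<phi> \<beta>)"
      unfolding pf_scale fun_eq_iff by (simp add: Delta_scale pf_scale flip: D)
  qed (auto intro: supp)
  then have "2 ^ expo_deg \<beta> * \<phi> \<beta> = 2 ^ ((CARD('n))\<^sup>2) * \<phi> \<beta>" by (rule fun_cong)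
  then show "\<phi> \<beta> \<noteq> 0 \<Longrightarrow> expo_deg \<beta> = (CARD('n))\<^sup>2" by simp
  have "(\<lambda>\<beta>. (- 1) ^ \<beta> i * \<phi> \<beta>) = (\<lambda>\<beta>. - 1 * \<phi> \<beta>)"
  proof (rule pf_inject[of d])
    have "pf d (\<lambda>\<beta>. (- 1) ^ \<beta> i * \<phi> \<beta>) x = pf d \<phi> (\<chi> j. if j = i then - x $ j else x $ j)" for x
      unfolding pf_def dmon_reflect by (simp add: mult_ac)
    then show "pf d (\<lambda>\<beta>. (- 1) ^ \<beta> i * \<phi> \<beta>) = pf d (\<lambda>\<beta>. - 1 * \<phi> \<beta>)"
      unfolding pf_scale fun_eq_iff by (simp add: Delta_reflect flip: D)
  qed (auto intro: supp)
  then have "(- 1) ^ \<beta> i * \<phi> \<beta> = - 1 * \<phi> \<beta>" by (rule fun_cong)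
  then show "\<phi> \<beta> \<noteq> 0 \<Longrightarrow> odd (\<beta> i)" by (cases "even (\<beta> i)") auto
  assume ab: "a \<noteq> b"
  let ?\<tau> = "Transposition.transpose a b"
  have box: "\<beta> \<circ> ?\<tau> \<in> expo_box d" if "\<beta> \<in> expo_box d" for \<beta> using that by (simp add: expo_box_def)
  have inv: "\<beta> \<circ> ?\<tau> \<circ> ?\<tau> = \<beta>" for \<beta> :: "'n \<Rightarrow> nat" by (simp add: fun_eq_iff)
  have "(\<lambda>\<beta>. \<phi> (\<beta> \<circ> ?\<tau>)) = (\<lambda>\<beta>. - 1 * \<phi> \<beta>)"
  proof (rule pf_inject[of d])
    have "pf d (\<lambda>\<beta>. \<phi> (\<beta> \<circ> ?\<tau>)) x = pf d \<phi> (vperm ?\<tau> x)" for x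
      unfolding pf_def
      by (rule sum.reindex_bij_witness[where i = "\<lambda>\<beta>. \<beta> \<circ> ?\<tau>" and j = "\<lambda>\<beta>. \<beta> \<circ> ?\<tau>"]) (simp_all add: box inv dmon_vperm)
    then show "pf d (\<lambda>\<beta>. \<phi> (\<beta> \<circ> ?\<tau>)) = pf d (\<lambda>\<beta>. - 1 * \<phi> \<beta>)"
      unfolding pf_scale fun_eq_iff by (simp add: Delta_swap[OF ab] flip: D)
    show "supp_in d (\<lambda>\<beta>. \<phi> (\<beta> \<circ> ?\<tau>))"
      unfolding supp_in_def
    proof (intro allI impI)
      fix \<beta> assume "\<phi> (\<beta> \<circ> ?\<tau>) \<noteq> 0"
      then have "\<beta> \<circ> ?\<tau> \<in> expo_box d" using d by (simp add: supp_in_def)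
      from box[OF this] show "\<beta> \<in> expo_box d" by (simp only: inv)
    qed
  qed (auto intro: supp)
  then have "\<phi> (\<beta> \<circ> ?\<tau>) = - 1 * \<phi> \<beta>" by (rule fun_cong)
  then show "\<phi> (\<beta> \<circ> ?\<tau>) = - \<phi> \<beta>" by simp
qed

lemma Delta_coeffs_inj:
  fixes \<phi> :: "('n::{finite,linorder} \<Rightarrow> nat) \<Rightarrow> real"
  assumes "Delta_coeffs \<phi>" "\<phi> \<beta> \<noteq> 0"
  shows "inj \<beta>"
proof (rule injI, rule ccontr)
  fix a b assume ab: "\<beta> a = \<beta> b" "a \<noteq> b"
  have "\<beta> \<circ> Transposition.transpose a b = \<beta>"
    using ab by (auto simp: fun_eq_iff Transposition.transpose_def)
  then show False using Delta_coeffs_swap[OF assms(1) ab(2), of \<beta>] assms(2) by simp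
qed

text \<open>Among c odd numbers the largest is at least 2c - 1, so removing it and inducting gives
  at least 1 + 3 + ... + (2c - 1) = c^2. In the case of equality the lower bound (c - 1)^2 for the
  other elements caps the largest one.\<close>

lemma sum_odd_ge:
  fixes A :: "nat set"
  assumes "finite A" "\<And>a. a \<in> A \<Longrightarrow> odd a"
  shows "\<Sum>A \<ge> (card A)\<^sup>2"
    and "\<Sum>A = (card A)\<^sup>2 \<Longrightarrow> A \<subseteq> {..<2 * card A}"
proof -
  have max: "2 * card A \<le> Suc (Max A)" if A: "finite A" "A \<noteq> {}" "\<And>a. a \<in> A \<Longrightarrow> odd a" for A :: "nat set"
  proof -
    have "A \<subseteq> (\<lambda>j. 2 * j + 1) ` {..Max A div 2}"
    proof
      fix a assume a: "a \<in> A"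
      then have "a = 2 * (a div 2) + 1" using A(3)[of a] by simp
      moreover have "a div 2 \<le> Max A div 2" using a A(1) by (simp add: div_le_mono)
      ultimately show "a \<in> (\<lambda>j. 2 * j + 1) ` {..Max A div 2}" by blast
    qed
    then have "card A \<le> card ((\<lambda>j. 2 * j + 1) ` {..Max A div 2})" by (intro card_mono) auto
    also have "\<dots> \<le> Suc (Max A div 2)" using card_image_le[of "{..Max A div 2}"] by simp
    finally have "card A \<le> Suc (Max A div 2)" .
    moreover have "odd (Max A)" using A Max_in by blast
    ultimately show ?thesis by presburger
  qed
  have aux: "x \<le> b \<Longrightarrow> a = m + b \<Longrightarrow> a = x + 2 * n + 1 \<Longrightarrow> m < 2 * Suc n" for a b m n x :: nat
    by simp
  have sq: "(Suc n)\<^sup>2 = n\<^sup>2 + 2 * n + 1" for n :: nat by (simp add: power2_eq_square)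
  have ge: "\<Sum>A \<ge> (card A)\<^sup>2" if "finite A" "\<And>a. a \<in> A \<Longrightarrow> odd a" "card A = n" for n and A :: "nat set"
    using that
  proof (induction n arbitrary: A)
    case (Suc n)
    then have ne: "A \<noteq> {}" by auto
    define B where "B = A - {Max A}"
    have cB: "card B = n" using Suc.prems Max_in[OF Suc.prems(1) ne] by (simp add: B_def)
    have "n\<^sup>2 \<le> \<Sum>B" using Suc.IH[of B] Suc.prems cB by (simp add: B_def)
    have "\<Sum>A = Max A + \<Sum>B" unfolding B_def by (rule sum.remove[OF Suc.prems(1) Max_in[OF Suc.prems(1) ne]])
    have "2 * Suc n \<le> Suc (Max A)" using max[OF Suc.prems(1) ne Suc.prems(2)] Suc.prems(3) by simp
    then have "2 * n + 1 \<le> Max A" by simp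
    with \<open>n\<^sup>2 \<le> \<Sum>B\<close> have "n\<^sup>2 + (2 * n + 1) \<le> \<Sum>B + Max A" by (rule add_mono)
    then show ?case unfolding Suc.prems(3) sq \<open>\<Sum>A = Max A + \<Sum>B\<close> by simp
  qed simp
  show "\<Sum>A \<ge> (card A)\<^sup>2" using ge[OF assms refl] .
  assume eq: "\<Sum>A = (card A)\<^sup>2"
  show "A \<subseteq> {..<2 * card A}"
  proof (cases "A = {}")
    case False
    then obtain n where n: "card A = Suc n" using assms(1) by (cases "card A") auto
    define B where "B = A - {Max A}"
    have cB: "card B = n" using n assms(1) Max_in[OF assms(1) False] by (simp add: B_def)
    have "(card B)\<^sup>2 \<le> \<Sum>B" using assms by (intro ge[OF _ _ refl]) (auto simp: B_def)
    moreover have "\<Sum>A = Max A + \<Sum>B" unfolding B_def by (rule sum.remove[OF assms(1) Max_in[OF assms(1) False]])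
    ultimately have "Max A < 2 * card A" using eq unfolding n cB sq by (rule aux)
    then show ?thesis using assms(1) Max_ge by (auto intro: le_less_trans)
  qed simp
qed

text \<open>The exponents are odd and distinct, and their sum is the least that this permits, which
  forces 1, 3, 5, ... in some order.\<close>

lemma Delta_coeffs_range:
  fixes \<phi> :: "('n::{finite,linorder} \<Rightarrow> nat) \<Rightarrow> real"
  assumes "Delta_coeffs \<phi>" "\<phi> \<beta> \<noteq> 0"
  shows "range \<beta> = (\<lambda>j. 2 * j + 1) ` {..<CARD('n)}"
proof -
  have inj: "inj \<beta>" by (rule Delta_coeffs_inj) fact+
  have c: "card (range \<beta>) = CARD('n)" by (rule card_image) fact
  have odd: "odd a" if "a \<in> range \<beta>" for a using that Delta_coeffs_odd[OF assms] by auto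
  have "\<Sum>(range \<beta>) = expo_deg \<beta>" by (simp add: expo_deg_def sum.reindex[OF inj])
  also have "\<dots> = (card (range \<beta>))\<^sup>2" unfolding c by (rule Delta_coeffs_deg) fact+
  finally have "range \<beta> \<subseteq> {..<2 * card (range \<beta>)}" by (intro sum_odd_ge odd) auto
  then have lt: "a < 2 * CARD('n)" if "a \<in> range \<beta>" for a using that unfolding c by blast
  have sub: "range \<beta> \<subseteq> (\<lambda>j. 2 * j + 1) ` {..<CARD('n)}"
  proof
    fix a assume a: "a \<in> range \<beta>"
    then have "a = 2 * (a div 2) + 1" using odd[OF a] by simp
    moreover have "a div 2 \<in> {..<CARD('n)}" using lt[OF a] by simp
    ultimately show "a \<in> (\<lambda>j. 2 * j + 1) ` {..<CARD('n)}" by (rule image_eqI)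
  qed
  show ?thesis
  proof (rule card_subset_eq[OF _ sub])
    have "card ((\<lambda>j. 2 * j + 1 :: nat) ` {..<CARD('n)}) = CARD('n)" by (subst card_image) (auto simp: inj_on_def)
    then show "card (range \<beta>) = card ((\<lambda>j. 2 * j + 1 :: nat) ` {..<CARD('n)})" unfolding c by simp
  qed simp
qed

subsection \<open>Dimension of the space of harmonic polynomials\<close>

lemma (in cube_measure) dmoment_perm:
  assumes \<tau>: "\<And>i. \<tau> (\<tau> i) = i"
  shows "dmoment (\<alpha> \<circ> \<tau>) = dmoment \<alpha>"
proof -
  have inj: "inj \<tau>" by (metis \<tau> injI)
  have mem: "i \<in> \<tau> ` S \<longleftrightarrow> \<tau> i \<in> S" for i S using \<tau> by (metis imageE imageI)
  have face: "face_moment S (\<alpha> \<circ> \<tau>) = face_moment (\<tau> ` S) \<alpha>" for S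
    unfolding face_moment_def by (rule prod.reindex_bij_witness[where i = \<tau> and j = \<tau>]) (auto simp: \<tau> mem)
  have "(\<Sum>S | card S = k. face_moment S (\<alpha> \<circ> \<tau>)) = (\<Sum>S | card S = k. face_moment S \<alpha>)"
    by (rule sum.reindex_bij_witness[where i = "image \<tau>" and j = "image \<tau>"])
       (auto simp: face image_image \<tau> card_image inj_on_subset[OF inj])
  moreover have "(\<Prod>i\<in>UNIV. fact ((\<alpha> \<circ> \<tau>) i) :: real) = (\<Prod>i\<in>UNIV. fact (\<alpha> i))"
    by (rule prod.reindex_bij_witness[where i = \<tau> and j = \<tau>]) (auto simp: \<tau>)
  ultimately show ?thesis unfolding dmoment_eq by simp
qed

lemma (in cube_measure) dmoment_odd:
  assumes "odd (\<alpha> i)"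
  shows "dmoment \<alpha> = 0"
proof -
  have "face_moment S \<alpha> = 0" for S
    unfolding face_moment_def using assms by (intro prod_zero) auto
  then show ?thesis by (simp add: dmoment_eq)
qed

lemma (in cube_measure) harmonic_coeffs_shift:
  assumes "harmonic_coeffs \<phi>"
  shows "harmonic_coeffs (\<lambda>\<beta>. \<phi> (\<beta> + \<gamma>))"
  using assms unfolding harmonic_coeffs_def by (simp add: add.assoc)

lemma (in cube_measure) subspace_harmonic_coeffs: "subspace {\<phi>. harmonic_coeffs \<phi>}"
  unfolding harmonic_coeffs_def subspace_def
  by (auto simp: scaleR_fun_def distrib_right sum.distrib mult.assoc simp flip: sum_distrib_left)

lemma (in cube_measure) harmonic_coeffs_supp:
  assumes "harmonic_coeffs \<phi>"
  shows "supp_in (2 * CARD('n)) \<phi>"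
  unfolding supp_in_def expo_box_def
proof (intro allI impI CollectI, rule ccontr)
  fix \<beta> i assume "\<phi> \<beta> \<noteq> 0" "\<not> \<beta> i \<le> 2 * CARD('n)"
  then show False using harmonic_coeffs_bounded[OF assms, of \<beta> i] by simp
qed

text \<open>A coefficient of the image of the alternating polynomial under a homogeneous invariant operator of
  positive degree vanishes: its exponents would have to be distinct and odd, with too small a sum.\<close>
lemma Delta_harmonic:
  fixes \<nu> :: "(real ^ 'n::{finite,linorder}) measure"
  assumes "cube_measure \<nu> k" "Delta_coeffs \<phi>"
  shows "cube_measure.harmonic_coeffs \<nu> \<phi>"
proof -
  interpret cube_measure \<nu> k by fact
  show ?thesis
    unfolding harmonic_coeffs_def
  proof (intro allI impI)
    fix m :: nat and \<beta> :: "'n \<Rightarrow> nat" assume m: "m > 0"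
    let ?s = "\<Sum>\<alpha> | expo_deg \<alpha> = m. \<phi> (\<alpha> + \<beta>) * dmoment \<alpha>"
    consider (even) i where "even (\<beta> i)" | (eq) a b where "a \<noteq> b" "\<beta> a = \<beta> b"
      | (inj) "\<And>i. odd (\<beta> i)" "inj \<beta>"
      unfolding inj_def by metis
    then show "?s = 0"
    proof cases
      case even
      show ?thesis
      proof (intro sum.neutral ballI)
        fix \<alpha> :: "'n \<Rightarrow> nat"
        show "\<phi> (\<alpha> + \<beta>) * dmoment \<alpha> = 0"
        proof (cases "odd (\<alpha> i)")
          case False
          then have "even ((\<alpha> + \<beta>) i)" using even by simp
          then have "\<phi> (\<alpha> + \<beta>) = 0" using Delta_coeffs_odd[OF assms(2)] by blast
          then show ?thesis by simp
        qed (simp add: dmoment_odd)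
      qed
    next
      case eq
      let ?\<tau> = "Transposition.transpose a b"
      have inv: "\<alpha> \<circ> ?\<tau> \<circ> ?\<tau> = \<alpha>" for \<alpha> :: "'n \<Rightarrow> nat" by (simp add: fun_eq_iff)
      have deg: "expo_deg (\<alpha> \<circ> ?\<tau>) = expo_deg \<alpha>" for \<alpha> :: "'n \<Rightarrow> nat"
        unfolding expo_deg_def by (rule sum.reindex_bij_witness[where i = ?\<tau> and j = ?\<tau>]) auto
      have neg: "\<phi> ((\<alpha> \<circ> ?\<tau>) + \<beta>) * dmoment (\<alpha> \<circ> ?\<tau>) = - (\<phi> (\<alpha> + \<beta>) * dmoment \<alpha>)" for \<alpha>
      proof -
        have "\<beta> \<circ> ?\<tau> = \<beta>" using eq by (auto simp: fun_eq_iff Transposition.transpose_def)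
        moreover have "(\<alpha> + \<beta>) \<circ> ?\<tau> = (\<alpha> \<circ> ?\<tau>) + (\<beta> \<circ> ?\<tau>)" by (simp add: fun_eq_iff)
        ultimately have "\<phi> ((\<alpha> \<circ> ?\<tau>) + \<beta>) = - \<phi> (\<alpha> + \<beta>)"
          using Delta_coeffs_swap[OF assms(2) eq(1), of "\<alpha> + \<beta>"] by simp
        moreover have "dmoment (\<alpha> \<circ> ?\<tau>) = dmoment \<alpha>" by (rule dmoment_perm) simp
        ultimately show ?thesis by simp
      qed
      \<comment> \<open>The averaging operator is invariant under the transposition while the family
        changes sign, so the sum is its own negative.\<close>
      have "?s = (\<Sum>\<alpha> | expo_deg \<alpha> = m. \<phi> ((\<alpha> \<circ> ?\<tau>) + \<beta>) * dmoment (\<alpha> \<circ> ?\<tau>))"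
        by (rule sum.reindex_bij_witness[where i = "\<lambda>\<alpha>. \<alpha> \<circ> ?\<tau>" and j = "\<lambda>\<alpha>. \<alpha> \<circ> ?\<tau>"]) (simp_all add: inv deg)
      also have "\<dots> = - ?s" unfolding neg by (rule sum_negf)
      finally show ?thesis by simp
    next
      case inj
      have "card (range \<beta>) = CARD('n)" by (rule card_image) fact
      moreover have "(card (range \<beta>))\<^sup>2 \<le> \<Sum>(range \<beta>)" using inj(1) by (intro sum_odd_ge) auto
      moreover have "\<Sum>(range \<beta>) = expo_deg \<beta>" by (simp add: expo_deg_def sum.reindex[OF inj(2)])
      ultimately have ge: "(CARD('n))\<^sup>2 \<le> expo_deg \<beta>" by simp
      show ?thesis
      proof (intro sum.neutral ballI)
        fix \<alpha> :: "'n \<Rightarrow> nat" assume "\<alpha> \<in> {\<alpha>. expo_deg \<alpha> = m}"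
        then have "expo_deg (\<alpha> + \<beta>) \<noteq> (CARD('n))\<^sup>2" using ge m by (simp add: expo_deg_add)
        then have "\<phi> (\<alpha> + \<beta>) = 0" using Delta_coeffs_deg[OF assms(2)] by blast
        then show "\<phi> (\<alpha> + \<beta>) * dmoment \<alpha> = 0" by simp
      qed
    qed
  qed
qed

section \<open>Independence, spanning and the dimension count\<close>

lemma independent_family:
  fixes f :: "'i \<Rightarrow> 'v::real_vector"
  assumes "finite I" and indep: "\<And>a i. (\<Sum>i\<in>I. a i *\<^sub>R f i) = 0 \<Longrightarrow> i \<in> I \<Longrightarrow> a i = 0"
  shows "inj_on f I" "independent (f ` I)"
proof -
  show inj: "inj_on f I"
  proof (rule inj_onI, rule ccontr)
    fix i j assume ij: "i \<in> I" "j \<in> I" "f i = f j" "i \<noteq> j"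
    define a :: "'i \<Rightarrow> real" where "a = (\<lambda>l. if l = i then 1 else if l = j then - 1 else 0)"
    have "(\<Sum>l\<in>I. a l *\<^sub>R f l) = (\<Sum>l\<in>{i, j}. a l *\<^sub>R f l)"
      using assms(1) ij by (intro sum.mono_neutral_right) (auto simp: a_def)
    also have "\<dots> = 0" using ij by (simp add: a_def)
    finally have "a i = 0" using ij(1) by (rule indep)
    then show False by (simp add: a_def)
  qed
  show "independent (f ` I)"
  proof (rule real_vector.independent_if_scalars_zero)
    fix g x assume g: "(\<Sum>x\<in>f ` I. g x *\<^sub>R x) = 0" and "x \<in> f ` I"
    then obtain i where i: "i \<in> I" "x = f i" by blast
    have "(\<Sum>i\<in>I. g (f i) *\<^sub>R f i) = 0" using g by (simp add: sum.reindex[OF inj])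
    then show "g x = 0" using indep[of "\<lambda>i. g (f i)" i] i by simp
  qed (use assms(1) in simp)
qed

text \<open>A dimension count valid inside function spaces of infinite dimension: a vector of
  \<open>W\<close> outside \<open>span B\<close> would give \<open>card B + 1\<close> independent
  images in the span of \<open>E\<close>.\<close>

lemma subspace_subset_span:
  fixes R :: "'v::real_vector \<Rightarrow> 'w::real_vector"
  assumes W: "subspace W" and R: "linear R" "inj_on R W" and E: "R ` W \<subseteq> span E" "finite E"
    and B: "B \<subseteq> W" "independent B" "finite B" "card E \<le> card B"
  shows "W \<subseteq> span B"
proof (rule subsetI, rule ccontr)
  fix w assume w: "w \<in> W" "w \<notin> span B"
  let ?C = "insert w B"
  have C: "independent ?C" using w(2) B(2) by (rule real_vector.independent_insertI)
  have sub: "?C \<subseteq> W" using w B by simp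
  have "span ?C \<subseteq> W" using sub W by (rule span_minimal)
  then have inj: "inj_on R (span ?C)" using R(2) inj_on_subset by blast
  then have "independent (R ` ?C)" using R(1) C linear_independent_injective_image by blast
  moreover have "R ` ?C \<subseteq> span E" using E(1) sub by blast
  ultimately have "card (R ` ?C) \<le> card E" using real_vector.independent_span_bound[OF E(2)] by blast
  moreover have "card (R ` ?C) = card ?C"
    by (rule card_image, rule inj_on_subset[OF R(2) sub])
  moreover have "w \<notin> B" using w(2) span_superset by blast
  ultimately show False using B(3,4) by simp
qed

lemma card_expo_le: "card {\<alpha>. \<forall>i. \<alpha> i \<le> \<gamma> i} = (\<Prod>i\<in>UNIV. \<gamma> i + 1)"
  for \<gamma> :: "'n::finite \<Rightarrow> nat"
proof -
  have "{\<alpha>. \<forall>i. \<alpha> i \<le> \<gamma> i} = PiE UNIV (\<lambda>i. {..\<gamma> i})" by (auto simp: PiE_def Pi_def)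
  then show ?thesis by (simp add: card_PiE)
qed

lemma prod_even_fact: "(\<Prod>j<n. 2 * Suc j) = 2 ^ n * fact n"
  by (induction n) (auto simp: algebra_simps)

text \<open>Adding 1 to the exponents 1, 3, 5, ... and multiplying gives 2 * 4 * 6 * ..., with one
  factor for each coordinate.\<close>

lemma Delta_coeffs_card:
  fixes \<phi> :: "('n::{finite,linorder} \<Rightarrow> nat) \<Rightarrow> real"
  assumes "Delta_coeffs \<phi>" "\<phi> \<beta> \<noteq> 0"
  shows "card {\<alpha>. \<forall>i. \<alpha> i \<le> \<beta> i} = 2 ^ CARD('n) * fact CARD('n)"
proof -
  have "card {\<alpha>. \<forall>i. \<alpha> i \<le> \<beta> i} = (\<Prod>b\<in>range \<beta>. b + 1)"
    unfolding card_expo_le using prod.reindex[OF Delta_coeffs_inj[OF assms], of "\<lambda>b. b + 1"] by simp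
  also have "\<dots> = (\<Prod>j<CARD('n). 2 * Suc j)"
    unfolding Delta_coeffs_range[OF assms] by (subst prod.reindex) (auto simp: inj_on_def)
  finally show ?thesis by (simp only: prod_even_fact)
qed

text \<open>Independence is read off at the term of least weight \<open>\<Sum>i. \<alpha> i * \<beta> i\<close>: all exponents of the alternating
  polynomial are rearrangements of \<open>\<beta>\<close>, so \<open>\<beta>\<close> itself is the unique one of maximal weight.\<close>
lemma Delta_shifts_independent:
  fixes \<phi> :: "('n::{finite,linorder} \<Rightarrow> nat) \<Rightarrow> real"
  assumes D: "Delta_coeffs \<phi>" and \<beta>: "\<phi> \<beta> \<noteq> 0"
    and sum0: "(\<Sum>\<alpha> | \<forall>i. \<alpha> i \<le> \<beta> i. a \<alpha> *\<^sub>R (\<lambda>\<gamma>. \<phi> (\<gamma> + \<alpha>))) = 0"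
    and \<alpha>0: "\<alpha>0 \<in> {\<alpha>. \<forall>i. \<alpha> i \<le> \<beta> i}"
  shows "a \<alpha>0 = 0"
proof (rule ccontr)
  assume "a \<alpha>0 \<noteq> 0"
  define I where "I = {\<alpha>. \<forall>i. \<alpha> i \<le> \<beta> i}"
  define w where "w = (\<lambda>\<alpha> :: 'n \<Rightarrow> nat. \<Sum>i\<in>UNIV. int (\<alpha> i) * int (\<beta> i))"
  have finI: "finite I" unfolding I_def by (rule finite_expo_le)
  let ?J = "{\<alpha> \<in> I. a \<alpha> \<noteq> 0}"
  have "finite ?J" "?J \<noteq> {}" using finI \<alpha>0 \<open>a \<alpha>0 \<noteq> 0\<close> by (auto simp: I_def)
  then obtain \<alpha> where \<alpha>: "\<alpha> \<in> ?J" and min: "\<And>\<alpha>'. \<alpha>' \<in> ?J \<Longrightarrow> w \<alpha> \<le> w \<alpha>'"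
    using ex_min_if_finite[of "w ` ?J"] by (auto simp: not_less image_iff)
  have sq: "(\<Sum>i\<in>UNIV. (int (\<gamma> i))\<^sup>2) = (\<Sum>i\<in>UNIV. (int (\<beta> i))\<^sup>2)" if "\<phi> \<gamma> \<noteq> 0" for \<gamma>
  proof -
    have "(\<Sum>i\<in>UNIV. (int (\<gamma> i))\<^sup>2) = (\<Sum>b\<in>range \<gamma>. (int b)\<^sup>2)" if "inj \<gamma>" for \<gamma> :: "'n \<Rightarrow> nat"
      using that by (simp add: sum.reindex)
    note this[OF Delta_coeffs_inj[OF D \<open>\<phi> \<gamma> \<noteq> 0\<close>]] this[OF Delta_coeffs_inj[OF D \<beta>]]
    then show ?thesis
      unfolding Delta_coeffs_range[OF D \<open>\<phi> \<gamma> \<noteq> 0\<close>] Delta_coeffs_range[OF D \<beta>] by simp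
  qed
  \<comment> \<open>Rearrangements have equal sums of squares, so the squared distance from \<gamma>
    to \<beta> equals 2 (w \<beta> - w \<gamma>).\<close>
  have max: "w \<gamma> < w \<beta>" if "\<phi> \<gamma> \<noteq> 0" "\<gamma> \<noteq> \<beta>" for \<gamma>
  proof -
    obtain i where i: "\<gamma> i \<noteq> \<beta> i" using \<open>\<gamma> \<noteq> \<beta>\<close> by blast
    have "0 < (\<Sum>i\<in>UNIV. (int (\<gamma> i) - int (\<beta> i))\<^sup>2)"
      using i by (intro sum_pos2[of _ i]) auto
    also have "\<dots> = (\<Sum>i\<in>UNIV. (int (\<gamma> i))\<^sup>2) + (\<Sum>i\<in>UNIV. (int (\<beta> i))\<^sup>2) - 2 * w \<gamma>"
      unfolding w_def by (simp add: power2_diff sum.distrib sum_subtractf sum_distrib_left mult.assoc)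
    also have "\<dots> = 2 * (w \<beta> - w \<gamma>)"
      unfolding sq[OF \<open>\<phi> \<gamma> \<noteq> 0\<close>] by (simp add: w_def power2_eq_square)
    finally show ?thesis by simp
  qed
  have \<alpha>le: "\<alpha> i \<le> \<beta> i" for i using \<alpha> by (simp add: I_def)
  \<comment> \<open>The relation will be evaluated at \<beta> - \<alpha>. The shift by \<gamma> then
    meets an exponent of weight w \<beta> - w \<alpha> + w \<gamma>, which is at least w \<beta> by
    the choice of \<alpha>; only \<beta> itself has such a weight with nonzero coefficient.\<close>
  have other: "a \<gamma> * \<phi> (\<beta> - \<alpha> + \<gamma>) = 0" if "\<gamma> \<in> I" "\<gamma> \<noteq> \<alpha>" for \<gamma>
  proof (rule ccontr)
    assume nz: "a \<gamma> * \<phi> (\<beta> - \<alpha> + \<gamma>) \<noteq> 0"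
    have "\<beta> - \<alpha> + \<gamma> \<noteq> \<beta>"
    proof
      assume "\<beta> - \<alpha> + \<gamma> = \<beta>"
      then have "\<beta> i - \<alpha> i + \<gamma> i = \<beta> i" for i by (metis minus_apply plus_fun_apply)
      then have "\<gamma> i = \<alpha> i" for i using \<alpha>le[of i] by (metis add.commute le_add_diff_inverse2 add_left_cancel)
      then show False using \<open>\<gamma> \<noteq> \<alpha>\<close> by blast
    qed
    then have "w (\<beta> - \<alpha> + \<gamma>) < w \<beta>" using nz by (intro max) auto
    moreover have "w (\<beta> - \<alpha> + \<gamma>) = w \<beta> - w \<alpha> + w \<gamma>"
    proof -
      have "int ((\<beta> - \<alpha> + \<gamma>) i) = int (\<beta> i) - int (\<alpha> i) + int (\<gamma> i)" for i
        using \<alpha>le[of i] by simp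
      then show ?thesis
        unfolding w_def by (simp only: left_diff_distrib distrib_right sum.distrib sum_subtractf)
    qed
    ultimately have "w \<gamma> < w \<alpha>" by simp
    moreover have "\<gamma> \<in> ?J" using nz that(1) by simp
    ultimately show False using min[of \<gamma>] by simp
  qed
  have "0 = (\<Sum>\<gamma>\<in>I. a \<gamma> *\<^sub>R (\<lambda>\<delta>. \<phi> (\<delta> + \<gamma>))) (\<beta> - \<alpha>)"
    using sum0 by (simp add: I_def)
  also have "\<dots> = (\<Sum>\<gamma>\<in>I. a \<gamma> * \<phi> (\<beta> - \<alpha> + \<gamma>))"
    by (simp add: sum_fun_apply scaleR_fun_def)
  also have "\<dots> = (\<Sum>\<gamma>\<in>{\<alpha>}. a \<gamma> * \<phi> (\<beta> - \<alpha> + \<gamma>))"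
    using finI \<alpha> other by (intro sum.mono_neutral_right) auto
  also have "\<dots> = a \<alpha> * \<phi> \<beta>"
  proof -
    have "\<beta> - \<alpha> + \<alpha> = \<beta>" using \<alpha>le by (simp add: fun_eq_iff)
    then show ?thesis by simp
  qed
  finally show False using \<alpha> \<beta> by simp
qed

text \<open>In divided-power coordinates the derivative of order \<alpha> is the shift by
  \<alpha>.\<close>

lemma expo_deg_shift_mem:
  fixes \<phi> :: "('n::finite \<Rightarrow> nat) \<Rightarrow> real"
  assumes "supp_in d \<phi>"
  shows "pf d (\<lambda>\<beta>. \<phi> (\<beta> + \<alpha>)) \<in> iterated_partials (pf d \<phi>)"
proof -
  have "expo_deg \<alpha> = n \<Longrightarrow> pf d (\<lambda>\<beta>. \<phi> (\<beta> + \<alpha>)) \<in> iterated_partials (pf d \<phi>)" for n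
  proof (induction n arbitrary: \<alpha>)
    case 0
    then have "\<alpha> = 0" by (simp add: expo_deg_0)
    then show ?case by (simp add: iterated_partials.base)
  next
    case (Suc n)
    obtain i \<beta> where \<beta>: "\<alpha> = expo_inc i \<beta>" "expo_deg \<beta> = n"
      using Suc.prems by (rule expo_deg_cases)
    have "supp_in d (\<lambda>\<gamma>. \<phi> (\<gamma> + \<beta>))"
      unfolding supp_in_def using assms expo_box_addD unfolding supp_in_def by blast
    then have pd: "partial_deriv i (pf d (\<lambda>\<gamma>. \<phi> (\<gamma> + \<beta>))) = pf d (\<lambda>\<gamma>. \<phi> (expo_inc i \<gamma> + \<beta>))"
      by (rule partial_deriv_pf)
    have inc: "expo_inc i \<gamma> + \<beta> = \<gamma> + \<alpha>" for \<gamma>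
      by (simp add: \<beta>(1) fun_eq_iff expo_inc_def)
    from iterated_partials.step[OF Suc.IH[OF \<beta>(2)], of i] show ?case unfolding pd inc .
  qed
  then show ?thesis by blast
qed

lemma linear_pf: "linear (pf d)"
  by (rule linearI) (auto simp: fun_eq_iff scaleR_fun_def pf_add pf_scale plus_fun_def)

lemma less_imp_le_pred: "a < b \<Longrightarrow> a \<le> b - (1 :: nat)"
  by arith

text \<open>From below, the shifts of the family of \<open>Delta\<close> by all \<alpha> \<le>
  \<beta>, for one exponent \<beta> of \<open>Delta\<close>, are independent harmonic families. From
  above, restriction to the staircase is injective on harmonic families. Both sets of exponents have
  the same size, so the shifts span, and the injective map \<open>pf N\<close> carries this over to
  functions.\<close>

theorem mean_value_functions_eq_span:
  fixes \<nu> :: "(real ^ 'n::{finite,linorder}) measure"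
  assumes "cube_measure \<nu> k" and poly: "mean_value_functions \<nu> \<subseteq> polyfun"
  shows "mean_value_functions \<nu> = span (iterated_partials Delta)"
    and "dim (mean_value_functions \<nu>) = 2 ^ CARD('n) * fact CARD('n)"
proof -
  interpret cube_measure \<nu> k by fact
  \<comment> \<open>Every harmonic family is supported in the box of this size, so that one map
    \<open>pf N\<close> represents all functions at once.\<close>
  define N where "N = 2 * CARD('n)"
  define W where "W = {\<phi>. harmonic_coeffs \<phi>}"
  have W: "subspace W" unfolding W_def by (rule subspace_harmonic_coeffs)
  have supp: "supp_in N \<psi>" if "\<psi> \<in> W" for \<psi>
    using that unfolding W_def N_def by (auto intro: harmonic_coeffs_supp)
  have MV: "mean_value_functions \<nu> = pf N ` W"
  proof
    show "mean_value_functions \<nu> \<subseteq> pf N ` W"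
    proof
      fix f assume f: "f \<in> mean_value_functions \<nu>"
      then have "f \<in> polyfun" using poly by blast
      then obtain d \<psi> where d: "supp_in d \<psi>" "f = pf d \<psi>" unfolding polyfun_def by blast
      then have \<psi>: "\<psi> \<in> W" using f pf_mean_value_iff[OF d(1)] by (simp add: W_def)
      have "pf N \<psi> = pf (max N d) \<psi>" by (rule pf_mono[symmetric, OF supp[OF \<psi>]]) simp
      also have "\<dots> = pf d \<psi>" by (rule pf_mono[OF d(1)]) simp
      finally have "f = pf N \<psi>" using d(2) by simp
      then show "f \<in> pf N ` W" using \<psi> by (rule image_eqI)
    qed
    show "pf N ` W \<subseteq> mean_value_functions \<nu>"
      using pf_mean_value_iff supp unfolding W_def by blast
  qed
  obtain \<phi> :: "('n \<Rightarrow> nat) \<Rightarrow> real" where D: "Delta_coeffs \<phi>" using Delta_coeffs_exist by blast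
  have \<phi>W: "\<phi> \<in> W" unfolding W_def using Delta_harmonic[OF assms(1) D] by simp
  have Delta: "Delta = pf N \<phi>"
  proof -
    obtain d where d: "supp_in d \<phi>" "Delta = pf d \<phi>" using D unfolding Delta_coeffs_def by blast
    have "pf N \<phi> = pf (max N d) \<phi>" by (rule pf_mono[symmetric, OF supp[OF \<phi>W]]) simp
    also have "\<dots> = pf d \<phi>" by (rule pf_mono[OF d(1)]) simp
    finally show ?thesis using d(2) by simp
  qed
  obtain \<beta> where \<beta>: "\<phi> \<beta> \<noteq> 0"
  proof (rule ccontr)
    assume "\<not> thesis"
    then have "\<phi> \<beta> = 0" for \<beta> using that by blast
    then have "Delta x = 0" for x :: "(real, 'n) vec" unfolding Delta pf_def by simp
    then show False using Delta_nonzero by blast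
  qed
  define I where "I = {\<alpha>. \<forall>i. \<alpha> i \<le> \<beta> i}"
  define B where "B = (\<lambda>\<alpha> \<gamma>. \<phi> (\<gamma> + \<alpha>)) ` I"
  have finI: "finite I" unfolding I_def by (rule finite_expo_le)
  have injB: "inj_on (\<lambda>\<alpha> \<gamma>. \<phi> (\<gamma> + \<alpha>)) I" and indB: "independent B"
    unfolding B_def using independent_family[OF finI, of "\<lambda>\<alpha> \<gamma>. \<phi> (\<gamma> + \<alpha>)"]
      Delta_shifts_independent[OF D \<beta>] unfolding I_def by blast+
  have cardB: "card B = 2 ^ CARD('n) * fact CARD('n)"
    unfolding B_def card_image[OF injB] unfolding I_def by (rule Delta_coeffs_card[OF D \<beta>])
  have BW: "B \<subseteq> W"
    unfolding B_def W_def using \<phi>W harmonic_coeffs_shift unfolding W_def by blast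
  obtain \<rho> :: "'n \<Rightarrow> nat" where \<rho>: "bij_betw \<rho> UNIV {..<CARD('n)}"
    using ex_bij_betw_finite_nat[of "UNIV :: 'n set"] by (auto simp: atLeast0LessThan)
  \<comment> \<open>The strict bounds of the staircase are written with \<le> to match
    \<open>card_expo_le\<close>; since \<open>\<rho> i < CARD('n)\<close>, subtracting 1 is exact on
    the naturals.\<close>
  define box where "box = {\<alpha> :: 'n \<Rightarrow> nat. \<forall>i. \<alpha> i \<le> 2 * (CARD('n) - \<rho> i) - 1}"
  define R where "R = (\<lambda>(\<psi> :: ('n \<Rightarrow> nat) \<Rightarrow> real) \<alpha>. if \<alpha> \<in> box then \<psi> \<alpha> else 0)"
  define E where "E = (\<lambda>\<alpha> \<gamma>. if \<gamma> = \<alpha> then 1 else 0 :: real) ` box"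
  have \<rho>lt: "\<rho> i < CARD('n)" for i using \<rho> unfolding bij_betw_def by auto
  have finbox: "finite box" unfolding box_def by (rule finite_expo_le)
  have cardbox: "card box = 2 ^ CARD('n) * fact CARD('n)"
  proof -
    have "card box = (\<Prod>i\<in>UNIV. 2 * (CARD('n) - \<rho> i) - 1 + 1)"
      unfolding box_def by (rule card_expo_le)
    also have "\<dots> = (\<Prod>i\<in>UNIV. 2 * (CARD('n) - \<rho> i))"
    proof (intro prod.cong refl)
      fix i show "2 * (CARD('n) - \<rho> i) - 1 + 1 = 2 * (CARD('n) - \<rho> i)" using \<rho>lt[of i] by simp
    qed
    also have "\<dots> = (\<Prod>j<CARD('n). 2 * (CARD('n) - j))"
      by (rule prod.reindex_bij_betw[OF \<rho>])
    also have "\<dots> = (\<Prod>j<CARD('n). 2 * Suc j)"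
      by (rule prod.reindex_bij_witness[where i = "\<lambda>j. CARD('n) - Suc j" and j = "\<lambda>j. CARD('n) - Suc j"]) auto
    finally show ?thesis by (simp only: prod_even_fact)
  qed
  have "W \<subseteq> span B"
  proof (rule subspace_subset_span[OF W])
    show R: "linear R"
      by (rule linearI) (auto simp: R_def fun_eq_iff scaleR_fun_def)
    show "inj_on R W"
      unfolding linear_inj_on_iff_eq_0[OF R W]
    proof (intro ballI impI)
      fix \<psi> assume \<psi>: "\<psi> \<in> W" "R \<psi> = 0"
      have "\<psi> \<alpha> = 0" for \<alpha>
      proof (rule harmonic_coeffs_determined[OF _ \<rho>])
        show "harmonic_coeffs \<psi>" using \<psi>(1) by (simp add: W_def)
        fix \<alpha> assume "\<And>i. \<alpha> i < 2 * (CARD('n) - \<rho> i)"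
        then have "\<alpha> i \<le> 2 * (CARD('n) - \<rho> i) - 1" for i by (rule less_imp_le_pred)
        then have "\<alpha> \<in> box" by (simp add: box_def)
        then show "\<psi> \<alpha> = 0" using fun_cong[OF \<psi>(2), of \<alpha>] by (simp add: R_def)
      qed
      then show "\<psi> = 0" by (simp add: fun_eq_iff)
    qed
    show "R ` W \<subseteq> span E"
    proof
      fix \<omega> assume "\<omega> \<in> R ` W"
      then obtain \<psi> where \<omega>: "\<omega> = R \<psi>" by blast
      have "\<omega> = (\<Sum>\<alpha>\<in>box. \<psi> \<alpha> *\<^sub>R (\<lambda>\<gamma>. if \<gamma> = \<alpha> then 1 else 0))"
      proof
        fix \<delta>
        have "(\<Sum>\<alpha>\<in>box. \<psi> \<alpha> *\<^sub>R (\<lambda>\<gamma>. if \<gamma> = \<alpha> then 1 else 0)) \<delta> = (\<Sum>\<alpha>\<in>box. if \<alpha> = \<delta> then \<psi> \<alpha> else 0)"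
          unfolding sum_fun_apply scaleR_fun_def by (intro sum.cong) auto
        then show "\<omega> \<delta> = (\<Sum>\<alpha>\<in>box. \<psi> \<alpha> *\<^sub>R (\<lambda>\<gamma>. if \<gamma> = \<alpha> then 1 else 0)) \<delta>"
          using finbox by (simp add: \<omega> R_def)
      qed
      also have "\<dots> \<in> span E"
        unfolding E_def by (intro span_sum span_scale span_base imageI)
      finally show "\<omega> \<in> span E" .
    qed
    show "finite E" unfolding E_def using finbox by simp
    show "finite B" unfolding B_def using finI by simp
    have "card E \<le> card box" unfolding E_def using finbox by (rule card_image_le)
    then show "card E \<le> card B" by (simp add: cardbox cardB)
  qed (fact BW indB)+
  moreover have "span B \<subseteq> W" using BW W by (rule span_minimal)
  ultimately have WB: "W = span B" by blast
  have injpf: "inj_on (pf N) (span B)"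
    unfolding WB[symmetric] using pf_inject supp by (intro inj_onI) blast
  have MVB: "mean_value_functions \<nu> = span (pf N ` B)"
    unfolding MV WB by (rule linear_span_image[OF linear_pf, symmetric])
  have BI: "pf N ` B \<subseteq> iterated_partials Delta"
    unfolding B_def Delta using expo_deg_shift_mem[OF supp[OF \<phi>W]] by blast
  have IM: "iterated_partials Delta \<subseteq> mean_value_functions \<nu>"
  proof
    fix f :: "(real, 'n) vec \<Rightarrow> real" assume "f \<in> iterated_partials Delta"
    then show "f \<in> mean_value_functions \<nu>"
    proof induction
      case base
      show ?case unfolding MV Delta using \<phi>W by blast
    next
      case (step g i)
      then obtain \<psi> where \<psi>: "\<psi> \<in> W" "g = pf N \<psi>" unfolding MV by blast
      have "(\<lambda>\<gamma>. \<psi> (\<gamma> + expo_inc i 0)) \<in> W" using \<psi>(1) harmonic_coeffs_shift unfolding W_def by blast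
      moreover have "\<gamma> + expo_inc i 0 = expo_inc i \<gamma>" for \<gamma> by (auto simp: expo_inc_def fun_eq_iff)
      ultimately have "(\<lambda>\<gamma>. \<psi> (expo_inc i \<gamma>)) \<in> W" by simp
      then show ?case unfolding MV \<psi>(2) partial_deriv_pf[OF supp[OF \<psi>(1)]] by blast
    qed
  qed
  have "subspace (mean_value_functions \<nu>)" unfolding MVB by (rule subspace_span)
  then have "span (iterated_partials Delta) \<subseteq> mean_value_functions \<nu>" by (rule span_minimal[OF IM])
  moreover have "mean_value_functions \<nu> \<subseteq> span (iterated_partials Delta)"
    unfolding MVB by (rule span_mono[OF BI])
  ultimately show "mean_value_functions \<nu> = span (iterated_partials Delta)" by blast
  have ind: "independent (pf N ` B)"
    by (rule linear_independent_injective_image[OF linear_pf indB injpf])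
  have "inj_on (pf N) B" using injpf span_superset inj_on_subset by blast
  then have "card (pf N ` B) = card B" by (rule card_image)
  then show "dim (mean_value_functions \<nu>) = 2 ^ CARD('n) * fact CARD('n)"
    using real_vector.dim_eq_card[OF _ ind, of "mean_value_functions \<nu>"] unfolding MVB span_span cardB by simp
qed

subsection \<open>Finite differences\<close>

definition fd :: "real \<Rightarrow> (real \<Rightarrow> real) \<Rightarrow> real \<Rightarrow> real" where
  "fd s h x = h (x + s) - h x"

lemma fd_pow_Suc: "(fd s ^^ Suc n) h x = (fd s ^^ n) h (x + s) - (fd s ^^ n) h x"
  by (simp add: fd_def)

lemma fd_pow_bound:
  assumes "\<And>j. j \<le> n \<Longrightarrow> \<bar>h (x + real j * s)\<bar> \<le> B"
  shows "\<bar>(fd s ^^ n) h x\<bar> \<le> 2 ^ n * B"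
  using assms
proof (induction n arbitrary: x)
  case 0
  from 0[of 0] show ?case by simp
next
  case (Suc n)
  have "\<bar>(fd s ^^ n) h (x + s)\<bar> \<le> 2 ^ n * B"
  proof (rule Suc.IH)
    fix j assume "j \<le> n"
    then show "\<bar>h (x + s + real j * s)\<bar> \<le> B" using Suc.prems[of "Suc j"] by (simp add: algebra_simps)
  qed
  moreover have "\<bar>(fd s ^^ n) h x\<bar> \<le> 2 ^ n * B" using Suc.prems by (intro Suc.IH) simp
  ultimately show ?case unfolding fd_pow_Suc power_Suc by linarith
qed

lemma fd_pow_diff: "(fd s ^^ n) (\<lambda>x. f x - g x) x = (fd s ^^ n) f x - (fd s ^^ n) g x"
  by (induction n arbitrary: x) (simp_all add: fd_def)

lemma fd_pow_shift: "(fd s ^^ n) (\<lambda>x. f (c + x)) x = (fd s ^^ n) f (c + x)"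
  by (induction n arbitrary: x) (simp_all add: fd_def add.assoc)

lemma fd_pow_0: "(fd s ^^ n) (\<lambda>_. 0) x = 0"
  by (induction n arbitrary: x) (simp_all add: fd_def)

lemma fd_pow_poly:
  assumes "degree p < n"
  shows "(fd s ^^ n) (poly p) x = 0"
  using assms
proof (induction n arbitrary: p)
  case (Suc n)
  define q where "q = pcompose p [:s, 1:] - p"
  have fd: "fd s (poly p) = poly q"
    by (simp add: fd_def q_def poly_pcompose fun_eq_iff add.commute)
  show ?case
  proof (cases "degree p = 0")
    case True
    then obtain c where "p = [:c:]" by (rule degree_eq_zeroE)
    then have "fd s (poly p) = (\<lambda>_. 0)" by (simp add: fd_def fun_eq_iff)
    then show ?thesis unfolding funpow_Suc_right comp_def by (simp add: fd_pow_0)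
  next
    case False
    have "coeff q (degree p) = 0"
    proof -
      have "lead_coeff (pcompose p [:s, 1:]) = lead_coeff p" by (subst lead_coeff_comp) auto
      then show ?thesis by (simp add: q_def degree_pcompose)
    qed
    moreover have "degree q \<le> degree p"
      unfolding q_def by (rule order_trans[OF degree_diff_le_max]) (simp add: degree_pcompose)
    ultimately have "degree q < degree p"
      using False by (metis degree_0 leading_coeff_0_iff le_neq_implies_less neq0_conv)
    then have "degree q < n" using Suc.prems by simp
    then have "(fd s ^^ n) (poly q) x = 0" by (rule Suc.IH)
    then show ?thesis unfolding funpow_Suc_right comp_def fd .
  qed
qed simp

text \<open>A step of length 2s is two steps of length s: \<open>fd (2 * s)\<close> is
  \<open>fd s\<close> followed by E, the identity plus translation by s, and the two commute. Each
  application of E at most doubles the bound.\<close>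

lemma fd_pow_double_bound:
  assumes "\<And>j. j \<le> n \<Longrightarrow> \<bar>(fd s ^^ n) h (x + real j * s)\<bar> \<le> B"
  shows "\<bar>(fd (2 * s) ^^ n) h x\<bar> \<le> 2 ^ n * B"
proof -
  define E where "E = (\<lambda>(h :: real \<Rightarrow> real) x. h x + h (x + s))"
  have fdE: "fd (2 * s) h = E (fd s h)" for h
    by (simp add: fd_def E_def fun_eq_iff algebra_simps)
  have comm: "fd s (E h) = E (fd s h)" for h
    by (simp add: fd_def E_def fun_eq_iff)
  have commn: "fd s ((E ^^ m) h) = (E ^^ m) (fd s h)" for m h
    by (induction m) (simp_all add: comm)
  have pow: "(fd (2 * s) ^^ m) h = (E ^^ m) ((fd s ^^ m) h)" for m
    by (induction m) (simp_all add: fdE commn)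
  have "\<bar>(E ^^ m) g x\<bar> \<le> 2 ^ m * B" if "\<And>j. j \<le> m \<Longrightarrow> \<bar>g (x + real j * s)\<bar> \<le> B" for m g x
    using that
  proof (induction m arbitrary: x)
    case 0
    from 0[of 0] show ?case by simp
  next
    case (Suc m)
    have "\<bar>(E ^^ m) g (x + s)\<bar> \<le> 2 ^ m * B"
    proof (rule Suc.IH)
      fix j assume "j \<le> m"
      then show "\<bar>g (x + s + real j * s)\<bar> \<le> B" using Suc.prems[of "Suc j"] by (simp add: algebra_simps)
    qed
    moreover have "\<bar>(E ^^ m) g x\<bar> \<le> 2 ^ m * B" using Suc.prems by (intro Suc.IH) simp
    ultimately show ?case by (simp add: E_def)
  qed
  from this[where m = n and g = "(fd s ^^ n) h" and x = x, OF assms] show ?thesis unfolding pow .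
qed

text \<open>Repeated doubling costs a factor 2^n per level, and all the points at which differences
  are taken stay between x and x + n s.\<close>

lemma fd_pow_halving_bound:
  assumes "s > 0" "\<And>x'. x \<le> x' \<Longrightarrow> x' \<le> x + real n * s \<Longrightarrow> \<bar>(fd (s / 2 ^ j) ^^ n) h x'\<bar> \<le> B"
  shows "\<bar>(fd s ^^ n) h x\<bar> \<le> 2 ^ (j * n) * B"
  using assms
proof (induction j arbitrary: x s)
  case 0
  then show ?case by simp
next
  case (Suc j)
  have "\<bar>(fd (s / 2) ^^ n) h (x + real l * (s / 2))\<bar> \<le> 2 ^ (j * n) * B" if l: "l \<le> n" for l
  proof (rule Suc.IH)
    fix x' assume x': "x + real l * (s / 2) \<le> x'" "x' \<le> x + real l * (s / 2) + real n * (s / 2)"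
    have "0 \<le> real l * (s / 2)" "real l * (s / 2) \<le> real n * (s / 2)"
      using Suc.prems(1) l by (simp_all add: mult_right_mono)
    moreover have "real n * s = real n * (s / 2) + real n * (s / 2)" by simp
    ultimately have "x \<le> x'" "x' \<le> x + real n * s" using x' by linarith+
    then have "\<bar>(fd (s / 2 ^ Suc j) ^^ n) h x'\<bar> \<le> B" by (rule Suc.prems(2))
    then show "\<bar>(fd (s / 2 / 2 ^ j) ^^ n) h x'\<bar> \<le> B" by simp
  qed (use Suc.prems(1) in simp)
  then have "\<bar>(fd (2 * (s / 2)) ^^ n) h x\<bar> \<le> 2 ^ n * (2 ^ (j * n) * B)" by (rule fd_pow_double_bound)
  then show ?case by (simp add: power_add)
qed

text \<open>At step s / 2^j the n-th difference ignores the local polynomial, hence is of order (s /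
  2^j)^(n + 1). Returning to step s costs 2^(j n), which leaves a bound of order 2^(-j). The error
  exponent exceeds the order of the difference by one to make this tend to 0.\<close>

lemma fd_pow_eq_0_if_local:
  fixes h :: "real \<Rightarrow> real"
  assumes s: "s > 0"
    and loc: "\<And>x'. x \<le> x' \<Longrightarrow> x' \<le> x + real n * s \<Longrightarrow>
       \<exists>p. degree p < n \<and> (\<forall>t. \<bar>t\<bar> \<le> 1 \<longrightarrow> \<bar>h (x' + t) - poly p t\<bar> \<le> C * \<bar>t\<bar> ^ (n + 1))"
  shows "(fd s ^^ n) h x = 0"
proof -
  have C: "C \<ge> 0"
  proof -
    obtain p where "\<forall>t. \<bar>t\<bar> \<le> 1 \<longrightarrow> \<bar>h (x + t) - poly p t\<bar> \<le> C * \<bar>t\<bar> ^ (n + 1)"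
      using loc[of x] s by auto
    from spec[OF this, of 1] show ?thesis by simp
  qed
  have bound: "\<bar>(fd s ^^ n) h x\<bar> \<le> 2 ^ n * (C * (real n * s) ^ (n + 1)) * (1 / 2) ^ j" if j: "real n * s \<le> 2 ^ j" for j
  proof -
    let ?e = "s / 2 ^ j"
    have e: "?e > 0" "real n * ?e \<le> 1" using s j by (simp_all add: divide_simps)
    have "\<bar>(fd s ^^ n) h x\<bar> \<le> 2 ^ (j * n) * (2 ^ n * (C * (real n * ?e) ^ (n + 1)))"
    proof (rule fd_pow_halving_bound[OF s])
      fix x' assume x': "x \<le> x'" "x' \<le> x + real n * s"
      obtain p where p: "degree p < n" "\<And>t. \<bar>t\<bar> \<le> 1 \<Longrightarrow> \<bar>h (x' + t) - poly p t\<bar> \<le> C * \<bar>t\<bar> ^ (n + 1)"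
        using loc[OF x'] by auto
      have "(fd ?e ^^ n) h x' = (fd ?e ^^ n) (\<lambda>t. h (x' + t)) 0" by (simp add: fd_pow_shift)
      also have "\<dots> = (fd ?e ^^ n) (\<lambda>t. h (x' + t) - poly p t) 0"
        unfolding fd_pow_diff by (simp add: fd_pow_poly[OF p(1)])
      also have "\<bar>\<dots>\<bar> \<le> 2 ^ n * (C * (real n * ?e) ^ (n + 1))"
      proof (rule fd_pow_bound)
        fix i assume i: "i \<le> n"
        have t: "0 \<le> real i * ?e" "real i * ?e \<le> real n * ?e"
          using i less_imp_le[OF e(1)] by (intro mult_nonneg_nonneg mult_right_mono of_nat_mono of_nat_0_le_iff; simp)+
        have "\<bar>h (x' + real i * ?e) - poly p (real i * ?e)\<bar> \<le> C * \<bar>real i * ?e\<bar> ^ (n + 1)"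
          using t e(2) by (intro p(2)) linarith
        also have "\<dots> \<le> C * (real n * ?e) ^ (n + 1)"
          using t C by (intro mult_left_mono power_mono) simp_all
        finally show "\<bar>h (x' + (0 + real i * ?e)) - poly p (0 + real i * ?e)\<bar> \<le> C * (real n * ?e) ^ (n + 1)" by simp
      qed
      finally show "\<bar>(fd ?e ^^ n) h x'\<bar> \<le> 2 ^ n * (C * (real n * ?e) ^ (n + 1))" .
    qed
    also have "\<dots> = 2 ^ n * (C * (real n * s) ^ (n + 1)) * (2 ^ (j * n) / (2 ^ j) ^ (n + 1))"
      by (simp add: power_divide power_mult_distrib)
    also have "(2 ^ (j * n) / (2 ^ j) ^ (n + 1) :: real) = (1 / 2) ^ j"
      by (simp add: power_mult power_divide)
    finally show ?thesis .
  qed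
  have "(\<lambda>j. 2 ^ n * (C * (real n * s) ^ (n + 1)) * (1 / 2) ^ j) \<longlonglongrightarrow> 2 ^ n * (C * (real n * s) ^ (n + 1)) * 0"
    by (intro tendsto_mult_left LIMSEQ_realpow_zero) auto
  moreover have "eventually (\<lambda>j. \<bar>(fd s ^^ n) h x\<bar> \<le> 2 ^ n * (C * (real n * s) ^ (n + 1)) * (1 / 2) ^ j) sequentially"
  proof -
    obtain m :: nat where m: "real n * s < 2 ^ m" using real_arch_pow[of 2 "real n * s"] by auto
    have "real n * s \<le> 2 ^ j" if "j \<ge> m" for j
    proof -
      have "(2 :: real) ^ m \<le> 2 ^ j" using that by (intro power_increasing) auto
      then show ?thesis using m by linarith
    qed
    then show ?thesis using bound by (intro eventually_sequentiallyI[of m]) blast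
  qed
  ultimately have "\<bar>(fd s ^^ n) h x\<bar> \<le> 2 ^ n * (C * (real n * s) ^ (n + 1)) * 0"
    by (rule tendsto_lowerbound) simp
  then show ?thesis by simp
qed

section \<open>Newton interpolation and functions with vanishing differences\<close>

lemma fd_pow_explicit: "\<exists>c. \<forall>s h x. (fd s ^^ n) h x = (\<Sum>j\<le>n. c j * h (x + real j * s))"
proof (induction n)
  case 0
  show ?case by (rule exI[of _ "\<lambda>_. 1"]) simp
next
  case (Suc n)
  then obtain c where c: "\<And>s h x. (fd s ^^ n) h x = (\<Sum>j\<le>n. c j * h (x + real j * s))" by blast
  define c' where "c' = (\<lambda>j. (if j = 0 then 0 else c (j - 1)) - (if j \<le> n then c j else 0))"
  have "(fd s ^^ Suc n) h x = (\<Sum>j\<le>Suc n. c' j * h (x + real j * s))" for s h x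
  proof -
    have "(fd s ^^ n) h (x + s) = (\<Sum>j\<le>n. c j * h (x + real (Suc j) * s))"
      unfolding c by (intro sum.cong) (auto simp: algebra_simps)
    also have "\<dots> = (\<Sum>j\<le>Suc n. (if j = 0 then 0 else c (j - 1)) * h (x + real j * s))"
      by (subst sum.atMost_Suc_shift) (simp del: of_nat_Suc)
    finally have 1: "(fd s ^^ n) h (x + s) = (\<Sum>j\<le>Suc n. (if j = 0 then 0 else c (j - 1)) * h (x + real j * s))" .
    have 2: "(fd s ^^ n) h x = (\<Sum>j\<le>Suc n. (if j \<le> n then c j else 0) * h (x + real j * s))"
      unfolding c by simp
    have "(fd s ^^ Suc n) h x = (fd s ^^ n) h (x + s) - (fd s ^^ n) h x" by (simp add: fd_def)
    then show ?thesis unfolding 1 2 c'_def by (simp only: left_diff_distrib sum_subtractf)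
  qed
  then show ?case by blast
qed

lemma fd_newton: "h (x + real n * s) = (\<Sum>j\<le>n. real (n choose j) * (fd s ^^ j) h x)"
proof (induction n arbitrary: x)
  case (Suc n)
  have step: "(fd s ^^ j) h (x + s) = (fd s ^^ j) h x + (fd s ^^ Suc j) h x" for j
    by (simp add: fd_def)
  have "h (x + real (Suc n) * s) = h (x + s + real n * s)" by (simp add: algebra_simps)
  also have "\<dots> = (\<Sum>j\<le>n. real (n choose j) * (fd s ^^ j) h (x + s))" by (rule Suc.IH)
  also have "\<dots> = (\<Sum>j\<le>n. real (n choose j) * (fd s ^^ j) h x) + (\<Sum>j\<le>n. real (n choose j) * (fd s ^^ Suc j) h x)"
    unfolding step by (simp only: distrib_left sum.distrib)
  also have "(\<Sum>j\<le>n. real (n choose j) * (fd s ^^ j) h x) = h x + (\<Sum>j\<le>n. real (n choose Suc j) * (fd s ^^ Suc j) h x)"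
  proof -
    have "(\<Sum>j\<le>n. real (n choose j) * (fd s ^^ j) h x) = (\<Sum>j\<le>Suc n. real (n choose j) * (fd s ^^ j) h x)" by simp
    then show ?thesis by (simp only: sum.atMost_Suc_shift) simp
  qed
  also have "h x + (\<Sum>j\<le>n. real (n choose Suc j) * (fd s ^^ Suc j) h x) + (\<Sum>j\<le>n. real (n choose j) * (fd s ^^ Suc j) h x)
      = (\<Sum>j\<le>Suc n. real (Suc n choose j) * (fd s ^^ j) h x)"
    by (simp only: sum.atMost_Suc_shift binomial_Suc_Suc of_nat_add distrib_right sum.distrib) simp
  finally show ?case .
qed simp

definition newton_poly :: "nat \<Rightarrow> real poly" where
  "newton_poly j = smult (1 / fact j) (\<Prod>i<j. [:- real i, 1:])"

lemma poly_newton_poly: "poly (newton_poly j) (real n) = real (n choose j)"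
  by (simp add: newton_poly_def poly_prod binomial_gbinomial gbinomial_prod_rev atLeast0LessThan)

lemma poly_eq_if_nat:
  assumes "\<And>n. poly p (real n) = poly (q :: real poly) (real n)"
  shows "p = q"
proof -
  have "range real \<subseteq> {x. poly (p - q) x = 0}" using assms by auto
  moreover have "infinite (range real)" using infinite_UNIV_nat by (simp add: finite_image_iff inj_def)
  ultimately have "infinite {x. poly (p - q) x = 0}" using infinite_super by blast
  then have "p - q = 0" using poly_roots_finite by blast
  then show ?thesis by simp
qed

text \<open>Newton's forward formula at steps 1 and 1 / q yields two polynomials that agree at the
  naturals and hence coincide, which determines h at nonnegative rationals; continuity gives all t
  \<ge> 0. The conclusion is explicit so that the interpolating polynomials do not depend on
  h.\<close>

lemma fd_eq_0_imp_poly: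
  fixes h :: "real \<Rightarrow> real"
  assumes cont: "continuous_on UNIV h" and fd0: "\<And>s x. s > 0 \<Longrightarrow> (fd s ^^ n) h x = 0"
  shows "h t = (\<Sum>j<n. poly (newton_poly j) t * (fd 1 ^^ j) h 0)"
proof -
  define Q where "Q = (\<lambda>x. \<Sum>j<n. smult ((fd 1 ^^ j) h x) (newton_poly j))"
  have newt: "h (x + real m * s) = (\<Sum>j<n. real (m choose j) * (fd s ^^ j) h x)" if s: "s > 0" for x m s
  proof -
    have z: "(fd s ^^ j) h x = 0" if "j \<ge> n" for j x
    proof -
      have "(fd s ^^ j) h = (fd s ^^ (j - n)) ((fd s ^^ n) h)"
        using that by (simp flip: funpow_add comp_apply[of "fd s ^^ (j - n)" "fd s ^^ n"])
      also have "(fd s ^^ n) h = (\<lambda>_. 0)" using fd0[OF s] by (simp add: fun_eq_iff)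
      finally show ?thesis by (simp add: fd_pow_0)
    qed
    have "h (x + real m * s) = (\<Sum>j\<le>m. real (m choose j) * (fd s ^^ j) h x)" by (rule fd_newton)
    also have "\<dots> = (\<Sum>j\<in>{..max m n}. real (m choose j) * (fd s ^^ j) h x)"
      by (intro sum.mono_neutral_left) auto
    also have "\<dots> = (\<Sum>j<n. real (m choose j) * (fd s ^^ j) h x)"
      by (intro sum.mono_neutral_right) (auto simp: z not_less)
    finally show ?thesis .
  qed
  have nat: "h (x + real m) = poly (Q x) (real m)" for x m
    using newt[of 1 x m] by (simp add: Q_def poly_sum poly_newton_poly mult.commute)
  have rat: "h (x + real m / real q) = poly (Q x) (real m / real q)" if q: "q > 0" for x m q
  proof -
    define P where "P = (\<Sum>j<n. smult ((fd (1 / real q) ^^ j) h x) (newton_poly j))"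
    have P: "h (x + real m / real q) = poly P (real m)" for m
      using newt[of "1 / real q" x m] q by (simp add: P_def poly_sum poly_newton_poly mult.commute)
    define P' where "P' = pcompose P [:0, real q:]"
    have "poly P' (real l) = poly (Q x) (real l)" for l
      using P[of "l * q"] nat[of x l] q by (simp add: P'_def poly_pcompose mult.commute)
    then have "P' = Q x" by (rule poly_eq_if_nat)
    then have "poly (Q x) (real m / real q) = poly P' (real m / real q)" by simp
    also have "\<dots> = poly P (real m)" using q by (simp add: P'_def poly_pcompose)
    finally show ?thesis using P by simp
  qed
  have pos: "h (x + t) = poly (Q x) t" if t: "t \<ge> 0" for x t
  proof -
    let ?t = "\<lambda>q. real (nat \<lfloor>t * real (Suc q)\<rfloor>) / real (Suc q)"
    have lim: "?t \<longlonglongrightarrow> t"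
    proof (rule tendsto_sandwich[of "\<lambda>q. t - 1 / real (Suc q)" _ _ "\<lambda>q. t"])
      have fl: "real (nat \<lfloor>t * real (Suc q)\<rfloor>) = of_int \<lfloor>t * real (Suc q)\<rfloor>" for q using t by simp
      show "eventually (\<lambda>q. t - 1 / real (Suc q) \<le> ?t q) sequentially"
      proof (intro always_eventually allI)
        fix q
        have "t * real (Suc q) - 1 \<le> of_int \<lfloor>t * real (Suc q)\<rfloor>" by linarith
        then have "(t * real (Suc q) - 1) / real (Suc q) \<le> of_int \<lfloor>t * real (Suc q)\<rfloor> / real (Suc q)"
          by (intro divide_right_mono) simp_all
        then show "t - 1 / real (Suc q) \<le> ?t q" unfolding fl by (simp add: diff_divide_distrib)
      qed
      show "eventually (\<lambda>q. ?t q \<le> t) sequentially"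
      proof (intro always_eventually allI)
        fix q
        have "of_int \<lfloor>t * real (Suc q)\<rfloor> \<le> t * real (Suc q)" by simp
        then have "of_int \<lfloor>t * real (Suc q)\<rfloor> / real (Suc q) \<le> t * real (Suc q) / real (Suc q)"
          by (intro divide_right_mono) simp_all
        then show "?t q \<le> t" unfolding fl by simp
      qed
      have "(\<lambda>q. t - 1 / real (Suc q)) \<longlonglongrightarrow> t - 0" by (intro tendsto_diff tendsto_const LIMSEQ_Suc[OF lim_1_over_n])
      then show "(\<lambda>q. t - 1 / real (Suc q)) \<longlonglongrightarrow> t" by simp
    qed simp
    have "isCont h (x + t)" using cont by (simp add: continuous_on_eq_continuous_at)
    then have "(\<lambda>q. h (x + ?t q)) \<longlonglongrightarrow> h (x + t)" by (rule isCont_tendsto_compose) (intro tendsto_add tendsto_const lim)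
    moreover have "(\<lambda>q. poly (Q x) (?t q)) \<longlonglongrightarrow> poly (Q x) t" by (intro tendsto_poly lim)
    moreover have "h (x + ?t q) = poly (Q x) (?t q)" for q by (rule rat) simp
    ultimately show ?thesis by (simp add: LIMSEQ_unique)
  qed
  \<comment> \<open>Negative t is reached from the base point - k. The polynomials for the base
    points 0 and - k are translates of each other because they agree at the naturals.\<close>
  obtain k :: nat where k: "- t \<le> real k" using real_arch_simple by blast
  have "pcompose (Q 0) [:- real k, 1:] = Q (- real k)"
  proof -
    have "poly (pcompose (pcompose (Q 0) [:- real k, 1:]) [:real k, 1:]) (real m) = poly (pcompose (Q (- real k)) [:real k, 1:]) (real m)" for m
      using pos[of "real m" 0] pos[of "real k + real m" "- real k"] by (simp add: poly_pcompose algebra_simps)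
    then have "pcompose (pcompose (Q 0) [:- real k, 1:]) [:real k, 1:] = pcompose (Q (- real k)) [:real k, 1:]"
      by (rule poly_eq_if_nat)
    then have "poly (pcompose (pcompose (Q 0) [:- real k, 1:]) [:real k, 1:]) (x - real k) = poly (pcompose (Q (- real k)) [:real k, 1:]) (x - real k)" for x
      by simp
    then have "poly (pcompose (Q 0) [:- real k, 1:]) x = poly (Q (- real k)) x" for x
      by (simp add: poly_pcompose)
    then show ?thesis by (simp flip: poly_eq_poly_eq_iff add: fun_eq_iff)
  qed
  then have "poly (Q (- real k)) (t + real k) = poly (Q 0) t"
  proof -
    assume "pcompose (Q 0) [:- real k, 1:] = Q (- real k)"
    then have "poly (Q (- real k)) (t + real k) = poly (pcompose (Q 0) [:- real k, 1:]) (t + real k)" by simp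
    then show ?thesis by (simp add: poly_pcompose)
  qed
  then have "h t = poly (Q 0) t" using pos[of "t + real k" "- real k"] k by simp
  then show ?thesis by (simp add: Q_def poly_sum mult.commute)
qed

subsection \<open>Taylor expansion of mollified functions\<close>

text \<open>The Taylor polynomial at \<open>a\<close>, in the increment \<open>t\<close>, of the truncated power \<open>max 0 a ^ n\<close>.\<close>
definition trunc_taylor :: "nat \<Rightarrow> real \<Rightarrow> real \<Rightarrow> real" where
  "trunc_taylor n a t = (\<Sum>j<n. real (n choose j) * max 0 a ^ (n - j) * t ^ j)"

lemma trunc_taylor_neg: "a \<le> 0 \<Longrightarrow> trunc_taylor n a t = 0"
  by (simp add: trunc_taylor_def power_0_left)

text \<open>For a \<ge> 0 the Taylor polynomial is (a + t)^n - t^n, and if a + t is negative then |a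
  + t| \<le> |t|; these two contributions are the factor 2. For a < 0 it is 0 and max 0 (a + t)
  \<le> |t|.\<close>

lemma trunc_taylor_error:
  assumes "n > 0"
  shows "\<bar>max 0 (a + t) ^ n - trunc_taylor n a t\<bar> \<le> 2 * \<bar>t\<bar> ^ n"
proof (cases "a \<ge> 0")
  case True
  have "(t + a) ^ n = (\<Sum>j\<le>n. real (n choose j) * t ^ j * a ^ (n - j))" by (rule binomial_ring)
  also have "{..n} = insert n {..<n}" by auto
  also have "(\<Sum>j\<in>insert n {..<n}. real (n choose j) * t ^ j * a ^ (n - j)) = t ^ n + trunc_taylor n a t"
    using True by (simp add: trunc_taylor_def mult_ac)
  finally have eq: "trunc_taylor n a t = (a + t) ^ n - t ^ n" by (simp add: add.commute)
  show ?thesis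
  proof (cases "a + t \<ge> 0")
    case False
    have "\<bar>a + t\<bar> ^ n \<le> \<bar>t\<bar> ^ n" using True False by (intro power_mono) auto
    then have "\<bar>(a + t) ^ n\<bar> \<le> \<bar>t\<bar> ^ n" by (simp add: power_abs)
    moreover have "max 0 (a + t) ^ n = 0" using False assms by simp
    moreover have "\<bar>t ^ n\<bar> = \<bar>t\<bar> ^ n" by (rule power_abs)
    ultimately show ?thesis unfolding eq by linarith
  qed (simp add: eq power_abs)
next
  case False
  have "max 0 (a + t) ^ n \<le> \<bar>t\<bar> ^ n" using False by (intro power_mono) auto
  moreover have "0 \<le> max 0 (a + t) ^ n" by simp
  moreover have "trunc_taylor n a t = 0" using False by (intro trunc_taylor_neg) simp
  ultimately show ?thesis by linarith
qed

section \<open>Mollification with piecewise polynomial kernels\<close>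

lemma integrable_continuous_support:
  fixes F :: "real ^ 'n::finite \<Rightarrow> real"
  assumes "continuous_on UNIV F" "\<And>u. norm u > \<rho> \<Longrightarrow> F u = 0"
  shows "integrable lborel F"
proof -
  have "integrable lborel (\<lambda>x. indicator (cball 0 \<rho>) x *\<^sub>R F x)"
    by (rule borel_integrable_compact) (auto intro: continuous_on_subset[OF assms(1)])
  moreover have "(\<lambda>x. indicator (cball 0 \<rho>) x *\<^sub>R F x) = F"
  proof
    fix x show "indicator (cball 0 \<rho>) x *\<^sub>R F x = F x"
      using assms(2)[of x] by (cases "norm x \<le> \<rho>") (auto simp: indicator_def)
  qed
  ultimately show ?thesis by simp
qed

lemma lborel_integral_translate:
  fixes F :: "real ^ 'n::finite \<Rightarrow> real"
  assumes "F \<in> borel_measurable borel"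
  shows "(\<integral>u. F (c + u) \<partial>lborel) = (\<integral>u. F u \<partial>lborel)"
proof -
  have "(\<integral>u. F u \<partial>distr lborel borel ((+) c)) = (\<integral>u. F (c + u) \<partial>lborel)"
    using assms by (intro integral_distr) auto
  then show ?thesis by (simp add: lborel_distr_plus)
qed

text \<open>Since 1 - |u - y|^2 = (1 - |u|^2) + (2 u.y - |y|^2), a translate of this kernel is a
  truncated power with an increment polynomial in y. The integral is left unnormalised.\<close>

definition bump :: "nat \<Rightarrow> real ^ 'n::finite \<Rightarrow> real" where
  "bump n u = max 0 (1 - u \<bullet> u) ^ n"

lemma continuous_on_bump [continuous_intros]:
  "continuous_on A f \<Longrightarrow> continuous_on A (\<lambda>x. bump n (f x))"
  unfolding bump_def by (intro continuous_intros)

lemma bump_0: "n > 0 \<Longrightarrow> norm u > 1 \<Longrightarrow> bump n u = 0"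
proof -
  assume n: "n > 0" and u: "norm u > 1"
  have "1 < (norm u)\<^sup>2" using u by (simp add: one_less_power)
  then have "1 - u \<bullet> u < 0" by (simp add: power2_norm_eq_inner)
  then show ?thesis using n by (simp add: bump_def)
qed

lemma bump_nonneg: "bump n u \<ge> 0"
  by (simp add: bump_def)

lemma bump_le_1: "bump n u \<le> 1"
  unfolding bump_def by (intro power_le_one) auto

definition moll :: "nat \<Rightarrow> (real ^ 'n::finite \<Rightarrow> real) \<Rightarrow> real ^ 'n \<Rightarrow> real" where
  "moll n f x = (\<integral>u. f (x + u) * bump n u \<partial>lborel)"

text \<open>The increment y is shifted from the merely continuous f to the kernel, and the kernel is
  replaced by its Taylor polynomial.\<close>

definition moll_taylor :: "nat \<Rightarrow> (real ^ 'n::finite \<Rightarrow> real) \<Rightarrow> real ^ 'n \<Rightarrow> real ^ 'n \<Rightarrow> real" where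
  "moll_taylor n f x y = (\<integral>u. f (x + u) * trunc_taylor n (1 - u \<bullet> u) (2 * (u \<bullet> y) - y \<bullet> y) \<partial>lborel)"

lemma continuous_trunc_taylor [continuous_intros]:
  "continuous_on A f \<Longrightarrow> continuous_on A g \<Longrightarrow> continuous_on A (\<lambda>x. trunc_taylor n (f x) (g x))"
  unfolding trunc_taylor_def by (intro continuous_intros)

lemma continuous_shift: "continuous_on UNIV f \<Longrightarrow> continuous_on UNIV (\<lambda>u. f (x + u :: real ^ 'n::finite) :: real)"
  by (rule continuous_on_compose2[of UNIV f]) (auto intro!: continuous_intros)

lemma trunc_taylor_support: "norm u > 1 \<Longrightarrow> trunc_taylor n (1 - u \<bullet> u) t = 0"
proof -
  assume u: "norm u > 1"
  have "1 < (norm u)\<^sup>2" using u by (simp add: one_less_power)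
  then show ?thesis by (intro trunc_taylor_neg) (simp add: power2_norm_eq_inner)
qed

text \<open>For |y| \<le> 1 both kernels vanish when |u| > 2, and on the ball of radius 2 the
  increment 2 u.y - y.y is at most 5 |y|. Combined with \<open>trunc_taylor_error\<close> this gives
  the constant 2 * 5^n.\<close>

lemma moll_taylor_error:
  fixes f :: "real ^ 'n::finite \<Rightarrow> real"
  assumes f: "continuous_on UNIV f" and n: "n > 0" and y: "norm y \<le> 1"
    and B: "\<And>u. norm u \<le> 2 \<Longrightarrow> \<bar>f (x + u)\<bar> \<le> B"
  shows "\<bar>moll n f (x + y) - moll_taylor n f x y\<bar> \<le> 2 * 5 ^ n * B * measure lborel (cball (0 :: real ^ 'n) 2) * norm y ^ n"
proof -
  let ?t = "\<lambda>u. 2 * (u \<bullet> y) - y \<bullet> y"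
  let ?D = "\<lambda>u. f (x + u) * (bump n (u - y) - trunc_taylor n (1 - u \<bullet> u) (?t u))"
  have fx: "continuous_on UNIV (\<lambda>u. f (x + u))" by (rule continuous_shift[OF f])
  have far: "bump n (u - y) = 0" "trunc_taylor n (1 - u \<bullet> u) (?t u) = 0" if "norm u > 2" for u
  proof -
    have "norm u \<le> norm (u - y) + norm y" using norm_triangle_ineq[of "u - y" y] by simp
    then show "bump n (u - y) = 0" using that y n by (intro bump_0) auto
    show "trunc_taylor n (1 - u \<bullet> u) (?t u) = 0" using that by (intro trunc_taylor_support) auto
  qed
  have "moll n f (x + y) = (\<integral>u. f (x + u) * bump n (u - y) \<partial>lborel)"
  proof -
    let ?F = "\<lambda>u. f (x + u) * bump n (u - y)"
    have "?F \<in> borel_measurable borel"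
      by (intro borel_measurable_continuous_onI continuous_intros fx)
    from lborel_integral_translate[OF this, of y] show ?thesis
      by (simp add: moll_def add.assoc)
  qed
  moreover have i1: "integrable lborel (\<lambda>u. f (x + u) * bump n (u - y))"
    by (rule integrable_continuous_support[of _ 2]) (auto intro!: continuous_intros fx simp: far)
  moreover have i2: "integrable lborel (\<lambda>u. f (x + u) * trunc_taylor n (1 - u \<bullet> u) (?t u))"
    by (rule integrable_continuous_support[of _ 2]) (auto intro!: continuous_intros fx simp: far)
  ultimately have "moll n f (x + y) - moll_taylor n f x y = (\<integral>u. ?D u \<partial>lborel)"
    by (simp add: moll_taylor_def right_diff_distrib)
  then have "\<bar>moll n f (x + y) - moll_taylor n f x y\<bar> \<le> (\<integral>u. \<bar>?D u\<bar> \<partial>lborel)"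
    by (simp only: integral_abs_bound)
  also have "\<dots> \<le> (\<integral>u. (2 * 5 ^ n * B * norm y ^ n) * indicator (cball (0 :: real ^ 'n) 2) u \<partial>lborel)"
  proof (rule Bochner_Integration.integral_mono)
    show "integrable lborel (\<lambda>u. \<bar>?D u\<bar>)"
      by (rule integrable_continuous_support[of _ 2]) (auto intro!: continuous_intros fx simp: far)
    show "integrable lborel (\<lambda>u :: real ^ 'n. (2 * 5 ^ n * B * norm y ^ n) * indicator (cball 0 2) u)"
      using emeasure_lborel_cball_finite[of "0 :: real ^ 'n" 2] by (intro integrable_mult_right integrable_real_indicator) auto
    fix u :: "real ^ 'n"
    show "\<bar>?D u\<bar> \<le> (2 * 5 ^ n * B * norm y ^ n) * indicator (cball 0 2) u"
    proof (cases "norm u \<le> 2")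
      case True
      have "1 - (u - y) \<bullet> (u - y) = 1 - u \<bullet> u + ?t u" by (simp add: inner_diff inner_commute)
      then have "\<bar>bump n (u - y) - trunc_taylor n (1 - u \<bullet> u) (?t u)\<bar> \<le> 2 * \<bar>?t u\<bar> ^ n"
        unfolding bump_def using trunc_taylor_error[OF n, of "1 - u \<bullet> u" "?t u"] by (simp only:)
      also have "\<dots> \<le> 2 * (5 * norm y) ^ n"
      proof (intro mult_left_mono power_mono)
        have "\<bar>u \<bullet> y\<bar> \<le> norm u * norm y" by (rule Cauchy_Schwarz_ineq2)
        also have "\<dots> \<le> 2 * norm y" using True by (intro mult_right_mono) auto
        finally have "\<bar>u \<bullet> y\<bar> \<le> 2 * norm y" .
        moreover have "y \<bullet> y \<le> norm y"
        proof -
          have "y \<bullet> y = norm y * norm y" by (simp flip: power2_norm_eq_inner add: power2_eq_square)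
          also have "\<dots> \<le> norm y * 1" using y by (intro mult_left_mono) auto
          finally show ?thesis by simp
        qed
        moreover have "0 \<le> y \<bullet> y" by simp
        ultimately show "\<bar>?t u\<bar> \<le> 5 * norm y" by linarith
      qed simp_all
      finally have e: "\<bar>bump n (u - y) - trunc_taylor n (1 - u \<bullet> u) (?t u)\<bar> \<le> 2 * (5 * norm y) ^ n" .
      have "\<bar>?D u\<bar> \<le> B * (2 * (5 * norm y) ^ n)"
        unfolding abs_mult using B[OF True] e by (intro mult_mono) auto
      then show ?thesis using True by (simp add: power_mult_distrib mult_ac)
    next
      case False
      then have "norm u > 2" by simp
      then have "?D u = 0" unfolding far[OF \<open>norm u > 2\<close>] by simp
      then show ?thesis using False by simp
    qed
  qed
  also have "\<dots> = 2 * 5 ^ n * B * measure lborel (cball (0 :: real ^ 'n) 2) * norm y ^ n"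
    by simp
  finally show ?thesis .
qed

lemma polyfun_inner_self: "(\<lambda>y :: real ^ 'n::finite. y \<bullet> y) \<in> polyfun"
  unfolding inner_vec_def inner_real_def by (rule polyfun_sum) (rule polyfun_mult[OF polyfun_component polyfun_component])

text \<open>Induction on j removes one factor 2 u.y - y.y at a time: the components of u are
  absorbed into F, those of y leave the integral.\<close>

lemma polyfun_integral_power:
  fixes F :: "real ^ 'n::finite \<Rightarrow> real"
  assumes "continuous_on UNIV F" "\<And>u. norm u > \<rho> \<Longrightarrow> F u = 0"
  shows "(\<lambda>y. \<integral>u. F u * (2 * (u \<bullet> y) - y \<bullet> y) ^ j \<partial>lborel) \<in> polyfun"
  using assms
proof (induction j arbitrary: F)
  case 0
  then show ?case by (simp add: polyfun_const)
next
  case (Suc j)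
  let ?t = "\<lambda>u y. 2 * (u \<bullet> y) - y \<bullet> y"
  have eq: "(\<integral>u. F u * ?t u y ^ Suc j \<partial>lborel)
     = (\<Sum>i\<in>UNIV. (2 * y $ i) * (\<integral>u. (F u * u $ i) * ?t u y ^ j \<partial>lborel)) - (y \<bullet> y) * (\<integral>u. F u * ?t u y ^ j \<partial>lborel)" for y
  proof -
    have "F u * ?t u y ^ Suc j = (\<Sum>i\<in>UNIV. (2 * y $ i) * ((F u * u $ i) * ?t u y ^ j)) - (y \<bullet> y) * (F u * ?t u y ^ j)" for u
    proof -
      have gen: "a * p * (2 * (u \<bullet> y)) = (\<Sum>i\<in>UNIV. (2 * y $ i) * ((a * u $ i) * p))" for a p
        by (simp add: inner_vec_def sum_distrib_left mult_ac)
      have "F u * ?t u y ^ Suc j = F u * ?t u y ^ j * (2 * (u \<bullet> y)) - (y \<bullet> y) * (F u * ?t u y ^ j)"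
        by (simp only: power_Suc right_diff_distrib left_diff_distrib mult_ac)
      then show ?thesis unfolding gen .
    qed
    moreover have "integrable lborel (\<lambda>u. (F u * u $ i) * ?t u y ^ j)" for i
      using Suc.prems by (intro integrable_continuous_support[of _ \<rho>]) (auto intro!: continuous_intros)
    moreover have "integrable lborel (\<lambda>u. F u * ?t u y ^ j)"
      using Suc.prems by (intro integrable_continuous_support[of _ \<rho>]) (auto intro!: continuous_intros)
    ultimately show ?thesis by simp
  qed
  have IH1: "(\<lambda>y. \<integral>u. (F u * u $ i) * ?t u y ^ j \<partial>lborel) \<in> polyfun" for i
    using Suc.prems by (intro Suc.IH) (auto intro!: continuous_intros)
  have IH2: "(\<lambda>y. \<integral>u. F u * ?t u y ^ j \<partial>lborel) \<in> polyfun"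
    using Suc.prems by (intro Suc.IH)
  show ?case
    unfolding eq
    by (intro polyfun_diff polyfun_sum polyfun_mult[OF polyfun_mult[OF polyfun_const polyfun_component] IH1] polyfun_mult[OF polyfun_inner_self IH2])
qed

lemma moll_taylor_sum:
  fixes f :: "real ^ 'n::finite \<Rightarrow> real"
  assumes f: "continuous_on UNIV f"
  shows "moll_taylor n f x y = (\<Sum>j<n. \<integral>u. (f (x + u) * (real (n choose j) * max 0 (1 - u \<bullet> u) ^ (n - j))) * (2 * (u \<bullet> y) - y \<bullet> y) ^ j \<partial>lborel)"
proof -
  have fx: "continuous_on UNIV (\<lambda>u. f (x + u))" by (rule continuous_shift[OF f])
  have "integrable lborel (\<lambda>u. (f (x + u) * (real (n choose j) * max 0 (1 - u \<bullet> u) ^ (n - j))) * (2 * (u \<bullet> y) - y \<bullet> y) ^ j)"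
    if "j < n" for j
    using that bump_0[of "n - j"] unfolding bump_def
    by (intro integrable_continuous_support[of _ 1]) (auto intro!: continuous_intros fx)
  then show ?thesis
    unfolding moll_taylor_def trunc_taylor_def by (simp add: sum_distrib_left mult.assoc flip: Bochner_Integration.integral_sum)
qed

lemma moll_taylor_polyfun:
  fixes f :: "real ^ 'n::finite \<Rightarrow> real"
  assumes f: "continuous_on UNIV f"
  shows "moll_taylor n f x \<in> polyfun"
proof -
  have fx: "continuous_on UNIV (\<lambda>u. f (x + u))" by (rule continuous_shift[OF f])
  have "(\<lambda>y. \<integral>u. (f (x + u) * (real (n choose j) * max 0 (1 - u \<bullet> u) ^ (n - j))) * (2 * (u \<bullet> y) - y \<bullet> y) ^ j \<partial>lborel) \<in> polyfun"
    if "j \<in> {..<n}" for j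
    using that bump_0[of "n - j"] unfolding bump_def
    by (intro polyfun_integral_power[of _ 1]) (auto intro!: continuous_intros fx)
  then have "(\<lambda>y. \<Sum>j<n. \<integral>u. (f (x + u) * (real (n choose j) * max 0 (1 - u \<bullet> u) ^ (n - j))) * (2 * (u \<bullet> y) - y \<bullet> y) ^ j \<partial>lborel) \<in> polyfun"
    by (rule polyfun_sum)
  moreover have "moll_taylor n f x = (\<lambda>y. \<Sum>j<n. \<integral>u. (f (x + u) * (real (n choose j) * max 0 (1 - u \<bullet> u) ^ (n - j))) * (2 * (u \<bullet> y) - y \<bullet> y) ^ j \<partial>lborel)"
    using moll_taylor_sum[OF f] by (rule ext)
  ultimately show ?thesis by simp
qed

text \<open>Along a coordinate axis the coefficients of the Taylor polynomial are integrals against fixed continuous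
  bumps, which makes them locally bounded in the base point.\<close>
lemma trunc_taylor_axis:
  fixes i :: "'n::finite"
  shows "\<exists>\<kappa>. (\<forall>m. continuous_on UNIV (\<kappa> m)) \<and> (\<forall>m u. norm u > 1 \<longrightarrow> \<kappa> m u = 0) \<and>
    (\<forall>(u :: real ^ 'n) t. trunc_taylor n (1 - u \<bullet> u) (2 * (u \<bullet> (t *\<^sub>R axis i 1)) - (t *\<^sub>R axis i 1) \<bullet> (t *\<^sub>R axis i 1 :: real ^ 'n))
       = (\<Sum>m\<le>2 * n. \<kappa> m u * t ^ m))"
proof -
  define P where "P = (\<lambda>(u :: real ^ 'n) j. [:0, 2 * u $ i, - 1:] ^ j)"
  have P: "continuous_on UNIV (\<lambda>u. coeff (P u j) m)" for j m
  proof (induction j arbitrary: m)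
    case (Suc j)
    have "coeff (P u (Suc j)) m = (case m of 0 \<Rightarrow> 0 | Suc m \<Rightarrow> 2 * u $ i * coeff (P u j) m - (case m of 0 \<Rightarrow> 0 | Suc m \<Rightarrow> coeff (P u j) m))" for u
      by (simp add: P_def coeff_pCons split: nat.splits)
    then show ?case
      by (cases m; cases "m - 1") (auto intro!: continuous_intros Suc.IH split: nat.splits)
  qed (simp add: P_def)
  have degP: "degree (P u j) \<le> 2 * j" for u j
    unfolding P_def by (rule order_trans[OF degree_power_le]) (simp add: degree_pCons_le mult.commute)
  define \<kappa> where "\<kappa> = (\<lambda>m u. \<Sum>j<n. real (n choose j) * max 0 (1 - u \<bullet> u) ^ (n - j) * coeff (P u j) m)"
  show ?thesis
  proof (intro exI[of _ \<kappa>] conjI allI impI)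
    show "continuous_on UNIV (\<kappa> m)" for m
      unfolding \<kappa>_def by (intro continuous_intros P)
    show "\<kappa> m u = 0" if u: "norm u > 1" for m u
    proof -
      have "max 0 (1 - u \<bullet> u) ^ (n - j) = 0" if "j < n" for j
        using bump_0[of "n - j" u] u that by (simp add: bump_def)
      then show ?thesis unfolding \<kappa>_def by (intro sum.neutral) auto
    qed
    fix u :: "real ^ 'n" and t :: real
    have t: "2 * (u \<bullet> (t *\<^sub>R axis i 1)) - (t *\<^sub>R axis i 1) \<bullet> (t *\<^sub>R axis i 1 :: real ^ 'n) = poly [:0, 2 * u $ i, - 1:] t"
      by (simp add: inner_axis cart_eq_inner_axis[symmetric] inner_axis_axis algebra_simps)
    have "poly (P u j) t = (\<Sum>m\<le>2 * n. coeff (P u j) m * t ^ m)" if "j < n" for j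
      unfolding poly_altdef using degP[of u j] that by (intro sum.mono_neutral_left) (auto simp: coeff_eq_0)
    then have "(\<Sum>j<n. real (n choose j) * max 0 (1 - u \<bullet> u) ^ (n - j) * poly (P u j) t)
      = (\<Sum>j<n. \<Sum>m\<le>2 * n. real (n choose j) * max 0 (1 - u \<bullet> u) ^ (n - j) * coeff (P u j) m * t ^ m)"
      by (simp add: sum_distrib_left mult.assoc)
    also have "\<dots> = (\<Sum>m\<le>2 * n. \<kappa> m u * t ^ m)"
      unfolding \<kappa>_def sum_distrib_right by (rule sum.swap)
    finally show "trunc_taylor n (1 - u \<bullet> u) (2 * (u \<bullet> (t *\<^sub>R axis i 1)) - (t *\<^sub>R axis i 1) \<bullet> (t *\<^sub>R axis i 1 :: real ^ 'n))
       = (\<Sum>m\<le>2 * n. \<kappa> m u * t ^ m)"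
      unfolding t trunc_taylor_def by (simp add: P_def poly_power)
  qed
qed

text \<open>When the coefficients below m vanish, divide by r^m and let r tend to 0 from the
  right.\<close>

lemma poly_small_coeff_0:
  fixes c :: "nat \<Rightarrow> real"
  assumes r0: "r0 > 0" and small: "\<And>r. 0 < r \<Longrightarrow> r \<le> r0 \<Longrightarrow> \<bar>\<Sum>j\<le>D. c j * r ^ j\<bar> \<le> C * r ^ n"
    and m: "m < n" "m \<le> D"
  shows "c m = 0"
  using m
proof (induction m rule: less_induct)
  case (less m)
  let ?q = "\<lambda>r. \<Sum>j\<le>D - m. c (m + j) * r ^ j"
  have eq: "(\<Sum>j\<le>D. c j * r ^ j) = r ^ m * ?q r" for r
  proof -
    have "(\<Sum>j\<le>D. c j * r ^ j) = (\<Sum>j\<in>{m..D}. c j * r ^ j)"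
      using less by (intro sum.mono_neutral_right) (auto simp: not_le)
    also have "\<dots> = (\<Sum>j\<le>D - m. c (m + j) * r ^ (m + j))"
      using less.prems by (intro sum.reindex_bij_witness[where i = "\<lambda>j. m + j" and j = "\<lambda>j. j - m"]) auto
    finally show ?thesis by (simp add: sum_distrib_left power_add mult_ac)
  qed
  have "\<bar>?q r\<bar> \<le> C * r ^ (n - m)" if r: "0 < r" "r \<le> r0" for r
  proof -
    have "r ^ m * \<bar>?q r\<bar> \<le> C * r ^ n" using small[OF r] r unfolding eq by (simp add: abs_mult)
    also have "r ^ n = r ^ m * r ^ (n - m)" using less.prems by (simp flip: power_add)
    finally have "r ^ m * \<bar>?q r\<bar> \<le> r ^ m * (C * r ^ (n - m))" by (simp add: mult_ac)
    then show ?thesis using r by simp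
  qed
  then have ev: "eventually (\<lambda>r. \<bar>?q r\<bar> \<le> C * r ^ (n - m)) (at_right 0)"
    using r0 by (auto simp: eventually_at_right[OF r0] intro!: exI[of _ r0])
  have "((\<lambda>r. \<bar>?q r\<bar>) \<longlongrightarrow> \<bar>?q 0\<bar>) (at_right 0)" by (intro tendsto_intros)
  moreover have "((\<lambda>r. C * r ^ (n - m)) \<longlongrightarrow> C * 0 ^ (n - m)) (at_right 0)" by (intro tendsto_intros)
  ultimately have "\<bar>?q 0\<bar> \<le> C * 0 ^ (n - m)" using ev
    by (intro tendsto_le[OF _ _ _ ev]) (auto simp: trivial_limit_at_right_real)
  moreover have "?q 0 = c m"
  proof -
    have "?q 0 = (\<Sum>j\<in>{0}. c (m + j) * 0 ^ j)" by (intro sum.mono_neutral_right) auto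
    then show ?thesis by simp
  qed
  moreover have "(0 :: real) ^ (n - m) = 0" using less.prems by simp
  ultimately show ?case by simp
qed

lemma pf_homogeneous_sum:
  "pf d \<phi> (r *\<^sub>R y) = (\<Sum>m\<le>CARD('n) * d. pf d (\<lambda>\<beta>. if expo_deg \<beta> = m then \<phi> \<beta> else 0) y * r ^ m)"
  for y :: "real ^ 'n::finite"
proof -
  have "pf d \<phi> (r *\<^sub>R y) = (\<Sum>\<beta>\<in>expo_box d. \<phi> \<beta> * dmon \<beta> y * r ^ expo_deg \<beta>)"
    by (simp add: pf_def dmon_scale mult_ac)
  also have "\<dots> = (\<Sum>m\<le>CARD('n) * d. \<Sum>\<beta> | \<beta> \<in> expo_box d \<and> expo_deg \<beta> = m. \<phi> \<beta> * dmon \<beta> y * r ^ expo_deg \<beta>)"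
    by (intro sum.group[symmetric]) (auto intro: expo_deg_le_box)
  also have "\<dots> = (\<Sum>m\<le>CARD('n) * d. pf d (\<lambda>\<beta>. if expo_deg \<beta> = m then \<phi> \<beta> else 0) y * r ^ m)"
  proof (intro sum.cong refl)
    fix m
    have "(\<Sum>\<beta> | \<beta> \<in> expo_box d \<and> expo_deg \<beta> = m. \<phi> \<beta> * dmon \<beta> y * r ^ expo_deg \<beta>)
      = (\<Sum>\<beta>\<in>expo_box d. (if expo_deg \<beta> = m then \<phi> \<beta> else 0) * dmon \<beta> y * r ^ m)"
      by (rule sum.mono_neutral_cong_left) auto
    then show "(\<Sum>\<beta> | \<beta> \<in> expo_box d \<and> expo_deg \<beta> = m. \<phi> \<beta> * dmon \<beta> y * r ^ expo_deg \<beta>)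
      = pf d (\<lambda>\<beta>. if expo_deg \<beta> = m then \<phi> \<beta> else 0) y * r ^ m"
      by (simp add: pf_def sum_distrib_right)
  qed
  finally show ?thesis .
qed

subsection \<open>Functions with the mean value property are polynomials\<close>

lemma continuous_bounded_cball:
  fixes f :: "real ^ 'n::finite \<Rightarrow> real"
  assumes "continuous_on UNIV f"
  obtains B where "B \<ge> 0" "\<And>z. norm z \<le> \<rho> \<Longrightarrow> \<bar>f z\<bar> \<le> B"
proof -
  have "compact (f ` cball 0 \<rho>)"
    by (intro compact_continuous_image continuous_on_subset[OF assms]) auto
  then have "bounded (f ` cball 0 \<rho>)" by (rule compact_imp_bounded)
  then obtain B where "\<forall>z\<in>f ` cball 0 \<rho>. norm z \<le> B" unfolding bounded_iff by blast
  then have "\<bar>f z\<bar> \<le> max B 0" if "norm z \<le> \<rho>" for z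
  proof -
    have "f z \<in> f ` cball 0 \<rho>" using that by simp
    then have "norm (f z) \<le> B" using \<open>\<forall>z\<in>f ` cball 0 \<rho>. norm z \<le> B\<close> by blast
    then show ?thesis by simp
  qed
  then show thesis using that[of "max B 0"] by simp
qed

lemma integral_bump_pos: "(\<integral>u. bump n (u :: real ^ 'n::finite) \<partial>lborel) > 0" if n: "n > 0"
proof -
  \<comment> \<open>On the ball of radius 1/2 the base 1 - |u|^2 of the kernel is at least
    3/4.\<close>
  let ?c = "(3 / 4 :: real) ^ n"
  have "0 < ?c * measure lborel (cball (0 :: real ^ 'n) (1 / 2))"
    by (intro mult_pos_pos) (simp_all add: content_cball_pos)
  also have "\<dots> = (\<integral>u. ?c * indicator (cball (0 :: real ^ 'n) (1 / 2)) u \<partial>lborel)"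
    by simp
  also have "\<dots> \<le> (\<integral>u. bump n (u :: real ^ 'n) \<partial>lborel)"
  proof (rule Bochner_Integration.integral_mono)
    show "integrable lborel (\<lambda>u :: real ^ 'n. ?c * indicator (cball 0 (1 / 2)) u)"
      using emeasure_lborel_cball_finite[of "0 :: real ^ 'n" "1 / 2"] by (intro integrable_mult_right integrable_real_indicator) auto
    show "integrable lborel (bump n :: real ^ 'n \<Rightarrow> real)"
      by (rule integrable_continuous_support[of _ 1]) (auto intro: continuous_on_bump[of _ "\<lambda>x. x", simplified] bump_0[OF n])
    fix u :: "real ^ 'n"
    show "?c * indicator (cball 0 (1 / 2)) u \<le> bump n u"
    proof (cases "norm u \<le> 1 / 2")
      case True
      have "(norm u)\<^sup>2 \<le> (1 / 2)\<^sup>2" using True by (intro power_mono) auto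
      then have "3 / 4 \<le> 1 - u \<bullet> u" by (simp add: power2_norm_eq_inner power_divide)
      then have "?c \<le> bump n u" unfolding bump_def by (intro power_mono) auto
      then show ?thesis using True by simp
    qed (simp add: bump_nonneg)
  qed
  finally show ?thesis .
qed

text \<open>Rescaled bumps concentrate at x: at a small scale e the values of G stay within |G x| /
  2 of G x on the support, so their average could not vanish if G x were nonzero.\<close>

lemma eq_0_if_bump_averages_0:
  fixes G :: "real ^ 'n::finite \<Rightarrow> real"
  assumes G: "continuous_on UNIV G" and n: "n > 0"
    and avg: "\<And>e. e > 0 \<Longrightarrow> (\<integral>u. G (x + e *\<^sub>R u) * bump n u \<partial>lborel) = 0"
  shows "G x = 0"
proof (rule ccontr)
  assume nz: "G x \<noteq> 0"
  have "isCont G x" using G by (simp add: continuous_on_eq_continuous_at)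
  then obtain d where d: "d > 0" "\<And>z. dist z x < d \<Longrightarrow> dist (G z) (G x) < \<bar>G x\<bar> / 2"
    unfolding continuous_at_eps_delta using nz by (metis half_gt_zero zero_less_abs_iff)
  define e where "e = d / 2"
  have e: "e > 0" using d by (simp add: e_def)
  let ?J = "\<integral>u. bump n (u :: real ^ 'n) \<partial>lborel"
  have cont: "continuous_on UNIV (\<lambda>u. G (x + e *\<^sub>R u))"
    by (rule continuous_on_compose2[OF G]) (auto intro!: continuous_intros)
  have i0: "integrable lborel (bump n :: real ^ 'n \<Rightarrow> real)"
    by (rule integrable_continuous_support[of _ 1]) (auto intro: continuous_on_bump[of _ "\<lambda>x. x", simplified] bump_0[OF n])
  have i1: "integrable lborel (\<lambda>u. G (x + e *\<^sub>R u) * bump n u)"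
    by (rule integrable_continuous_support[of _ 1]) (auto intro!: continuous_intros cont simp: bump_0[OF n])
  have i2: "integrable lborel (\<lambda>u. \<bar>G x * bump n u - G (x + e *\<^sub>R u) * bump n u\<bar>)"
    by (intro integrable_abs Bochner_Integration.integrable_diff integrable_mult_right i0 i1)
  have "\<bar>G x\<bar> * ?J = \<bar>(\<integral>u. G x * bump n (u :: real ^ 'n) \<partial>lborel) - (\<integral>u. G (x + e *\<^sub>R u) * bump n u \<partial>lborel)\<bar>"
    unfolding avg[OF e] by (simp add: abs_mult abs_of_pos[OF integral_bump_pos[OF n]])
  also have "(\<integral>u. G x * bump n (u :: real ^ 'n) \<partial>lborel) - (\<integral>u. G (x + e *\<^sub>R u) * bump n u \<partial>lborel)
     = (\<integral>u. G x * bump n u - G (x + e *\<^sub>R u) * bump n u \<partial>lborel)"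
    by (rule Bochner_Integration.integral_diff[symmetric]) (intro integrable_mult_right i0 i1)+
  finally have "\<bar>G x\<bar> * ?J \<le> (\<integral>u. \<bar>G x * bump n u - G (x + e *\<^sub>R u) * bump n u\<bar> \<partial>lborel)"
    by (simp only: integral_abs_bound)
  also have "\<dots> \<le> (\<integral>u. \<bar>G x\<bar> / 2 * bump n (u :: real ^ 'n) \<partial>lborel)"
  proof (rule Bochner_Integration.integral_mono[OF i2])
    show "integrable lborel (\<lambda>u :: real ^ 'n. \<bar>G x\<bar> / 2 * bump n u)" by (intro integrable_mult_right i0)
    fix u :: "real ^ 'n"
    have "\<bar>G x * bump n u - G (x + e *\<^sub>R u) * bump n u\<bar> = \<bar>G x - G (x + e *\<^sub>R u)\<bar> * bump n u"
      by (simp add: abs_mult bump_nonneg flip: left_diff_distrib)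
    also have "\<dots> \<le> \<bar>G x\<bar> / 2 * bump n u"
    proof (cases "norm u \<le> 1")
      case True
      have "dist (x + e *\<^sub>R u) x \<le> e * 1" using e True by (simp add: dist_norm mult_left_le)
      then have "dist (G (x + e *\<^sub>R u)) (G x) < \<bar>G x\<bar> / 2" using e by (intro d(2)) (simp add: e_def)
      then show ?thesis by (intro mult_right_mono bump_nonneg) (simp add: dist_real_def abs_minus_commute)
    qed (simp add: bump_0[OF n])
    finally show "\<bar>G x * bump n u - G (x + e *\<^sub>R u) * bump n u\<bar> \<le> \<bar>G x\<bar> / 2 * bump n u" .
  qed
  also have "\<dots> = \<bar>G x\<bar> / 2 * ?J" by simp
  finally have "\<bar>G x\<bar> * ?J \<le> \<bar>G x\<bar> / 2 * ?J" .
  then show False using integral_bump_pos[OF n, where 'n = 'n] nz by simp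
qed

context cube_measure
begin

text \<open>Averaging over \<nu> commutes with mollification by Fubini. Joint integrability follows
  from a bound for f on a ball that contains almost all points x + r w + u with u in the support of
  the kernel.\<close>

lemma mean_value_moll:
  assumes f: "f \<in> mean_value_functions \<nu>" and n: "n > 0" and r: "r > 0"
  shows "integrable \<nu> (\<lambda>w. moll n f (x + r *\<^sub>R w))"
    and "moll n f x = (\<integral>w. moll n f (x + r *\<^sub>R w) \<partial>\<nu>)"
proof -
  interpret P: pair_sigma_finite \<nu> "lborel :: (real ^ 'n) measure" ..
  have cf: "continuous_on UNIV f" using f by (simp add: mean_value_functions_def)
  define F where "F = (\<lambda>w u. f (x + r *\<^sub>R w + u) * bump n u)"
  have "continuous_on UNIV (\<lambda>p :: (real ^ 'n) \<times> (real ^ 'n). f (x + r *\<^sub>R fst p + snd p) * bump n (snd p))"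
    by (intro continuous_intros continuous_on_compose2[OF cf]) auto
  then have "(\<lambda>p :: (real ^ 'n) \<times> (real ^ 'n). f (x + r *\<^sub>R fst p + snd p) * bump n (snd p)) \<in> borel_measurable (borel \<Otimes>\<^sub>M borel)"
    unfolding borel_prod by (rule borel_measurable_continuous_onI)
  moreover have "sets (\<nu> \<Otimes>\<^sub>M lborel) = sets (borel \<Otimes>\<^sub>M (borel :: (real ^ 'n) measure))"
    by (rule sets_pair_measure_cong) simp_all
  ultimately have meas: "case_prod F \<in> borel_measurable (\<nu> \<Otimes>\<^sub>M lborel)"
    unfolding F_def case_prod_beta' using measurable_cong_sets[OF _ refl] by blast
  have cF: "continuous_on UNIV (F w)" for w
    unfolding F_def by (intro continuous_intros continuous_on_compose2[OF cf]) auto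
  have F0: "F w u = 0" if "norm u > 1" for w u
    using bump_0[OF n that] by (simp add: F_def)
  obtain R where R: "AE w in \<nu>. norm w \<le> R" using bounded_AE by blast
  obtain B where B: "\<And>z. norm z \<le> norm x + r * R + 1 \<Longrightarrow> \<bar>f z\<bar> \<le> B" "B \<ge> 0"
    using continuous_bounded_cball[OF cf] by metis
  have int: "integrable lborel (F w)" for w
    by (rule integrable_continuous_support[OF cF F0])
  have bound: "(\<integral>u. norm (F w u) \<partial>lborel) \<le> B * measure lborel (cball (0 :: real ^ 'n) 1)" if w: "norm w \<le> R" for w
  proof -
    have "(\<integral>u. norm (F w u) \<partial>lborel) \<le> (\<integral>u. B * indicator (cball (0 :: real ^ 'n) 1) u \<partial>lborel)"
    proof (rule Bochner_Integration.integral_mono)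
      show "integrable lborel (\<lambda>u. norm (F w u))" using int by (rule integrable_norm)
      show "integrable lborel (\<lambda>u :: real ^ 'n. B * indicator (cball 0 1) u)"
        using emeasure_lborel_cball_finite[of "0 :: real ^ 'n" 1] by (intro integrable_mult_right integrable_real_indicator) auto
      fix u :: "real ^ 'n"
      show "norm (F w u) \<le> B * indicator (cball 0 1) u"
      proof (cases "norm u \<le> 1")
        case True
        have "norm (x + r *\<^sub>R w + u) \<le> norm x + norm (r *\<^sub>R w) + norm u"
          using norm_triangle_ineq[of "x + r *\<^sub>R w" u] norm_triangle_ineq[of x "r *\<^sub>R w"] by linarith
        also have "norm (r *\<^sub>R w) \<le> r * R" using w r by simp
        finally have "\<bar>f (x + r *\<^sub>R w + u)\<bar> \<le> B" using True by (intro B(1)) simp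
        then have "\<bar>f (x + r *\<^sub>R w + u)\<bar> * bump n u \<le> B * 1"
          using B(2) bump_nonneg bump_le_1 by (intro mult_mono) auto
        then show ?thesis using True by (simp add: F_def abs_mult bump_nonneg)
      qed (simp add: F0)
    qed
    then show ?thesis by simp
  qed
  have "integrable \<nu> (\<lambda>w. \<integral>u. norm (case_prod F (w, u)) \<partial>lborel)"
  proof (rule integrable_const_bound)
    show "AE w in \<nu>. norm (\<integral>u. norm (case_prod F (w, u)) \<partial>lborel) \<le> B * measure lborel (cball (0 :: real ^ 'n) 1)"
      using R
    proof eventually_elim
      case (elim w)
      from bound[OF elim] show ?case by simp
    qed
    have "(\<lambda>(w, u). norm (F w u)) \<in> borel_measurable (\<nu> \<Otimes>\<^sub>M lborel)"
      using measurable_compose[OF meas borel_measurable_norm] by (simp add: case_prod_beta')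
    from lborel.borel_measurable_lebesgue_integral[OF this]
    show "(\<lambda>w. \<integral>u. norm (case_prod F (w, u)) \<partial>lborel) \<in> borel_measurable \<nu>" by simp
  qed
  then have intF: "integrable (\<nu> \<Otimes>\<^sub>M lborel) (case_prod F)"
    using meas int by (intro P.Fubini_integrable) auto
  have eqF: "(\<integral>u. F w u \<partial>lborel) = moll n f (x + r *\<^sub>R w)" for w by (simp add: moll_def F_def)
  show "integrable \<nu> (\<lambda>w. moll n f (x + r *\<^sub>R w))"
    using P.integrable_fst[OF intF] by (simp add: eqF)
  have "moll n f x = (\<integral>u. (\<integral>w. F w u \<partial>\<nu>) \<partial>lborel)"
  proof -
    have "(\<integral>w. F w u \<partial>\<nu>) = f (x + u) * bump n u" for u
    proof -
      have "f (x + u) = (\<integral>w. f (x + u + r *\<^sub>R w) \<partial>\<nu>)"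
        using f r unfolding mean_value_functions_def by blast
      also have "\<dots> = (\<integral>w. f (x + r *\<^sub>R w + u) \<partial>\<nu>)" by (simp add: add_ac)
      finally show ?thesis by (simp add: F_def)
    qed
    then show ?thesis by (simp add: moll_def)
  qed
  also have "\<dots> = (\<integral>w. (\<integral>u. F w u \<partial>lborel) \<partial>\<nu>)"
    by (rule P.Fubini_integral[OF intF])
  finally show "moll n f x = (\<integral>w. moll n f (x + r *\<^sub>R w) \<partial>\<nu>)" by (simp only: eqF)
qed

text \<open>The mean value property holds at all scales, so it passes to each homogeneous part of the Taylor polynomial.\<close>
lemma taylor_part_harmonic:
  assumes f: "f \<in> mean_value_functions \<nu>" and T: "moll_taylor n f x = pf d \<phi>" and supp: "supp_in d \<phi>" and m: "m < n"
  shows "harmonic_coeffs (\<lambda>\<beta>. if expo_deg \<beta> = m then \<phi> \<beta> else 0)"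
proof -
  have n: "n > 0" using m by simp
  have cf: "continuous_on UNIV f" using f by (simp add: mean_value_functions_def)
  define \<psi> where "\<psi> = (\<lambda>m \<beta>. if expo_deg \<beta> = m then \<phi> \<beta> else 0)"
  define D where "D = CARD('n) * d"
  have supp\<psi>: "supp_in d (\<psi> m)" for m using supp by (auto simp: \<psi>_def supp_in_def)
  obtain R0 where "AE w in \<nu>. norm w \<le> R0" using bounded_AE by blast
  then have R: "AE w in \<nu>. norm w \<le> max R0 0" by eventually_elim simp
  obtain B where B: "\<And>z. norm z \<le> norm x + 2 \<Longrightarrow> \<bar>f z\<bar> \<le> B" "B \<ge> 0"
    using continuous_bounded_cball[OF cf] by metis
  have Bu: "\<bar>f (x + u)\<bar> \<le> B" if "norm u \<le> 2" for u
    using norm_triangle_ineq[of x u] that by (intro B(1)) linarith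
  define C where "C = 2 * 5 ^ n * B * measure lborel (cball (0 :: real ^ 'n) 2)"
  have C: "C \<ge> 0" unfolding C_def using B(2) by simp
  have err: "\<bar>pf d \<phi> v - moll n f (x + v)\<bar> \<le> C * norm v ^ n" if "norm v \<le> 1" for v
    using moll_taylor_error[OF cf n that Bu] unfolding C_def T by (simp add: abs_minus_commute)
  have int: "integrable \<nu> (\<lambda>w. pf d \<omega> (y + s *\<^sub>R w))" for \<omega> y s
    by (intro integrable_continuous continuous_on_compose2[OF continuous_on_pf[of UNIV]]) (auto intro!: continuous_intros)
  have mv: "pf d (\<psi> m) y = (\<integral>w. pf d (\<psi> m) (y + s *\<^sub>R w) \<partial>\<nu>)" if s: "s > 0" and mD: "m \<le> D" for y s
  proof -
    \<comment> \<open>The defect of the mean value property in the part of degree m. The sum of the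
      terms c j * r^j is the defect of the whole Taylor polynomial at scale r; the mollified
      function has no defect and is within order r^n of it, so the coefficients below n
      vanish.\<close>
    define c where "c = (\<lambda>m. pf d (\<psi> m) y - (\<integral>w. pf d (\<psi> m) (y + s *\<^sub>R w) \<partial>\<nu>))"
    \<comment> \<open>A bound for |y| and, almost surely, for |y + s w|; the summand 1 keeps it
      positive.\<close>
    define \<rho> where "\<rho> = norm y + s * max R0 0 + 1"
    have \<rho>: "\<rho> > 0" unfolding \<rho>_def using s by (intro add_nonneg_pos add_nonneg_nonneg) auto
    have "c m = 0"
    proof (rule poly_small_coeff_0[where ?r0.0 = "1 / \<rho>" and D = D and C = "2 * (C * \<rho> ^ n)" and n = n])
      fix r :: real assume r: "0 < r" "r \<le> 1 / \<rho>"
      have r\<rho>: "r * \<rho> \<le> 1" using r \<rho> by (simp add: le_divide_eq)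
      have small: "\<bar>pf d \<phi> (r *\<^sub>R v) - moll n f (x + r *\<^sub>R v)\<bar> \<le> C * \<rho> ^ n * r ^ n" if "norm v \<le> \<rho>" for v
      proof -
        have nv: "norm (r *\<^sub>R v) \<le> r * \<rho>" using r that by simp
        have "\<bar>pf d \<phi> (r *\<^sub>R v) - moll n f (x + r *\<^sub>R v)\<bar> \<le> C * norm (r *\<^sub>R v) ^ n"
          using nv r\<rho> by (intro err) simp
        also have "\<dots> \<le> C * (r * \<rho>) ^ n" using nv C by (intro mult_left_mono power_mono) auto
        finally show ?thesis by (simp add: power_mult_distrib mult_ac)
      qed
      have hint: "integrable \<nu> (\<lambda>w. pf d \<phi> (r *\<^sub>R (y + s *\<^sub>R w)) - moll n f (x + r *\<^sub>R (y + s *\<^sub>R w)))"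
        and split: "pf d \<phi> (r *\<^sub>R y) - (\<integral>w. pf d \<phi> (r *\<^sub>R (y + s *\<^sub>R w)) \<partial>\<nu>) = (pf d \<phi> (r *\<^sub>R y) - moll n f (x + r *\<^sub>R y)) - (\<integral>w. pf d \<phi> (r *\<^sub>R (y + s *\<^sub>R w)) - moll n f (x + r *\<^sub>R (y + s *\<^sub>R w)) \<partial>\<nu>)"
      proof -
        have eq: "x + r *\<^sub>R y + (r * s) *\<^sub>R w = x + r *\<^sub>R (y + s *\<^sub>R w)" for w
          by (simp add: scaleR_add_right add.assoc)
        have rs: "r * s > 0" using r s by simp
        note mvm = mean_value_moll[OF f n rs, of "x + r *\<^sub>R y", unfolded eq]
        have int1: "integrable \<nu> (\<lambda>w. pf d \<phi> (r *\<^sub>R (y + s *\<^sub>R w)))"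
          using int[of \<phi> "r *\<^sub>R y" "r * s"] by (simp add: scaleR_add_right)
        show "integrable \<nu> (\<lambda>w. pf d \<phi> (r *\<^sub>R (y + s *\<^sub>R w)) - moll n f (x + r *\<^sub>R (y + s *\<^sub>R w)))"
          using int1 mvm(1) by (rule Bochner_Integration.integrable_diff)
        have "(\<integral>w. pf d \<phi> (r *\<^sub>R (y + s *\<^sub>R w)) - moll n f (x + r *\<^sub>R (y + s *\<^sub>R w)) \<partial>\<nu>)
          = (\<integral>w. pf d \<phi> (r *\<^sub>R (y + s *\<^sub>R w)) \<partial>\<nu>) - moll n f (x + r *\<^sub>R y)"
          unfolding mvm(2) by (rule Bochner_Integration.integral_diff[OF int1 mvm(1)])
        then show "pf d \<phi> (r *\<^sub>R y) - (\<integral>w. pf d \<phi> (r *\<^sub>R (y + s *\<^sub>R w)) \<partial>\<nu>) = (pf d \<phi> (r *\<^sub>R y) - moll n f (x + r *\<^sub>R y)) - (\<integral>w. pf d \<phi> (r *\<^sub>R (y + s *\<^sub>R w)) - moll n f (x + r *\<^sub>R (y + s *\<^sub>R w)) \<partial>\<nu>)"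
          by simp
      qed
      have "(\<Sum>j\<le>D. c j * r ^ j) = (\<Sum>j\<le>D. pf d (\<psi> j) y * r ^ j) - (\<integral>w. (\<Sum>j\<le>D. pf d (\<psi> j) (y + s *\<^sub>R w) * r ^ j) \<partial>\<nu>)"
        unfolding c_def by (simp add: int left_diff_distrib sum_subtractf)
      also have "\<dots> = pf d \<phi> (r *\<^sub>R y) - (\<integral>w. pf d \<phi> (r *\<^sub>R (y + s *\<^sub>R w)) \<partial>\<nu>)"
        unfolding D_def \<psi>_def by (simp only: pf_homogeneous_sum)
      also note split
      finally have eq: "(\<Sum>j\<le>D. c j * r ^ j) = (pf d \<phi> (r *\<^sub>R y) - moll n f (x + r *\<^sub>R y)) - (\<integral>w. pf d \<phi> (r *\<^sub>R (y + s *\<^sub>R w)) - moll n f (x + r *\<^sub>R (y + s *\<^sub>R w)) \<partial>\<nu>)" .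
      have b1: "\<bar>pf d \<phi> (r *\<^sub>R y) - moll n f (x + r *\<^sub>R y)\<bar> \<le> C * \<rho> ^ n * r ^ n"
        using s by (intro small) (simp add: \<rho>_def)
      have b2: "\<bar>\<integral>w. pf d \<phi> (r *\<^sub>R (y + s *\<^sub>R w)) - moll n f (x + r *\<^sub>R (y + s *\<^sub>R w)) \<partial>\<nu>\<bar> \<le> C * \<rho> ^ n * r ^ n"
      proof -
        have "AE w in \<nu>. norm (pf d \<phi> (r *\<^sub>R (y + s *\<^sub>R w)) - moll n f (x + r *\<^sub>R (y + s *\<^sub>R w))) \<le> C * \<rho> ^ n * r ^ n"
          using R
        proof eventually_elim
          case (elim w)
          have "norm (y + s *\<^sub>R w) \<le> norm y + s * norm w" using norm_triangle_ineq[of y "s *\<^sub>R w"] s by simp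
          also have "s * norm w \<le> s * max R0 0" using elim s by (intro mult_left_mono) auto
          finally have "norm (y + s *\<^sub>R w) \<le> \<rho>" by (simp add: \<rho>_def)
          from small[OF this] show ?case by simp
        qed
        then have "(\<integral>w. norm (pf d \<phi> (r *\<^sub>R (y + s *\<^sub>R w)) - moll n f (x + r *\<^sub>R (y + s *\<^sub>R w))) \<partial>\<nu>) \<le> (\<integral>w. C * \<rho> ^ n * r ^ n \<partial>\<nu>)"
          using hint by (intro integral_mono_AE integrable_norm) auto
        also have "(\<integral>w. C * \<rho> ^ n * r ^ n \<partial>\<nu>) = C * \<rho> ^ n * r ^ n" by (simp add: prob_space)
        finally have "norm (\<integral>w. pf d \<phi> (r *\<^sub>R (y + s *\<^sub>R w)) - moll n f (x + r *\<^sub>R (y + s *\<^sub>R w)) \<partial>\<nu>) \<le> C * \<rho> ^ n * r ^ n"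
          by (rule order_trans[OF integral_norm_bound])
        then show ?thesis by (simp only: real_norm_def)
      qed
      show "\<bar>\<Sum>j\<le>D. c j * r ^ j\<bar> \<le> 2 * (C * \<rho> ^ n) * r ^ n"
        unfolding eq using b1 b2 by linarith
    qed (use \<rho> m mD in auto)
    then show ?thesis by (simp add: c_def)
  qed
  show ?thesis
  proof (cases "m \<le> D")
    case True
    have "pf d (\<psi> m) \<in> mean_value_functions \<nu>"
      unfolding mean_value_functions_def using mv[OF _ True] by (blast intro: continuous_on_pf)
    then show ?thesis using pf_mean_value_iff[OF supp\<psi>] by (simp add: \<psi>_def)
  next
    case False
    have "\<psi> m \<beta> = 0" for \<beta>
    proof (rule ccontr)
      assume nz: "\<psi> m \<beta> \<noteq> 0"
      then have "\<beta> \<in> expo_box d" using supp\<psi> unfolding supp_in_def by blast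
      then have "expo_deg \<beta> \<le> D" unfolding D_def by (rule expo_deg_le_box)
      then show False using nz False by (simp add: \<psi>_def split: if_splits)
    qed
    then have "\<psi> m = (\<lambda>_. 0)" by (rule ext)
    then have "harmonic_coeffs (\<psi> m)" by (simp add: harmonic_coeffs_def)
    then show ?thesis by (simp add: \<psi>_def)
  qed
qed


text \<open>Let K be twice the dimension and expand to order K + 1. The error has exponent K + 1,
  and the coefficient of t^K vanishes because K-fold differentiation along an axis kills harmonic
  families. What remains has degree below K, the form required by
  \<open>fd_pow_eq_0_if_local\<close>. The constant is uniform on balls because the other
  coefficients are integrals of f against fixed kernels.\<close>

lemma moll_local_poly:
  fixes i :: 'n
  assumes f: "f \<in> mean_value_functions \<nu>"
  shows "\<exists>C. \<forall>x. norm x \<le> \<rho> \<longrightarrow> (\<exists>p. degree p < 2 * CARD('n) \<and>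
     (\<forall>t. \<bar>t\<bar> \<le> 1 \<longrightarrow> \<bar>moll (2 * CARD('n) + 1) f (x + t *\<^sub>R axis i 1) - poly p t\<bar> \<le> C * \<bar>t\<bar> ^ (2 * CARD('n) + 1)))"
proof -
  define K where "K = 2 * CARD('n)"
  define n where "n = K + 1"
  have n: "n > 0" "K < n" "K > 0" by (simp_all add: n_def K_def)
  have cf: "continuous_on UNIV f" using f by (simp add: mean_value_functions_def)
  from trunc_taylor_axis[of n i] obtain \<kappa> where *: "(\<forall>m. continuous_on UNIV (\<kappa> m)) \<and> (\<forall>m u. norm u > 1 \<longrightarrow> \<kappa> m u = 0) \<and>
    (\<forall>(u :: real ^ 'n) t. trunc_taylor n (1 - u \<bullet> u) (2 * (u \<bullet> (t *\<^sub>R axis i 1)) - (t *\<^sub>R axis i 1) \<bullet> (t *\<^sub>R axis i 1 :: real ^ 'n))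
       = (\<Sum>m\<le>2 * n. \<kappa> m u * t ^ m))" ..
  note c\<kappa> = *[THEN conjunct1, rule_format] and \<kappa>0 = *[THEN conjunct2, THEN conjunct1, rule_format]
    and \<kappa> = *[THEN conjunct2, THEN conjunct2, rule_format]
  define A where "A = (\<lambda>x m. \<integral>u. f (x + u) * \<kappa> m u \<partial>lborel)"
  have cfx: "continuous_on UNIV (\<lambda>u. f (x + u))" for x by (rule continuous_shift[OF cf])
  have intA: "integrable lborel (\<lambda>u. f (x + u) * \<kappa> m u)" for x m
    by (rule integrable_continuous_support[of _ 1]) (auto intro!: continuous_intros cfx c\<kappa> simp: \<kappa>0)
  have expand: "moll_taylor n f x (t *\<^sub>R axis i 1) = (\<Sum>m\<le>2 * n. A x m * t ^ m)" for x t
  proof -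
    have "moll_taylor n f x (t *\<^sub>R axis i 1) = (\<integral>u. (\<Sum>m\<le>2 * n. f (x + u) * \<kappa> m u * t ^ m) \<partial>lborel)"
      unfolding moll_taylor_def \<kappa> by (simp only: sum_distrib_left mult.assoc)
    also have "\<dots> = (\<Sum>m\<le>2 * n. \<integral>u. f (x + u) * \<kappa> m u * t ^ m \<partial>lborel)"
      by (rule Bochner_Integration.integral_sum) (rule integrable_mult_left, rule intA)
    finally show ?thesis by (simp add: A_def)
  qed
  have AK: "A x K = 0" for x
  proof -
    obtain d \<phi> where supp: "supp_in d \<phi>" and T: "moll_taylor n f x = pf d \<phi>"
      using moll_taylor_polyfun[OF cf, of n x] unfolding polyfun_def by blast
    define b where "b = (\<lambda>m. pf d (\<lambda>\<beta>. if expo_deg \<beta> = m then \<phi> \<beta> else 0) (axis i 1))"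
    \<comment> \<open>On the axis only the monomial that is a pure power of the i-th variable
      survives; in degree K its coefficient is 0 by \<open>harmonic_coeffs_bounded\<close>.\<close>
    have bK: "b K = 0"
      unfolding b_def pf_def
    proof (intro sum.neutral ballI)
      fix \<beta> :: "'n \<Rightarrow> nat"
      show "(if expo_deg \<beta> = K then \<phi> \<beta> else 0) * dmon \<beta> (axis i 1) = 0"
      proof (cases "\<exists>j. j \<noteq> i \<and> \<beta> j \<noteq> 0")
        case True
        then obtain j where "j \<noteq> i" "\<beta> j \<noteq> 0" by blast
        then have "(axis i 1 :: real ^ 'n) $ j ^ \<beta> j / fact (\<beta> j) = 0" by (simp add: axis_def)
        then have "dmon \<beta> (axis i 1) = 0" unfolding dmon_def by (intro prod_zero) (auto intro: exI[of _ j])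
        then show ?thesis by simp
      next
        case False
        then have "(\<Sum>j\<in>UNIV. \<beta> j) = (\<Sum>j\<in>{i}. \<beta> j)" by (intro sum.mono_neutral_right) auto
        then have deg: "expo_deg \<beta> = \<beta> i" by (simp add: expo_deg_def)
        show ?thesis
        proof (cases "expo_deg \<beta> = K")
          case True
          have "(if expo_deg \<beta> = K then \<phi> \<beta> else 0) = 0"
            using harmonic_coeffs_bounded[OF taylor_part_harmonic[OF f T supp n(2)], of \<beta> i] deg True by (simp add: K_def)
          then show ?thesis by simp
        qed simp
      qed
    qed
    define M where "M = max (2 * n) (CARD('n) * d)"
    \<comment> \<open>The difference of the two expansions of the Taylor polynomial along the axis,
      by the kernels \<kappa> and by homogeneous parts.\<close>
    define e where "e = (\<lambda>m. (if m \<le> 2 * n then A x m else 0) - (if m \<le> CARD('n) * d then b m else 0))"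
    have "e K = 0"
    proof (rule pos_poly_eq_0D[where n = M])
      fix t :: real
      have "(\<Sum>m\<le>M. e m * t ^ m) = (\<Sum>m\<le>M. (if m \<le> 2 * n then A x m else 0) * t ^ m) - (\<Sum>m\<le>M. (if m \<le> CARD('n) * d then b m else 0) * t ^ m)"
        by (simp add: e_def left_diff_distrib sum_subtractf)
      also have "(\<Sum>m\<le>M. (if m \<le> 2 * n then A x m else 0) * t ^ m) = (\<Sum>m\<le>2 * n. A x m * t ^ m)"
        by (rule sum.mono_neutral_cong_right) (auto simp: M_def)
      also have "(\<Sum>m\<le>M. (if m \<le> CARD('n) * d then b m else 0) * t ^ m) = (\<Sum>m\<le>CARD('n) * d. b m * t ^ m)"
        by (rule sum.mono_neutral_cong_right) (auto simp: M_def)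
      also have "(\<Sum>m\<le>CARD('n) * d. b m * t ^ m) = moll_taylor n f x (t *\<^sub>R axis i 1)"
        unfolding T b_def pf_homogeneous_sum[of d \<phi> t "axis i 1"] ..
      finally show "(\<Sum>m\<le>M. e m * t ^ m) = 0" unfolding expand by simp
    qed (simp add: M_def n_def)
    then show ?thesis using bK by (simp add: e_def n_def)
  qed
  obtain B where B: "\<And>z. norm z \<le> \<rho> + 2 \<Longrightarrow> \<bar>f z\<bar> \<le> B" "B \<ge> 0"
    using continuous_bounded_cball[OF cf] by metis
  define k where "k = (\<lambda>m. \<integral>u. \<bar>\<kappa> m u\<bar> \<partial>lborel)"
  have int\<kappa>: "integrable lborel (\<kappa> m)" for m
    by (rule integrable_continuous_support[OF c\<kappa> \<kappa>0])
  have Abound: "\<bar>A x m\<bar> \<le> B * k m" if x: "norm x \<le> \<rho>" for x m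
  proof -
    have "\<bar>A x m\<bar> \<le> (\<integral>u. \<bar>f (x + u) * \<kappa> m u\<bar> \<partial>lborel)"
      unfolding A_def by (rule integral_abs_bound)
    also have "\<dots> \<le> (\<integral>u. B * \<bar>\<kappa> m u\<bar> \<partial>lborel)"
    proof (rule Bochner_Integration.integral_mono)
      show "integrable lborel (\<lambda>u. \<bar>f (x + u) * \<kappa> m u\<bar>)" by (intro integrable_abs intA)
      show "integrable lborel (\<lambda>u. B * \<bar>\<kappa> m u\<bar>)" by (intro integrable_mult_right integrable_abs int\<kappa>)
      fix u
      show "\<bar>f (x + u) * \<kappa> m u\<bar> \<le> B * \<bar>\<kappa> m u\<bar>"
      proof (cases "norm u \<le> 1")
        case True
        then have "\<bar>f (x + u)\<bar> \<le> B" using norm_triangle_ineq[of x u] x by (intro B(1)) linarith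
        then show ?thesis unfolding abs_mult by (rule mult_right_mono) simp
      qed (simp add: \<kappa>0)
    qed
    finally show ?thesis by (simp add: k_def)
  qed
  \<comment> \<open>The first summand bounds the Taylor remainder, the second the terms of degree n
    to 2n of the Taylor polynomial, where |t|^m \<le> |t|^n.\<close>
  define C where "C = 2 * 5 ^ n * B * measure lborel (cball (0 :: real ^ 'n) 2) + (\<Sum>m\<in>{n..2 * n}. B * k m)"
  have "\<exists>p. degree p < K \<and> (\<forall>t. \<bar>t\<bar> \<le> 1 \<longrightarrow> \<bar>moll n f (x + t *\<^sub>R axis i 1) - poly p t\<bar> \<le> C * \<bar>t\<bar> ^ n)"
    if x: "norm x \<le> \<rho>" for x
  proof (intro exI conjI allI impI)
    define p where "p = (\<Sum>m<K. monom (A x m) m)"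
    show "degree p < K"
    proof -
      have "degree p \<le> K - 1"
        unfolding p_def by (intro degree_sum_le) (auto intro!: order_trans[OF degree_monom_le])
      then show ?thesis using n by simp
    qed
    fix t :: real assume t: "\<bar>t\<bar> \<le> 1"
    have 1: "\<bar>moll n f (x + t *\<^sub>R axis i 1) - moll_taylor n f x (t *\<^sub>R axis i 1)\<bar> \<le> 2 * 5 ^ n * B * measure lborel (cball (0 :: real ^ 'n) 2) * \<bar>t\<bar> ^ n"
    proof -
      have Bu: "\<bar>f (x + u)\<bar> \<le> B" if "norm u \<le> 2" for u
        using norm_triangle_ineq[of x u] that x by (intro B(1)) linarith
      have nt: "norm (t *\<^sub>R axis i 1 :: real ^ 'n) = \<bar>t\<bar>" by simp
      from moll_taylor_error[OF cf n(1), of "t *\<^sub>R axis i 1" x B, unfolded nt, OF t Bu] show ?thesis .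
    qed
    have "moll_taylor n f x (t *\<^sub>R axis i 1) = (\<Sum>m<K. A x m * t ^ m) + (\<Sum>m\<in>{n..2 * n}. A x m * t ^ m)"
    proof -
      have "{..2 * n} = {..<K} \<union> ({K} \<union> {n..2 * n})" by (auto simp: n_def)
      then have "moll_taylor n f x (t *\<^sub>R axis i 1) = (\<Sum>m\<in>{..<K} \<union> ({K} \<union> {n..2 * n}). A x m * t ^ m)"
        unfolding expand by simp
      also have "\<dots> = (\<Sum>m<K. A x m * t ^ m) + (A x K * t ^ K + (\<Sum>m\<in>{n..2 * n}. A x m * t ^ m))"
        by (subst sum.union_disjoint; auto simp: n_def)+
      finally show ?thesis by (simp add: AK)
    qed
    moreover have "poly p t = (\<Sum>m<K. A x m * t ^ m)" by (simp add: p_def poly_sum poly_monom)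
    moreover have "\<bar>\<Sum>m\<in>{n..2 * n}. A x m * t ^ m\<bar> \<le> (\<Sum>m\<in>{n..2 * n}. B * k m) * \<bar>t\<bar> ^ n"
    proof -
      have "\<bar>\<Sum>m\<in>{n..2 * n}. A x m * t ^ m\<bar> \<le> (\<Sum>m\<in>{n..2 * n}. \<bar>A x m * t ^ m\<bar>)" by (rule sum_abs)
      also have "\<dots> \<le> (\<Sum>m\<in>{n..2 * n}. B * k m * \<bar>t\<bar> ^ n)"
      proof (rule sum_mono)
        fix m assume m: "m \<in> {n..2 * n}"
        have "\<bar>t ^ m\<bar> \<le> \<bar>t\<bar> ^ n" unfolding power_abs using m t by (intro power_decreasing) auto
        moreover have "0 \<le> B * k m" using Abound[OF x, of m] by linarith
        ultimately show "\<bar>A x m * t ^ m\<bar> \<le> B * k m * \<bar>t\<bar> ^ n"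
          unfolding abs_mult using Abound[OF x, of m] by (intro mult_mono) auto
      qed
      finally show ?thesis by (simp add: sum_distrib_right)
    qed
    ultimately show "\<bar>moll n f (x + t *\<^sub>R axis i 1) - poly p t\<bar> \<le> C * \<bar>t\<bar> ^ n"
      using 1 unfolding C_def distrib_right by linarith
  qed
  then show ?thesis unfolding n_def K_def by blast
qed

lemma fd_moll_eq_0:
  fixes i :: 'n
  assumes f: "f \<in> mean_value_functions \<nu>" and s: "s > 0"
  shows "(fd s ^^ (2 * CARD('n))) (\<lambda>t. moll (2 * CARD('n) + 1) f (x + t *\<^sub>R axis i 1)) 0 = 0"
proof -
  let ?\<rho> = "norm x + real (2 * CARD('n)) * s"
  obtain C where C: "\<And>x. norm x \<le> ?\<rho> \<Longrightarrow> \<exists>p. degree p < 2 * CARD('n) \<and>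
     (\<forall>t. \<bar>t\<bar> \<le> 1 \<longrightarrow> \<bar>moll (2 * CARD('n) + 1) f (x + t *\<^sub>R axis i 1) - poly p t\<bar> \<le> C * \<bar>t\<bar> ^ (2 * CARD('n) + 1))"
    using moll_local_poly[OF f, of ?\<rho> i] by blast
  show ?thesis
  proof (rule fd_pow_eq_0_if_local[OF s])
    fix x' :: real assume x': "0 \<le> x'" "x' \<le> 0 + real (2 * CARD('n)) * s"
    have "norm (x + x' *\<^sub>R axis i 1) \<le> norm x + norm (x' *\<^sub>R axis i 1 :: real ^ 'n)" by (rule norm_triangle_ineq)
    also have "norm (x' *\<^sub>R axis i 1 :: real ^ 'n) = x'" using x' by simp
    finally have "norm (x + x' *\<^sub>R axis i 1) \<le> ?\<rho>" using x' by simp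
    from C[OF this] show "\<exists>p. degree p < 2 * CARD('n) \<and>
     (\<forall>t. \<bar>t\<bar> \<le> 1 \<longrightarrow> \<bar>moll (2 * CARD('n) + 1) f (x + (x' + t) *\<^sub>R axis i 1) - poly p t\<bar> \<le> C * \<bar>t\<bar> ^ (2 * CARD('n) + 1))"
      by (simp only: scaleR_add_left add.assoc)
  qed
qed

text \<open>Dilating f takes the place of shrinking the kernel, so the results for the unit bump
  apply at every scale.\<close>

lemma mean_value_dilate:
  assumes f: "f \<in> mean_value_functions \<nu>" and e: "e > 0"
  shows "(\<lambda>x. f (e *\<^sub>R x)) \<in> mean_value_functions \<nu>"
  unfolding mean_value_functions_def
proof (intro CollectI conjI allI impI)
  have cf: "continuous_on UNIV f" using f by (simp add: mean_value_functions_def)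
  show "continuous_on UNIV (\<lambda>x. f (e *\<^sub>R x))"
    by (rule continuous_on_compose2[OF cf]) (auto intro!: continuous_intros)
  fix x :: "real ^ 'n" and r :: real assume r: "r > 0"
  have "f (e *\<^sub>R x) = (\<integral>y. f (e *\<^sub>R x + (e * r) *\<^sub>R y) \<partial>\<nu>)"
    using f mult_pos_pos[OF e r] unfolding mean_value_functions_def by blast
  then show "f (e *\<^sub>R x) = (\<integral>y. f (e *\<^sub>R (x + r *\<^sub>R y)) \<partial>\<nu>)"
    by (simp add: scaleR_add_right)
qed

text \<open>The difference of f, as a function G of the base point, has bump average 0 at every
  scale e: that average is a difference with step s / e of the mollification of the dilated f.
  Continuity then gives G = 0.\<close>

lemma fd_eq_0:
  fixes i :: 'n
  assumes f: "f \<in> mean_value_functions \<nu>" and s: "s > 0"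
  shows "(fd s ^^ (2 * CARD('n))) (\<lambda>t. f (x + t *\<^sub>R axis i 1)) 0 = 0"
proof -
  let ?K = "2 * CARD('n)"
  let ?n = "?K + 1"
  obtain c where c: "\<And>s h x. (fd s ^^ ?K) h x = (\<Sum>j\<le>?K. c j * h (x + real j * s))"
    using fd_pow_explicit by blast
  have cf: "continuous_on UNIV f" using f by (simp add: mean_value_functions_def)
  define G where "G = (\<lambda>z. \<Sum>j\<le>?K. c j * f (z + (real j * s) *\<^sub>R axis i 1))"
  have "G x = 0"
  proof (rule eq_0_if_bump_averages_0[where n = ?n])
    show "continuous_on UNIV G"
      unfolding G_def by (intro continuous_intros continuous_on_compose2[OF cf]) auto
    fix e :: real assume e: "e > 0"
    let ?f = "\<lambda>x. f (e *\<^sub>R x)" and ?y = "(1 / e) *\<^sub>R x"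
    have cfe: "continuous_on UNIV (\<lambda>u. f (e *\<^sub>R (v + u)))" for v
      by (rule continuous_on_compose2[OF cf]) (auto intro!: continuous_intros)
    have "s / e > 0" using s e by simp
    from fd_moll_eq_0[OF mean_value_dilate[OF f e] this, of ?y i]
    have "0 = (\<Sum>j\<le>?K. c j * moll ?n ?f (?y + (real j * (s / e)) *\<^sub>R axis i 1))"
      unfolding c by simp
    also have "\<dots> = (\<Sum>j\<le>?K. \<integral>u. c j * (f (x + (real j * s) *\<^sub>R axis i 1 + e *\<^sub>R u) * bump ?n u) \<partial>lborel)"
      unfolding moll_def using e by (simp add: scaleR_add_right)
    also have "\<dots> = (\<integral>u. (\<Sum>j\<le>?K. c j * (f (x + (real j * s) *\<^sub>R axis i 1 + e *\<^sub>R u) * bump ?n u)) \<partial>lborel)"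
    proof (rule Bochner_Integration.integral_sum[symmetric])
      fix j
      have "continuous_on UNIV (\<lambda>u. f (x + (real j * s) *\<^sub>R axis i 1 + e *\<^sub>R u))"
        by (rule continuous_on_compose2[OF cf]) (auto intro!: continuous_intros)
      then have "integrable lborel (\<lambda>u. f (x + (real j * s) *\<^sub>R axis i 1 + e *\<^sub>R u) * bump ?n u)"
        by (intro integrable_continuous_support[of _ 1]) (auto intro!: continuous_intros simp: bump_0)
      then show "integrable lborel (\<lambda>u. c j * (f (x + (real j * s) *\<^sub>R axis i 1 + e *\<^sub>R u) * bump ?n u))"
        by (rule integrable_mult_right)
    qed
    also have "\<dots> = (\<integral>u. G (x + e *\<^sub>R u) * bump ?n u \<partial>lborel)"
      unfolding G_def sum_distrib_right by (simp only: add_ac mult_ac)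
    finally show "(\<integral>u. G (x + e *\<^sub>R u) * bump ?n u \<partial>lborel) = 0" by simp
  qed simp
  then show ?thesis unfolding c G_def by simp
qed

end

section \<open>Functions polynomial in each coordinate\<close>

definition vupd :: "real ^ 'n \<Rightarrow> 'n \<Rightarrow> real \<Rightarrow> real ^ 'n" where
  "vupd x i t = (\<chi> j. if j = i then t else x $ j)"

lemma vupd_eq: "vupd x i t = vupd x i 0 + t *\<^sub>R axis i (1 :: real)" for x :: "real ^ 'n::finite"
  by (simp add: vupd_def vec_eq_iff axis_def)

lemma vupd_commute: "i \<noteq> j \<Longrightarrow> vupd (vupd x i s) j t = vupd (vupd x j t) i s"
  by (auto simp: vupd_def vec_eq_iff)

lemma vupd_component: "vupd x i s $ j = (if j = i then s else x $ j)"
  by (simp add: vupd_def)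

lemma vupd_same [simp]: "vupd x i (x $ i) = x"
  by (auto simp: vupd_def vec_eq_iff)

text \<open>Induction on the set \<open>T\<close> of coordinates that f may depend on. Interpolating
  in one of them leaves functions with that coordinate frozen at a node; freezing commutes with
  interpolation in the other coordinates, so these functions satisfy the same hypotheses with a
  smaller \<open>T\<close>. The nodes and the polynomials \<open>L l\<close> are common to all
  lines.\<close>

lemma polyfun_if_coordinatewise_interpolated:
  fixes f :: "real ^ 'n::finite \<Rightarrow> real"
  assumes "finite T" and L: "\<And>x i. i \<in> T \<Longrightarrow> f x = (\<Sum>l<K. poly (L l) (x $ i) * f (vupd x i (real l)))"
    and dep: "\<And>x y. (\<And>i. i \<in> T \<Longrightarrow> x $ i = y $ i) \<Longrightarrow> f x = f y"
  shows "f \<in> polyfun"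
  using assms
proof (induction T arbitrary: f rule: finite_induct)
  case empty
  have eq: "(\<lambda>_. f 0) = f" by (rule ext, rule empty.prems(2)) simp
  have "(\<lambda>_. f 0) \<in> polyfun" by (rule polyfun_const)
  from back_subst[of "\<lambda>g. g \<in> polyfun", OF this eq] show ?case .
next
  case (insert i T)
  have F: "(\<lambda>x. f (vupd x i (real l))) \<in> polyfun" for l
  proof (rule insert.IH)
    fix x j assume j: "j \<in> T"
    then have "i \<noteq> j" using insert.hyps by blast
    have "f (vupd x i (real l)) = (\<Sum>m<K. poly (L m) (vupd x i (real l) $ j) * f (vupd (vupd x i (real l)) j (real m)))"
      using j by (intro insert.prems) simp
    then show "f (vupd x i (real l)) = (\<Sum>m<K. poly (L m) (x $ j) * f (vupd (vupd x j (real m)) i (real l)))"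
      unfolding vupd_commute[OF \<open>i \<noteq> j\<close>] vupd_component using \<open>i \<noteq> j\<close> by simp
  next
    fix x y :: "real ^ 'n" assume "\<And>j. j \<in> T \<Longrightarrow> x $ j = y $ j"
    then show "f (vupd x i (real l)) = f (vupd y i (real l))"
      by (intro insert.prems) (auto simp: vupd_component)
  qed
  have P: "(\<lambda>x :: real ^ 'n. poly p (x $ i)) \<in> polyfun" for p
    unfolding poly_altdef by (intro polyfun_sum polyfun_mult polyfun_const polyfun_power polyfun_component)
  have eq: "(\<lambda>x. \<Sum>l<K. poly (L l) (x $ i) * f (vupd x i (real l))) = f"
    by (rule ext, rule insert.prems(1)[symmetric]) simp
  have "(\<lambda>x. \<Sum>l<K. poly (L l) (x $ i) * f (vupd x i (real l))) \<in> polyfun"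
    by (intro polyfun_sum polyfun_mult P F)
  from back_subst[of "\<lambda>g. g \<in> polyfun", OF this eq] show ?case .
qed

lemma (in cube_measure) mean_value_polyfun: "mean_value_functions \<nu> \<subseteq> polyfun"
proof
  fix f assume f: "f \<in> mean_value_functions \<nu>"
  then have cf: "continuous_on UNIV f" by (simp add: mean_value_functions_def)
  let ?K = "2 * CARD('n)"
  have "\<exists>c. \<forall>h x. (fd 1 ^^ j) h x = (\<Sum>l\<le>j. c l * h (x + real l))" for j
  proof -
    obtain c where "\<And>s h x. (fd s ^^ j) h x = (\<Sum>l\<le>j. c l * h (x + real l * s))"
      using fd_pow_explicit[of j] by blast
    from this[of 1] show ?thesis by auto
  qed
  then obtain c where c: "\<And>j h x. (fd 1 ^^ j) h x = (\<Sum>l\<le>j. c j l * h (x + real l))" by metis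
  \<comment> \<open>Newton's formula rearranged by nodes: the weight of the value at l, the same for
    every function.\<close>
  define L where "L = (\<lambda>l. \<Sum>j | j < ?K \<and> l \<le> j. smult (c j l) (newton_poly j))"
  show "f \<in> polyfun"
  proof (rule polyfun_if_coordinatewise_interpolated[of UNIV, where K = ?K and L = L])
    fix x :: "real ^ 'n" and i :: 'n
    define h where "h = (\<lambda>t. f (vupd x i t))"
    have he: "h = (\<lambda>t. f (vupd x i 0 + t *\<^sub>R axis i 1))" unfolding h_def vupd_eq[of x i, symmetric] ..
    have ch: "continuous_on UNIV h"
      unfolding he by (rule continuous_on_compose2[OF cf]) (auto intro!: continuous_intros)
    have "(fd s ^^ ?K) h t = 0" if s: "s > 0" for s t
    proof -
      have "(fd s ^^ ?K) h t = (fd s ^^ ?K) (\<lambda>u. h (t + u)) 0" by (simp add: fd_pow_shift)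
      also have "(\<lambda>u. h (t + u)) = (\<lambda>u. f ((vupd x i 0 + t *\<^sub>R axis i 1) + u *\<^sub>R axis i 1))"
        by (simp add: he scaleR_add_left add.assoc)
      finally show ?thesis using fd_eq_0[OF f s] by simp
    qed
    then have "h (x $ i) = (\<Sum>j<?K. poly (newton_poly j) (x $ i) * (fd 1 ^^ j) h 0)"
      by (rule fd_eq_0_imp_poly[OF ch])
    also have "\<dots> = (\<Sum>j<?K. \<Sum>l\<le>j. poly (newton_poly j) (x $ i) * (c j l * h (real l)))"
      unfolding c by (simp add: sum_distrib_left)
    also have "\<dots> = (\<Sum>j<?K. \<Sum>l | l < ?K \<and> l \<le> j. poly (newton_poly j) (x $ i) * (c j l * h (real l)))"
      by (intro sum.cong refl) auto
    also have "\<dots> = (\<Sum>l<?K. \<Sum>j | j < ?K \<and> l \<le> j. poly (newton_poly j) (x $ i) * (c j l * h (real l)))"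
      using sum.swap_restrict[of "{..<?K}" "{..<?K}" "\<lambda>j l. poly (newton_poly j) (x $ i) * (c j l * h (real l))" "\<lambda>j l. l \<le> j"] by simp
    also have "\<dots> = (\<Sum>l<?K. poly (L l) (x $ i) * h (real l))"
      by (simp add: L_def poly_sum sum_distrib_left sum_distrib_right mult_ac)
    finally show "f x = (\<Sum>l<?K. poly (L l) (x $ i) * f (vupd x i (real l)))"
      unfolding h_def vupd_same .
  next
    fix x y :: "real ^ 'n" assume "\<And>i. i \<in> UNIV \<Longrightarrow> x $ i = y $ i"
    then have "x = y" by (simp add: vec_eq_iff)
    then show "f x = f y" by simp
  qed simp
qed

subsection \<open>Hausdorff measure\<close>

definition hausdorff_pre :: "nat \<Rightarrow> real \<Rightarrow> 'a::metric_space set \<Rightarrow> ennreal" where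
  "hausdorff_pre d \<delta> A =
     (INF U\<in>{U :: nat \<Rightarrow> 'a set. (\<forall>i. bounded (U i) \<and> diameter (U i) \<le> \<delta>) \<and> A \<subseteq> (\<Union>i. U i)}.
        suminf (\<lambda>i. hausdorff_gauge d (U i)))"

lemma hausdorff_outer_eq: "hausdorff_outer d A = (SUP \<delta>\<in>{0<..}. hausdorff_pre d \<delta> A)"
  by (simp add: hausdorff_outer_def hausdorff_pre_def)

lemma hausdorff_pre_le:
  "(\<And>i. bounded (U i)) \<Longrightarrow> (\<And>i. diameter (U i) \<le> \<delta>) \<Longrightarrow> A \<subseteq> (\<Union>i. U i) \<Longrightarrow>
     hausdorff_pre d \<delta> A \<le> (suminf (\<lambda>i. hausdorff_gauge d (U i)))" for U :: "nat \<Rightarrow> _"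
  unfolding hausdorff_pre_def by (rule INF_lower) auto

lemma hausdorff_pre_greatest:
  assumes "\<And>U :: nat \<Rightarrow> _. (\<And>i. bounded (U i)) \<Longrightarrow> (\<And>i. diameter (U i) \<le> \<delta>) \<Longrightarrow> A \<subseteq> (\<Union>i. U i) \<Longrightarrow>
     c \<le> (suminf (\<lambda>i. hausdorff_gauge d (U i)))"
  shows "c \<le> hausdorff_pre d \<delta> A"
  unfolding hausdorff_pre_def by (rule INF_greatest) (use assms in auto)

lemma hausdorff_pre_mono: "A \<subseteq> B \<Longrightarrow> hausdorff_pre d \<delta> A \<le> hausdorff_pre d \<delta> B"
  unfolding hausdorff_pre_def by (rule INF_superset_mono) auto

lemma hausdorff_pre_antimono: "\<delta> \<le> \<delta>' \<Longrightarrow> hausdorff_pre d \<delta>' A \<le> hausdorff_pre d \<delta> A"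
  unfolding hausdorff_pre_def by (rule INF_superset_mono) (auto intro: order_trans)

lemma hausdorff_gauge_empty [simp]: "hausdorff_gauge d {} = 0"
  by (simp add: hausdorff_gauge_def)

lemma hausdorff_pre_single:
  assumes "bounded U" "diameter U \<le> \<delta>" "0 \<le> \<delta>"
  shows "hausdorff_pre d \<delta> U \<le> hausdorff_gauge d U"
proof -
  have "hausdorff_pre d \<delta> U \<le> (suminf (\<lambda>i. hausdorff_gauge d (if i = (0::nat) then U else {})))"
    using assms by (intro hausdorff_pre_le) auto
  also have "\<dots> = (\<Sum>i\<in>{0::nat}. hausdorff_gauge d (if i = 0 then U else {}))"
    by (rule suminf_finite) auto
  finally show ?thesis by simp
qed

lemma hausdorff_pre_empty: "0 \<le> \<delta> \<Longrightarrow> hausdorff_pre d \<delta> {} = 0"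
  using hausdorff_pre_single[of "{}" \<delta> d] by simp

lemma hausdorff_pre_subadd: "hausdorff_pre d \<delta> (\<Union>i. A i) \<le> (suminf (\<lambda>i. hausdorff_pre d \<delta> (A i)))" for A :: "nat \<Rightarrow> _"
proof (rule ennreal_le_epsilon)
  fix e :: real assume e: "0 < e" and fin: "(suminf (\<lambda>n. hausdorff_pre d \<delta> (A n))) < top"
  have "\<exists>U :: nat \<Rightarrow> _. (\<forall>i. bounded (U i) \<and> diameter (U i) \<le> \<delta>) \<and> A n \<subseteq> (\<Union>i. U i) \<and>
      (suminf (\<lambda>i. hausdorff_gauge d (U i))) \<le> hausdorff_pre d \<delta> (A n) + e * (1/2) ^ Suc n" for n
  proof -
    have "hausdorff_pre d \<delta> (A n) < hausdorff_pre d \<delta> (A n) + e * (1/2) ^ Suc n"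
      using e fin by (auto simp add: less_top dest!: ennreal_suminf_lessD)
    then obtain U where U: "U \<in> {U :: nat \<Rightarrow> _. (\<forall>i. bounded (U i) \<and> diameter (U i) \<le> \<delta>) \<and> A n \<subseteq> (\<Union>i. U i)}"
      "(suminf (\<lambda>i. hausdorff_gauge d (U i))) < hausdorff_pre d \<delta> (A n) + e * (1/2) ^ Suc n"
      unfolding hausdorff_pre_def INF_less_iff by blast
    have "(suminf (\<lambda>i. hausdorff_gauge d (U i))) \<le> hausdorff_pre d \<delta> (A n) + e * (1/2) ^ Suc n"
      using U(2) by (rule less_imp_le)
    then show ?thesis using U(1) by blast
  qed
  then obtain U :: "nat \<Rightarrow> nat \<Rightarrow> _" where U: "\<And>n i. bounded (U n i)" "\<And>n i. diameter (U n i) \<le> \<delta>"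
    "\<And>n. A n \<subseteq> (\<Union>i. U n i)"
    "\<And>n. (suminf (\<lambda>i. hausdorff_gauge d (U n i))) \<le> hausdorff_pre d \<delta> (A n) + e * (1/2) ^ Suc n"
    by metis
  define W where "W = (\<lambda>p. U (fst (prod_decode p)) (snd (prod_decode p)))"
  have "(\<Union>i. A i) \<subseteq> (\<Union>p. W p)"
  proof
    fix x assume "x \<in> (\<Union>i. A i)"
    then obtain n where "x \<in> A n" by blast
    then obtain i where "x \<in> U n i" using U(3) by blast
    then have "x \<in> W (prod_encode (n, i))" by (simp add: W_def)
    then show "x \<in> (\<Union>p. W p)" by blast
  qed
  then have "hausdorff_pre d \<delta> (\<Union>i. A i) \<le> (suminf (\<lambda>p. hausdorff_gauge d (W p)))"
    by (intro hausdorff_pre_le) (auto simp: W_def U)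
  also have "\<dots> = (suminf (\<lambda>n. suminf (\<lambda>i. hausdorff_gauge d (U n i))))"
    unfolding W_def
    using suminf_ennreal_2dimen[of "\<lambda>n. suminf (\<lambda>i. hausdorff_gauge d (U n i))" "\<lambda>p. hausdorff_gauge d (U (fst p) (snd p))"] by simp
  also have "\<dots> \<le> (suminf (\<lambda>n. hausdorff_pre d \<delta> (A n) + e * (1/2) ^ Suc n))"
    by (intro suminf_le allI U summableI)
  also have "\<dots> = (suminf (\<lambda>n. hausdorff_pre d \<delta> (A n))) + (suminf (\<lambda>n. ennreal e * ennreal ((1/2) ^ Suc n)))"
    using e by (subst suminf_add[symmetric])
      (auto simp del: ennreal_suminf_cmult simp add: ennreal_mult[symmetric])
  also have "\<dots> = (suminf (\<lambda>n. hausdorff_pre d \<delta> (A n))) + e"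
    unfolding ennreal_suminf_cmult
    by (subst suminf_ennreal_eq[OF zero_le_power power_half_series]) auto
  finally show "hausdorff_pre d \<delta> (\<Union>i. A i) \<le> (suminf (\<lambda>n. hausdorff_pre d \<delta> (A n))) + e" .
qed

lemma hausdorff_pre_le_outer: "\<delta> > 0 \<Longrightarrow> hausdorff_pre d \<delta> A \<le> hausdorff_outer d A"
  unfolding hausdorff_outer_eq by (rule SUP_upper) simp

lemma hausdorff_outer_mono: "A \<subseteq> B \<Longrightarrow> hausdorff_outer d A \<le> hausdorff_outer d B"
  unfolding hausdorff_outer_eq by (intro SUP_mono) (auto intro: hausdorff_pre_mono)

lemma hausdorff_outer_empty: "hausdorff_outer d {} = 0"
  unfolding hausdorff_outer_eq by (auto simp: hausdorff_pre_empty)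

lemma hausdorff_outer_subadd: "hausdorff_outer d (\<Union>i. A i) \<le> (suminf (\<lambda>i. hausdorff_outer d (A i)))" for A :: "nat \<Rightarrow> _"
  unfolding hausdorff_outer_eq[of d "\<Union>i. A i"]
proof (rule SUP_least)
  fix \<delta> :: real assume "\<delta> \<in> {0<..}"
  have "hausdorff_pre d \<delta> (\<Union>i. A i) \<le> (suminf (\<lambda>i. hausdorff_pre d \<delta> (A i)))" by (rule hausdorff_pre_subadd)
  also have "\<dots> \<le> (suminf (\<lambda>i. hausdorff_outer d (A i)))"
    using \<open>\<delta> \<in> {0<..}\<close> by (intro suminf_le allI summableI hausdorff_pre_le_outer) auto
  finally show "hausdorff_pre d \<delta> (\<Union>i. A i) \<le> (suminf (\<lambda>i. hausdorff_outer d (A i)))" .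
qed

lemma hausdorff_outer_Un: "hausdorff_outer d (A \<union> B) \<le> hausdorff_outer d A + hausdorff_outer d B"
proof -
  let ?S = "\<lambda>i :: nat. if i = 0 then A else if i = 1 then B else {}"
  have "A \<union> B = (\<Union>i. ?S i)" by (auto split: if_splits)
  then have "hausdorff_outer d (A \<union> B) \<le> (suminf (\<lambda>i. hausdorff_outer d (?S i)))"
    using hausdorff_outer_subadd[of d ?S] by simp
  also have "\<dots> = (\<Sum>i\<in>{0, 1}. hausdorff_outer d (?S i))"
    by (rule suminf_finite) (auto simp: hausdorff_outer_empty)
  finally show ?thesis by simp
qed

text \<open>A set of diameter at most \<delta> cannot meet both parts, so each cover splits into a
  cover of \<open>A\<close> and a cover of \<open>B\<close>.\<close>

lemma hausdorff_pre_separated: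
  assumes sep: "\<And>a b. a \<in> A \<Longrightarrow> b \<in> B \<Longrightarrow> dist a b > \<delta>"
  shows "hausdorff_pre d \<delta> A + hausdorff_pre d \<delta> B \<le> hausdorff_pre d \<delta> (A \<union> B)"
proof (rule hausdorff_pre_greatest)
  fix U :: "nat \<Rightarrow> 'a set"
  assume b: "\<And>i. bounded (U i)" and diam: "\<And>i. diameter (U i) \<le> \<delta>" and cov: "A \<union> B \<subseteq> (\<Union>i. U i)"
  define V where "V = (\<lambda>i. if U i \<inter> A \<noteq> {} then U i else {})"
  define W where "W = (\<lambda>i. if U i \<inter> A \<noteq> {} then {} else U i)"
  have \<delta>: "0 \<le> \<delta>" using diameter_ge_0[OF b] diam order_trans by blast
  have "hausdorff_pre d \<delta> A \<le> (suminf (\<lambda>i. hausdorff_gauge d (V i)))"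
  proof (rule hausdorff_pre_le)
    show "A \<subseteq> (\<Union>i. V i)"
    proof
      fix x assume x: "x \<in> A"
      then obtain i where "x \<in> U i" using cov by blast
      then have "x \<in> V i" using x by (auto simp: V_def)
      then show "x \<in> (\<Union>i. V i)" by blast
    qed
  qed (auto simp: V_def b diam \<delta>)
  moreover have "hausdorff_pre d \<delta> B \<le> (suminf (\<lambda>i. hausdorff_gauge d (W i)))"
  proof (rule hausdorff_pre_le)
    show "B \<subseteq> (\<Union>i. W i)"
    proof
      fix x assume x: "x \<in> B"
      then obtain i where i: "x \<in> U i" using cov by blast
      have "U i \<inter> A = {}"
      proof (rule ccontr)
        assume "U i \<inter> A \<noteq> {}"
        then obtain a where a: "a \<in> U i" "a \<in> A" by blast
        have "dist a x \<le> diameter (U i)" using b a i diameter_bounded_bound by blast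
        then show False using sep[OF a(2) x] diam[of i] by linarith
      qed
      then have "x \<in> W i" using i by (simp add: W_def)
      then show "x \<in> (\<Union>i. W i)" by blast
    qed
  qed (auto simp: W_def b diam \<delta>)
  ultimately have "hausdorff_pre d \<delta> A + hausdorff_pre d \<delta> B \<le> (suminf (\<lambda>i. hausdorff_gauge d (V i))) + (suminf (\<lambda>i. hausdorff_gauge d (W i)))"
    by (rule add_mono)
  also have "\<dots> = (suminf (\<lambda>i. hausdorff_gauge d (V i) + hausdorff_gauge d (W i)))"
    by (intro suminf_add summableI)
  also have "\<dots> = (suminf (\<lambda>i. hausdorff_gauge d (U i)))"
    by (intro suminf_cong) (auto simp: V_def W_def)
  finally show "hausdorff_pre d \<delta> A + hausdorff_pre d \<delta> B \<le> (suminf (\<lambda>i. hausdorff_gauge d (U i)))" .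
qed

lemma hausdorff_outer_separated:
  assumes \<eta>: "\<eta> > 0" and sep: "\<And>a b. a \<in> A \<Longrightarrow> b \<in> B \<Longrightarrow> \<eta> \<le> dist a b"
  shows "hausdorff_outer d A + hausdorff_outer d B \<le> hausdorff_outer d (A \<union> B)"
proof -
  have le: "hausdorff_pre d \<delta>1 A + hausdorff_pre d \<delta>2 B \<le> hausdorff_outer d (A \<union> B)" if "\<delta>1 > 0" "\<delta>2 > 0" for \<delta>1 \<delta>2
  proof -
    let ?\<delta> = "min (\<eta> / 2) (min \<delta>1 \<delta>2)"
    have "hausdorff_pre d \<delta>1 A + hausdorff_pre d \<delta>2 B \<le> hausdorff_pre d ?\<delta> A + hausdorff_pre d ?\<delta> B"
      by (intro add_mono hausdorff_pre_antimono) auto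
    also have "\<dots> \<le> hausdorff_pre d ?\<delta> (A \<union> B)"
    proof (rule hausdorff_pre_separated)
      fix a b assume "a \<in> A" "b \<in> B"
      then have "\<eta> \<le> dist a b" by (rule sep)
      moreover have "?\<delta> \<le> \<eta> / 2" by simp
      ultimately show "?\<delta> < dist a b" using \<eta> by linarith
    qed
    also have "\<dots> \<le> hausdorff_outer d (A \<union> B)"
      using that \<eta> by (intro hausdorff_pre_le_outer) auto
    finally show ?thesis .
  qed
  have "hausdorff_outer d A + hausdorff_pre d \<delta>2 B \<le> hausdorff_outer d (A \<union> B)" if "\<delta>2 > 0" for \<delta>2
    unfolding hausdorff_outer_eq[of d A]
    using le that by (subst ennreal_SUP_add_left[symmetric]) (auto intro!: SUP_least)
  note le_B = this
  show ?thesis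
    unfolding hausdorff_outer_eq[of d B]
    by (subst ennreal_SUP_add_right) (auto intro!: SUP_least le_B)
qed

text \<open>Caratheodory's criterion: the shells \<open>R j\<close> of the complement are pairwise separated apart from neighbours,
  so their outer measures are summable and the tails account for the gap between \<open>A - F\<close> and the sets at
  positive distance from \<open>F\<close>.\<close>
lemma hausdorff_outer_closed:
  fixes F :: "'a::metric_space set"
  assumes F: "closed F"
  shows "hausdorff_outer d (A \<inter> F) + hausdorff_outer d (A - F) \<le> hausdorff_outer d A"
proof (cases "F = {} \<or> hausdorff_outer d A = top")
  case True
  then show ?thesis by (auto simp: hausdorff_outer_empty)
next
  case False
  then have ne: "F \<noteq> {}" and fin: "hausdorff_outer d A < top" by (auto simp: less_top)
  define u where "u = (\<lambda>x. infdist x F)"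
  have u: "\<bar>u x - u y\<bar> \<le> dist x y" for x y unfolding u_def by (rule infdist_triangle_abs)
  have u0: "u x > 0" if "x \<notin> F" for x
    using that F ne in_closed_iff_infdist_zero[of F x] infdist_nonneg[of x F] unfolding u_def by linarith
  have uF: "u x = 0" if "x \<in> F" for x using that by (simp add: u_def)
  define R where "R = (\<lambda>j :: nat. {x \<in> A. 1 / real (j + 2) \<le> u x \<and> u x < 1 / real (j + 1)})"
  define Q where "Q = (\<lambda>j :: nat. {x \<in> A. 1 / real (j + 1) \<le> u x})"
  have Q: "hausdorff_outer d (A \<inter> F) + hausdorff_outer d (Q j) \<le> hausdorff_outer d A" for j
  proof -
    have "hausdorff_outer d (A \<inter> F) + hausdorff_outer d (Q j) \<le> hausdorff_outer d (A \<inter> F \<union> Q j)"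
    proof (rule hausdorff_outer_separated)
      fix a b assume "a \<in> A \<inter> F" "b \<in> Q j"
      then have "u a = 0" "1 / real (j + 1) \<le> u b" by (auto simp: Q_def uF)
      then show "1 / real (j + 1) \<le> dist a b" using u[of a b] by linarith
    qed simp
    also have "\<dots> \<le> hausdorff_outer d A" by (rule hausdorff_outer_mono) (auto simp: Q_def)
    finally show ?thesis .
  qed
  have alt: "(\<Sum>j<m. hausdorff_outer d (R (2 * j + b))) \<le> hausdorff_outer d (\<Union>j<m. R (2 * j + b))" for m b
  proof (induction m)
    case (Suc m)
    \<comment> \<open>The gap in the values of u between the shell with index 2m + b and all earlier
      shells of the same parity. It is used for m > 0; at m = b = 0 the first fraction would be 1 /
      0 = 0.\<close>
    let ?\<eta> = "1 / real (2 * m + b) - 1 / real (2 * m + b + 1)"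
    show ?case
    proof (cases "m = 0")
      case False
      have \<eta>: "?\<eta> > 0" using False by (simp add: divide_simps)
      have "(\<Sum>j<Suc m. hausdorff_outer d (R (2 * j + b))) \<le> hausdorff_outer d (\<Union>j<m. R (2 * j + b)) + hausdorff_outer d (R (2 * m + b))"
        using Suc.IH by (simp add: add_right_mono)
      also have "\<dots> \<le> hausdorff_outer d ((\<Union>j<m. R (2 * j + b)) \<union> R (2 * m + b))"
      proof (rule hausdorff_outer_separated[OF \<eta>])
        fix x y assume "x \<in> (\<Union>j<m. R (2 * j + b))" "y \<in> R (2 * m + b)"
        then obtain j where j: "j < m" "1 / real (2 * j + b + 2) \<le> u x" and y: "u y < 1 / real (2 * m + b + 1)"
          by (auto simp: R_def)
        have "1 / real (2 * m + b) \<le> 1 / real (2 * j + b + 2)" using j(1) by (intro divide_left_mono) auto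
        then show "?\<eta> \<le> dist x y" using j(2) y u[of x y] by linarith
      qed
      also have "(\<Union>j<m. R (2 * j + b)) \<union> R (2 * m + b) = (\<Union>j<Suc m. R (2 * j + b))"
        by (auto simp: less_Suc_eq)
      finally show ?thesis .
    next
      case True
      have "{..<Suc 0} = {0}" by auto
      then show ?thesis by (simp add: True)
    qed
  qed simp
  have alt_le: "(suminf (\<lambda>j. hausdorff_outer d (R (2 * j + b)))) \<le> hausdorff_outer d A" for b
    unfolding suminf_eq_SUP
  proof (rule SUP_least)
    fix m
    have "(\<Sum>j<m. hausdorff_outer d (R (2 * j + b))) \<le> hausdorff_outer d (\<Union>j<m. R (2 * j + b))" by (rule alt)
    also have "\<dots> \<le> hausdorff_outer d A" by (rule hausdorff_outer_mono) (auto simp: R_def)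
    finally show "(\<Sum>j<m. hausdorff_outer d (R (2 * j + b))) \<le> hausdorff_outer d A" .
  qed
  have partial: "(\<Sum>j<2 * m. hausdorff_outer d (R j)) = (\<Sum>j<m. hausdorff_outer d (R (2 * j + 0))) + (\<Sum>j<m. hausdorff_outer d (R (2 * j + 1)))" for m
    by (induction m) (simp_all add: add_ac)
  have "(suminf (\<lambda>j. hausdorff_outer d (R j))) \<le> hausdorff_outer d A + hausdorff_outer d A"
    unfolding suminf_eq_SUP
  proof (rule SUP_least)
    fix m
    have "(\<Sum>j<m. hausdorff_outer d (R j)) \<le> (\<Sum>j<2 * m. hausdorff_outer d (R j))" by (rule sum_mono2) auto
    also have "\<dots> \<le> (suminf (\<lambda>j. hausdorff_outer d (R (2 * j + 0)))) + (suminf (\<lambda>j. hausdorff_outer d (R (2 * j + 1))))"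
      unfolding partial by (intro add_mono sum_le_suminf summableI) auto
    also have "\<dots> \<le> hausdorff_outer d A + hausdorff_outer d A" by (intro add_mono alt_le)
    finally show "(\<Sum>j<m. hausdorff_outer d (R j)) \<le> hausdorff_outer d A + hausdorff_outer d A" .
  qed
  also have "\<dots> < top" using fin by (simp add: ennreal_add_less_top)
  finally have sumfin: "(suminf (\<lambda>j. hausdorff_outer d (R j))) \<noteq> top" by simp
  have tail: "(\<lambda>n. suminf (\<lambda>j. hausdorff_outer d (R (j + n)))) \<longlonglongrightarrow> 0"
  proof -
    define r where "r = (\<lambda>j. enn2real (hausdorff_outer d (R j)))"
    have le: "hausdorff_outer d (R j) \<le> hausdorff_outer d A" for j by (rule hausdorff_outer_mono) (auto simp: R_def)
    have r: "hausdorff_outer d (R j) = ennreal (r j)" for j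
      unfolding r_def using le_less_trans[OF le fin] by simp
    have r0: "r j \<ge> 0" for j by (simp add: r_def)
    have sr: "summable r"
      using sumfin unfolding r by (intro summable_suminf_not_top r0) simp
    have "(suminf (\<lambda>j. ennreal (r (j + n)))) = ennreal (suminf (\<lambda>j. r (j + n)))" for n
      using sr by (intro suminf_ennreal2 r0) (simp add: summable_iff_shift)
    moreover have "(\<lambda>n. ennreal (suminf (\<lambda>j. r (j + n)))) \<longlonglongrightarrow> ennreal 0"
      by (intro tendsto_ennrealI) (rule suminf_exist_split2[OF sr])
    ultimately show ?thesis unfolding r by simp
  qed
  have "hausdorff_outer d (A - F) \<le> hausdorff_outer d (Q n) + (suminf (\<lambda>j. hausdorff_outer d (R (j + n))))" for n
  proof -
    have "A - F \<subseteq> Q n \<union> (\<Union>j. R (j + n))"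
    proof
      fix x assume x: "x \<in> A - F"
      then have ux: "u x > 0" using u0 by simp
      show "x \<in> Q n \<union> (\<Union>j. R (j + n))"
      proof (cases "1 / real (n + 1) \<le> u x")
        case True
        then show ?thesis using x by (simp add: Q_def)
      next
        case False
        define m where "m = nat \<lfloor>1 / u x\<rfloor>"
        have fl: "real m \<le> 1 / u x" "1 / u x < real m + 1" using ux by (simp_all add: m_def)
        have "real (n + 1) < 1 / u x" using False ux by (simp add: not_le field_simps)
        then have nm: "n + 1 \<le> m" using fl by linarith
        \<comment> \<open>The shell index j satisfies j + 1 < 1 / u x \<le> j + 2. The interval is
          closed on the right, so an integral value 1 / u x = m belongs to j = m - 2 and any other
          value to j = m - 1.\<close>
        have ceil: "\<exists>j\<ge>n. real (j + 1) < 1 / u x \<and> 1 / u x \<le> real (j + 2)"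
        proof (cases "real m = 1 / u x")
          case True
          then have "n + 2 \<le> m" using \<open>real (n + 1) < 1 / u x\<close> by linarith
          then show ?thesis using True by (intro exI[of _ "m - 2"]) (auto simp: of_nat_diff)
        next
          case False
          then show ?thesis using nm fl by (intro exI[of _ "m - 1"]) (auto simp: of_nat_diff)
        qed
        then obtain j where j: "j \<ge> n" "real (j + 1) < 1 / u x" "1 / u x \<le> real (j + 2)" by blast
        have "1 / real (j + 2) \<le> u x" "u x < 1 / real (j + 1)"
          using j(2,3) ux by (simp_all add: field_simps)
        then have "x \<in> R ((j - n) + n)" using x j(1) by (simp add: R_def)
        then show ?thesis by blast
      qed
    qed
    then have "hausdorff_outer d (A - F) \<le> hausdorff_outer d (Q n \<union> (\<Union>j. R (j + n)))" by (rule hausdorff_outer_mono)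
    also have "\<dots> \<le> hausdorff_outer d (Q n) + hausdorff_outer d (\<Union>j. R (j + n))" by (rule hausdorff_outer_Un)
    also have "\<dots> \<le> hausdorff_outer d (Q n) + (suminf (\<lambda>j. hausdorff_outer d (R (j + n))))"
      by (intro add_left_mono hausdorff_outer_subadd)
    finally show ?thesis .
  qed
  note AF = this
  have "hausdorff_outer d (A \<inter> F) + hausdorff_outer d (A - F) \<le> hausdorff_outer d A + suminf (\<lambda>j. hausdorff_outer d (R (j + n)))" for n
  proof -
    have "hausdorff_outer d (A \<inter> F) + hausdorff_outer d (A - F) \<le>
        hausdorff_outer d (A \<inter> F) + (hausdorff_outer d (Q n) + suminf (\<lambda>j. hausdorff_outer d (R (j + n))))"
      by (rule add_left_mono[OF AF])
    also have "\<dots> = (hausdorff_outer d (A \<inter> F) + hausdorff_outer d (Q n)) + suminf (\<lambda>j. hausdorff_outer d (R (j + n)))"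
      by (rule add.assoc[symmetric])
    also have "\<dots> \<le> hausdorff_outer d A + suminf (\<lambda>j. hausdorff_outer d (R (j + n)))"
      by (rule add_right_mono[OF Q])
    finally show ?thesis .
  qed
  moreover have "(\<lambda>n. hausdorff_outer d A + suminf (\<lambda>j. hausdorff_outer d (R (j + n)))) \<longlonglongrightarrow> hausdorff_outer d A + 0"
    by (intro tendsto_add tendsto_const tail)
  ultimately have "hausdorff_outer d (A \<inter> F) + hausdorff_outer d (A - F) \<le> hausdorff_outer d A + 0"
    by (intro LIMSEQ_le_const[where X = "\<lambda>n. hausdorff_outer d A + suminf (\<lambda>j. hausdorff_outer d (R (j + n)))"]) blast+
  then show ?thesis by simp
qed

text \<open>Outside measure spaces \<open>measure_of\<close> falls back to the zero measure, so
  countable additivity on Borel sets is what gives \<open>hausdorff_measure\<close> its values.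
  Closed sets satisfy Caratheodory's criterion, and these sets form a sigma algebra.\<close>

lemma measure_space_hausdorff: "measure_space UNIV (sets borel) (hausdorff_outer d :: 'a::metric_space set \<Rightarrow> ennreal)"
proof -
  let ?H = "hausdorff_outer d :: 'a set \<Rightarrow> ennreal"
  let ?L = "lambda_system UNIV (Pow UNIV) ?H"
  have "outer_measure_space (Pow UNIV) ?H"
    unfolding outer_measure_space_def positive_def increasing_def countably_subadditive_def
    by (auto simp: hausdorff_outer_empty hausdorff_outer_mono hausdorff_outer_subadd)
  then have L: "measure_space UNIV ?L ?H"
    by (rule sigma_algebra.caratheodory_lemma[OF sigma_algebra_Pow])
  have "F \<in> ?L" if "closed F" for F
  proof -
    have "?H (F \<inter> x) + ?H ((UNIV - F) \<inter> x) = ?H x" for x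
    proof (rule antisym)
      have "F \<inter> x = x \<inter> F" "(UNIV - F) \<inter> x = x - F" by auto
      then show "?H (F \<inter> x) + ?H ((UNIV - F) \<inter> x) \<le> ?H x" using hausdorff_outer_closed[OF that, of d x] by simp
      have "?H x \<le> ?H ((F \<inter> x) \<union> ((UNIV - F) \<inter> x))" by (rule hausdorff_outer_mono) auto
      also have "\<dots> \<le> ?H (F \<inter> x) + ?H ((UNIV - F) \<inter> x)" by (rule hausdorff_outer_Un)
      finally show "?H x \<le> ?H (F \<inter> x) + ?H ((UNIV - F) \<inter> x)" .
    qed
    then show ?thesis by (simp add: lambda_system_def)
  qed
  then have "sigma_sets UNIV (Collect closed) \<subseteq> ?L"
    using L by (intro sigma_algebra.sigma_sets_subset) (auto simp: measure_space_def)
  then have "sets borel \<subseteq> ?L"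
    by (simp add: borel_eq_closed)
  then show ?thesis
    by (intro measure_down[OF L]) (simp_all add: sets.sigma_algebra_axioms[of borel, simplified])
qed

lemma sets_hausdorff_measure [simp, measurable_cong]: "sets (hausdorff_measure d) = sets borel"
  unfolding hausdorff_measure_def by (metis sets.sigma_sets_eq sets_measure_of space_borel top_greatest Pow_UNIV)

lemma space_hausdorff_measure [simp]: "space (hausdorff_measure d) = UNIV"
  unfolding hausdorff_measure_def by (simp add: space_measure_of_conv)

lemma emeasure_hausdorff:
  "A \<in> sets borel \<Longrightarrow> emeasure (hausdorff_measure d) A = hausdorff_outer d A"
  using measure_space_hausdorff[of d] unfolding hausdorff_measure_def measure_space_def
  by (intro emeasure_measure_of_sigma) auto

subsection \<open>Scaling\<close>

text \<open>The Lipschitz bound is available only on \<open>A\<close>, hence covering sets are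
  intersected with \<open>A\<close> before taking images; their diameters grow by at most the factor
  c.\<close>

lemma hausdorff_pre_lipschitz:
  fixes g :: "'a::metric_space \<Rightarrow> 'b::metric_space"
  assumes c0: "c > 0" and g: "\<And>x y. x \<in> A \<Longrightarrow> y \<in> A \<Longrightarrow> dist (g x) (g y) \<le> c * dist x y"
  shows "hausdorff_pre d (c * \<delta>) (g ` A) \<le> ennreal (c ^ d) * hausdorff_pre d \<delta> A"
proof -
  have c: "c \<ge> 0" using c0 by simp
  have gauge: "hausdorff_gauge d (g ` (U \<inter> A)) \<le> ennreal (c ^ d) * hausdorff_gauge d U"
    "diameter (g ` (U \<inter> A)) \<le> c * diameter U" "bounded (g ` (U \<inter> A))" if U: "bounded U" for U
  proof -
    have le: "dist (g x) (g y) \<le> c * diameter U" if "x \<in> U \<inter> A" "y \<in> U \<inter> A" for x y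
    proof -
      have "dist (g x) (g y) \<le> c * dist x y" using that by (intro g) auto
      also have "\<dots> \<le> c * diameter U"
        using that U c by (intro mult_left_mono diameter_bounded_bound) auto
      finally show ?thesis .
    qed
    show b: "bounded (g ` (U \<inter> A))"
    proof (cases "U \<inter> A = {}")
      case False
      then obtain x where "x \<in> U \<inter> A" by blast
      then show ?thesis using le unfolding bounded_def by blast
    qed simp
    show diam: "diameter (g ` (U \<inter> A)) \<le> c * diameter U"
    proof (cases "U \<inter> A = {}")
      case True
      then show ?thesis using c diameter_ge_0[OF U] by simp
    next
      case False
      then have "diameter (g ` (U \<inter> A)) = (SUP (x, y)\<in>(g ` (U \<inter> A)) \<times> (g ` (U \<inter> A)). dist x y)"
        unfolding diameter_def by simp
      also have "\<dots> \<le> c * diameter U"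
        using False le by (intro cSUP_least) auto
      finally show ?thesis .
    qed
    show "hausdorff_gauge d (g ` (U \<inter> A)) \<le> ennreal (c ^ d) * hausdorff_gauge d U"
    proof (cases "U \<inter> A = {}")
      case False
      have "unit_ball_vol (real d) * (diameter (g ` (U \<inter> A)) / 2) ^ d \<le> unit_ball_vol (real d) * (c * diameter U / 2) ^ d"
        using diam diameter_ge_0[OF b] by (intro mult_left_mono power_mono divide_right_mono) auto
      also have "\<dots> = c ^ d * (unit_ball_vol (real d) * (diameter U / 2) ^ d)"
        by (simp add: power_mult_distrib power_divide)
      finally have "ennreal (unit_ball_vol (real d) * (diameter (g ` (U \<inter> A)) / 2) ^ d) \<le>
          ennreal (c ^ d) * ennreal (unit_ball_vol (real d) * (diameter U / 2) ^ d)"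
        using c diameter_ge_0[OF U] by (subst ennreal_mult[symmetric]) (auto intro: ennreal_leI)
      moreover have "U \<noteq> {}" "g ` (U \<inter> A) \<noteq> {}" using False by auto
      ultimately show ?thesis unfolding hausdorff_gauge_def by simp
    qed simp
  qed
  \<comment> \<open>Moving the factor to the other side as its inverse lets the estimate be made for
    one cover at a time.\<close>
  let ?e = "ennreal (c ^ d)" and ?e' = "ennreal (1 / c ^ d)"
  have ee: "?e * ?e' = 1" using c0 by (simp flip: ennreal_mult)
  have "?e' * hausdorff_pre d (c * \<delta>) (g ` A) \<le> hausdorff_pre d \<delta> A"
  proof (rule hausdorff_pre_greatest)
    fix U :: "nat \<Rightarrow> 'a set"
    assume U: "\<And>i. bounded (U i)" "\<And>i. diameter (U i) \<le> \<delta>" "A \<subseteq> (\<Union>i. U i)"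
    have "hausdorff_pre d (c * \<delta>) (g ` A) \<le> (suminf (\<lambda>i. hausdorff_gauge d (g ` (U i \<inter> A))))"
    proof (rule hausdorff_pre_le)
      show "diameter (g ` (U i \<inter> A)) \<le> c * \<delta>" for i
        using gauge(2)[OF U(1)] mult_left_mono[OF U(2) c] by (rule order_trans)
      show "bounded (g ` (U i \<inter> A))" for i by (rule gauge(3)[OF U(1)])
      show "g ` A \<subseteq> (\<Union>i. g ` (U i \<inter> A))" using U(3) by blast
    qed
    also have "\<dots> \<le> (suminf (\<lambda>i. ?e * hausdorff_gauge d (U i)))"
      by (intro suminf_le allI summableI gauge U)
    also have "\<dots> = ?e * suminf (\<lambda>i. hausdorff_gauge d (U i))" by simp
    finally have "?e' * hausdorff_pre d (c * \<delta>) (g ` A) \<le> ?e' * (?e * suminf (\<lambda>i. hausdorff_gauge d (U i)))"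
      by (rule mult_left_mono) simp
    also have "\<dots> = (?e * ?e') * suminf (\<lambda>i. hausdorff_gauge d (U i))" by (simp only: mult_ac)
    finally show "?e' * hausdorff_pre d (c * \<delta>) (g ` A) \<le> suminf (\<lambda>i. hausdorff_gauge d (U i))"
      unfolding ee by simp
  qed
  then have "?e * (?e' * hausdorff_pre d (c * \<delta>) (g ` A)) \<le> ?e * hausdorff_pre d \<delta> A"
    by (rule mult_left_mono) simp
  then show ?thesis unfolding mult.assoc[symmetric] ee by simp
qed

lemma hausdorff_outer_lipschitz:
  fixes g :: "'a::metric_space \<Rightarrow> 'b::metric_space"
  assumes c: "c > 0" and g: "\<And>x y. x \<in> A \<Longrightarrow> y \<in> A \<Longrightarrow> dist (g x) (g y) \<le> c * dist x y"
  shows "hausdorff_outer d (g ` A) \<le> ennreal (c ^ d) * hausdorff_outer d A"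
  unfolding hausdorff_outer_eq[of d "g ` A"]
proof (rule SUP_least)
  fix \<delta> :: real assume \<delta>: "\<delta> \<in> {0<..}"
  have "hausdorff_pre d (c * (\<delta> / c)) (g ` A) \<le> ennreal (c ^ d) * hausdorff_pre d (\<delta> / c) A"
    by (rule hausdorff_pre_lipschitz[OF c g])
  also have "\<dots> \<le> ennreal (c ^ d) * hausdorff_outer d A"
    using \<delta> c by (intro mult_left_mono hausdorff_pre_le_outer) auto
  finally show "hausdorff_pre d \<delta> (g ` A) \<le> ennreal (c ^ d) * hausdorff_outer d A" using c by simp
qed

lemma hausdorff_outer_isometric_image:
  fixes g :: "'a::metric_space \<Rightarrow> 'b::metric_space"
  assumes g: "\<And>x y. x \<in> A \<Longrightarrow> y \<in> A \<Longrightarrow> dist (g x) (g y) = dist x y"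
  shows "hausdorff_outer d (g ` A) = hausdorff_outer d A"
proof (rule antisym)
  show "hausdorff_outer d (g ` A) \<le> hausdorff_outer d A"
    using hausdorff_outer_lipschitz[of 1 A g d] g by simp
  have inj: "inj_on g A"
  proof (rule inj_onI)
    fix x y assume "x \<in> A" "y \<in> A" "g x = g y"
    then show "x = y" using g[of x y] by simp
  qed
  have "hausdorff_outer d (inv_into A g ` g ` A) \<le> ennreal (1 ^ d) * hausdorff_outer d (g ` A)"
  proof (rule hausdorff_outer_lipschitz)
    fix x y assume "x \<in> g ` A" "y \<in> g ` A"
    then obtain a b where ab: "a \<in> A" "b \<in> A" "x = g a" "y = g b" by blast
    show "dist (inv_into A g x) (inv_into A g y) \<le> 1 * dist x y"
      unfolding ab(3,4) inv_into_f_f[OF inj ab(1)] inv_into_f_f[OF inj ab(2)] g[OF ab(1,2)] by simp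
  qed simp
  moreover have "inv_into A g ` g ` A = A"
    using inj by (rule inv_into_image_cancel) simp
  ultimately show "hausdorff_outer d A \<le> hausdorff_outer d (g ` A)" by simp
qed

lemma hausdorff_pre_Un: "0 \<le> \<delta> \<Longrightarrow> hausdorff_pre d \<delta> (A \<union> B) \<le> hausdorff_pre d \<delta> A + hausdorff_pre d \<delta> B"
proof -
  assume \<delta>: "0 \<le> \<delta>"
  let ?S = "\<lambda>i :: nat. if i = 0 then A else if i = 1 then B else {}"
  have "A \<union> B = (\<Union>i. ?S i)" by (auto split: if_splits)
  then have "hausdorff_pre d \<delta> (A \<union> B) \<le> suminf (\<lambda>i. hausdorff_pre d \<delta> (?S i))"
    using hausdorff_pre_subadd[of d \<delta> ?S] by simp
  also have "\<dots> = (\<Sum>i\<in>{0, 1}. hausdorff_pre d \<delta> (?S i))"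
    by (rule suminf_finite) (auto simp: hausdorff_pre_empty \<delta>)
  finally show ?thesis by simp
qed

lemma hausdorff_pre_UN:
  assumes "finite I" "0 \<le> \<delta>"
  shows "hausdorff_pre d \<delta> (\<Union>i\<in>I. A i) \<le> (\<Sum>i\<in>I. hausdorff_pre d \<delta> (A i))"
  using assms(1)
proof induction
  case empty
  then show ?case using assms(2) by (simp add: hausdorff_pre_empty)
next
  case (insert i I)
  have "hausdorff_pre d \<delta> (\<Union>i\<in>insert i I. A i) \<le> hausdorff_pre d \<delta> (A i) + hausdorff_pre d \<delta> (\<Union>i\<in>I. A i)"
    using hausdorff_pre_Un[OF assms(2)] by simp
  also have "\<dots> \<le> hausdorff_pre d \<delta> (A i) + (\<Sum>i\<in>I. hausdorff_pre d \<delta> (A i))"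
    by (rule add_left_mono[OF insert.IH])
  finally show ?case using insert by simp
qed

lemma emeasure_hausdorff_translate:
  fixes a :: "'a::euclidean_space"
  assumes "B \<in> sets borel"
  shows "emeasure (hausdorff_measure d) ((+) a -` B) = emeasure (hausdorff_measure d) B"
proof -
  have [measurable]: "B \<in> sets borel" by (rule assms)
  have m: "(+) a -` B \<in> sets borel"
    using measurable_sets[of "(+) a" borel borel B] assms by simp
  have "(+) a ` ((+) a -` B) = B"
    by (rule surj_image_vimage_eq) (rule surj_plus)
  moreover have "hausdorff_outer d ((+) a ` ((+) a -` B)) = hausdorff_outer d ((+) a -` B)"
    by (rule hausdorff_outer_isometric_image) (simp add: dist_norm)
  ultimately show ?thesis using m assms by (simp add: emeasure_hausdorff)
qed

subsection \<open>Uniqueness of translation invariant measures\<close>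

text \<open>Both products equal the double integral of the indicator of x in A and x + y in B.
  Integrating over y first gives the left side by invariance of \<nu>. Replacing x by x - y, by
  invariance of \<mu>, and then integrating over y gives the right side by invariance and symmetry
  of \<nu>.\<close>

lemma translation_invariant_proportional:
  fixes \<mu> \<nu> :: "'a::euclidean_space measure"
  assumes sf: "sigma_finite_measure \<mu>" "sigma_finite_measure \<nu>"
    and sets: "sets \<mu> = sets borel" "sets \<nu> = sets borel"
    and ae: "AE x in \<mu>. x \<in> E" "AE x in \<nu>. x \<in> E"
    and neg: "\<And>x. x \<in> E \<Longrightarrow> - x \<in> E"
    and inv: "\<And>a B. a \<in> E \<Longrightarrow> B \<in> sets borel \<Longrightarrow> emeasure \<mu> ((+) a -` B) = emeasure \<mu> B"
      "\<And>a B. a \<in> E \<Longrightarrow> B \<in> sets borel \<Longrightarrow> emeasure \<nu> ((+) a -` B) = emeasure \<nu> B"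
    and sym: "\<And>B. B \<in> sets borel \<Longrightarrow> emeasure \<nu> (uminus -` B) = emeasure \<nu> B"
    and A: "A \<in> sets borel" and B: "B \<in> sets borel"
  shows "emeasure \<mu> A * emeasure \<nu> B = emeasure \<mu> B * emeasure \<nu> A"
proof -
  interpret \<mu>: sigma_finite_measure \<mu> by (rule sf)
  interpret \<nu>: sigma_finite_measure \<nu> by (rule sf)
  interpret P: pair_sigma_finite \<mu> \<nu> ..
  note [measurable_cong] = sets
  note [measurable] = A B
  have sp: "space \<mu> = UNIV" "space \<nu> = UNIV" using sets[THEN sets_eq_imp_space_eq] by simp_all
  have vim: "(+) a -` C \<in> sets borel" "uminus -` C \<in> sets borel" if [measurable]: "C \<in> sets borel" for a :: 'a and C
    using measurable_sets[of "(+) a" borel borel C] measurable_sets[of "uminus :: 'a \<Rightarrow> 'a" borel borel C] that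
    by simp_all
  have ind: "(\<integral>\<^sup>+y. indicator C y \<partial>M) = emeasure M C" if "sets M = sets borel" "C \<in> sets borel" for C :: "'a set" and M
    using that by (simp add: nn_integral_indicator)
  have "emeasure \<mu> A * emeasure \<nu> B = (\<integral>\<^sup>+x. indicator A x * emeasure \<nu> B \<partial>\<mu>)"
    using A sets by (simp add: nn_integral_multc)
  also have "\<dots> = (\<integral>\<^sup>+x. (\<integral>\<^sup>+y. indicator A x * indicator B (x + y) \<partial>\<nu>) \<partial>\<mu>)"
  proof (rule nn_integral_cong_AE)
    show "AE x in \<mu>. indicator A x * emeasure \<nu> B = (\<integral>\<^sup>+y. indicator A x * indicator B (x + y) \<partial>\<nu>)"
      using ae(1)
    proof eventually_elim
      case (elim x)
      have "(\<integral>\<^sup>+y. indicator A x * indicator B (x + y) \<partial>\<nu>) = indicator A x * (\<integral>\<^sup>+y. indicator ((+) x -` B) y \<partial>\<nu>)"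
        by (subst nn_integral_cmult[symmetric]) (auto simp: indicator_def intro!: nn_integral_cong)
      also have "(\<integral>\<^sup>+y. indicator ((+) x -` B) y \<partial>\<nu>) = emeasure \<nu> ((+) x -` B)"
        by (rule ind[OF sets(2) vim(1)[OF B]])
      also have "\<dots> = emeasure \<nu> B" by (rule inv(2)[OF elim B])
      finally show ?case by simp
    qed
  qed
  also have "\<dots> = (\<integral>\<^sup>+y. (\<integral>\<^sup>+x. indicator A x * indicator B (x + y) \<partial>\<mu>) \<partial>\<nu>)"
    by (rule P.Fubini'[symmetric]) measurable
  also have "\<dots> = (\<integral>\<^sup>+y. (\<integral>\<^sup>+x. indicator A (x - y) * indicator B x \<partial>\<mu>) \<partial>\<nu>)"
  proof (rule nn_integral_cong_AE)
    show "AE y in \<nu>. (\<integral>\<^sup>+x. indicator A x * indicator B (x + y) \<partial>\<mu>) = (\<integral>\<^sup>+x. indicator A (x - y) * indicator B x \<partial>\<mu>)"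
      using ae(2)
    proof eventually_elim
      case (elim y)
      let ?C = "(+) (- y) -` A \<inter> B"
      have C: "?C \<in> sets borel" using vim(1)[OF A] B by blast
      have "(\<integral>\<^sup>+x. indicator A x * indicator B (x + y) \<partial>\<mu>) = (\<integral>\<^sup>+x. indicator ((+) y -` ?C) x \<partial>\<mu>)"
        by (intro nn_integral_cong) (auto simp: indicator_def add.commute)
      also have "\<dots> = emeasure \<mu> ((+) y -` ?C)" by (rule ind[OF sets(1) vim(1)[OF C]])
      also have "\<dots> = emeasure \<mu> ?C" by (rule inv(1)[OF elim C])
      also have "\<dots> = (\<integral>\<^sup>+x. indicator ?C x \<partial>\<mu>)" by (rule ind[OF sets(1) C, symmetric])
      also have "\<dots> = (\<integral>\<^sup>+x. indicator A (x - y) * indicator B x \<partial>\<mu>)"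
        by (intro nn_integral_cong) (auto simp: indicator_def)
      finally show ?case .
    qed
  qed
  also have "\<dots> = (\<integral>\<^sup>+x. (\<integral>\<^sup>+y. indicator A (x - y) * indicator B x \<partial>\<nu>) \<partial>\<mu>)"
    by (rule P.Fubini') measurable
  also have "\<dots> = (\<integral>\<^sup>+x. indicator B x * emeasure \<nu> A \<partial>\<mu>)"
  proof (rule nn_integral_cong_AE)
    show "AE x in \<mu>. (\<integral>\<^sup>+y. indicator A (x - y) * indicator B x \<partial>\<nu>) = indicator B x * emeasure \<nu> A"
      using ae(1)
    proof eventually_elim
      case (elim x)
      let ?C = "(+) x -` A"
      have C: "?C \<in> sets borel" by (rule vim(1)[OF A])
      have "(\<integral>\<^sup>+y. indicator A (x - y) * indicator B x \<partial>\<nu>) = indicator B x * (\<integral>\<^sup>+y. indicator (uminus -` ?C) y \<partial>\<nu>)"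
        by (subst nn_integral_cmult[symmetric]) (auto simp: indicator_def vim(2)[OF C] sets intro!: nn_integral_cong)
      also have "(\<integral>\<^sup>+y. indicator (uminus -` ?C) y \<partial>\<nu>) = emeasure \<nu> (uminus -` ?C)"
        by (rule ind[OF sets(2) vim(2)[OF C]])
      also have "\<dots> = emeasure \<nu> ?C" by (rule sym[OF C])
      also have "\<dots> = emeasure \<nu> A" by (rule inv(2)[OF elim A])
      finally show ?case .
    qed
  qed
  also have "\<dots> = emeasure \<mu> B * emeasure \<nu> A"
    using B sets by (simp add: nn_integral_multc)
  finally show ?thesis .
qed

subsection \<open>Hausdorff measure on coordinate subspaces\<close>

definition coord_space :: "'n set \<Rightarrow> (real ^ 'n) set" where
  "coord_space S = {x. \<forall>i. i \<notin> S \<longrightarrow> x $ i = 0}"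

definition coord_proj :: "'n set \<Rightarrow> real ^ 'n \<Rightarrow> real ^ 'n" where
  "coord_proj S x = (\<chi> i. if i \<in> S then x $ i else 0)"

definition subcube :: "'n set \<Rightarrow> (real ^ 'n) set" where
  "subcube S = {x \<in> coord_space S. \<forall>i. \<bar>x $ i\<bar> \<le> 1}"

definition slab :: "'n set \<Rightarrow> (real ^ 'n) set" where
  "slab S = {x. \<forall>i. i \<notin> S \<longrightarrow> \<bar>x $ i\<bar> \<le> 1}"

text \<open>Lebesgue measure of the coordinate subspace, up to the volume of the remaining directions.\<close>
definition slab_measure :: "'n::finite set \<Rightarrow> (real ^ 'n) measure" where
  "slab_measure S = distr (density lborel (indicator (slab S))) borel (coord_proj S)"

lemma coord_proj_measurable [measurable]: "coord_proj S \<in> borel_measurable borel"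
proof (rule borel_measurable_continuous_onI)
  show "continuous_on UNIV (coord_proj S)"
    unfolding coord_proj_def
  proof (intro continuous_on_vec_lambda)
    show "continuous_on UNIV (\<lambda>x :: real ^ 'a. if i \<in> S then x $ i else 0)" for i
      by (cases "i \<in> S") (auto intro: continuous_intros)
  qed
qed

lemma
  shows coord_space_measurable [measurable]: "coord_space S \<in> sets borel"
    and subcube_measurable [measurable]: "subcube S \<in> sets borel"
    and slab_measurable [measurable]: "slab S \<in> sets borel"
proof -
  have cl: "closed {x :: real ^ 'n. x $ i = 0}" "closed {x :: real ^ 'n. \<bar>x $ i\<bar> \<le> 1}" for i
    by (intro closed_Collect_eq closed_Collect_le continuous_intros)+
  have 1: "closed (coord_space S)"
  proof -
    have "coord_space S = (\<Inter>i\<in>-S. {x. x $ i = 0})" by (auto simp: coord_space_def)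
    then show ?thesis using cl by auto
  qed
  have 2: "closed (subcube S)"
  proof -
    have "subcube S = coord_space S \<inter> (\<Inter>i. {x. \<bar>x $ i\<bar> \<le> 1})" by (auto simp: subcube_def)
    moreover have "closed (\<Inter>i. {x :: real ^ 'a. \<bar>x $ i\<bar> \<le> 1})" using cl(2) by (intro closed_INT) auto
    ultimately show ?thesis using 1 by (simp add: closed_Int)
  qed
  have 3: "closed (slab S)"
  proof -
    have "slab S = (\<Inter>i\<in>-S. {x. \<bar>x $ i\<bar> \<le> 1})" by (auto simp: slab_def)
    moreover have "closed (\<Inter>i\<in>-S. {x :: real ^ 'a. \<bar>x $ i\<bar> \<le> 1})" using cl(2) by (intro closed_INT) auto
    ultimately show ?thesis by simp
  qed
  show "coord_space S \<in> sets borel" "subcube S \<in> sets borel" "slab S \<in> sets borel"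
    using borel_closed[OF 1] borel_closed[OF 2] borel_closed[OF 3] by blast+
qed

lemma sets_slab_measure [simp, measurable_cong]: "sets (slab_measure S) = sets borel"
  by (simp add: slab_measure_def)

lemma emeasure_slab_measure:
  assumes "B \<in> sets borel"
  shows "emeasure (slab_measure S) B = emeasure lborel (slab S \<inter> coord_proj S -` B)"
proof -
  have m: "coord_proj S -` B \<in> sets borel"
    using measurable_sets[OF coord_proj_measurable assms] by simp
  have "emeasure (slab_measure S) B = emeasure (density lborel (indicator (slab S))) (coord_proj S -` B)"
    unfolding slab_measure_def using assms by (subst emeasure_distr) auto
  also have "\<dots> = (\<integral>\<^sup>+x. indicator (slab S) x * indicator (coord_proj S -` B) x \<partial>lborel)"
    using m by (subst emeasure_density) auto
  also have "\<dots> = (\<integral>\<^sup>+x. indicator (slab S \<inter> coord_proj S -` B) x \<partial>lborel)"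
    by (intro nn_integral_cong) (auto simp: indicator_def)
  also have "\<dots> = emeasure lborel (slab S \<inter> coord_proj S -` B)"
    using m by (intro nn_integral_indicator) auto
  finally show ?thesis .
qed

section \<open>Positivity and finiteness of the Hausdorff measure of subcubes\<close>

lemma emeasure_lborel_vec_box:
  fixes a b :: "real ^ 'n::finite"
  assumes "\<And>i. a $ i \<le> b $ i"
  shows "emeasure lborel {x. \<forall>i. a $ i \<le> x $ i \<and> x $ i \<le> b $ i} = ennreal (\<Prod>i\<in>UNIV. b $ i - a $ i)"
proof -
  have eq: "{x. \<forall>i. a $ i \<le> x $ i \<and> x $ i \<le> b $ i} = cbox a b"
    by (auto simp: mem_box_cart)
  have ne: "cbox a b \<noteq> {}" using assms by (auto simp: interval_ne_empty_cart)
  have "emeasure lborel (cbox a b) = ennreal (measure lborel (cbox a b))"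
    by (rule emeasure_eq_ennreal_measure) (use emeasure_lborel_cbox_finite[of a b] in auto)
  also have "measure lborel (cbox a b) = (\<Prod>i\<in>UNIV. b $ i - a $ i)"
    by (rule content_cbox_cart[OF ne])
  finally show ?thesis unfolding eq .
qed

lemma slab_measure_subcube: "emeasure (slab_measure S) (subcube S) = 2 ^ CARD('n)"
  for S :: "'n::finite set"
proof -
  have "slab S \<inter> coord_proj S -` subcube S = {x. \<forall>i. (-1 :: real ^ 'n) $ i \<le> x $ i \<and> x $ i \<le> (1 :: real ^ 'n) $ i}"
  proof (intro set_eqI iffI)
    fix x assume x: "x \<in> slab S \<inter> coord_proj S -` subcube S"
    have "\<bar>x $ i\<bar> \<le> 1" for i
    proof (cases "i \<in> S")
      case True
      then have "coord_proj S x $ i = x $ i" by (simp add: coord_proj_def)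
      then show ?thesis using x unfolding subcube_def by (metis (no_types, lifting) IntD2 mem_Collect_eq vimageD)
    next
      case False
      then show ?thesis using x by (simp add: slab_def)
    qed
    then show "x \<in> {x. \<forall>i. (-1 :: real ^ 'n) $ i \<le> x $ i \<and> x $ i \<le> (1 :: real ^ 'n) $ i}"
      by (simp add: abs_le_iff minus_le_iff)
  next
    fix x assume "x \<in> {x. \<forall>i. (-1 :: real ^ 'n) $ i \<le> x $ i \<and> x $ i \<le> (1 :: real ^ 'n) $ i}"
    then have x: "\<bar>x $ i\<bar> \<le> 1" for i by (simp add: abs_le_iff minus_le_iff)
    then show "x \<in> slab S \<inter> coord_proj S -` subcube S"
      by (auto simp: slab_def coord_proj_def subcube_def coord_space_def)
  qed
  then have "emeasure (slab_measure S) (subcube S) = emeasure lborel {x. \<forall>i. (-1 :: real ^ 'n) $ i \<le> x $ i \<and> x $ i \<le> (1 :: real ^ 'n) $ i}"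
    by (simp add: emeasure_slab_measure)
  also have "\<dots> = ennreal (\<Prod>i\<in>(UNIV :: 'n set). 2)"
    by (subst emeasure_lborel_vec_box) auto
  finally show ?thesis by (simp add: ennreal_power flip: ennreal_power)
qed

text \<open>Over a set of diameter D the slab is contained in a box with sides 2 D in the directions
  of \<open>S\<close> and 2 in the others, of volume 2^\<open>CARD('n)\<close> * D^k. The constant
  \<open>C\<close> converts D^k into the gauge.\<close>

lemma slab_measure_le_gauge:
  fixes S :: "'n::finite set"
  shows "\<exists>C>0. \<forall>U. bounded U \<longrightarrow> U \<in> sets borel \<longrightarrow>
    emeasure (slab_measure S) U \<le> ennreal C * hausdorff_gauge (card S) U"
proof -
  define k where "k = card S"
  define C where "C = 2 ^ CARD('n) * 2 ^ k / unit_ball_vol (real k)"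
  have C: "C > 0" by (simp add: C_def)
  have "emeasure (slab_measure S) U \<le> ennreal C * hausdorff_gauge k U" if U: "bounded U" "U \<in> sets borel" for U
  proof (cases "slab S \<inter> coord_proj S -` U = {}")
    case True
    then show ?thesis by (simp add: emeasure_slab_measure[OF U(2)])
  next
    case False
    then obtain z where z: "z \<in> slab S" "coord_proj S z \<in> U" by auto
    define D where "D = diameter U"
    have D: "D \<ge> 0" unfolding D_def by (rule diameter_ge_0[OF U(1)])
    define a b where "a = (\<chi> i. if i \<in> S then z $ i - D else -1)" and "b = (\<chi> i. if i \<in> S then z $ i + D else 1)"
    have "slab S \<inter> coord_proj S -` U \<subseteq> {x. \<forall>i. a $ i \<le> x $ i \<and> x $ i \<le> b $ i}"
    proof (intro subsetI CollectI allI)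
      fix x i assume x: "x \<in> slab S \<inter> coord_proj S -` U"
      show "a $ i \<le> x $ i \<and> x $ i \<le> b $ i"
      proof (cases "i \<in> S")
        case True
        have "\<bar>x $ i - z $ i\<bar> = \<bar>(coord_proj S x - coord_proj S z) $ i\<bar>"
          using True by (simp add: coord_proj_def)
        also have "\<dots> \<le> norm (coord_proj S x - coord_proj S z)" by (rule component_le_norm_cart)
        also have "\<dots> = dist (coord_proj S x) (coord_proj S z)" by (simp add: dist_norm)
        also have "\<dots> \<le> D" unfolding D_def
          using U(1) x z(2) by (intro diameter_bounded_bound) auto
        finally show ?thesis using True by (auto simp: a_def b_def)
      next
        case False
        then have "\<bar>x $ i\<bar> \<le> 1" using x by (simp add: slab_def)
        then show ?thesis using False by (auto simp: a_def b_def)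
      qed
    qed
    then have "emeasure (slab_measure S) U \<le> emeasure lborel {x. \<forall>i. a $ i \<le> x $ i \<and> x $ i \<le> b $ i}"
      unfolding emeasure_slab_measure[OF U(2)]
    proof (rule emeasure_mono)
      have "{x. \<forall>i. a $ i \<le> x $ i \<and> x $ i \<le> b $ i} = cbox a b" by (auto simp: mem_box_cart)
      then show "{x. \<forall>i. a $ i \<le> x $ i \<and> x $ i \<le> b $ i} \<in> sets lborel" by simp
    qed
    also have "\<dots> = ennreal (\<Prod>i\<in>UNIV. b $ i - a $ i)"
      by (rule emeasure_lborel_vec_box) (use D in \<open>auto simp: a_def b_def\<close>)
    also have "(\<Prod>i\<in>UNIV. b $ i - a $ i) = (\<Prod>i\<in>(UNIV :: 'n set). 2 * (if i \<in> S then D else 1))"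
      by (intro prod.cong) (auto simp: a_def b_def)
    also have "\<dots> = 2 ^ CARD('n) * D ^ k"
      unfolding prod.distrib by (simp add: prod.If_cases k_def)
    also have "\<dots> = C * (unit_ball_vol (real k) * (D / 2) ^ k)"
      using unit_ball_vol_pos[of "real k"] by (simp add: C_def power_divide del: unit_ball_vol_pos)
    also have "ennreal \<dots> = ennreal C * ennreal (unit_ball_vol (real k) * (D / 2) ^ k)"
      using C D by (intro ennreal_mult) auto
    also have "ennreal (unit_ball_vol (real k) * (D / 2) ^ k) = hausdorff_gauge k U"
      using z(2) by (auto simp: hausdorff_gauge_def D_def)
    finally show ?thesis .
  qed
  then show ?thesis using C unfolding k_def by blast
qed

text \<open>Mass distribution principle: by \<open>slab_measure_le_gauge\<close> the total gauge of
  any cover is at least a fixed multiple of the slab measure of the subcube.\<close>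

lemma hausdorff_subcube_pos:
  "0 < emeasure (hausdorff_measure (card S)) (subcube S)" for S :: "'n::finite set"
proof -
  obtain C where C: "C > 0" "\<And>U. bounded U \<Longrightarrow> U \<in> sets borel \<Longrightarrow>
      emeasure (slab_measure S) U \<le> ennreal C * hausdorff_gauge (card S) U"
    using slab_measure_le_gauge[of S] by (elim exE conjE) (simp only: mp)
  have "ennreal (2 ^ CARD('n) / C) \<le> hausdorff_pre (card S) 1 (subcube S)"
  proof (rule hausdorff_pre_greatest)
    fix U :: "nat \<Rightarrow> (real ^ 'n) set"
    assume U: "\<And>i. bounded (U i)" "\<And>i. diameter (U i) \<le> 1" "subcube S \<subseteq> (\<Union>i. U i)"
    \<comment> \<open>Passing to closures makes the covering sets Borel without changing their
      gauges.\<close>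
    have cl: "bounded (closure (U i))" "closure (U i) \<in> sets borel"
      "hausdorff_gauge (card S) (closure (U i)) = hausdorff_gauge (card S) (U i)" for i
      using U(1)[of i] by (simp_all add: bounded_closure hausdorff_gauge_def diameter_closure)
    have "ennreal (2 ^ CARD('n)) = emeasure (slab_measure S) (subcube S)"
      unfolding slab_measure_subcube by (subst ennreal_power[symmetric]) simp_all
    also have "\<dots> \<le> emeasure (slab_measure S) (\<Union>i. closure (U i))"
    proof (rule emeasure_mono)
      have "(\<Union>i. U i) \<subseteq> (\<Union>i. closure (U i))" by (rule UN_mono[OF order_refl closure_subset])
      with U(3) show "subcube S \<subseteq> (\<Union>i. closure (U i))" by (rule order_trans)
      show "(\<Union>i. closure (U i)) \<in> sets (slab_measure S)"
        by (rule sets.countable_UN) (simp add: image_subset_iff)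
    qed
    also have "\<dots> \<le> suminf (\<lambda>i. emeasure (slab_measure S) (closure (U i)))"
      by (rule emeasure_subadditive_countably) (simp add: image_subset_iff)
    also have "\<dots> \<le> suminf (\<lambda>i. ennreal C * hausdorff_gauge (card S) (U i))"
    proof (intro suminf_le allI summableI)
      show "emeasure (slab_measure S) (closure (U i)) \<le> ennreal C * hausdorff_gauge (card S) (U i)" for i
        using C(2)[OF cl(1,2), of i] unfolding cl(3) .
    qed
    also have "\<dots> = ennreal C * suminf (\<lambda>i. hausdorff_gauge (card S) (U i))" by simp
    finally have le: "ennreal (2 ^ CARD('n)) \<le> ennreal C * suminf (\<lambda>i. hausdorff_gauge (card S) (U i))" .
    have "ennreal (2 ^ CARD('n) / C) = ennreal (1 / C) * ennreal (2 ^ CARD('n))"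
      using C(1) by (subst ennreal_mult[symmetric]) simp_all
    also have "\<dots> \<le> ennreal (1 / C) * (ennreal C * suminf (\<lambda>i. hausdorff_gauge (card S) (U i)))"
      by (rule mult_left_mono[OF le]) simp
    also have "\<dots> = (ennreal (1 / C) * ennreal C) * suminf (\<lambda>i. hausdorff_gauge (card S) (U i))"
      by (simp only: mult.assoc)
    also have "ennreal (1 / C) * ennreal C = 1" using C(1) by (subst ennreal_mult[symmetric]) simp_all
    finally show "ennreal (2 ^ CARD('n) / C) \<le> suminf (\<lambda>i. hausdorff_gauge (card S) (U i))" by simp
  qed
  also have "\<dots> \<le> hausdorff_outer (card S) (subcube S)" by (rule hausdorff_pre_le_outer) simp
  finally have "ennreal (2 ^ CARD('n) / C) \<le> hausdorff_outer (card S) (subcube S)" .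
  moreover have "0 < ennreal (2 ^ CARD('n) / C)" using C(1) by simp
  ultimately have "0 < hausdorff_outer (card S) (subcube S)" by (rule less_le_trans[rotated])
  then show ?thesis unfolding emeasure_hausdorff[OF subcube_measurable] .
qed

text \<open>The subcube is covered by 2^k copies of half its size, so halving \<delta> costs the
  factor 2^k * (1/2)^k = 1. All scales are thereby bounded by an initial one that admits the subcube
  itself as its only nonempty covering set.\<close>

lemma hausdorff_subcube_finite:
  "emeasure (hausdorff_measure (card S)) (subcube S) < \<infinity>" for S :: "'n::finite set"
proof -
  let ?k = "card S" and ?Q = "subcube S"
  \<comment> \<open>The contraction by 1/2 onto the orthant of the subcube with sign pattern
    \<open>T\<close>.\<close>
  define g where "g = (\<lambda>T x. (1/2) *\<^sub>R (x + (\<chi> i. if i \<in> S then if i \<in> T then 1 else - 1 else 0)) :: real ^ 'n)"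
  have cov: "?Q \<subseteq> (\<Union>T\<in>Pow S. g T ` ?Q)"
  proof
    fix q assume q: "q \<in> ?Q"
    define T where "T = {i \<in> S. q $ i \<ge> 0}"
    define x :: "real ^ 'n" where "x = (\<chi> i. if i \<in> S then if i \<in> T then 2 * q $ i - 1 else 2 * q $ i + 1 else 0)"
    have q0: "q $ i = 0" if "i \<notin> S" for i using q that by (simp add: subcube_def coord_space_def)
    have q1: "- 1 \<le> q $ i" "q $ i \<le> 1" for i using q by (auto simp: subcube_def abs_le_iff minus_le_iff)
    have "q = g T x"
      by (simp add: vec_eq_iff g_def x_def q0)
    moreover have "x \<in> ?Q"
    proof -
      have "\<bar>x $ i\<bar> \<le> 1" for i using q1[of i] by (auto simp: x_def T_def abs_le_iff)
      then show ?thesis by (simp add: subcube_def coord_space_def x_def)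
    qed
    moreover have "T \<in> Pow S" by (auto simp: T_def)
    ultimately show "q \<in> (\<Union>T\<in>Pow S. g T ` ?Q)" by blast
  qed
  have g: "dist (g T x) (g T y) \<le> (1/2) * dist x y" for T x y
  proof -
    have "g T x - g T y = (1/2) *\<^sub>R (x - y)" by (simp add: g_def scaleR_diff_right scaleR_add_right)
    then show ?thesis by (simp add: dist_norm)
  qed
  have half: "hausdorff_pre ?k (\<delta> / 2) ?Q \<le> hausdorff_pre ?k \<delta> ?Q" if \<delta>: "\<delta> > 0" for \<delta>
  proof -
    have "hausdorff_pre ?k (\<delta> / 2) ?Q \<le> hausdorff_pre ?k (\<delta> / 2) (\<Union>T\<in>Pow S. g T ` ?Q)"
      by (rule hausdorff_pre_mono[OF cov])
    also have "\<dots> \<le> (\<Sum>T\<in>Pow S. hausdorff_pre ?k (\<delta> / 2) (g T ` ?Q))"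
      using \<delta> by (intro hausdorff_pre_UN) auto
    also have "\<dots> \<le> (\<Sum>T\<in>Pow S. ennreal ((1/2) ^ ?k) * hausdorff_pre ?k \<delta> ?Q)"
    proof (rule sum_mono)
      fix T assume "T \<in> Pow S"
      have "hausdorff_pre ?k ((1/2) * \<delta>) (g T ` ?Q) \<le> ennreal ((1/2) ^ ?k) * hausdorff_pre ?k \<delta> ?Q"
        by (rule hausdorff_pre_lipschitz) (simp, rule g)
      then show "hausdorff_pre ?k (\<delta> / 2) (g T ` ?Q) \<le> ennreal ((1/2) ^ ?k) * hausdorff_pre ?k \<delta> ?Q" by simp
    qed
    also have "\<dots> = of_nat (2 ^ ?k) * (ennreal ((1/2) ^ ?k) * hausdorff_pre ?k \<delta> ?Q)"
      by (simp only: sum_constant card_Pow[OF finite])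
    also have "\<dots> = (ennreal (2 ^ ?k) * ennreal ((1/2) ^ ?k)) * hausdorff_pre ?k \<delta> ?Q"
      by (simp add: mult.assoc ennreal_power flip: ennreal_power)
    also have "ennreal (2 ^ ?k) * ennreal ((1/2) ^ ?k) = 1"
      by (simp add: power_divide flip: ennreal_mult)
    finally show ?thesis by simp
  qed
  have bd: "bounded ?Q"
  proof (rule bounded_subset[OF bounded_cbox])
    show "?Q \<subseteq> cbox (-1) 1" by (auto simp: subcube_def mem_box_cart abs_le_iff minus_le_iff)
  qed
  define \<delta>0 where "\<delta>0 = diameter ?Q + 1"
  have \<delta>0: "\<delta>0 > 0" using diameter_ge_0[OF bd] by (simp add: \<delta>0_def)
  have iter: "hausdorff_pre ?k (\<delta>0 / 2 ^ m) ?Q \<le> hausdorff_pre ?k \<delta>0 ?Q" for m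
  proof (induction m)
    case (Suc m)
    have "hausdorff_pre ?k (\<delta>0 / 2 ^ m / 2) ?Q \<le> hausdorff_pre ?k (\<delta>0 / 2 ^ m) ?Q"
      using \<delta>0 by (intro half) simp
    also note Suc.IH
    finally show ?case by (simp add: field_simps)
  qed simp
  have "hausdorff_outer ?k ?Q \<le> hausdorff_pre ?k \<delta>0 ?Q"
    unfolding hausdorff_outer_eq
  proof (rule SUP_least)
    fix \<delta> :: real assume "\<delta> \<in> {0<..}"
    then have \<delta>: "\<delta> > 0" by simp
    obtain m where "\<delta>0 / \<delta> < 2 ^ m" using real_arch_pow[of 2 "\<delta>0 / \<delta>"] by auto
    then have "\<delta>0 / 2 ^ m \<le> \<delta>" using \<delta> by (simp add: field_simps)
    then have "hausdorff_pre ?k \<delta> ?Q \<le> hausdorff_pre ?k (\<delta>0 / 2 ^ m) ?Q" by (rule hausdorff_pre_antimono)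
    also note iter
    finally show "hausdorff_pre ?k \<delta> ?Q \<le> hausdorff_pre ?k \<delta>0 ?Q" .
  qed
  also have "\<dots> \<le> hausdorff_gauge ?k ?Q"
    using \<delta>0 by (intro hausdorff_pre_single bd) (auto simp: \<delta>0_def)
  also have "\<dots> < \<infinity>" by (auto simp: hausdorff_gauge_def)
  finally show ?thesis by (simp add: emeasure_hausdorff)
qed

definition sup_ball :: "real \<Rightarrow> (real ^ 'n) set" where
  "sup_ball r = {x. \<forall>i. \<bar>x $ i\<bar> \<le> r}"

lemma sup_ball_eq_cbox: "sup_ball r = cbox (\<chi> i. - r) (\<chi> i. r)"
  unfolding sup_ball_def by (auto simp: mem_box_cart abs_le_iff minus_le_iff)

lemma sup_ball_measurable [measurable]: "sup_ball r \<in> sets borel"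
  unfolding sup_ball_eq_cbox by simp

lemma sigma_finite_sup_ball:
  fixes M :: "(real ^ 'n::finite) measure"
  assumes "sets M = sets borel" and fin: "\<And>r. r > 0 \<Longrightarrow> emeasure M (sup_ball r) < \<infinity>"
  shows "sigma_finite_measure M"
proof
  let ?A = "range (\<lambda>n. sup_ball (real n + 1)) :: (real ^ 'n) set set"
  have "space M = UNIV" using assms(1)[THEN sets_eq_imp_space_eq] by simp
  moreover have "(\<Union>n. sup_ball (real n + 1)) = (UNIV :: (real ^ 'n) set)"
  proof (intro set_eqI iffI UNIV_I)
    fix x :: "real ^ 'n"
    obtain n where "norm x \<le> real n" using real_arch_simple by blast
    then have "\<bar>x $ i\<bar> \<le> real n + 1" for i using component_le_norm_cart[of x i] by linarith
    then show "x \<in> (\<Union>n. sup_ball (real n + 1))" by (auto simp: sup_ball_def)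
  qed
  moreover have "emeasure M a \<noteq> \<infinity>" if "a \<in> ?A" for a
  proof -
    obtain n where "a = sup_ball (real n + 1)" using \<open>a \<in> ?A\<close> by blast
    then show ?thesis using fin[of "real n + 1"] by (simp add: less_top)
  qed
  ultimately show "\<exists>A. countable A \<and> A \<subseteq> sets M \<and> \<Union> A = space M \<and> (\<forall>a\<in>A. emeasure M a \<noteq> \<infinity>)"
    by (intro exI[of _ ?A]) (auto simp: assms(1))
qed

lemma emeasure_lborel_translate:
  "B \<in> sets borel \<Longrightarrow> emeasure lborel ((+) a -` B) = emeasure lborel B" for a :: "'a::euclidean_space"
  using emeasure_distr[of "(+) a" lborel borel B] by (simp add: lborel_distr_plus)

lemma emeasure_lborel_uminus:
  fixes B :: "'a::euclidean_space set"
  assumes "B \<in> sets borel"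
  shows "emeasure lborel (uminus -` B) = emeasure lborel B"
proof -
  have "lborel = density (distr lborel borel (\<lambda>x :: 'a. 0 + (-1) *\<^sub>R x)) (\<lambda>_. ennreal (\<bar>-1\<bar> ^ DIM('a)))"
    using lborel_affine[of "-1" "0 :: 'a"] by simp
  also have "\<dots> = distr lborel borel (uminus :: 'a \<Rightarrow> 'a)" by (simp add: density_1 cong: distr_cong)
  finally have "emeasure lborel B = emeasure (distr lborel borel (uminus :: 'a \<Rightarrow> 'a)) B" by simp
  then show ?thesis using assms by (simp add: emeasure_distr)
qed

text \<open>Hausdorff measure on the coordinate subspace and the slab measure are both invariant
  under its translations, hence proportional; comparison on the subcube, whose slab measure is
  2^\<open>CARD('n)\<close>, fixes the ratio.\<close>

theorem hausdorff_coord_space: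
  fixes S :: "'n::finite set"
  assumes B: "B \<in> sets borel"
  shows "emeasure (hausdorff_measure (card S)) (coord_space S \<inter> B) * 2 ^ CARD('n) =
    emeasure (slab_measure S) B * emeasure (hausdorff_measure (card S)) (subcube S)"
proof -
  let ?H = "hausdorff_measure (card S) :: (real ^ 'n) measure"
  define \<mu> where "\<mu> = density ?H (indicator (coord_space S))"
  have em: "emeasure \<mu> B = emeasure ?H (coord_space S \<inter> B)" if "B \<in> sets borel" for B
  proof -
    have "emeasure \<mu> B = (\<integral>\<^sup>+x. indicator (coord_space S) x * indicator B x \<partial>?H)"
      unfolding \<mu>_def using that by (subst emeasure_density) auto
    also have "\<dots> = (\<integral>\<^sup>+x. indicator (coord_space S \<inter> B) x \<partial>?H)"
      by (intro nn_integral_cong) (auto simp: indicator_def)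
    also have "\<dots> = emeasure ?H (coord_space S \<inter> B)" using that by (intro nn_integral_indicator) auto
    finally show ?thesis .
  qed
  have sets: "sets \<mu> = sets borel" by (simp add: \<mu>_def)
  have sf1: "sigma_finite_measure \<mu>"
  proof (rule sigma_finite_sup_ball[OF sets])
    fix r :: real assume r: "r > 0"
    have "coord_space S \<inter> sup_ball r \<subseteq> (\<lambda>x. r *\<^sub>R x) ` subcube S"
    proof
      fix x assume x: "x \<in> coord_space S \<inter> sup_ball r"
      then have "\<bar>x $ i\<bar> \<le> r" for i by (simp add: sup_ball_def)
      then have "(1 / r) *\<^sub>R x \<in> subcube S" using x r by (auto simp: subcube_def coord_space_def abs_mult)
      moreover have "x = r *\<^sub>R ((1 / r) *\<^sub>R x)" using r by simp
      ultimately show "x \<in> (\<lambda>x. r *\<^sub>R x) ` subcube S" by blast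
    qed
    then have "emeasure \<mu> (sup_ball r) \<le> hausdorff_outer (card S) ((\<lambda>x. r *\<^sub>R x) ` (subcube S :: (real ^ 'n) set))"
      by (simp add: em emeasure_hausdorff hausdorff_outer_mono)
    also have "\<dots> \<le> ennreal (r ^ card S) * hausdorff_outer (card S) (subcube S :: (real ^ 'n) set)"
    proof (rule hausdorff_outer_lipschitz[OF r])
      have "r *\<^sub>R x - r *\<^sub>R y = r *\<^sub>R (x - y)" for x y :: "real ^ 'n" by (simp add: scaleR_diff_right)
      then show "dist (r *\<^sub>R x) (r *\<^sub>R y) \<le> r * dist x y" for x y :: "real ^ 'n" using r by (simp add: dist_norm)
    qed
    also have "\<dots> < \<infinity>"
      using hausdorff_subcube_finite[of S] by (simp add: emeasure_hausdorff ennreal_mult_less_top)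
    finally show "emeasure \<mu> (sup_ball r) < \<infinity>" .
  qed
  have sf2: "sigma_finite_measure (slab_measure S)"
  proof (rule sigma_finite_sup_ball)
    fix r :: real assume r: "r > 0"
    have "slab S \<inter> coord_proj S -` sup_ball r \<subseteq> sup_ball (max r 1)"
    proof
      fix x assume x: "x \<in> slab S \<inter> coord_proj S -` sup_ball r"
      have "\<bar>x $ i\<bar> \<le> max r 1" for i
      proof (cases "i \<in> S")
        case True
        then have "x $ i = coord_proj S x $ i" by (simp add: coord_proj_def)
        moreover have "\<bar>coord_proj S x $ i\<bar> \<le> r" using x by (simp add: sup_ball_def)
        ultimately show ?thesis by linarith
      next
        case False
        then show ?thesis using x by (simp add: slab_def max.coboundedI2)
      qed
      then show "x \<in> sup_ball (max r 1)" by (simp add: sup_ball_def)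
    qed
    then have "emeasure (slab_measure S) (sup_ball r) \<le> emeasure lborel (sup_ball (max r 1) :: (real ^ 'n) set)"
      by (simp add: emeasure_slab_measure emeasure_mono)
    also have "\<dots> < \<infinity>" unfolding sup_ball_eq_cbox by (rule emeasure_lborel_cbox_finite)
    finally show "emeasure (slab_measure S) (sup_ball r) < \<infinity>" .
  qed simp
  have vim: "(+) a -` C \<in> sets borel" "uminus -` C \<in> sets borel" "coord_proj S -` C \<in> sets borel"
    if "C \<in> sets borel" for a :: "real ^ 'n" and C
    using measurable_sets[of "(+) a" borel borel C] measurable_sets[of "uminus :: real ^ 'n \<Rightarrow> real ^ 'n" borel borel C]
      measurable_sets[of "coord_proj S" borel borel C] that
    by simp_all
  have "emeasure \<mu> B * emeasure (slab_measure S) (subcube S) = emeasure \<mu> (subcube S) * emeasure (slab_measure S) B"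
  proof (rule translation_invariant_proportional[OF sf1 sf2 sets, where E = "coord_space S"])
    show "AE x in \<mu>. x \<in> coord_space S"
      unfolding \<mu>_def by (subst AE_density) (auto simp: indicator_def)
    have "AE x in density lborel (indicator (slab S)). coord_proj S x \<in> coord_space S"
      by (simp add: coord_proj_def coord_space_def)
    then show "AE x in slab_measure S. x \<in> coord_space S"
      unfolding slab_measure_def by (subst AE_distr_iff) auto
    show "- x \<in> coord_space S" if "x \<in> coord_space S" for x :: "real ^ 'n"
      using that by (simp add: coord_space_def)
  next
    fix a :: "real ^ 'n" and C :: "(real ^ 'n) set" assume a: "a \<in> coord_space S" and C: "C \<in> sets borel"
    have "coord_space S \<inter> (+) a -` C = (+) a -` (coord_space S \<inter> C)"
      using a by (auto simp: coord_space_def)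
    moreover have "emeasure ?H ((+) a -` (coord_space S \<inter> C)) = emeasure ?H (coord_space S \<inter> C)"
      using C by (intro emeasure_hausdorff_translate) auto
    ultimately show "emeasure \<mu> ((+) a -` C) = emeasure \<mu> C"
      unfolding em[OF C] em[OF vim(1)[OF C]] by (simp only:)
    have pr: "coord_proj S (a + x) = a + coord_proj S x" for x
      using a by (auto simp: vec_eq_iff coord_proj_def coord_space_def)
    have sl: "a + x \<in> slab S \<longleftrightarrow> x \<in> slab S" for x using a by (simp add: slab_def coord_space_def)
    have "slab S \<inter> coord_proj S -` ((+) a -` C) = (+) a -` (slab S \<inter> coord_proj S -` C)"
      by (auto simp: pr sl)
    moreover have "emeasure lborel ((+) a -` (slab S \<inter> coord_proj S -` C)) = emeasure lborel (slab S \<inter> coord_proj S -` C)"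
      using vim(3)[OF C] by (intro emeasure_lborel_translate) auto
    ultimately show "emeasure (slab_measure S) ((+) a -` C) = emeasure (slab_measure S) C"
      unfolding emeasure_slab_measure[OF C] emeasure_slab_measure[OF vim(1)[OF C]] by (simp only:)
  next
    fix C :: "(real ^ 'n) set" assume C: "C \<in> sets borel"
    have pr: "coord_proj S (- x) = - coord_proj S x" for x :: "real ^ 'n"
      by (auto simp: vec_eq_iff coord_proj_def)
    have sl: "- x \<in> slab S \<longleftrightarrow> x \<in> slab S" for x :: "real ^ 'n" by (simp add: slab_def)
    have "slab S \<inter> coord_proj S -` (uminus -` C) = uminus -` (slab S \<inter> coord_proj S -` C)"
      by (auto simp: pr sl)
    moreover have "emeasure lborel (uminus -` (slab S \<inter> coord_proj S -` C)) = emeasure lborel (slab S \<inter> coord_proj S -` C)"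
      using vim(3)[OF C] by (intro emeasure_lborel_uminus) auto
    ultimately show "emeasure (slab_measure S) (uminus -` C) = emeasure (slab_measure S) C"
      unfolding emeasure_slab_measure[OF C] emeasure_slab_measure[OF vim(2)[OF C]] by (simp only:)
  qed (simp_all add: B)
  moreover have "coord_space S \<inter> subcube S = (subcube S :: (real ^ 'n) set)" by (auto simp: subcube_def)
  ultimately show ?thesis
    unfolding em[OF B] em[OF subcube_measurable] slab_measure_subcube by (simp only: mult.commute)
qed

subsection \<open>The skeleton of the cube\<close>

lemma std_cube_eq: "std_cube = (sup_ball 1 :: (real ^ 'n::finite) set)"
proof -
  let ?h = "\<lambda>x :: real ^ 'n. (-1) + 2 *\<^sub>R x"
  have "{v :: real ^ 'n. \<forall>i. v $ i = 1 \<or> v $ i = - 1} = ?h ` {x. \<forall>i. x $ i = 0 \<or> x $ i = 1}"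
  proof (intro set_eqI iffI)
    fix v :: "real ^ 'n" assume v: "v \<in> {v. \<forall>i. v $ i = 1 \<or> v $ i = - 1}"
    have "v = ?h ((1/2) *\<^sub>R (v + 1))" by (simp add: vec_eq_iff field_simps)
    moreover have "(1/2) *\<^sub>R (v + 1) \<in> {x. \<forall>i. x $ i = 0 \<or> x $ i = 1}" using v by auto
    ultimately show "v \<in> ?h ` {x. \<forall>i. x $ i = 0 \<or> x $ i = 1}" by (rule image_eqI)
  qed auto
  moreover have "{x :: real ^ 'n. \<forall>i. x $ i = 0 \<or> x $ i = 1} = {x. \<forall>b\<in>Basis. x \<bullet> b = 0 \<or> x \<bullet> b = 1}"
    by (auto simp: Basis_vec_def inner_axis)
  moreover have "(One :: real ^ 'n) = 1"
  proof (rule euclidean_eqI)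
    fix b :: "real ^ 'n" assume b: "b \<in> Basis"
    then obtain i where "b = axis i 1" by (auto simp: Basis_vec_def)
    then have "1 \<bullet> b = 1" by (simp add: inner_axis)
    moreover have "One \<bullet> b = 1" using b by (simp add: inner_sum_left inner_Basis)
    ultimately show "One \<bullet> b = 1 \<bullet> b" by simp
  qed
  ultimately have "std_cube = ?h ` cbox 0 1"
    unfolding std_cube_def using unit_interval_convex_hull[where 'a = "real ^ 'n"]
    by (simp only: convex_hull_affinity)
  also have "\<dots> = sup_ball 1"
  proof (intro set_eqI iffI)
    fix v assume "v \<in> ?h ` cbox 0 1"
    then obtain x where x: "v = ?h x" "x \<in> cbox 0 1" by blast
    have "\<bar>v $ i\<bar> \<le> 1" for i
    proof -
      have "0 \<le> x $ i" "x $ i \<le> 1" using x(2) by (auto simp: mem_box_cart)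
      then show ?thesis by (simp add: x(1) abs_le_iff)
    qed
    then show "v \<in> sup_ball 1" by (simp add: sup_ball_def)
  next
    fix v :: "real ^ 'n" assume v: "v \<in> sup_ball 1"
    have "v = ?h ((1/2) *\<^sub>R (v + 1))" by (simp add: vec_eq_iff field_simps)
    moreover have "(1/2) *\<^sub>R (v + 1) \<in> cbox 0 1"
    proof -
      have "- 1 \<le> v $ i" "v $ i \<le> 1" for i using v by (auto simp: sup_ball_def abs_le_iff minus_le_iff)
      then have "0 \<le> (v $ i + 1) / 2" "(v $ i + 1) / 2 \<le> 1" for i by (simp_all add: field_simps) (smt (verit) \<open>\<And>i. - 1 \<le> v $ i\<close>)
      then show ?thesis by (simp add: mem_box_cart)
    qed
    ultimately show "v \<in> ?h ` cbox 0 1" by (rule image_eqI)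
  qed
  finally show ?thesis .
qed

lemma subspace_coord_space: "subspace (coord_space S)"
  by (simp add: subspace_def coord_space_def)

lemma axis_image_Basis: "(\<lambda>i. axis i 1) ` T \<subseteq> (Basis :: (real ^ 'n::finite) set)"
  by (auto simp: Basis_vec_def)

lemma card_axis_image: "card ((\<lambda>i. axis i (1::real)) ` T) = card T"
  by (rule card_image) (auto simp: inj_on_def axis_eq_axis)

lemma dim_coord_space: "dim (coord_space T) = card T" for T :: "'n::finite set"
proof -
  have "coord_space T = {x :: real ^ 'n. \<forall>b\<in>Basis. b \<notin> (\<lambda>i. axis i 1) ` T \<longrightarrow> x \<bullet> b = 0}"
    by (auto simp: coord_space_def Basis_vec_def inner_axis axis_eq_axis image_iff)
  then show ?thesis
    using dim_substandard[OF axis_image_Basis[of T]] by (simp add: card_axis_image)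
qed

text \<open>Freezing the coordinates with |x_i| = 1 gives a face through x whose dimension is at
  most the number of the others. Conversely, a face containing x contains a segment through x in
  each direction with |x_i| < 1, so its dimension is at least their number.\<close>

lemma mem_skeleton_std_cube:
  fixes x :: "real ^ 'n::finite"
  shows "x \<in> skeleton std_cube k \<longleftrightarrow> x \<in> sup_ball 1 \<and> card {i. \<bar>x $ i\<bar> < 1} \<le> k"
proof
  let ?T = "{i. \<bar>x $ i\<bar> < 1}"
  assume x: "x \<in> sup_ball 1 \<and> card ?T \<le> k"
  define F where "F = {y \<in> sup_ball 1. \<forall>i. i \<notin> ?T \<longrightarrow> y $ i = x $ i}"
  have "F face_of sup_ball 1"
    unfolding face_of_def
  proof (intro conjI ballI impI)
    show "F \<subseteq> sup_ball 1" by (auto simp: F_def)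
    have "F = sup_ball 1 \<inter> (\<Inter>i\<in>-?T. {y. y $ i = x $ i})" by (auto simp: F_def)
    moreover have "convex {y :: real ^ 'n. y $ i = x $ i}" for i
      by (auto simp: convex_def simp flip: distrib_right)
    ultimately show "convex F" unfolding sup_ball_eq_cbox by (auto intro!: convex_Int convex_INT convex_box)
  next
    fix a b y assume ab: "a \<in> sup_ball 1" "b \<in> sup_ball 1" and y: "y \<in> F" and seg: "y \<in> open_segment a b"
    obtain u where u: "0 < u" "u < 1" "y = (1 - u) *\<^sub>R a + u *\<^sub>R b" using seg by (auto simp: in_segment)
    have eq: "a $ i = x $ i \<and> b $ i = x $ i" if i: "i \<notin> ?T" for i
    proof -
      have yi: "x $ i = (1 - u) * a $ i + u * b $ i" using y i u(3) by (simp add: F_def)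
      have bd: "- 1 \<le> a $ i" "a $ i \<le> 1" "- 1 \<le> b $ i" "b $ i \<le> 1"
        using ab by (auto simp: sup_ball_def abs_le_iff minus_le_iff)
      have "\<bar>x $ i\<bar> \<le> 1" "\<not> \<bar>x $ i\<bar> < 1" using x i by (auto simp: sup_ball_def)
      then have "x $ i = 1 \<or> x $ i = - 1" by linarith
      then show ?thesis
      proof
        assume x1: "x $ i = 1"
        have 0: "(1 - u) * (1 - a $ i) + u * (1 - b $ i) = 0" using yi x1 by (simp add: algebra_simps)
        have "(1 - u) * (1 - a $ i) \<ge> 0" "u * (1 - b $ i) \<ge> 0" using u bd by simp_all
        then have "(1 - u) * (1 - a $ i) = 0" "u * (1 - b $ i) = 0" using 0 by linarith+
        then show ?thesis using u x1 by simp
      next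
        assume x1: "x $ i = - 1"
        have 0: "(1 - u) * (1 + a $ i) + u * (1 + b $ i) = 0" using yi x1 by (simp add: algebra_simps)
        have "(1 - u) * (1 + a $ i) \<ge> 0" "u * (1 + b $ i) \<ge> 0" using u bd by simp_all
        then have "(1 - u) * (1 + a $ i) = 0" "u * (1 + b $ i) = 0" using 0 by linarith+
        then have "1 + a $ i = 0" "1 + b $ i = 0" using u by simp_all
        then show ?thesis using x1 by linarith
      qed
    qed
    show "a \<in> F" "b \<in> F" using ab eq by (auto simp: F_def)
  qed
  moreover have "aff_dim F \<le> int k"
  proof -
    have "F \<subseteq> (+) x ` coord_space ?T"
    proof
      fix y assume "y \<in> F"
      then have "y - x \<in> coord_space ?T" by (simp add: F_def coord_space_def)
      moreover have "y = x + (y - x)" by simp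
      ultimately show "y \<in> (+) x ` coord_space ?T" by blast
    qed
    then have "aff_dim F \<le> aff_dim ((+) x ` coord_space ?T)" by (rule aff_dim_subset)
    also have "\<dots> = int (card ?T)"
      by (simp add: aff_dim_translation_eq aff_dim_subspace[OF subspace_coord_space] dim_coord_space)
    finally show ?thesis using x by linarith
  qed
  moreover have "x \<in> F" using x by (simp add: F_def)
  ultimately show "x \<in> skeleton std_cube k" unfolding skeleton_def std_cube_eq by blast
next
  let ?T = "{i. \<bar>x $ i\<bar> < 1}"
  assume "x \<in> skeleton std_cube k"
  then obtain F where F: "F face_of sup_ball 1" "aff_dim F \<le> int k" "x \<in> F"
    unfolding skeleton_def std_cube_eq by blast
  have x: "x \<in> sup_ball 1" using F(1,3) by (auto simp: face_of_def)
  let ?W = "(+) (- x) ` F"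
  have "(\<lambda>i. axis i 1) ` ?T \<subseteq> span ?W"
  proof
    fix b assume "b \<in> (\<lambda>i. axis i (1::real)) ` ?T"
    then obtain i where i: "\<bar>x $ i\<bar> < 1" "b = axis i 1" by blast
    \<comment> \<open>The distance of x to the boundary in direction i, so that x + t e_i and x - t
      e_i stay in the cube.\<close>
    define t where "t = 1 - \<bar>x $ i\<bar>"
    have t: "t > 0" using i by (simp add: t_def)
    define p q where "p = x + t *\<^sub>R b" and "q = x - t *\<^sub>R b"
    have "\<bar>p $ j\<bar> \<le> 1 \<and> \<bar>q $ j\<bar> \<le> 1" for j
    proof (cases "j = i")
      case True
      have "\<bar>x $ i + t\<bar> \<le> 1 \<and> \<bar>x $ i - t\<bar> \<le> 1" using i(1) unfolding t_def by linarith
      then show ?thesis by (simp add: p_def q_def i(2) True)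
    next
      case False
      then have "axis i (1::real) $ j = 0" by (simp add: axis_def)
      then show ?thesis using x by (simp add: p_def q_def i(2) sup_ball_def)
    qed
    then have pq: "p \<in> sup_ball 1" "q \<in> sup_ball 1" by (auto simp: sup_ball_def)
    have bn: "b \<noteq> 0" by (simp add: i(2) axis_eq_0_iff)
    have "x = (1 - 1/2) *\<^sub>R p + (1/2) *\<^sub>R q"
      by (simp add: p_def q_def vec_eq_iff field_simps)
    moreover have "p \<noteq> q"
    proof
      assume "p = q"
      then have "(2 * t) *\<^sub>R b = 0" by (simp add: p_def q_def vec_eq_iff)
      then show False using t bn by simp
    qed
    ultimately have "x \<in> open_segment p q" unfolding in_segment by (intro conjI exI[of _ "1/2"]) auto
    then have "p \<in> F" using F(1,3) pq unfolding face_of_def by blast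
    then have "- x + p \<in> ?W" by blast
    then have "(1 / t) *\<^sub>R (- x + p) \<in> span ?W" by (intro span_scale span_base)
    moreover have "(1 / t) *\<^sub>R (- x + p) = b" using t by (simp add: p_def)
    ultimately show "b \<in> span ?W" by simp
  qed
  moreover have "independent ((\<lambda>i. axis i 1) ` ?T :: (real ^ 'n) set)"
    by (rule independent_mono[OF independent_Basis axis_image_Basis])
  ultimately have "card ((\<lambda>i. axis i (1::real)) ` ?T) \<le> dim (span ?W)"
    by (rule independent_card_le_dim)
  then have "card ?T \<le> dim ?W" by (simp add: card_axis_image)
  moreover have "aff_dim F = int (dim ?W)"
    by (rule aff_dim_eq_dim) (rule hull_inc[OF F(3)])
  ultimately show "x \<in> sup_ball 1 \<and> card ?T \<le> k" using F(2) x by linarith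
qed

text \<open>The centre of the face with free coordinates \<open>S\<close>; it is a vertex only when
  \<open>S\<close> is empty.\<close>

definition cube_vertex :: "'n set \<Rightarrow> 'n set \<Rightarrow> real ^ 'n" where
  "cube_vertex S T = (\<chi> i. if i \<in> S then 0 else if i \<in> T then 1 else - 1)"

definition cube_face :: "'n set \<Rightarrow> 'n set \<Rightarrow> (real ^ 'n) set" where
  "cube_face S T = (+) (cube_vertex S T) ` subcube S"

text \<open>Signs are recorded only at the fixed coordinates, so that each k-face has exactly one
  index.\<close>

definition face_index :: "nat \<Rightarrow> ('n set \<times> 'n set) set" where
  "face_index k = (SIGMA S:{S. card S = k}. Pow (- S))"

lemma finite_face_index [simp]: "finite (face_index k :: ('n::finite set \<times> 'n set) set)"
  by (rule finite_subset[OF subset_UNIV]) simp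

lemma mem_cube_face:
  "y \<in> cube_face S T \<longleftrightarrow> (\<forall>i. if i \<in> S then \<bar>y $ i\<bar> \<le> 1 else y $ i = (if i \<in> T then 1 else - 1))"
proof
  assume "y \<in> cube_face S T"
  then obtain z where z: "z \<in> subcube S" "y = cube_vertex S T + z" unfolding cube_face_def by blast
  then show "\<forall>i. if i \<in> S then \<bar>y $ i\<bar> \<le> 1 else y $ i = (if i \<in> T then 1 else - 1)"
    by (auto simp: cube_vertex_def subcube_def coord_space_def)
next
  assume y: "\<forall>i. if i \<in> S then \<bar>y $ i\<bar> \<le> 1 else y $ i = (if i \<in> T then 1 else - 1)"
  have yS: "\<bar>y $ i\<bar> \<le> 1" if "i \<in> S" for i using spec[OF y, of i] that by simp
  have yT: "y $ i = (if i \<in> T then 1 else - 1)" if "i \<notin> S" for i using spec[OF y, of i] that by simp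
  have "\<bar>coord_proj S y $ i\<bar> \<le> 1" for i using yS by (simp add: coord_proj_def)
  then have "coord_proj S y \<in> subcube S" by (simp add: subcube_def coord_space_def coord_proj_def)
  moreover have "y = cube_vertex S T + coord_proj S y"
    using yT by (simp add: vec_eq_iff cube_vertex_def coord_proj_def)
  ultimately show "y \<in> cube_face S T" unfolding cube_face_def by blast
qed

text \<open>A point of the skeleton may have fewer than k free coordinates; k \<le>
  \<open>CARD('n)\<close> allows the set of them to be enlarged to exactly k elements.\<close>

lemma skeleton_std_cube_eq:
  assumes k: "k \<le> CARD('n::finite)"
  shows "skeleton std_cube k = (\<Union>(S, T)\<in>face_index k. cube_face S (T :: 'n set))"
proof (intro set_eqI iffI)
  fix x :: "real ^ 'n" assume "x \<in> skeleton std_cube k"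
  then have x: "x \<in> sup_ball 1" "card {i. \<bar>x $ i\<bar> < 1} \<le> k" by (simp_all add: mem_skeleton_std_cube)
  obtain S where S: "{i. \<bar>x $ i\<bar> < 1} \<subseteq> S" "card S = k"
    using exists_subset_between[OF x(2) k subset_UNIV finite] by blast
  define T where "T = {i \<in> - S. x $ i = 1}"
  have "if i \<in> S then \<bar>x $ i\<bar> \<le> 1 else x $ i = (if i \<in> T then 1 else - 1)" for i
  proof (cases "i \<in> S")
    case True
    then show ?thesis using x(1) by (simp add: sup_ball_def)
  next
    case False
    then have "\<not> \<bar>x $ i\<bar> < 1" using S(1) by blast
    moreover have "\<bar>x $ i\<bar> \<le> 1" using x(1) by (simp add: sup_ball_def)
    ultimately have "x $ i = 1 \<or> x $ i = - 1" by linarith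
    then show ?thesis using False by (auto simp: T_def)
  qed
  then have "x \<in> cube_face S T" unfolding mem_cube_face by blast
  moreover have "(S, T) \<in> face_index k" using S(2) by (auto simp: face_index_def T_def)
  ultimately show "x \<in> (\<Union>(S, T)\<in>face_index k. cube_face S T)" by blast
next
  fix x :: "real ^ 'n" assume "x \<in> (\<Union>(S, T)\<in>face_index k. cube_face S T)"
  then obtain S T where ST: "card S = k" "x \<in> cube_face S T" by (auto simp: face_index_def)
  have xS: "\<bar>x $ i\<bar> \<le> 1" if "i \<in> S" for i 
  proof -
    have "if i \<in> S then \<bar>x $ i\<bar> \<le> 1 else x $ i = (if i \<in> T then 1 else - 1)"
      using ST(2) unfolding mem_cube_face by (rule spec)
    then show ?thesis using that by simp
  qed
  have xT: "\<bar>x $ i\<bar> = 1" if "i \<notin> S" for i 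
  proof -
    have "if i \<in> S then \<bar>x $ i\<bar> \<le> 1 else x $ i = (if i \<in> T then 1 else - 1)"
      using ST(2) unfolding mem_cube_face by (rule spec)
    then show ?thesis using that by (simp split: if_splits)
  qed
  have "{i. \<bar>x $ i\<bar> < 1} \<subseteq> S" using xT by fastforce
  then have "card {i. \<bar>x $ i\<bar> < 1} \<le> k" unfolding ST(1)[symmetric] by (rule card_mono[OF finite])
  moreover have "x \<in> sup_ball 1" 
  proof -
    have "\<bar>x $ i\<bar> \<le> 1" for i
      by (cases "i \<in> S") (simp_all add: xS xT)
    then show ?thesis by (simp add: sup_ball_def)
  qed
  ultimately show "x \<in> skeleton std_cube k" by (simp add: mem_skeleton_std_cube)
qed

subsection \<open>Integration over the skeleton of the cube\<close>

text \<open>A bijection between the index sets relabels coordinates, which is a 1-Lipschitz map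
  taking one subcube over the other.\<close>

lemma hausdorff_subcube_le:
  fixes S S' :: "'n::finite set"
  assumes "card S = card S'"
  shows "emeasure (hausdorff_measure d) (subcube S') \<le> emeasure (hausdorff_measure d) (subcube S)"
proof -
  obtain f where f: "bij_betw f S' S" using finite_same_card_bij[OF finite finite, of S' S] assms by auto
  define g :: "real ^ 'n \<Rightarrow> real ^ 'n" where "g = (\<lambda>x. \<chi> i. if i \<in> S' then x $ f i else 0)"
  have "subcube S' \<subseteq> g ` subcube S"
  proof
    fix y :: "real ^ 'n" assume y: "y \<in> subcube S'"
    define x :: "real ^ 'n" where "x = (\<chi> j. if j \<in> S then y $ inv_into S' f j else 0)"
    have "x \<in> subcube S" using y by (simp add: x_def subcube_def coord_space_def)
    moreover have "g x $ i = y $ i" for i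
    proof (cases "i \<in> S'")
      case True
      then have "f i \<in> S" "inv_into S' f (f i) = i"
        using bij_betwE[OF f] bij_betw_inv_into_left[OF f] by auto
      then show ?thesis using True by (simp add: g_def x_def)
    next
      case False
      then show ?thesis using y by (simp add: g_def subcube_def coord_space_def)
    qed
    then have "y = g x" by (simp add: vec_eq_iff)
    ultimately show "y \<in> g ` subcube S" by blast
  qed
  then have "hausdorff_outer d (subcube S') \<le> hausdorff_outer d (g ` subcube S)" by (rule hausdorff_outer_mono)
  also have "\<dots> \<le> ennreal (1 ^ d) * hausdorff_outer d (subcube S)"
  proof (rule hausdorff_outer_lipschitz)
    fix x y :: "real ^ 'n"
    have "(norm (g x - g y))\<^sup>2 = (\<Sum>i\<in>UNIV. ((g x - g y) $ i)\<^sup>2)"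
      by (simp add: norm_vec_def L2_set_def sum_nonneg)
    also have "\<dots> = (\<Sum>i\<in>S'. (x $ f i - y $ f i)\<^sup>2)"
      by (rule sum.mono_neutral_cong_right) (auto simp: g_def)
    also have "\<dots> = (\<Sum>j\<in>S. (x $ j - y $ j)\<^sup>2)"
      by (rule sum.reindex_bij_betw[OF f])
    also have "\<dots> \<le> (\<Sum>j\<in>UNIV. (x $ j - y $ j)\<^sup>2)" by (rule sum_mono2) auto
    also have "\<dots> = (norm (x - y))\<^sup>2" by (simp add: norm_vec_def L2_set_def sum_nonneg)
    finally have "norm (g x - g y) \<le> norm (x - y)" by (rule power2_le_imp_le) simp
    then show "dist (g x) (g y) \<le> 1 * dist x y" by (simp add: dist_norm)
  qed simp
  finally show ?thesis by (simp add: emeasure_hausdorff)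
qed

text \<open>One constant serves all directions of k-faces. It is left unspecified and cancels in the
  mean in \<open>cube_measure_skeleton\<close>.\<close>

lemma hausdorff_subcube_const:
  "\<exists>c>0. \<forall>S :: 'n::finite set. card S = k \<longrightarrow> emeasure (hausdorff_measure k) (subcube S) = ennreal c"
proof (cases "\<exists>S0 :: 'n set. card S0 = k")
  case True
  then obtain S0 :: "'n set" where S0: "card S0 = k" by blast
  define e where "e = emeasure (hausdorff_measure k) (subcube S0)"
  have e: "0 < e" "e < \<infinity>"
    using hausdorff_subcube_pos[of S0] hausdorff_subcube_finite[of S0] by (simp_all add: S0 e_def)
  obtain c where c: "e = ennreal c" "c \<ge> 0" using e(2) by (cases e) auto
  have "emeasure (hausdorff_measure k) (subcube S) = ennreal c" if "card S = k" for S :: "'n set"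
  proof -
    have "emeasure (hausdorff_measure k) (subcube S) = e"
      unfolding e_def
      by (rule antisym; rule hausdorff_subcube_le) (simp_all add: S0 that)
    then show ?thesis using c(1) by simp
  qed
  moreover have "c > 0" using e(1) c by simp
  ultimately show ?thesis by blast
next
  case False
  then show ?thesis by (intro exI[of _ 1]) auto
qed

lemma cube_face_measurable [measurable]: "cube_face S T \<in> sets borel" for S T :: "'n::finite set"
proof -
  have "cube_face S T = (+) (- cube_vertex S T) -` subcube S"
    unfolding cube_face_def
  proof (intro set_eqI iffI)
    fix x assume "x \<in> (+) (- cube_vertex S T) -` subcube S"
    then have "- cube_vertex S T + x \<in> subcube S" by simp
    moreover have "x = cube_vertex S T + (- cube_vertex S T + x)" by simp
    ultimately show "x \<in> (+) (cube_vertex S T) ` subcube S" by blast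
  qed auto
  then show ?thesis using measurable_sets[of "(+) (- cube_vertex S T)" borel borel "subcube S"] by simp
qed

lemma slab_Int_vimage_subcube: "slab S \<inter> coord_proj S -` subcube S = sup_ball 1"
proof (intro set_eqI iffI)
  fix x assume x: "x \<in> slab S \<inter> coord_proj S -` subcube S"
  have "\<bar>x $ i\<bar> \<le> 1" for i
  proof (cases "i \<in> S")
    case True
    then have "x $ i = coord_proj S x $ i" by (simp add: coord_proj_def)
    then show ?thesis using x by (simp add: subcube_def)
  next
    case False
    then show ?thesis using x by (simp add: slab_def)
  qed
  then show "x \<in> sup_ball 1" by (simp add: sup_ball_def)
next
  fix x assume x: "x \<in> (sup_ball 1 :: (real ^ 'a) set)"
  then show "x \<in> slab S \<inter> coord_proj S -` subcube S"
    by (auto simp: slab_def coord_proj_def subcube_def coord_space_def sup_ball_def)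
qed

text \<open>Faces of all directions are parametrised by the full cube, whose fixed directions are
  projected away; 2^\<open>CARD('n)\<close> is the volume of that cube.\<close>

lemma emeasure_cube_face:
  fixes S T :: "'n::finite set"
  assumes c: "emeasure (hausdorff_measure (card S)) (subcube S) = ennreal c" "c \<ge> 0" and B: "B \<in> sets borel"
  shows "emeasure (hausdorff_measure (card S)) (cube_face S T \<inter> B) =
    ennreal (c / 2 ^ CARD('n)) * emeasure lborel (sup_ball 1 \<inter> (\<lambda>x. cube_vertex S T + coord_proj S x) -` B)"
    (is "?L = _ * ?R")
proof -
  let ?H = "hausdorff_measure (card S) :: (real ^ 'n) measure" and ?v = "cube_vertex S T"
  have vim: "(+) ?v -` B \<in> sets borel" using measurable_sets[of "(+) ?v" borel borel B] B by simp
  have "cube_face S T \<inter> B = (+) ?v ` (subcube S \<inter> (+) ?v -` B)" unfolding cube_face_def by auto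
  moreover have "hausdorff_outer (card S) ((+) ?v ` (subcube S \<inter> (+) ?v -` B)) = hausdorff_outer (card S) (subcube S \<inter> (+) ?v -` B)"
    by (rule hausdorff_outer_isometric_image) (simp add: dist_norm)
  ultimately have "hausdorff_outer (card S) (cube_face S T \<inter> B) = hausdorff_outer (card S) (subcube S \<inter> (+) ?v -` B)"
    by (simp only:)
  then have "?L = emeasure ?H (subcube S \<inter> (+) ?v -` B)"
    using emeasure_hausdorff[OF sets.Int[OF cube_face_measurable[of S T] B]]
      emeasure_hausdorff[OF sets.Int[OF subcube_measurable[of S] vim]] by (simp only:)
  moreover have "subcube S \<inter> (+) ?v -` B = coord_space S \<inter> (subcube S \<inter> (+) ?v -` B)" by (auto simp: subcube_def)
  ultimately have "?L * 2 ^ CARD('n) = emeasure (slab_measure S) (subcube S \<inter> (+) ?v -` B) * ennreal c"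
    using hausdorff_coord_space[of "subcube S \<inter> (+) ?v -` B" S] vim c(1) by (simp only: sets.Int subcube_measurable)
  also have "emeasure (slab_measure S) (subcube S \<inter> (+) ?v -` B) =
      emeasure lborel (slab S \<inter> coord_proj S -` (subcube S \<inter> (+) ?v -` B))"
    using vim by (intro emeasure_slab_measure) auto
  also have "slab S \<inter> coord_proj S -` (subcube S \<inter> (+) ?v -` B) = sup_ball 1 \<inter> (\<lambda>x. ?v + coord_proj S x) -` B"
    unfolding slab_Int_vimage_subcube[of S, symmetric] by auto
  finally have eq: "?L * 2 ^ CARD('n) = ?R * ennreal c" .
  have two: "(2 :: ennreal) ^ CARD('n) = ennreal (2 ^ CARD('n))"
    by (subst ennreal_power[symmetric]) simp_all
  have "?L = ?L * (2 ^ CARD('n) * ennreal (1 / 2 ^ CARD('n)))"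
    unfolding two by (subst ennreal_mult[symmetric]) simp_all
  also have "\<dots> = ?R * (ennreal c * ennreal (1 / 2 ^ CARD('n)))"
    unfolding mult.assoc[symmetric] eq ..
  also have "ennreal c * ennreal (1 / 2 ^ CARD('n)) = ennreal (c / 2 ^ CARD('n))"
    using c(2) by (subst ennreal_mult[symmetric]) simp_all
  finally show ?thesis by (simp only: mult.commute)
qed

lemma set_integral_cube_face:
  fixes S T :: "'n::finite set" and g :: "real ^ 'n \<Rightarrow> real"
  assumes c: "emeasure (hausdorff_measure (card S)) (subcube S) = ennreal c" "c \<ge> 0"
    and g: "g \<in> borel_measurable borel"
  shows "(LINT y:cube_face S T|hausdorff_measure (card S). g y) =
    c / 2 ^ CARD('n) * (LINT x:sup_ball 1|lborel. g (cube_vertex S T + coord_proj S x))"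
proof -
  let ?H = "hausdorff_measure (card S) :: (real ^ 'n) measure" and ?F = "cube_face S T"
  let ?p = "\<lambda>x. cube_vertex S T + coord_proj S x" and ?r = "c / 2 ^ CARD('n)"
  let ?D = "distr (density lborel (\<lambda>x. ennreal (indicator (sup_ball 1) x))) borel ?p"
  note [measurable] = g
  have p: "?p \<in> borel_measurable borel" by measurable
  have em: "emeasure (density M (\<lambda>x. ennreal (indicator A x))) B = emeasure M (A \<inter> B)"
    if "sets M = sets borel" "A \<in> sets borel" "B \<in> sets borel" for M :: "(real ^ 'n) measure" and A B
  proof -
    have "emeasure (density M (\<lambda>x. ennreal (indicator A x))) B = (\<integral>\<^sup>+x. ennreal (indicator A x) * indicator B x \<partial>M)"
      using that by (subst emeasure_density) (auto simp: measurable_cong_sets[OF that(1) refl])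
    also have "\<dots> = (\<integral>\<^sup>+x. indicator (A \<inter> B) x \<partial>M)"
      by (intro nn_integral_cong) (auto simp: indicator_def)
    also have "\<dots> = emeasure M (A \<inter> B)" using that by (intro nn_integral_indicator) auto
    finally show ?thesis .
  qed
  have "density ?H (\<lambda>x. ennreal (indicator ?F x)) = density ?D (\<lambda>_. ennreal ?r)"
  proof (rule measure_eqI)
    fix B assume "B \<in> sets (density ?H (\<lambda>x. ennreal (indicator ?F x)))"
    then have B: "B \<in> sets borel" by simp
    have pB: "?p -` B \<in> sets borel" using measurable_sets[OF p B] by simp
    have "emeasure (density ?D (\<lambda>_. ennreal ?r)) B = ennreal ?r * emeasure ?D B"
      using B by (intro emeasure_density_const) simp
    also have "emeasure ?D B = emeasure (density lborel (\<lambda>x. ennreal (indicator (sup_ball 1) x))) (?p -` B)"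
      using B p by (subst emeasure_distr) auto
    also have "\<dots> = emeasure lborel (sup_ball 1 \<inter> ?p -` B)" using pB by (intro em) auto
    also have "ennreal ?r * \<dots> = emeasure ?H (?F \<inter> B)"
      by (rule emeasure_cube_face[OF c B, symmetric])
    also have "\<dots> = emeasure (density ?H (\<lambda>x. ennreal (indicator ?F x))) B"
      using B by (intro em[symmetric]) auto
    finally show "emeasure (density ?H (\<lambda>x. ennreal (indicator ?F x))) B = emeasure (density ?D (\<lambda>_. ennreal ?r)) B"
      by (rule sym)
  qed simp
  then have eq: "integral\<^sup>L (density ?H (\<lambda>x. ennreal (indicator ?F x))) g = integral\<^sup>L (density ?D (\<lambda>_. ennreal ?r)) g"
    by (rule arg_cong)
  have "integral\<^sup>L (density ?H (\<lambda>x. ennreal (indicator ?F x))) g = (LINT y:?F|?H. g y)"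
    unfolding set_lebesgue_integral_def by (subst integral_density) auto
  moreover have "integral\<^sup>L (density ?D (\<lambda>_. ennreal ?r)) g = (\<integral>x. ?r *\<^sub>R g x \<partial>?D)"
    using c(2) by (subst integral_density) auto
  moreover have "(\<integral>x. ?r *\<^sub>R g x \<partial>?D) = ?r * integral\<^sup>L ?D g" by simp
  moreover have "integral\<^sup>L ?D g = (\<integral>x. g (?p x) \<partial>density lborel (\<lambda>x. ennreal (indicator (sup_ball 1) x)))"
    by (rule integral_distr) auto
  moreover have "\<dots> = (LINT x:sup_ball 1|lborel. g (?p x))"
    unfolding set_lebesgue_integral_def by (subst integral_density) auto
  ultimately show ?thesis using eq by (simp only:)
qed

lemma cube_face_subset_sup_ball: "cube_face S T \<subseteq> sup_ball 1"
proof
  fix x assume x: "x \<in> cube_face S T"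
  have "\<bar>x $ i\<bar> \<le> 1" for i
  proof -
    have "if i \<in> S then \<bar>x $ i\<bar> \<le> 1 else x $ i = (if i \<in> T then 1 else - 1)"
      using x unfolding mem_cube_face by (rule spec)
    then show ?thesis by (simp split: if_splits)
  qed
  then show "x \<in> sup_ball 1" by (simp add: sup_ball_def)
qed

lemma emeasure_cube_face_finite:
  fixes S T :: "'n::finite set"
  shows "emeasure (hausdorff_measure (card S)) (cube_face S T) < \<infinity>"
proof -
  have "hausdorff_outer (card S) (cube_face S T) = hausdorff_outer (card S) (subcube S)"
    unfolding cube_face_def by (rule hausdorff_outer_isometric_image) (simp add: dist_norm)
  then show ?thesis using hausdorff_subcube_finite[of S] by (simp add: emeasure_hausdorff)
qed

text \<open>Distinct faces with the same free coordinates are disjoint. Otherwise some j is free in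
  the first face and fixed in the second, and the overlap corresponds to a part of a box of width 0
  in direction j.\<close>

lemma cube_face_overlap_null:
  fixes S S' T T' :: "'n::finite set"
  assumes "(S, T) \<in> face_index k" "(S', T') \<in> face_index k" "(S, T) \<noteq> (S', T')"
  shows "emeasure (hausdorff_measure k) (cube_face S T \<inter> cube_face S' T') = 0"
proof (cases "S = S'")
  case True
  then have "T \<noteq> T'" "T \<subseteq> - S" "T' \<subseteq> - S" using assms by (auto simp: face_index_def)
  then obtain i where i: "i \<notin> S" "i \<in> T \<longleftrightarrow> i \<notin> T'" by blast
  have "cube_face S T \<inter> cube_face S' T' = {}"
  proof (rule ccontr)
    assume "cube_face S T \<inter> cube_face S' T' \<noteq> {}"
    then obtain x where x: "x \<in> cube_face S T" "x \<in> cube_face S' T'" by blast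
    have "x $ i = (if i \<in> T then 1 else - 1)" "x $ i = (if i \<in> T' then 1 else - 1)"
      using i(1) True x[unfolded mem_cube_face, THEN spec, of i] by simp_all
    then show False using i(2) by (auto split: if_splits)
  qed
  then show ?thesis by simp
next
  case False
  have S: "card S = k" "card S' = k" using assms by (auto simp: face_index_def)
  have "\<not> S \<subseteq> S'" using False S card_subset_eq[OF finite, of S S'] by auto
  then obtain j where j: "j \<in> S" "j \<notin> S'" by blast
  obtain c where c: "c > 0" "emeasure (hausdorff_measure (card S)) (subcube S) = ennreal c"
    using hausdorff_subcube_const[where 'n = 'n and k = "card S"] by auto
  define t :: real where "t = (if j \<in> T' then 1 else - 1)"
  define a b :: "real ^ 'n" where "a = (\<chi> i. if i = j then t else - 1)" and "b = (\<chi> i. if i = j then t else 1)"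
  have "(\<lambda>x. cube_vertex S T + coord_proj S x) -` cube_face S' T' \<subseteq> {x. x $ j = t}"
  proof
    fix x assume "x \<in> (\<lambda>x. cube_vertex S T + coord_proj S x) -` cube_face S' T'"
    then have "cube_vertex S T + coord_proj S x \<in> cube_face S' T'" by simp
    then have "(cube_vertex S T + coord_proj S x) $ j = t"
      using j(2) unfolding mem_cube_face t_def by (auto dest!: spec[of _ j])
    then show "x \<in> {x. x $ j = t}" using j(1) by (simp add: cube_vertex_def coord_proj_def)
  qed
  then have sub: "sup_ball 1 \<inter> (\<lambda>x. cube_vertex S T + coord_proj S x) -` cube_face S' T' \<subseteq> {x. \<forall>i. a $ i \<le> x $ i \<and> x $ i \<le> b $ i}"
    by (auto simp: a_def b_def sup_ball_def abs_le_iff minus_le_iff)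
  have "{x. \<forall>i. a $ i \<le> x $ i \<and> x $ i \<le> b $ i} = cbox a b" by (auto simp: mem_box_cart)
  then have "emeasure lborel (sup_ball 1 \<inter> (\<lambda>x. cube_vertex S T + coord_proj S x) -` cube_face S' T') \<le>
      emeasure lborel {x. \<forall>i. a $ i \<le> x $ i \<and> x $ i \<le> b $ i}"
    by (intro emeasure_mono[OF sub]) simp
  also have "\<dots> = ennreal (\<Prod>i\<in>UNIV. b $ i - a $ i)"
    by (rule emeasure_lborel_vec_box) (simp add: a_def b_def)
  also have "(\<Prod>i\<in>UNIV. b $ i - a $ i) = 0"
    by (rule prod_zero[OF finite]) (auto simp: a_def b_def intro!: exI[of _ j])
  finally have "emeasure lborel (sup_ball 1 \<inter> (\<lambda>x. cube_vertex S T + coord_proj S x) -` cube_face S' T') = 0" by simp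
  then show ?thesis
    using emeasure_cube_face[OF c(2) less_imp_le[OF c(1)] cube_face_measurable, of T S' T'] S by simp
qed

section \<open>Moments of the skeleton\<close>

lemma skeleton_measurable: "k \<le> CARD('n) \<Longrightarrow> skeleton std_cube k \<in> sets (borel :: (real ^ 'n::finite) measure)"
  unfolding skeleton_std_cube_eq by (intro sets.finite_UN) auto

lemma emeasure_skeleton_finite:
  assumes k: "k \<le> CARD('n::finite)"
  shows "emeasure (hausdorff_measure k) (skeleton (std_cube :: (real ^ 'n) set) k) < \<infinity>"
proof -
  have "emeasure (hausdorff_measure k) (skeleton (std_cube :: (real ^ 'n) set) k) \<le>
      (\<Sum>p\<in>face_index k. emeasure (hausdorff_measure k) (case p of (S, T) \<Rightarrow> cube_face S (T :: 'n set)))"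
    unfolding skeleton_std_cube_eq[OF k] by (rule emeasure_subadditive_finite) auto
  also have "\<dots> < \<infinity>"
  proof -
    have "emeasure (hausdorff_measure k) (case p of (S, T) \<Rightarrow> cube_face S (T :: 'n set)) < \<infinity>" if "p \<in> face_index k" for p
      using that emeasure_cube_face_finite by (auto simp: face_index_def)
    then show ?thesis by (simp add: less_top)
  qed
  finally show ?thesis .
qed

lemma set_integral_skeleton:
  fixes g :: "real ^ 'n::finite \<Rightarrow> real"
  assumes k: "k \<le> CARD('n)" and g: "continuous_on UNIV g"
    and c: "c > 0" "\<And>S :: 'n set. card S = k \<Longrightarrow> emeasure (hausdorff_measure k) (subcube S) = ennreal c"
  shows "(LINT y:skeleton std_cube k|hausdorff_measure k. g y) =
    (\<Sum>(S, T)\<in>face_index k. c / 2 ^ CARD('n) * (LINT x:sup_ball 1|lborel. g (cube_vertex S T + coord_proj S x)))"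
proof -
  let ?A = "\<lambda>(S, T). cube_face S (T :: 'n set)" and ?H = "hausdorff_measure k :: (real ^ 'n) measure"
  have gm: "g \<in> borel_measurable borel" by (rule borel_measurable_continuous_onI[OF g])
  have "compact (g ` sup_ball 1)"
    unfolding sup_ball_eq_cbox by (intro compact_continuous_image continuous_on_subset[OF g] compact_cbox) auto
  then obtain M where M: "\<And>x. x \<in> sup_ball 1 \<Longrightarrow> norm (g x) \<le> M"
    using compact_imp_bounded[of "g ` sup_ball 1"] unfolding bounded_iff by blast
  have "(LINT y:(\<Union>p\<in>face_index k. ?A p)|?H. g y) = (\<Sum>p\<in>face_index k. LINT y:?A p|?H. g y)"
  proof (rule set_integral_finite_UN_AE)
    fix p q :: "'n set \<times> 'n set" assume pq: "p \<in> face_index k" "q \<in> face_index k"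
    show "AE x in ?H. x \<in> ?A p \<and> x \<in> ?A q \<longrightarrow> p = q"
    proof (cases "p = q")
      case False
      obtain S T S' T' where p: "p = (S, T)" and q: "q = (S', T')" by (cases p, cases q) blast
      have "emeasure ?H (cube_face S T \<inter> cube_face S' T') = 0"
        using cube_face_overlap_null pq False unfolding p q by blast
      then have "cube_face S T \<inter> cube_face S' T' \<in> null_sets ?H" by (simp add: null_sets_def)
      then have "AE x in ?H. x \<notin> cube_face S T \<inter> cube_face S' T'" by (rule AE_not_in)
      then show ?thesis unfolding p q by eventually_elim blast
    qed simp
  next
    fix p :: "'n set \<times> 'n set" assume p: "p \<in> face_index k"
    then obtain S T where ST: "p = (S, T)" "card S = k" by (auto simp: face_index_def)
    have "integrable ?H (\<lambda>x. indicator (cube_face S T) x *\<^sub>R g x)"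
    proof (rule integrableI_bounded_set_indicator)
      show "emeasure ?H (cube_face S T) < \<infinity>" using emeasure_cube_face_finite[of S T] ST(2) by simp
      show "AE x in ?H. x \<in> cube_face S T \<longrightarrow> norm (g x) \<le> M" using M cube_face_subset_sup_ball by (intro AE_I2) blast
    qed (simp_all add: gm measurable_cong_sets[OF sets_hausdorff_measure refl])
    then show "set_integrable ?H (?A p) g" unfolding set_integrable_def ST(1) by simp
  qed auto
  also have "\<dots> = (\<Sum>p\<in>face_index k. case p of (S, T) \<Rightarrow> c / 2 ^ CARD('n) * (LINT x:sup_ball 1|lborel. g (cube_vertex S T + coord_proj S x)))"
  proof (rule sum.cong[OF refl])
    fix p :: "'n set \<times> 'n set" assume "p \<in> face_index k"
    then obtain S T where ST: "p = (S, T)" "card S = k" by (auto simp: face_index_def)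
    show "(LINT y:?A p|?H. g y) = (case p of (S, T) \<Rightarrow> c / 2 ^ CARD('n) * (LINT x:sup_ball 1|lborel. g (cube_vertex S T + coord_proj S x)))"
      using set_integral_cube_face[of S c g T] c ST gm by simp
  qed
  finally show ?thesis unfolding skeleton_std_cube_eq[OF k] .
qed

lemma set_integral_sup_ball_prod:
  fixes h :: "'n::finite \<Rightarrow> real \<Rightarrow> real"
  assumes h: "\<And>i. continuous_on UNIV (h i)"
  shows "(LINT x:sup_ball 1|lborel. \<Prod>i\<in>UNIV. h i (x $ i)) = (\<Prod>i\<in>UNIV. LINT t:{-1..1}|lborel. h i t)"
proof -
  let ?B = "Basis :: (real ^ 'n) set" and ?ax = "\<lambda>i :: 'n. axis i (1::real)"
  define idx where "idx = inv ?ax"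
  have inj: "inj ?ax" by (auto simp: inj_on_def axis_eq_axis)
  have idx: "idx (?ax i) = i" for i unfolding idx_def by (rule inv_f_f[OF inj])
  have Basis: "?B = range ?ax" by (auto simp: Basis_vec_def)
  define f where "f = (\<lambda>b t. indicator {-1..1} t *\<^sub>R h (idx b) t)"
  have hm [measurable]: "h i \<in> borel_measurable borel" for i by (rule borel_measurable_continuous_onI[OF h])
  have int: "integrable lborel (f b)" for b
  proof -
    have "continuous_on {-1..1} (h (idx b))" by (rule continuous_on_subset[OF h]) simp
    then have "set_integrable lborel {-1..1} (h (idx b))"
      by (rule borel_integrable_atLeastAtMost'[of "-1" 1])
    then show ?thesis unfolding set_integrable_def f_def .
  qed
  have reB: "(\<Prod>b\<in>?B. F b) = (\<Prod>i\<in>UNIV. F (?ax i))" for F :: "real ^ 'n \<Rightarrow> real"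
    unfolding Basis by (rule prod.reindex_cong[OF inj]) auto
  have pt: "indicator (sup_ball 1) x *\<^sub>R (\<Prod>i\<in>UNIV. h i (x $ i)) = (\<Prod>b\<in>?B. f b (x \<bullet> b))" for x
  proof -
    have "(\<Prod>b\<in>?B. f b (x \<bullet> b)) = (\<Prod>i\<in>UNIV. indicator {-1..1} (x $ i) * h i (x $ i))"
      unfolding reB by (simp add: f_def idx inner_axis)
    also have "\<dots> = (\<Prod>i\<in>UNIV. indicator {-1..1} (x $ i)) * (\<Prod>i\<in>UNIV. h i (x $ i))"
      by (rule prod.distrib)
    also have "(\<Prod>i\<in>UNIV. indicator {-1..1} (x $ i)) = (indicator (sup_ball 1) x :: real)"
      by (auto simp: indicator_def sup_ball_def abs_le_iff minus_le_iff)
    finally show ?thesis by simp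
  qed
  interpret product_sigma_finite "\<lambda>_ :: real ^ 'n. lborel :: real measure" by standard
  let ?P = "Pi\<^sub>M ?B (\<lambda>_. lborel :: real measure)" and ?s = "\<lambda>y :: real ^ 'n \<Rightarrow> real. \<Sum>b\<in>?B. y b *\<^sub>R b"
  have fm: "(\<lambda>x. \<Prod>b\<in>?B. f b (x \<bullet> b)) \<in> borel_measurable borel" unfolding f_def by measurable
  have "(LINT x:sup_ball 1|lborel. \<Prod>i\<in>UNIV. h i (x $ i)) = (\<integral>x. (\<Prod>b\<in>?B. f b (x \<bullet> b)) \<partial>lborel)"
    unfolding set_lebesgue_integral_def pt ..
  also have "\<dots> = (\<integral>x. (\<Prod>b\<in>?B. f b (x \<bullet> b)) \<partial>(distr ?P borel ?s))"
    by (rule arg_cong[where f = "\<lambda>M. integral\<^sup>L M (\<lambda>x. \<Prod>b\<in>?B. f b (x \<bullet> b))"]) (rule lborel_eq)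
  also have "\<dots> = (\<integral>y. (\<Prod>b\<in>?B. f b (?s y \<bullet> b)) \<partial>?P)"
    by (rule integral_distr[OF _ fm]) measurable
  also have "\<dots> = (\<integral>y. (\<Prod>b\<in>?B. f b (y b)) \<partial>?P)"
    by (intro Bochner_Integration.integral_cong refl prod.cong)
      (simp add: inner_sum_left inner_Basis if_distrib[of "\<lambda>x. _ * x"] cong: if_cong)
  also have "\<dots> = (\<Prod>b\<in>?B. integral\<^sup>L lborel (f b))"
    by (rule product_integral_prod[OF finite_Basis int])
  also have "\<dots> = (\<Prod>i\<in>UNIV. LINT t:{-1..1}|lborel. h i t)"
    unfolding reB by (simp add: f_def idx set_lebesgue_integral_def)
  finally show ?thesis .
qed

text \<open>By \<open>set_integral_sup_ball_prod\<close> the integral factors. A free coordinate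
  contributes the integral of t^a over [-1, 1]. A fixed one, summed over both signs, contributes 2 +
  2 (-1)^a, the 2 being the length of the interval on which its factor is constant. Expanding the
  product over the fixed coordinates is the sum over \<open>T\<close>.\<close>

lemma sum_face_moments:
  fixes S :: "'n::finite set" and \<alpha> :: "'n \<Rightarrow> nat"
  shows "(\<Sum>T\<in>Pow (- S). LINT x:(sup_ball 1 :: (real ^ 'n) set)|lborel. \<Prod>i\<in>UNIV. (cube_vertex S T + coord_proj S x) $ i ^ \<alpha> i) =
    2 ^ CARD('n) * 2 ^ (CARD('n) - card S) * face_moment S \<alpha>"
proof -
  define J :: "nat \<Rightarrow> real" where "J = (\<lambda>a. if even a then 2 / (real a + 1) else 0)"
  define s :: "'n set \<Rightarrow> 'n \<Rightarrow> real" where "s = (\<lambda>T i. if i \<in> T then 1 else - 1)"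
  have J: "(LINT t:{-1..1}|lborel. (t :: real) ^ a) = J a" for a
  proof -
    have "(LINT t:{-1..1}|lborel. (t :: real) ^ a) = (\<integral>t. (t :: real) ^ a * indicator {-1..1} t \<partial>lborel)"
      unfolding set_lebesgue_integral_def by (intro Bochner_Integration.integral_cong refl) simp
    also have "\<dots> = (1 ^ Suc a - (-1) ^ Suc a) / Suc a" by (rule integral_power) simp
    also have "\<dots> = J a" by (auto simp: J_def add.commute)
    finally show ?thesis .
  qed
  have K: "(LINT t:{-1..1::real}|lborel. r) = 2 * r" for r :: real
    by (simp add: set_lebesgue_integral_def)
  have "(LINT x:(sup_ball 1 :: (real ^ 'n) set)|lborel. \<Prod>i\<in>UNIV. (cube_vertex S T + coord_proj S x) $ i ^ \<alpha> i) =
      (\<Prod>i\<in>S. J (\<alpha> i)) * ((\<Prod>i\<in>T. 2) * (\<Prod>i\<in>-S-T. 2 * (-1) ^ \<alpha> i))" if T: "T \<in> Pow (- S)" for T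
  proof -
    have "(LINT x:(sup_ball 1 :: (real ^ 'n) set)|lborel. \<Prod>i\<in>UNIV. (cube_vertex S T + coord_proj S x) $ i ^ \<alpha> i) =
        (LINT x:(sup_ball 1 :: (real ^ 'n) set)|lborel. \<Prod>i\<in>UNIV. (if i \<in> S then x $ i else s T i) ^ \<alpha> i)"
    proof -
      have "(cube_vertex S T + coord_proj S x) $ i = (if i \<in> S then x $ i else s T i)" for i x
        by (simp add: cube_vertex_def coord_proj_def s_def)
      then show ?thesis by (simp only:)
    qed
    also have "\<dots> = (\<Prod>i\<in>UNIV. LINT t:{-1..1}|lborel. (if i \<in> S then t else s T i) ^ \<alpha> i)"
    proof (rule set_integral_sup_ball_prod)
      show "continuous_on UNIV (\<lambda>t. (if i \<in> S then t else s T i) ^ \<alpha> i)" for i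
        by (cases "i \<in> S") (auto intro!: continuous_intros)
    qed
    also have "\<dots> = (\<Prod>i\<in>UNIV. if i \<in> S then J (\<alpha> i) else 2 * s T i ^ \<alpha> i)"
      by (intro prod.cong refl) (simp add: J K)
    also have "\<dots> = (\<Prod>i\<in>S. J (\<alpha> i)) * (\<Prod>i\<in>-S. 2 * s T i ^ \<alpha> i)"
      by (simp add: prod.If_cases Compl_eq[symmetric])
    also have "(\<Prod>i\<in>-S. 2 * s T i ^ \<alpha> i) = (\<Prod>i\<in>-S. if i \<in> T then 2 else 2 * (-1) ^ \<alpha> i)"
      by (intro prod.cong refl) (simp add: s_def)
    also have "\<dots> = (\<Prod>i\<in>-S \<inter> {i. i \<in> T}. 2) * (\<Prod>i\<in>-S \<inter> - {i. i \<in> T}. 2 * (-1) ^ \<alpha> i)"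
      by (rule prod.If_cases) simp
    also have "-S \<inter> {i. i \<in> T} = T" using T by auto
    also have "-S \<inter> - {i. i \<in> T} = -S - T" by auto
    finally show ?thesis .
  qed
  then have "(\<Sum>T\<in>Pow (- S). LINT x:(sup_ball 1 :: (real ^ 'n) set)|lborel. \<Prod>i\<in>UNIV. (cube_vertex S T + coord_proj S x) $ i ^ \<alpha> i) =
      (\<Sum>T\<in>Pow (- S). (\<Prod>i\<in>S. J (\<alpha> i)) * ((\<Prod>i\<in>T. 2) * (\<Prod>i\<in>-S-T. 2 * (-1) ^ \<alpha> i)))"
    by (rule sum.cong[OF refl])
  also have "\<dots> = (\<Prod>i\<in>S. J (\<alpha> i)) * (\<Prod>i\<in>-S. 2 + 2 * (-1) ^ \<alpha> i)"
    unfolding sum_distrib_left[symmetric] by (subst prod_add[symmetric]) simp_all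
  also have "\<dots> = (\<Prod>i\<in>UNIV. if i \<in> S then J (\<alpha> i) else 2 + 2 * (-1) ^ \<alpha> i)"
    by (simp add: prod.If_cases Compl_eq[symmetric])
  also have "\<dots> = (\<Prod>i\<in>UNIV. (2 * (if i \<in> S then 1 else 2)) *
      (if even (\<alpha> i) then if i \<in> S then 1 / real (\<alpha> i + 1) else 1 else 0))"
    by (intro prod.cong refl) (auto simp: J_def add.commute)
  also have "\<dots> = (\<Prod>i\<in>(UNIV :: 'n set). 2) * (\<Prod>i\<in>(UNIV :: 'n set). if i \<in> S then 1 else 2) * face_moment S \<alpha>"
    unfolding face_moment_def prod.distrib ..
  also have "(\<Prod>i\<in>(UNIV :: 'n set). if i \<in> S then 1 else 2) = (2 :: real) ^ (CARD('n) - card S)"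
    by (simp add: prod.If_cases Compl_eq[symmetric] Compl_eq_Diff_UNIV card_Diff_subset)
  finally show ?thesis by simp
qed

text \<open>All moments of the skeleton carry the same factor c * 2^(\<open>CARD('n)\<close> - k),
  and the zeroth moment is the total mass. Dividing removes c and leaves the average of the face
  moments over the choices of k coordinates.\<close>

theorem cube_measure_skeleton:
  fixes k :: nat
  assumes k: "k \<le> CARD('n::finite)"
  defines "\<nu> \<equiv> uniform_measure (hausdorff_measure k) (skeleton (std_cube :: (real ^ 'n) set) k)"
  shows "cube_measure \<nu> k"
    and "harmonic_functions (std_cube :: (real ^ 'n) set) k = mean_value_functions \<nu>"
    and "0 < measure (hausdorff_measure k) (skeleton (std_cube :: (real ^ 'n) set) k)"
proof -
  let ?H = "hausdorff_measure k :: (real ^ 'n) measure" and ?K = "skeleton (std_cube :: (real ^ 'n) set) k"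
  let ?N = "CARD('n)"
  have K: "?K \<in> sets borel" by (rule skeleton_measurable[OF k])
  obtain c where c: "c > 0" "\<And>S :: 'n set. card S = k \<Longrightarrow> emeasure ?H (subcube S) = ennreal c"
    using hausdorff_subcube_const[where 'n = 'n and k = k] by blast
  have mom: "(LINT y:?K|?H. \<Prod>i\<in>UNIV. y $ i ^ \<alpha> i) = c * 2 ^ (?N - k) * (\<Sum>S\<in>{S :: 'n set. card S = k}. face_moment (S :: 'n set) \<alpha>)" for \<alpha> :: "'n \<Rightarrow> nat"
  proof -
    have "(LINT y:?K|?H. \<Prod>i\<in>UNIV. y $ i ^ \<alpha> i) = (\<Sum>(S, T)\<in>face_index k. c / 2 ^ ?N *
        (LINT x:(sup_ball 1 :: (real ^ 'n) set)|lborel. \<Prod>i\<in>UNIV. (cube_vertex S T + coord_proj S x) $ i ^ \<alpha> i))"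
      by (rule set_integral_skeleton[OF k _ c]) (intro continuous_intros)
    also have "\<dots> = (\<Sum>S\<in>{S :: 'n set. card S = k}. \<Sum>T\<in>Pow (- S). c / 2 ^ ?N *
        (LINT x:(sup_ball 1 :: (real ^ 'n) set)|lborel. \<Prod>i\<in>UNIV. (cube_vertex S T + coord_proj S x) $ i ^ \<alpha> i))"
      unfolding face_index_def by (rule sum.Sigma[symmetric]) auto
    also have "\<dots> = (\<Sum>S\<in>{S :: 'n set. card S = k}. c * 2 ^ (?N - k) * face_moment (S :: 'n set) \<alpha>)"
    proof -
      have inner: "(\<Sum>T\<in>Pow (- S). c / 2 ^ ?N *
          (LINT x:(sup_ball 1 :: (real ^ 'n) set)|lborel. \<Prod>i\<in>UNIV. (cube_vertex S T + coord_proj S x) $ i ^ \<alpha> i)) = c * 2 ^ (?N - k) * face_moment (S :: 'n set) \<alpha>"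
        if S: "card S = k" for S :: "'n set"
      proof -
        have "(\<Sum>T\<in>Pow (- S). c / 2 ^ ?N *
            (LINT x:(sup_ball 1 :: (real ^ 'n) set)|lborel. \<Prod>i\<in>UNIV. (cube_vertex S T + coord_proj S x) $ i ^ \<alpha> i)) =
          c / 2 ^ ?N * (\<Sum>T\<in>Pow (- S).
            LINT x:(sup_ball 1 :: (real ^ 'n) set)|lborel. \<Prod>i\<in>UNIV. (cube_vertex S T + coord_proj S x) $ i ^ \<alpha> i)"
          by (rule sum_distrib_left[symmetric])
        also have "\<dots> = c / 2 ^ ?N * (2 ^ ?N * 2 ^ (?N - card S) * face_moment S \<alpha>)"
          by (rule arg_cong[where f = "\<lambda>z. c / 2 ^ ?N * z"], rule sum_face_moments)
        also have "\<dots> = c * 2 ^ (?N - k) * face_moment S \<alpha>" by (simp add: S)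
        finally show ?thesis .
      qed
      show ?thesis
        by (rule sum.cong) (simp_all only: inner mem_Collect_eq)
    qed
    finally show ?thesis by (simp add: sum_distrib_left)
  qed
  define m where "m = measure ?H ?K"
  have fin: "emeasure ?H ?K < \<infinity>" by (rule emeasure_skeleton_finite[OF k])
  have m_eq: "m = c * 2 ^ (?N - k) * real (?N choose k)"
  proof -
    have "m = (LINT y:?K|?H. \<Prod>i\<in>UNIV. y $ i ^ (\<lambda>_. 0) i)"
      using K by (simp add: m_def set_lebesgue_integral_def)
    also have "\<dots> = c * 2 ^ (?N - k) * (\<Sum>S\<in>{S :: 'n set. card S = k}. face_moment S (\<lambda>_ :: 'n. 0))" by (rule mom)
    also have "(\<Sum>S\<in>{S :: 'n set. card S = k}. face_moment S (\<lambda>_ :: 'n. 0)) = real (card {S :: 'n set. card S = k})"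
    proof -
      have "face_moment S (\<lambda>_. 0) = 1" for S :: "'n set"
        unfolding face_moment_def by (rule prod.neutral) simp
      then show ?thesis by simp
    qed
    also have "card {S :: 'n set. card S = k} = ?N choose k"
      using n_subsets[of "UNIV :: 'n set" k] by simp
    finally show ?thesis .
  qed
  then have m: "m > 0" using c(1) k by (simp add: zero_less_binomial)
  then show "0 < measure ?H ?K" by (simp add: m_def)
  have em: "emeasure ?H ?K = ennreal m"
    unfolding m_def using fin by (intro emeasure_eq_ennreal_measure) auto
  have sets: "sets \<nu> = sets borel" unfolding \<nu>_def by simp
  have \<nu>: "\<nu> = density ?H (\<lambda>x. ennreal (indicator ?K x / m))"
    unfolding \<nu>_def uniform_measure_def em
    using m by (intro arg_cong[where f = "density ?H"] ext) (auto simp: indicator_def divide_ennreal simp flip: ennreal_1)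
  have int: "(\<integral>y. g y \<partial>\<nu>) = (LINT y:?K|?H. g y) / m" if "g \<in> borel_measurable borel" for g :: "real ^ 'n \<Rightarrow> real"
  proof -
    have "(\<integral>y. g y \<partial>\<nu>) = (\<integral>y. (indicator ?K y / m) *\<^sub>R g y \<partial>?H)"
      unfolding \<nu> using that K m
      by (intro integral_density) (auto simp: measurable_cong_sets[OF sets_hausdorff_measure refl])
    also have "\<dots> = (\<integral>y. (indicator ?K y *\<^sub>R g y) / m \<partial>?H)" by (simp add: field_simps)
    finally show ?thesis by (simp add: set_lebesgue_integral_def)
  qed
  show "cube_measure \<nu> k"
  proof (intro cube_measure.intro cube_measure_axioms.intro)
    show "prob_space \<nu>"
      unfolding \<nu>_def using em m by (intro prob_space_uniform_measure) auto
    have "AE y in ?H. y \<in> ?K \<longrightarrow> norm y \<le> (\<Sum>i\<in>(UNIV :: 'n set). 1)"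
    proof (intro AE_I2 impI)
      fix y :: "real ^ 'n" assume "y \<in> ?K"
      then have "y \<in> sup_ball 1" by (simp add: mem_skeleton_std_cube)
      then have "\<bar>y $ i\<bar> \<le> 1" for i by (simp add: sup_ball_def)
      then show "norm y \<le> (\<Sum>i\<in>(UNIV :: 'n set). 1)"
        by (intro order_trans[OF norm_le_l1_cart] sum_mono)
    qed
    then show "\<exists>R. AE y in \<nu>. norm y \<le> R"
      unfolding \<nu>_def using K by (intro exI[of _ "\<Sum>i\<in>(UNIV :: 'n set). 1"] AE_uniform_measureI) auto
    fix \<alpha> :: "'n \<Rightarrow> nat"
    have "(\<lambda>y :: real ^ 'n. \<Prod>i\<in>UNIV. y $ i ^ \<alpha> i) \<in> borel_measurable borel"
      by (rule borel_measurable_continuous_onI) (intro continuous_intros)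
    then have "(\<integral>y. (\<Prod>i\<in>UNIV. y $ i ^ \<alpha> i) \<partial>\<nu>) = c * 2 ^ (?N - k) * (\<Sum>S\<in>{S :: 'n set. card S = k}. face_moment (S :: 'n set) \<alpha>) / m"
      unfolding mom[symmetric] by (rule int)
    also have "\<dots> = (\<Sum>S\<in>{S :: 'n set. card S = k}. face_moment (S :: 'n set) \<alpha>) / real (?N choose k)"
      unfolding m_eq using c(1) by simp
    finally show "(\<integral>y. (\<Prod>i\<in>UNIV. y $ i ^ \<alpha> i) \<partial>\<nu>) = (\<Sum>S\<in>{S :: 'n set. card S = k}. face_moment (S :: 'n set) \<alpha>) / real (?N choose k)" .
  qed (simp_all add: sets k)
  have "(\<integral>y. f (x + r *\<^sub>R y) \<partial>\<nu>) = 1 / m * (LINT y:?K|?H. f (x + r *\<^sub>R y))"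
    if "continuous_on UNIV f" for f :: "real ^ 'n \<Rightarrow> real" and x r
  proof -
    have "continuous_on UNIV (\<lambda>y. f (x + r *\<^sub>R y))"
      by (rule continuous_on_compose2[OF that]) (auto intro!: continuous_intros)
    then show ?thesis by (simp add: int[OF borel_measurable_continuous_onI])
  qed
  then show "harmonic_functions (std_cube :: (real ^ 'n) set) k = mean_value_functions \<nu>"
    unfolding harmonic_functions_def mean_value_functions_def m_def by (intro Collect_cong conj_cong refl) simp
qed

subsection \<open>Change of coordinates\<close>

lemma skeleton_linear_image:
  assumes "linear L" "inj L"
  shows "skeleton (L ` P) k = L ` skeleton P k"
proof -
  have "{F. F face_of L ` P \<and> aff_dim F \<le> int k} = image L ` {F. F face_of P \<and> aff_dim F \<le> int k}" (is "?A = ?B")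
  proof (intro set_eqI iffI)
    fix F assume F: "F \<in> ?A"
    then obtain G where G: "G \<subseteq> P" "F = L ` G" using face_of_imp_subset[of F "L ` P"] subset_imageE by blast
    have "G face_of P" using F face_of_linear_image[OF assms, of G P] unfolding G(2) by simp
    moreover have "aff_dim G \<le> int k" using F aff_dim_injective_linear_image[OF assms, of G] unfolding G(2) by simp
    ultimately show "F \<in> ?B" unfolding G(2) by blast
  next
    fix F assume "F \<in> ?B"
    then obtain G where "G face_of P" "aff_dim G \<le> int k" "F = L ` G" by blast
    then show "F \<in> ?A"
      using face_of_linear_image[OF assms, of G P] aff_dim_injective_linear_image[OF assms, of G] by simp
  qed
  then show ?thesis unfolding skeleton_def by (simp only: image_Union)
qed

lemma hausdorff_outer_similarity:
  fixes g :: "'a::metric_space \<Rightarrow> 'b::metric_space"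
  assumes c: "c > 0" and g: "\<And>x y. dist (g x) (g y) = c * dist x y"
  shows "hausdorff_outer d (g ` A) = ennreal (c ^ d) * hausdorff_outer d A"
proof (rule antisym)
  show "hausdorff_outer d (g ` A) \<le> ennreal (c ^ d) * hausdorff_outer d A"
    by (rule hausdorff_outer_lipschitz[OF c]) (simp add: g)
  have inj: "inj g"
  proof (rule injI)
    fix x y assume "g x = g y"
    then show "x = y" using g[of x y] c by simp
  qed
  have "hausdorff_outer d (inv g ` g ` A) \<le> ennreal ((1 / c) ^ d) * hausdorff_outer d (g ` A)"
  proof (rule hausdorff_outer_lipschitz)
    fix x y assume "x \<in> g ` A" "y \<in> g ` A"
    then obtain a b where ab: "x = g a" "y = g b" by blast
    show "dist (inv g x) (inv g y) \<le> 1 / c * dist x y"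
      unfolding ab inv_f_f[OF inj] g using c by simp
  qed (use c in simp)
  moreover have "inv g ` g ` A = A" using inj by (rule image_inv_f_f)
  ultimately have le: "hausdorff_outer d A \<le> ennreal ((1 / c) ^ d) * hausdorff_outer d (g ` A)" by simp
  have "ennreal (c ^ d) * hausdorff_outer d A \<le> ennreal (c ^ d) * (ennreal ((1 / c) ^ d) * hausdorff_outer d (g ` A))"
    by (rule mult_left_mono[OF le]) simp
  also have "\<dots> = (ennreal (c ^ d) * ennreal ((1 / c) ^ d)) * hausdorff_outer d (g ` A)"
    by (simp only: mult.assoc)
  also have "ennreal (c ^ d) * ennreal ((1 / c) ^ d) = 1"
    using c by (subst ennreal_mult[symmetric]) (simp_all add: power_one_over)
  finally show "ennreal (c ^ d) * hausdorff_outer d A \<le> hausdorff_outer d (g ` A)" by simp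
qed

lemma similarity_measure_integral:
  fixes L L' :: "'a::euclidean_space \<Rightarrow> 'a" and g :: "'a \<Rightarrow> real"
  assumes c: "c > 0" and L: "\<And>x y. dist (L x) (L y) = c * dist x y"
    and inv: "\<And>x. L' (L x) = x" "\<And>x. L (L' x) = x"
    and cont: "continuous_on UNIV L" "continuous_on UNIV L'"
    and K: "K \<in> sets borel" and g: "g \<in> borel_measurable borel"
  shows "measure (hausdorff_measure d) (L ` K) = c ^ d * measure (hausdorff_measure d) K"
    and "(LINT y:L ` K|hausdorff_measure d. g y) = c ^ d * (LINT y:K|hausdorff_measure d. g (L y))"
proof -
  let ?H = "hausdorff_measure d :: 'a measure"
  note [measurable] = borel_measurable_continuous_onI[OF cont(1)] borel_measurable_continuous_onI[OF cont(2)]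
  have im: "L ` A = L' -` A" for A
  proof (intro set_eqI iffI)
    fix x assume "x \<in> L' -` A"
    then have "L (L' x) \<in> L ` A" by blast
    then show "x \<in> L ` A" by (simp only: inv)
  qed (auto simp: inv)
  have LK: "L ` A \<in> sets borel" if "A \<in> sets borel" for A
    unfolding im using measurable_sets[of L' borel borel A] that by simp
  have em: "emeasure ?H (L ` A) = ennreal (c ^ d) * emeasure ?H A" if "A \<in> sets borel" for A
    using that LK[OF that] by (simp add: emeasure_hausdorff hausdorff_outer_similarity[OF c L])
  show "measure ?H (L ` K) = c ^ d * measure ?H K"
    unfolding measure_def em[OF K] using c by (simp add: enn2real_mult)
  have eq: "?H = density (distr ?H borel L) (\<lambda>_. ennreal (c ^ d))"
  proof (rule measure_eqI)
    fix A assume "A \<in> sets ?H"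
    then have A: "A \<in> sets borel" by simp
    have LA: "L -` A \<in> sets borel" using measurable_sets[of L borel borel A] A by simp
    have "L ` (L -` A) = A"
    proof (rule surj_image_vimage_eq)
      show "surj L" by (rule surjI[of L L']) (rule inv)
    qed
    then have "emeasure ?H A = ennreal (c ^ d) * emeasure ?H (L -` A)" using em[OF LA] by simp
    also have "emeasure ?H (L -` A) = emeasure (distr ?H borel L) A"
      using A by (subst emeasure_distr) (auto simp: measurable_cong_sets[OF sets_hausdorff_measure refl])
    also have "ennreal (c ^ d) * \<dots> = emeasure (density (distr ?H borel L) (\<lambda>_. ennreal (c ^ d))) A"
      using A by (intro emeasure_density_const[symmetric]) simp
    finally show "emeasure ?H A = emeasure (density (distr ?H borel L) (\<lambda>_. ennreal (c ^ d))) A" .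
  qed simp
  let ?G = "\<lambda>y. indicator (L ` K) y *\<^sub>R g y"
  have G: "?G \<in> borel_measurable borel" using LK[OF K] g by simp
  have "integral\<^sup>L ?H ?G = integral\<^sup>L (density (distr ?H borel L) (\<lambda>_. ennreal (c ^ d))) ?G"
    using eq by (rule arg_cong)
  also have "\<dots> = (\<integral>y. c ^ d *\<^sub>R ?G y \<partial>distr ?H borel L)"
    using G c by (intro integral_density) auto
  also have "\<dots> = (\<integral>y. c ^ d *\<^sub>R ?G (L y) \<partial>?H)"
    using G by (intro integral_distr) (auto simp: measurable_cong_sets[OF sets_hausdorff_measure refl])
  also have "\<dots> = c ^ d * (\<integral>y. ?G (L y) \<partial>?H)" by simp
  also have "(\<lambda>y. ?G (L y)) = (\<lambda>y. indicator K y *\<^sub>R g (L y))"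
    by (auto simp: fun_eq_iff im indicator_def inv)
  finally show "(LINT y:L ` K|?H. g y) = c ^ d * (LINT y:K|?H. g (L y))"
    unfolding set_lebesgue_integral_def .
qed

lemma harmonic_functions_similarity:
  fixes Q :: "'a::euclidean_space \<Rightarrow> 'a"
  assumes Q: "orthogonal_transformation Q" and c: "c > 0"
    and K: "skeleton P k \<in> sets borel"
  shows "f \<in> harmonic_functions ((\<lambda>x. c *\<^sub>R Q x) ` P) k \<longleftrightarrow> (\<lambda>x. f (Q x)) \<in> harmonic_functions P k"
proof -
  let ?L = "\<lambda>x. c *\<^sub>R Q x" and ?L' = "\<lambda>x. inv Q ((1 / c) *\<^sub>R x)" and ?K = "skeleton P k"
  let ?H = "hausdorff_measure k :: 'a measure"
  have lin: "linear Q" by (rule orthogonal_transformation_linear[OF Q])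
  have bij: "bij Q" by (rule orthogonal_transformation_bij[OF Q])
  have Qi: "orthogonal_transformation (inv Q)" by (rule orthogonal_transformation_inv[OF Q])
  have iQ: "inv Q (Q x) = x" "Q (inv Q x) = x" for x
    using bij by (simp_all add: bij_is_inj bij_is_surj surj_f_inv_f)
  have contQ: "continuous_on A Q" "continuous_on A (inv Q)" for A
    by (intro linear_continuous_on linear_conv_bounded_linear[THEN iffD1] orthogonal_transformation_linear Q Qi)+
  have L: "linear ?L" "inj ?L"
    using lin c bij_is_inj[OF bij] by (auto simp: inj_def intro!: linear_compose_scale_right)
  have distL: "dist (?L x) (?L y) = c * dist x y" for x y
  proof -
    have "?L x - ?L y = c *\<^sub>R Q (x - y)" by (simp add: linear_diff[OF lin] scaleR_diff_right)
    then show ?thesis using c by (simp add: dist_norm orthogonal_transformation_norm[OF Q])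
  qed
  have inv: "?L' (?L x) = x" "?L (?L' x) = x" for x using c by (simp_all add: iQ)
  have contL: "continuous_on UNIV ?L" "continuous_on UNIV ?L'"
    by (intro continuous_intros contQ, rule continuous_on_compose2[OF contQ(2)[of UNIV]]) (auto intro: continuous_intros)
  have sk: "skeleton (?L ` P) k = ?L ` ?K" by (rule skeleton_linear_image[OF L])
  have cont_iff: "continuous_on UNIV f \<longleftrightarrow> continuous_on UNIV (\<lambda>x. f (Q x))"
  proof
    assume "continuous_on UNIV f"
    then show "continuous_on UNIV (\<lambda>x. f (Q x))" by (rule continuous_on_compose2[OF _ contQ(1)]) simp
  next
    assume "continuous_on UNIV (\<lambda>x. f (Q x))"
    then have "continuous_on UNIV (\<lambda>x. f (Q (inv Q x)))"
      by (rule continuous_on_compose2[OF _ contQ(2)]) simp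
    then show "continuous_on UNIV f" by (simp add: iQ)
  qed
  have mean: "1 / measure ?H (skeleton (?L ` P) k) * (LINT y:skeleton (?L ` P) k|?H. f (Q x + r *\<^sub>R y)) =
      1 / measure ?H ?K * (LINT y:?K|?H. f (Q (x + (r * c) *\<^sub>R y)))" if "continuous_on UNIV f" for x r
  proof -
    have "continuous_on UNIV (\<lambda>y. f (Q x + r *\<^sub>R y))"
      by (rule continuous_on_compose2[OF that]) (auto intro!: continuous_intros)
    then have "(\<lambda>y. f (Q x + r *\<^sub>R y)) \<in> borel_measurable borel" by (rule borel_measurable_continuous_onI)
    note S = similarity_measure_integral[OF c distL inv contL K this, of k]
    have "Q x + r *\<^sub>R ?L y = Q (x + (r * c) *\<^sub>R y)" for y
      by (simp add: linear_add[OF lin] linear_scale[OF lin])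
    then show ?thesis unfolding sk S using c by simp
  qed
  show ?thesis
  proof
    assume f: "f \<in> harmonic_functions (?L ` P) k"
    then have cf: "continuous_on UNIV f" by (simp add: harmonic_functions_def)
    have "f (Q x) = 1 / measure ?H ?K * (LINT y:?K|?H. f (Q (x + r *\<^sub>R y)))" if "r > 0" for x r
    proof -
      have "r / c > 0" using that c by simp
      then have "f (Q x) = 1 / measure ?H (skeleton (?L ` P) k) * (LINT y:skeleton (?L ` P) k|?H. f (Q x + (r / c) *\<^sub>R y))"
        using f[unfolded harmonic_functions_def, THEN CollectD, THEN conjunct2, rule_format, of "r / c" "Q x"] by (simp only:)
      also note mean[OF cf]
      also have "r / c * c = r" using c by simp
      finally show ?thesis .
    qed
    note mv = this
    have "continuous_on UNIV (\<lambda>x. f (Q x))" using cf by (rule cont_iff[THEN iffD1])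
    then show "(\<lambda>x. f (Q x)) \<in> harmonic_functions P k"
      unfolding harmonic_functions_def by (intro CollectI conjI allI impI) (assumption, rule mv)
  next
    assume f: "(\<lambda>x. f (Q x)) \<in> harmonic_functions P k"
    then have cf: "continuous_on UNIV f" unfolding cont_iff by (simp add: harmonic_functions_def)
    have "f x = 1 / measure ?H (skeleton (?L ` P) k) * (LINT y:skeleton (?L ` P) k|?H. f (x + r *\<^sub>R y))" if "r > 0" for x r
    proof -
      have "r * c > 0" using that c by simp
      then have "f (Q (inv Q x)) = 1 / measure ?H ?K * (LINT y:?K|?H. f (Q (inv Q x + (r * c) *\<^sub>R y)))"
        using f[unfolded harmonic_functions_def, THEN CollectD, THEN conjunct2, rule_format, of "r * c" "inv Q x"] by (simp only:)
      also note mean[OF cf, symmetric]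
      finally show ?thesis unfolding iQ .
    qed
    note mv = this
    show "f \<in> harmonic_functions (?L ` P) k"
      unfolding harmonic_functions_def by (intro CollectI conjI allI impI) (rule cf, rule mv)
  qed
qed

section \<open>Partial derivatives under linear substitutions\<close>

lemma deriv_line:
  fixes D :: "real ^ 'n::finite \<Rightarrow> real"
  assumes "(D has_derivative D') (at y)"
  shows "deriv (\<lambda>t. D (y + t *\<^sub>R v)) 0 = D' v"
proof (rule DERIV_imp_deriv)
  have "((\<lambda>t. y + t *\<^sub>R v) has_derivative (\<lambda>t. t *\<^sub>R v)) (at (0::real))"
    by (auto intro!: derivative_eq_intros)
  moreover have "(D has_derivative D') (at (y + 0 *\<^sub>R v))" using assms by simp
  ultimately have "((\<lambda>t. D (y + t *\<^sub>R v)) has_derivative (\<lambda>t. D' (t *\<^sub>R v))) (at 0)"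
    by (rule has_derivative_compose)
  moreover have "(\<lambda>t. D' (t *\<^sub>R v)) = (\<lambda>t. D' v * t)"
    using linear_scale[OF has_derivative_linear[OF assms]] by (auto simp: mult.commute)
  ultimately show "((\<lambda>t. D (y + t *\<^sub>R v)) has_field_derivative D' v) (at 0)"
    unfolding has_field_derivative_def by (simp only:)
qed

lemma partial_deriv_eq:
  assumes "(D has_derivative D') (at y)"
  shows "partial_deriv i D y = D' (axis i 1)"
  unfolding partial_deriv_def by (rule deriv_line[OF assms])

lemma polyfun_has_derivative:
  assumes "D \<in> polyfun"
  obtains D' where "\<And>y. (D has_derivative D' y) (at y)"
  using polyfun_differentiable[OF assms] unfolding differentiable_def by metis

lemma partial_deriv_compose_linear:
  assumes D: "D \<in> polyfun" and L: "linear L"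
  shows "partial_deriv i (\<lambda>x. D (L x)) x = (\<Sum>j\<in>UNIV. L (axis i 1) $ j * partial_deriv j D (L x))"
proof -
  obtain D' where D': "\<And>y. (D has_derivative D' y) (at y)" using polyfun_has_derivative[OF D] by blast
  have lin: "linear (D' y)" for y by (rule has_derivative_linear[OF D'])
  have "partial_deriv i (\<lambda>x. D (L x)) x = deriv (\<lambda>t. D (L x + t *\<^sub>R L (axis i 1))) 0"
    unfolding partial_deriv_def by (simp add: linear_add[OF L] linear_scale[OF L])
  also have "\<dots> = D' (L x) (L (axis i 1))" by (rule deriv_line[OF D'])
  also have "L (axis i 1) = (\<Sum>j\<in>UNIV. L (axis i 1) $ j *\<^sub>R axis j 1)"
    by (simp add: basis_expansion flip: scalar_mult_eq_scaleR)
  also have "D' (L x) \<dots> = (\<Sum>j\<in>UNIV. L (axis i 1) $ j * D' (L x) (axis j 1))"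
    by (simp add: linear_sum[OF lin] linear_scale[OF lin])
  finally show ?thesis by (simp add: partial_deriv_eq[OF D'])
qed

lemma partial_deriv_linear:
  assumes "f \<in> polyfun" "g \<in> polyfun"
  shows "partial_deriv i (f + g) = partial_deriv i f + partial_deriv i g"
    and "partial_deriv i (c *\<^sub>R f) = c *\<^sub>R partial_deriv i f"
proof -
  obtain f' where f': "\<And>y. (f has_derivative f' y) (at y)" using polyfun_has_derivative[OF assms(1)] by blast
  obtain g' where g': "\<And>y. (g has_derivative g' y) (at y)" using polyfun_has_derivative[OF assms(2)] by blast
  have "((\<lambda>x. f x + g x) has_derivative (\<lambda>v. f' y v + g' y v)) (at y)" for y
    by (rule has_derivative_add[OF f' g'])
  then have "(f + g has_derivative (\<lambda>v. f' y v + g' y v)) (at y)" for y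
    by (simp add: plus_fun_def)
  from partial_deriv_eq[OF this] show "partial_deriv i (f + g) = partial_deriv i f + partial_deriv i g"
    by (auto simp: partial_deriv_eq[OF f'] partial_deriv_eq[OF g'])
  have "((\<lambda>x. c *\<^sub>R f x) has_derivative (\<lambda>v. c *\<^sub>R f' y v)) (at y)" for y
    by (rule has_derivative_scaleR_right[OF f'])
  then have "(c *\<^sub>R f has_derivative (\<lambda>v. c *\<^sub>R f' y v)) (at y)" for y
    by (simp add: scaleR_fun_def)
  from partial_deriv_eq[OF this] show "partial_deriv i (c *\<^sub>R f) = c *\<^sub>R partial_deriv i f"
    by (auto simp: partial_deriv_eq[OF f'] scaleR_fun_def)
qed

lemma polyfun_partial_deriv: "f \<in> polyfun \<Longrightarrow> partial_deriv i f \<in> polyfun"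
proof -
  assume "f \<in> polyfun"
  then obtain d \<phi> where \<phi>: "supp_in d \<phi>" "f = pf d \<phi>" unfolding polyfun_def by blast
  show ?thesis unfolding \<phi>(2) partial_deriv_pf[OF \<phi>(1)] by (rule polyfunI[OF supp_in_inc[OF \<phi>(1)]])
qed

lemma subspace_polyfun: "subspace polyfun"
proof (rule subspaceI)
  show "0 \<in> polyfun" using polyfun_const[of 0] by (simp add: zero_fun_def)
  show "f + g \<in> polyfun" if "f \<in> polyfun" "g \<in> polyfun" for f g :: "real ^ 'a \<Rightarrow> real"
    using polyfun_add[OF that] by (simp add: plus_fun_def)
  show "c *\<^sub>R f \<in> polyfun" if "f \<in> polyfun" for c and f :: "real ^ 'a \<Rightarrow> real"
    using polyfun_mult[OF polyfun_const[of c] that] by (simp add: scaleR_fun_def)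
qed

lemma iterated_partials_polyfun:
  assumes "D \<in> polyfun"
  shows "iterated_partials D \<subseteq> polyfun"
proof
  fix f assume "f \<in> iterated_partials D"
  then show "f \<in> polyfun" by induction (simp_all add: assms polyfun_partial_deriv)
qed

text \<open>\<open>partial_deriv\<close> is built from \<open>deriv\<close>, whose linearity
  requires differentiability; membership in \<open>polyfun\<close> is therefore carried along with
  closure under differentiation.\<close>

lemma partial_deriv_span:
  assumes D: "D \<in> polyfun" and h: "h \<in> span (iterated_partials D)"
  shows "h \<in> polyfun \<and> partial_deriv i h \<in> span (iterated_partials D)"
proof -
  define W where "W = {h \<in> polyfun. partial_deriv i h \<in> span (iterated_partials D)}"
  have "subspace W"
  proof (rule subspaceI)
    have "partial_deriv i (0 *\<^sub>R D) = 0 *\<^sub>R partial_deriv i D" by (rule partial_deriv_linear(2)[OF D D])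
    then show "0 \<in> W" using subspace_0[OF subspace_polyfun] by (simp add: W_def span_zero)
  next
    fix f g assume "f \<in> W" "g \<in> W"
    then show "f + g \<in> W"
      by (simp add: W_def partial_deriv_linear(1) span_add subspace_add[OF subspace_polyfun])
  next
    fix c f assume "f \<in> W"
    then have f: "f \<in> polyfun" "partial_deriv i f \<in> span (iterated_partials D)" by (simp_all add: W_def)
    then show "c *\<^sub>R f \<in> W"
      by (simp add: W_def partial_deriv_linear(2)[OF f(1) f(1)] span_scale subspace_scale[OF subspace_polyfun])
  qed
  moreover have "iterated_partials D \<subseteq> W"
    using iterated_partials_polyfun[OF D] by (auto simp: W_def intro: span_base iterated_partials.step)
  ultimately have "span (iterated_partials D) \<subseteq> W" by (intro span_minimal)
  then show ?thesis using h by (auto simp: W_def)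
qed

lemma linear_compose_right: "linear (\<lambda>f x. f (L x) :: real)"
  by (rule linearI) (simp_all add: fun_eq_iff scaleR_fun_def)

text \<open>By the chain rule a partial derivative of h(L x) is a fixed linear combination of
  partial derivatives of h taken at L x, so the right side is closed under differentiation.\<close>

lemma span_iterated_partials_compose_le:
  assumes D: "D \<in> polyfun" and L: "linear L"
  shows "span (iterated_partials (\<lambda>x. D (L x))) \<subseteq> (\<lambda>h x. h (L x)) ` span (iterated_partials D)"
proof (rule span_minimal)
  let ?V = "(\<lambda>h x. h (L x)) ` span (iterated_partials D)"
  show "subspace ?V" by (rule linear_subspace_image[OF linear_compose_right subspace_span])
  show "iterated_partials (\<lambda>x. D (L x)) \<subseteq> ?V"
  proof
    fix g assume "g \<in> iterated_partials (\<lambda>x. D (L x))"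
    then show "g \<in> ?V"
    proof induction
      case base
      then show ?case by (intro image_eqI[OF refl] span_base iterated_partials.base)
    next
      case (step g i)
      then obtain h where h: "h \<in> span (iterated_partials D)" "g = (\<lambda>x. h (L x))" by blast
      have hp: "h \<in> polyfun" "partial_deriv j h \<in> span (iterated_partials D)" for j
        using partial_deriv_span[OF D h(1)] by blast+
      have "partial_deriv i g = (\<lambda>x. (\<Sum>j\<in>UNIV. L (axis i 1) $ j *\<^sub>R partial_deriv j h) (L x))"
        unfolding h(2) by (rule ext) (simp add: partial_deriv_compose_linear[OF hp(1) L] sum_fun_apply scaleR_fun_def)
      moreover have "(\<Sum>j\<in>UNIV. L (axis i 1) $ j *\<^sub>R partial_deriv j h) \<in> span (iterated_partials D)"
        by (intro span_sum span_scale hp)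
      ultimately show ?case by blast
    qed
  qed
qed

lemma span_iterated_partials_compose:
  assumes D: "D \<in> polyfun" and L: "linear L" "linear L'" and inv: "\<And>x. L (L' x) = x" "\<And>x. L' (L x) = x"
  shows "span (iterated_partials (\<lambda>x. D (L x))) = (\<lambda>h x. h (L x)) ` span (iterated_partials D)"
proof
  have "span (iterated_partials (\<lambda>x. D (L (L' x)))) \<subseteq> (\<lambda>h x. h (L' x)) ` span (iterated_partials (\<lambda>x. D (L x)))"
    by (rule span_iterated_partials_compose_le[OF polyfun_compose_linear[OF D L(1)] L(2)])
  then have le: "span (iterated_partials D) \<subseteq> (\<lambda>h x. h (L' x)) ` span (iterated_partials (\<lambda>x. D (L x)))"
    by (simp only: inv)
  show "(\<lambda>h x. h (L x)) ` span (iterated_partials D) \<subseteq> span (iterated_partials (\<lambda>x. D (L x)))"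
  proof
    fix f assume "f \<in> (\<lambda>h x. h (L x)) ` span (iterated_partials D)"
    then obtain h where "h \<in> span (iterated_partials D)" "f = (\<lambda>x. h (L x))" by blast
    moreover from this le obtain e where "e \<in> span (iterated_partials (\<lambda>x. D (L x)))" "h = (\<lambda>x. e (L' x))" by blast
    ultimately show "f \<in> span (iterated_partials (\<lambda>x. D (L x)))" by (simp only: inv)
  qed
qed (rule span_iterated_partials_compose_le[OF D L(1)])

lemma dim_injective_linear_image:
  fixes \<Phi> :: "'a::real_vector \<Rightarrow> 'b::real_vector"
  assumes "linear \<Phi>" "inj \<Phi>" "subspace V"
  shows "dim (\<Phi> ` V) = dim V"
proof -
  obtain B where B: "B \<subseteq> V" "independent B" "V \<subseteq> span B" "card B = dim V"
    using real_vector.basis_exists by metis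
  have "span B = V" using B(1,3) assms(3) by (simp add: span_minimal subset_antisym)
  then have "span (\<Phi> ` B) = span (\<Phi> ` V)"
    using linear_span_image[OF assms(1), of B] linear_subspace_image[OF assms(1,3)] by (simp add: span_eq_iff[THEN iffD2])
  moreover have "independent (\<Phi> ` B)"
    by (rule linear_independent_injective_image[OF assms(1) B(2)]) (rule inj_on_subset[OF assms(2) subset_UNIV])
  ultimately have "dim (\<Phi> ` V) = card (\<Phi> ` B)" by (intro real_vector.dim_eq_card)
  then show ?thesis using B(4) card_image[OF inj_on_subset[OF assms(2) subset_UNIV]] by metis
qed

text \<open>The standard cube is the algebraic result applied to the uniform measure on the
  skeleton, every mean value function being polynomial. For an image under c Q, similarity
  invariance identifies the harmonic functions with the h(inv Q x), h harmonic for the standard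
  cube. This substitution is linear and injective, hence preserves dimension, and it carries the
  span of the derivatives of \<open>Delta\<close> onto that of the rotated polynomial.\<close>

theorem theorem1p1:
  fixes k :: nat
  assumes "k \<le> CARD('n::{finite,linorder})"
  shows
    "(let H = harmonic_functions (std_cube :: (real ^ 'n::{finite,linorder}) set) k in
        subspace H \<and> dim H = 2 ^ CARD('n::{finite,linorder}) * fact CARD('n::{finite,linorder}) \<and>
        H = span (iterated_partials Delta))
     \<and>
     (\<forall>(Q :: real ^ 'n::{finite,linorder} \<Rightarrow> real ^ 'n::{finite,linorder}) c. orthogonal_transformation Q \<longrightarrow> c > 0 \<longrightarrow>
       (let H = harmonic_functions ((\<lambda>x. c *\<^sub>R Q x) ` std_cube) k in
          subspace H \<and> dim H = 2 ^ CARD('n::{finite,linorder}) * fact CARD('n::{finite,linorder}) \<and>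
          H = span (iterated_partials (\<lambda>x. Delta (inv Q x)))))"
proof -
  define H :: "((real, 'n) vec \<Rightarrow> real) set" where "H = harmonic_functions std_cube k"
  define \<nu> :: "(real, 'n) vec measure" where "\<nu> = uniform_measure (hausdorff_measure k) (skeleton std_cube k)"
  have cm: "cube_measure \<nu> k" and H: "H = mean_value_functions \<nu>"
    unfolding \<nu>_def H_def using cube_measure_skeleton[OF assms] by blast+
  interpret cube_measure \<nu> k by (rule cm)
  have span: "H = span (iterated_partials Delta)" and dim: "dim H = 2 ^ CARD('n) * fact CARD('n)"
    unfolding H using mean_value_functions_eq_span[OF cm mean_value_polyfun] by blast+
  have sub: "subspace H" unfolding span by (rule subspace_span)
  have "subspace H' \<and> dim H' = 2 ^ CARD('n) * fact CARD('n) \<and> H' = span (iterated_partials (\<lambda>x. Delta (inv Q x)))"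
    if Q: "orthogonal_transformation Q" and c: "c > 0" and H': "H' = harmonic_functions ((\<lambda>x. c *\<^sub>R Q x) ` std_cube) k"
    for Q :: "(real, 'n) vec \<Rightarrow> (real, 'n) vec" and c H'
  proof -
    let ?\<Phi> = "\<lambda>(h :: (real, 'n) vec \<Rightarrow> real) x. h (inv Q x)"
    have bij: "bij Q" by (rule orthogonal_transformation_bij[OF Q])
    have iQ: "inv Q (Q x) = x" "Q (inv Q x) = x" for x
      using bij by (simp_all add: bij_is_inj bij_is_surj surj_f_inv_f)
    have lin: "linear Q" "linear (inv Q)"
      by (intro orthogonal_transformation_linear orthogonal_transformation_inv Q)+
    have iff: "f \<in> H' \<longleftrightarrow> (\<lambda>x. f (Q x)) \<in> H" for f
      unfolding H' H_def by (rule harmonic_functions_similarity[OF Q c skeleton_measurable[OF assms]])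
    have im: "H' = ?\<Phi> ` H"
    proof (intro set_eqI iffI)
      fix f assume "f \<in> H'"
      then have "(\<lambda>x. f (Q x)) \<in> H" by (simp only: iff)
      moreover have "f = ?\<Phi> (\<lambda>x. f (Q x))" by (simp only: iQ)
      ultimately show "f \<in> ?\<Phi> ` H" by (intro image_eqI[of _ ?\<Phi> "\<lambda>x. f (Q x)"])
    next
      fix f assume "f \<in> ?\<Phi> ` H"
      then obtain h where "h \<in> H" "f = ?\<Phi> h" by blast
      then show "f \<in> H'" unfolding iff by (simp only: iQ)
    qed
    have "H' = span (iterated_partials (\<lambda>x. Delta (inv Q x)))"
      unfolding im span by (rule span_iterated_partials_compose[OF Delta_polyfun lin(2,1) iQ, symmetric])
    moreover have "inj ?\<Phi>"
    proof (rule injI)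
      fix g h assume eq: "?\<Phi> g = ?\<Phi> h"
      have "g x = h x" for x using fun_cong[OF eq, of "Q x"] by (simp only: iQ)
      then show "g = h" by (rule ext)
    qed
    then have "dim H' = dim H" unfolding im by (rule dim_injective_linear_image[OF linear_compose_right _ sub])
    ultimately show ?thesis using dim by (simp add: subspace_span)
  qed
  then show ?thesis using sub dim span unfolding H_def[symmetric] Let_def by blast
qed

end
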